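(* Let $n\ge3$, let $\mathcal B_n$ be the Brauer monoid of degree $n$, and let $z\in\{0,1\}$ with $z\equiv n\pmod 2$. (i) The ideals of $\mathcal B_n$ are exactly the sets $I_q=\{\alpha\in\mathcal B_n:\operatorname{rank}(\alpha)\le q\}$ for $q=z,z+2,\dots,n$, yielding the Rees congruences $R_q=R_{I_q}$. (ii) The proper IN-pairs $(I,M)$ of $\mathcal B_n$ with $M\le\overline{\mathcal S}_q$ for some $q$ are exactly the pairs $(I_{q-2},\overline N)$, for $q=z+2,z+4,\dots,n$ and $N$ a non-trivial normal subgroup of $\mathcal S_q$, yielding the congruences $R_N=R_{I_{q-2},\overline N}$. (iii) For $n$ odd, the only retractable IN-pair $(I,M)$ of $\mathcal B_n$ with $M\le\overline{\mathcal S}_q$ for some $q$ is $\mathscr C_1=(I_1,\{\overline{\mathrm{id}}_3\})$, yielding the congruences $\lambda_1,\rho_1,\mu_1$. (iv) For $n$ even, the retractable IN-pairs $(I,M)$ of $\mathcal B_n$ with $M\le\overline{\mathcal S}_q$ for some $q$ are exactly $\mathscr C_0=(I_0,\{\overline{\mathrm{id}}_2\})$, $\mathscr C_{\mathcal S_2}=(I_0,\overline{\mathcal S}_2)$, $\mathscr C_2=(I_2,\{\overline{\mathrm{id}}_4\})$ and $\mathscr C_K=(I_2,\overline K)$, where $K$ is the Klein 4-group in $\mathcal S_4$, yielding the congruences $\lambda_i,\rho_i,\mu_i$ for $i=0,\mathcal S_2,2,K$ respectively. (v) The congruences listed in (i)–(iv) (namely all $R_q$, all $R_N$, together with $\lambda_1,\rho_1,\mu_1$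 if $n$ is odd, or $\lambda_i,\rho_i,\mu_i$ for $i\in\{0,\mathcal S_2,2,K\}$ if $n$ is even) are pairwise distinct, and they are all the congruences of $\mathcal B_n$. (vi) The order (inclusion) on $\operatorname{Cong}(\mathcal B_n)$ is as follows. For $n$ odd: $\mu_1=\Delta$ is the bottom, it is covered by $\lambda_1$ and $\rho_1$, which are incomparable and both covered by $R_1$, and the rest is the chain $$R_1\subsetneq R_{\mathcal A_3}\subsetneq R_{\mathcal S_3}\subsetneq R_3\subsetneq R_{\mathcal A_5}\subsetneq R_{\mathcal S_5}\subsetneq R_5\subsetneq\cdots\subsetneq R_n=\nabla .$$ For $n$ even: the sixteen congruences $\xi_i$ with $\xi\in\{\mu,\lambda,\rho,R\}$ and $i\in\{0,\mathcal S_2,2,K\}$ form the direct product of the four-element diamond $\mu<\lambda,\rho<R$ (with $\lambda,\rho$ incomparable) and the chain $0<\mathcal S_2<2<K$ (that is, $\xi_i\subseteq\zeta_j$ iff $\xi\le\zeta$ in the diamond and $i\le j$ in the chain), with bottom $\mu_0=\Delta$ and top $R_K$, and the rest is the chain $$R_K\subsetneq R_{\mathcal A_4}\subsetneq R_{\mathcal S_4}\subsetneq R_4\subsetneq R_{\mathcal A_6}\subsetneq R_{\mathcal S_6}\subsetneq R_6\subsetneq\cdots\subsetneq R_n=\nabla .$$ (vii) The $*$-congruences of $\mathcal B_n$ are precisely all the congruences of $\mathcal B_n$ other than $\lambda_1,\rho_1$ (for $n$ odd), or other than $\lambda_0,\lambda_{\mathcal S_2},\lambda_2,\lambda_K,\rho_0,\rho_{\mathcal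 S_2},\rho_2,\rho_K$ (for $n$ even); that is, they are all $R_q$ and all $R_N$, together with $\mu_1$ if $n$ is odd, or $\mu_0,\mu_{\mathcal S_2},\mu_2,\mu_K$ if $n$ is even.
   Context: **Brauer monoid.** Let $\mathbf n=\{1,\dots,n\}$, $\mathbf n'=\{1',\dots,n'\}$. The partition monoid $\mathcal P_n$ is the set of all set partitions of $\mathbf n\cup\mathbf n'$. To form $\alpha\beta$: rename each lower point $i'$ of $\alpha$ to $i''$ and each upper point $i$ of $\beta$ to $i''$, and consider the graph on $\mathbf n\cup\mathbf n''\cup\mathbf n'$ whose edges join points lying in a common block of (renamed) $\alpha$ or of (renamed) $\beta$; two points of $\mathbf n\cup\mathbf n'$ lie in the same block of $\alpha\beta$ iff they are connected by a path in this graph. $\mathcal B_n$ is the submonoid of all $\alpha\in\mathcal P_n$ all of whose blocks have size exactly $2$. A block is a transversal if it meets both $\mathbf n$ and $\mathbf n'$; $\operatorname{rank}(\alpha)$ is the number of transversals of $\alpha$. The involution $\alpha\mapsto\alpha^*$ interchanges $i$ and $i'$ for every $i$; a $*$-congruence is a congruence $\xi$ such that $(\alpha,\beta)\in\xi$ implies $(\alpha^*,\beta^* )\in\xi$. The $\mathscr J$-classes of $\mathcal B_n$ are $J_q=\{\alpha:\operatorname{rank}(\alpha)=q\}$, $q=z,z+2,\dots,n$; the minimal ideal is $I_z=J_z$. $\mathcal S_q$, $\mathcal A_q$ are the symmetric and alternating groups of degree $q$. For $q\equiv n\pmod 2$ and $\sigma\in\mathcal S_q$, $\overline\sigma\in J_q$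 has transversals $\{i,(i\sigma)'\}$ ($1\le i\le q$), upper blocks $\{q+1,q+2\},\dots,\{n-1,n\}$ and lower blocks $\{(q+1)',(q+2)'\},\dots,\{(n-1)',n'\}$; for $N\subseteq\mathcal S_q$, $\overline N=\{\overline\sigma:\sigma\in N\}$. Then $\overline{\mathcal S}_q$ is a maximal subgroup contained in $J_q$. **General constructions**, for a finite semigroup $S$ with minimal ideal $M$. $S^1$ is $S$ with an identity adjoined if necessary; $\mathscr R,\mathscr L,\mathscr H,\mathscr J$ are Green's relations; the $\mathscr J$-classes are ordered by $J_a\le J_b$ iff $a\in S^1bS^1$. $\Delta=\{(a,a):a\in S\}$, $\nabla=S\times S$. Ideals are non-empty. The Rees congruence of an ideal $I$ is $R_I=\Delta\cup(I\times I)$. An ideal $I$ is retractable if there is a homomorphism $f:I\to M$ (a retraction) with $xf=x$ for all $x\in M$; such $f$ is then unique. An IN-pair is a pair $(I,N)$ where $I$ is an ideal and $N$ is a normal subgroup of a maximal subgroup of $S$ contained in some regular $\mathscr J$-class $J$ that is minimal among the $\mathscr J$-classes contained in $S\setminus I$; it is proper if $|N|\ge2$. Put $\nu_N=\{(sxt,syt)\in J\times J: x,y\in N,\ s,t\in S^1\}$ and $R_{I,N}=\Delta\cup\nu_N\cup(I\times I)$. The IN-pair is retractable if $I$ is retractable and $|xN|=|Nx|=1$ for all $x\in M$; then, with $f:I\to M$ the retraction, $\lambda_{I,N}=\Delta\cup\nu_N\cup\{(x,y)\in I\times I:xf\mathrel{\mathscr L}yf\}$, $\rho_{I,N}=\Delta\cup\nu_N\cup\{(x,y)\in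 I\times I:xf\mathrel{\mathscr R}yf\}$, $\mu_{I,N}=\Delta\cup\nu_N\cup\{(x,y)\in I\times I:xf\mathrel{\mathscr H}yf\}$. **Abbreviations.** $\lambda_i=\lambda_{\mathscr C_i}$, $\rho_i=\rho_{\mathscr C_i}$, $\mu_i=\mu_{\mathscr C_i}$. $R_{\mathcal S_2}$ and $R_K$ are the congruences $R_N$ with $N=\mathcal S_2$ and $N=K$. *)

theory Defs
  imports "HOL-Library.Disjoint_Sets" "HOL-Algebra.Sym_Groups"
begin

section \<open>Semigroup-theoretic constructions\<close>

text \<open>
  The constructions are set up for a monoid \<open>S\<close> (a record of \<^theory>\<open>HOL-Algebra.Group\<close>), so that
  no identity has to be adjoined: \<open>S\<^sup>1 = S\<close>.
\<close>

definition Cong :: "('a, 'b) monoid_scheme \<Rightarrow> ('a \<times> 'a) set set" where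
  "Cong S = {\<xi>. equiv (carrier S) \<xi> \<and>
     (\<forall>(a, b) \<in> \<xi>. \<forall>s \<in> carrier S.
        (s \<otimes>\<^bsub>S\<^esub> a, s \<otimes>\<^bsub>S\<^esub> b) \<in> \<xi> \<and> (a \<otimes>\<^bsub>S\<^esub> s, b \<otimes>\<^bsub>S\<^esub> s) \<in> \<xi>)}"

definition Delta :: "('a, 'b) monoid_scheme \<Rightarrow> ('a \<times> 'a) set" where
  "Delta S = Id_on (carrier S)"

definition Nabla :: "('a, 'b) monoid_scheme \<Rightarrow> ('a \<times> 'a) set" where
  "Nabla S = carrier S \<times> carrier S"

definition semigroup_ideal :: "('a, 'b) monoid_scheme \<Rightarrow> 'a set \<Rightarrow> bool" where
  "semigroup_ideal S I \<longleftrightarrow> I \<noteq> {} \<and> I \<subseteq> carrier S \<and>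
     (\<forall>x \<in> I. \<forall>s \<in> carrier S. s \<otimes>\<^bsub>S\<^esub> x \<in> I \<and> x \<otimes>\<^bsub>S\<^esub> s \<in> I)"

text \<open>A finite semigroup has exactly one ideal that is minimal under inclusion.\<close>

definition minimal_ideal :: "('a, 'b) monoid_scheme \<Rightarrow> 'a set" where
  "minimal_ideal S =
     (THE M. semigroup_ideal S M \<and> (\<forall>I. semigroup_ideal S I \<and> I \<subseteq> M \<longrightarrow> I = M))"

definition greenL :: "('a, 'b) monoid_scheme \<Rightarrow> ('a \<times> 'a) set" where
  "greenL S = {(a, b) \<in> carrier S \<times> carrier S.
     {s \<otimes>\<^bsub>S\<^esub> a | s. s \<in> carrier S} = {s \<otimes>\<^bsub>S\<^esub> b | s. s \<in> carrier S}}"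

definition greenR :: "('a, 'b) monoid_scheme \<Rightarrow> ('a \<times> 'a) set" where
  "greenR S = {(a, b) \<in> carrier S \<times> carrier S.
     {a \<otimes>\<^bsub>S\<^esub> t | t. t \<in> carrier S} = {b \<otimes>\<^bsub>S\<^esub> t | t. t \<in> carrier S}}"

definition greenH :: "('a, 'b) monoid_scheme \<Rightarrow> ('a \<times> 'a) set" where
  "greenH S = greenL S \<inter> greenR S"

definition two_sided :: "('a, 'b) monoid_scheme \<Rightarrow> 'a \<Rightarrow> 'a set" where
  "two_sided S a = {s \<otimes>\<^bsub>S\<^esub> a \<otimes>\<^bsub>S\<^esub> t | s t. s \<in> carrier S \<and> t \<in> carrier S}"

definition greenJ :: "('a, 'b) monoid_scheme \<Rightarrow> ('a \<times> 'a) set" where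
  "greenJ S = {(a, b) \<in> carrier S \<times> carrier S. two_sided S a = two_sided S b}"

definition J_classes :: "('a, 'b) monoid_scheme \<Rightarrow> 'a set set" where
  "J_classes S = carrier S // greenJ S"

definition J_le :: "('a, 'b) monoid_scheme \<Rightarrow> 'a set \<Rightarrow> 'a set \<Rightarrow> bool" where
  "J_le S J J' \<longleftrightarrow> (\<exists>a \<in> J. \<exists>b \<in> J'. a \<in> two_sided S b)"

definition regular_class :: "('a, 'b) monoid_scheme \<Rightarrow> 'a set \<Rightarrow> bool" where
  "regular_class S J \<longleftrightarrow> (\<forall>a \<in> J. \<exists>b \<in> carrier S. a \<otimes>\<^bsub>S\<^esub> b \<otimes>\<^bsub>S\<^esub> a = a)"

text \<open>
  A subgroup of the semigroup \<open>S\<close> has its own identity \<open>e\<close>, an idempotent of \<open>S\<close> which is in general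
  different from the identity of \<open>S\<close>.
\<close>

definition subgroup_of :: "('a, 'b) monoid_scheme \<Rightarrow> 'a set \<Rightarrow> bool" where
  "subgroup_of S G \<longleftrightarrow> G \<subseteq> carrier S \<and> (\<exists>e. group (S\<lparr>carrier := G, one := e\<rparr>))"

definition maximal_subgroup :: "('a, 'b) monoid_scheme \<Rightarrow> 'a set \<Rightarrow> bool" where
  "maximal_subgroup S G \<longleftrightarrow>
     subgroup_of S G \<and> (\<forall>G'. subgroup_of S G' \<and> G \<subseteq> G' \<longrightarrow> G' = G)"

definition rees :: "('a, 'b) monoid_scheme \<Rightarrow> 'a set \<Rightarrow> ('a \<times> 'a) set" where
  "rees S I = Delta S \<union> I \<times> I"

definition retraction :: "('a, 'b) monoid_scheme \<Rightarrow> 'a set \<Rightarrow> ('a \<Rightarrow> 'a) \<Rightarrow> bool" where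
  "retraction S I f \<longleftrightarrow>
     f \<in> hom (S\<lparr>carrier := I\<rparr>) (S\<lparr>carrier := minimal_ideal S\<rparr>) \<and>
     (\<forall>x \<in> minimal_ideal S. f x = x)"

definition retractable_ideal :: "('a, 'b) monoid_scheme \<Rightarrow> 'a set \<Rightarrow> bool" where
  "retractable_ideal S I \<longleftrightarrow> semigroup_ideal S I \<and> (\<exists>f. retraction S I f)"

text \<open>The retraction is unique on \<open>I\<close>; its values outside \<open>I\<close> are irrelevant.\<close>

definition the_retraction :: "('a, 'b) monoid_scheme \<Rightarrow> 'a set \<Rightarrow> 'a \<Rightarrow> 'a" where
  "the_retraction S I = (SOME f. retraction S I f)"

definition IN_pair :: "('a, 'b) monoid_scheme \<Rightarrow> 'a set \<Rightarrow> 'a set \<Rightarrow> bool" where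
  "IN_pair S I N \<longleftrightarrow> semigroup_ideal S I \<and>
     (\<exists>G J. maximal_subgroup S G \<and> (\<exists>e. N \<lhd> S\<lparr>carrier := G, one := e\<rparr>) \<and>
        G \<subseteq> J \<and> J \<in> J_classes S \<and> regular_class S J \<and> J \<subseteq> carrier S - I \<and>
        (\<forall>J' \<in> J_classes S. J' \<subseteq> carrier S - I \<and> J_le S J' J \<longrightarrow> J' = J))"

definition proper_IN_pair :: "('a, 'b) monoid_scheme \<Rightarrow> 'a set \<Rightarrow> 'a set \<Rightarrow> bool" where
  "proper_IN_pair S I N \<longleftrightarrow> IN_pair S I N \<and> card N \<ge> 2"

definition retractable_IN_pair :: "('a, 'b) monoid_scheme \<Rightarrow> 'a set \<Rightarrow> 'a set \<Rightarrow> bool" where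
  "retractable_IN_pair S I N \<longleftrightarrow> IN_pair S I N \<and> retractable_ideal S I \<and>
     (\<forall>x \<in> minimal_ideal S. card (x <#\<^bsub>S\<^esub> N) = 1 \<and> card (N #>\<^bsub>S\<^esub> x) = 1)"

text \<open>The \<open>\<J>\<close>-class \<open>J\<close> that occurs in \<open>\<nu>\<^sub>N\<close> is the one containing \<open>N\<close>, written \<open>greenJ S `` N\<close>.\<close>

definition nu :: "('a, 'b) monoid_scheme \<Rightarrow> 'a set \<Rightarrow> ('a \<times> 'a) set" where
  "nu S N = {(s \<otimes>\<^bsub>S\<^esub> x \<otimes>\<^bsub>S\<^esub> t, s \<otimes>\<^bsub>S\<^esub> y \<otimes>\<^bsub>S\<^esub> t) | s t x y.
       s \<in> carrier S \<and> t \<in> carrier S \<and> x \<in> N \<and> y \<in> N}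
     \<inter> (greenJ S `` N) \<times> (greenJ S `` N)"

definition R_IN :: "('a, 'b) monoid_scheme \<Rightarrow> 'a set \<Rightarrow> 'a set \<Rightarrow> ('a \<times> 'a) set" where
  "R_IN S I N = Delta S \<union> nu S N \<union> I \<times> I"

definition lambda_IN :: "('a, 'b) monoid_scheme \<Rightarrow> 'a set \<Rightarrow> 'a set \<Rightarrow> ('a \<times> 'a) set" where
  "lambda_IN S I N = Delta S \<union> nu S N \<union>
     {(x, y) \<in> I \<times> I. (the_retraction S I x, the_retraction S I y) \<in> greenL S}"

definition rho_IN :: "('a, 'b) monoid_scheme \<Rightarrow> 'a set \<Rightarrow> 'a set \<Rightarrow> ('a \<times> 'a) set" where
  "rho_IN S I N = Delta S \<union> nu S N \<union>
     {(x, y) \<in> I \<times> I. (the_retraction S I x, the_retraction S I y) \<in> greenR S}"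

definition mu_IN :: "('a, 'b) monoid_scheme \<Rightarrow> 'a set \<Rightarrow> 'a set \<Rightarrow> ('a \<times> 'a) set" where
  "mu_IN S I N = Delta S \<union> nu S N \<union>
     {(x, y) \<in> I \<times> I. (the_retraction S I x, the_retraction S I y) \<in> greenH S}"

definition covered_by :: "'a set set \<Rightarrow> 'a set \<Rightarrow> 'a set \<Rightarrow> bool" where
  "covered_by P a b \<longleftrightarrow> a \<in> P \<and> b \<in> P \<and> a \<subset> b \<and> \<not> (\<exists>c \<in> P. a \<subset> c \<and> c \<subset> b)"


section \<open>The partition monoid and the Brauer monoid\<close>

text \<open>
  \<open>Upper i\<close>, \<open>Lower i\<close> and \<open>Middle i\<close> stand for \<open>i\<close>, \<open>i'\<close> and \<open>i''\<close>; middle points occur only in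
  the product graph.
\<close>

datatype point = Upper nat | Middle nat | Lower nat

type_synonym diagram = "point set set"

definition points :: "nat \<Rightarrow> point set" where
  "points n = Upper ` {1..n} \<union> Lower ` {1..n}"

fun lower_to_middle :: "point \<Rightarrow> point" where
  "lower_to_middle (Lower i) = Middle i"
| "lower_to_middle (Upper i) = Upper i"
| "lower_to_middle (Middle i) = Middle i"

fun upper_to_middle :: "point \<Rightarrow> point" where
  "upper_to_middle (Upper i) = Middle i"
| "upper_to_middle (Lower i) = Lower i"
| "upper_to_middle (Middle i) = Middle i"

fun flip :: "point \<Rightarrow> point" where
  "flip (Upper i) = Lower i"
| "flip (Lower i) = Upper i"
| "flip (Middle i) = Middle i"

definition product_graph :: "diagram \<Rightarrow> diagram \<Rightarrow> (point \<times> point) set" where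
  "product_graph \<alpha> \<beta> =
     {(x, y). \<exists>A \<in> (`) lower_to_middle ` \<alpha> \<union> (`) upper_to_middle ` \<beta>. x \<in> A \<and> y \<in> A}"

definition diagram_mult :: "nat \<Rightarrow> diagram \<Rightarrow> diagram \<Rightarrow> diagram" where
  "diagram_mult n \<alpha> \<beta> =
     points n // {(x, y) \<in> points n \<times> points n. (x, y) \<in> (product_graph \<alpha> \<beta>)\<^sup>*}"

definition partition_monoid :: "nat \<Rightarrow> diagram monoid" where
  "partition_monoid n =
     \<lparr>carrier = {\<alpha>. partition_on (points n) \<alpha>},
      mult = diagram_mult n,
      one = {{Upper i, Lower i} | i. i \<in> {1..n}}\<rparr>"

definition brauer :: "nat \<Rightarrow> diagram monoid" where
  "brauer n = (partition_monoid n)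
     \<lparr>carrier := {\<alpha> \<in> carrier (partition_monoid n). \<forall>A \<in> \<alpha>. card A = 2}\<rparr>"

definition rank :: "diagram \<Rightarrow> nat" where
  "rank \<alpha> = card {A \<in> \<alpha>. A \<inter> range Upper \<noteq> {} \<and> A \<inter> range Lower \<noteq> {}}"

definition star :: "diagram \<Rightarrow> diagram" where
  "star \<alpha> = (`) flip ` \<alpha>"

definition star_Cong :: "nat \<Rightarrow> (diagram \<times> diagram) set set" where
  "star_Cong n = {\<xi> \<in> Cong (brauer n). \<forall>(\<alpha>, \<beta>) \<in> \<xi>. (star \<alpha>, star \<beta>) \<in> \<xi>}"

definition ranks :: "nat \<Rightarrow> nat \<Rightarrow> nat set" where
  "ranks m n = {q. m \<le> q \<and> q \<le> n \<and> q mod 2 = n mod 2}"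

definition rank_ideal :: "nat \<Rightarrow> nat \<Rightarrow> diagram set" where
  "rank_ideal n q = {\<alpha> \<in> carrier (brauer n). rank \<alpha> \<le> q}"

definition bar :: "nat \<Rightarrow> nat \<Rightarrow> (nat \<Rightarrow> nat) \<Rightarrow> diagram" where
  "bar n q \<sigma> =
     {{Upper i, Lower (\<sigma> i)} | i. i \<in> {1..q}}
     \<union> {{Upper j, Upper (j + 1)} | j. q < j \<and> j < n \<and> odd (j - q)}
     \<union> {{Lower j, Lower (j + 1)} | j. q < j \<and> j < n \<and> odd (j - q)}"

text \<open>
  The diagrams compose from left to right while \<^const>\<open>sym_group\<close> composes from right to left, so
  \<open>bar n q\<close> is an anti-isomorphism onto its image. (Normal) subgroups do not depend on the order of
  multiplication.
\<close>

definition bar_sym :: "nat \<Rightarrow> nat \<Rightarrow> diagram set" where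
  "bar_sym n q = bar n q ` carrier (sym_group q)"

definition within_bar_sym :: "nat \<Rightarrow> diagram set \<Rightarrow> bool" where
  "within_bar_sym n M \<longleftrightarrow>
     (\<exists>q. q \<le> n \<and> q mod 2 = n mod 2 \<and>
        subgroup M ((brauer n)\<lparr>carrier := bar_sym n q, one := bar n q id\<rparr>))"

text \<open>The normal Klein 4-group of \<open>\<S>\<^sub>4\<close>; there are non-normal Klein 4-subgroups such as \<open>\<langle>(1 2), (3 4)\<rangle>\<close>.\<close>

definition klein4 :: "(nat \<Rightarrow> nat) set" where
  "klein4 = {id,
     transpose 1 2 \<circ> transpose 3 4,
     transpose 1 3 \<circ> transpose 2 4,
     transpose 1 4 \<circ> transpose 2 3}"

definition R_rank :: "nat \<Rightarrow> nat \<Rightarrow> (diagram \<times> diagram) set" where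
  "R_rank n q = rees (brauer n) (rank_ideal n q)"

text \<open>\<open>R_normal n q N\<close> is the congruence \<open>R\<^sub>N\<close> of a normal subgroup \<open>N\<close> of the symmetric group of degree \<open>q\<close>.\<close>

definition R_normal :: "nat \<Rightarrow> nat \<Rightarrow> (nat \<Rightarrow> nat) set \<Rightarrow> (diagram \<times> diagram) set" where
  "R_normal n q N = R_IN (brauer n) (rank_ideal n (q - 2)) (bar n q ` N)"

definition normals :: "nat \<Rightarrow> nat \<Rightarrow> (nat \<times> (nat \<Rightarrow> nat) set) set" where
  "normals z n = {(q, N). q \<in> ranks (z + 2) n \<and> N \<lhd> sym_group q \<and> N \<noteq> {id}}"


section \<open>Labels for the congruences\<close>

text \<open>The subscripts \<open>1\<close> (for odd \<open>n\<close>) and \<open>0, \<S>\<^sub>2, 2, K\<close> (for even \<open>n\<close>).\<close>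

datatype index = ix_1 | ix_0 | ix_S2 | ix_2 | ix_K

definition indices :: "nat \<Rightarrow> index set" where
  "indices n = (if odd n then {ix_1} else {ix_0, ix_S2, ix_2, ix_K})"

fun pair_C :: "nat \<Rightarrow> index \<Rightarrow> diagram set \<times> diagram set" where
  "pair_C n ix_1 = (rank_ideal n 1, {bar n 3 id})"
| "pair_C n ix_0 = (rank_ideal n 0, {bar n 2 id})"
| "pair_C n ix_S2 = (rank_ideal n 0, bar_sym n 2)"
| "pair_C n ix_2 = (rank_ideal n 2, {bar n 4 id})"
| "pair_C n ix_K = (rank_ideal n 2, bar n 4 ` klein4)"

datatype symb = Mu | Lambda | Rho | Rees

fun xi :: "nat \<Rightarrow> symb \<Rightarrow> index \<Rightarrow> (diagram \<times> diagram) set" where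
  "xi n Mu i = mu_IN (brauer n) (fst (pair_C n i)) (snd (pair_C n i))"
| "xi n Lambda i = lambda_IN (brauer n) (fst (pair_C n i)) (snd (pair_C n i))"
| "xi n Rho i = rho_IN (brauer n) (fst (pair_C n i)) (snd (pair_C n i))"
| "xi n Rees ix_1 = R_rank n 1"
| "xi n Rees ix_0 = R_rank n 0"
| "xi n Rees ix_S2 = R_normal n 2 (carrier (sym_group 2))"
| "xi n Rees ix_2 = R_rank n 2"
| "xi n Rees ix_K = R_normal n 4 klein4"

definition diamond_le :: "symb \<Rightarrow> symb \<Rightarrow> bool" where
  "diamond_le a b \<longleftrightarrow> a = b \<or> a = Mu \<or> b = Rees"

text \<open>Position in the chain \<open>0 < \<S>\<^sub>2 < 2 < K\<close>; the value at \<open>ix_1\<close> is not used.\<close>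

fun chain_pos :: "index \<Rightarrow> nat" where
  "chain_pos ix_0 = 0"
| "chain_pos ix_S2 = 1"
| "chain_pos ix_2 = 2"
| "chain_pos ix_K = 3"
| "chain_pos ix_1 = 0"

text \<open>
  The list of congruences in the classification, before evaluation: distinct labels are meant to
  denote distinct congruences.
\<close>

datatype label = RankL nat | NormalL nat "(nat \<Rightarrow> nat) set" | XiL symb index

fun cong_of :: "nat \<Rightarrow> label \<Rightarrow> (diagram \<times> diagram) set" where
  "cong_of n (RankL q) = R_rank n q"
| "cong_of n (NormalL q N) = R_normal n q N"
| "cong_of n (XiL a i) = xi n a i"

definition labels :: "nat \<Rightarrow> nat \<Rightarrow> label set" where
  "labels z n = RankL ` ranks z n
     \<union> {NormalL q N | q N. (q, N) \<in> normals z n}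
     \<union> {XiL a i | a i. a \<in> {Lambda, Rho, Mu} \<and> i \<in> indices n}"

text \<open>The chain \<open>R\<^bsub>\<A>\<^sub>q\<^esub>, R\<^bsub>\<S>\<^sub>q\<^esub>, R\<^sub>q\<close> for \<open>q = m, m + 2, \<dots>, n\<close>, where \<open>m\<close> has the parity of \<open>n\<close>.\<close>

definition upper_chain :: "nat \<Rightarrow> nat \<Rightarrow> (diagram \<times> diagram) set list" where
  "upper_chain m n = concat (map
     (\<lambda>q. [R_normal n q (carrier (alt_group q)), R_normal n q (carrier (sym_group q)), R_rank n q])
     (filter (\<lambda>q. q mod 2 = n mod 2) [m..<n + 1]))"

definition rest_chain :: "nat \<Rightarrow> (diagram \<times> diagram) set list" where
  "rest_chain n =
     (if odd n then R_rank n 1 # upper_chain 3 n else R_normal n 4 klein4 # upper_chain 4 n)"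

end

theory Submission
  imports Defs
begin

text \<open>
  A diagram is determined by its upper and lower patterns (the pairs of points that it joins on either
  side) together with a bijection between the remaining points. Multiplying by a hook, the projection
  with the single pair \<open>{i, j}\<close> on both sides, lowers the rank by at most two in a controlled way. Let
  \<open>\<xi>\<close> be a congruence and let \<open>r\<close> be maximal such that \<open>\<xi>\<close> relates an element of rank \<open>r\<close> to one of
  smaller rank (the minimal rank if there is none). Then \<open>\<xi>\<close> relates every element of \<open>I\<^sub>r\<close> to one of the
  minimal ideal, where a single related pair with different lower patterns already forces all elements
  with the same upper pattern to be related. So on \<open>I\<^sub>r\<close> the congruence only records whether upper and
  whether lower patterns matter, and they do not if \<open>r \<ge> 3\<close>. Related elements of rank above \<open>r\<close> have equal
  patterns, hence differ by a permutation; if this happens nontrivially in rank \<open>q\<close>, hooks separate the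
  two elements in rank \<open>q - 2\<close>, so \<open>q = r + 2\<close>, and the permutations that occur form a normal subgroup
  of \<open>\<S>\<^sub>q\<close>. If patterns matter, this subgroup acts trivially on the minimal ideal, and for even \<open>q \<le> 4\<close>
  that means preserving every perfect matching of \<open>{1..q}\<close>, which accounts for \<open>\<S>\<^sub>2\<close> and \<open>K\<close>.
\<close>

section \<open>Unions of two matchings\<close>

text \<open>Everything about products rests on one combinatorial fact: in the union of two matchings
  a point covered once is the end of a path. So products of perfect matchings are perfect matchings,
  and a product is identified by exhibiting paths for its blocks. The constants come from counting
  free points. Two free points can be paired in only one way, so elements of rank at most 2 have a
  canonical shadow in the minimal ideal; a third free point offers incompatible pairings, which
  destroys the retraction and both flags. The parity of \<open>n\<close> matters because for odd
  \<open>n\<close> an element of minimal rank has one free point, through which pairs can be moved,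
  while for even \<open>n\<close> pairs can only be switched two at a time. Stating all congruences
  through the parameters \<open>cu\<close>, \<open>cl\<close>, \<open>r\<close>, \<open>N\<close>
  turns distinctness, inclusion, covering and closure under \<open>star\<close> into comparisons of
  parameters (\<open>family_le_iff\<close>). The involution exchanges \<open>cu\<close> and
  \<open>cl\<close>, so most one-sided arguments are carried out for one side and transported by
  \<open>star_rel\<close>.\<close>

definition is_matching :: "'a set set \<Rightarrow> bool" where
  "is_matching C \<longleftrightarrow> disjoint C \<and> (\<forall>A \<in> C. card A = 2)"

text \<open>Points outside the matching are fixed, so this is a total involution, and a point
  covered by only one of two matchings is a fixed point of exactly one of the two
  involutions.\<close>

definition swap_of :: "'a set set \<Rightarrow> 'a \<Rightarrow> 'a" where
  "swap_of C x = (if x \<in> \<Union>C then THE y. {x, y} \<in> C else x)"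

definition block_graph :: "'a set set \<Rightarrow> ('a \<times> 'a) set" where
  "block_graph C = {(x, y). \<exists>A \<in> C. x \<in> A \<and> y \<in> A}"

lemma is_matching_unique: "y = w" if "is_matching C" "{x, y} \<in> C" "{x, w} \<in> C"
proof -
  have "{x, y} = {x, w}"
    using that disjointD[of C "{x, y}" "{x, w}"] unfolding is_matching_def by auto
  then show ?thesis by (auto simp: doubleton_eq_iff)
qed

lemma is_matching_neq: "x \<noteq> y" if "is_matching C" "{x, y} \<in> C"
  using that unfolding is_matching_def by fastforce

lemma is_matching_ex: "\<exists>y. {x, y} \<in> C \<and> A = {x, y}" if "is_matching C" "A \<in> C" "x \<in> A"
proof -
  have "card A = 2" using that unfolding is_matching_def by blast
  then obtain u v where "A = {u, v}" by (auto simp: card_2_iff)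
  then show ?thesis using that by (cases "x = u") (auto simp: insert_commute)
qed

lemma is_matching_subset: "is_matching C" if "is_matching D" "C \<subseteq> D"
  using that unfolding is_matching_def by (meson pairwise_subset subsetD)

lemma is_matching_image: "is_matching ((`) f ` C)" if C: "is_matching C" and f: "inj_on f (\<Union>C)"
proof -
  have "disjoint ((`) f ` C)"
    using C f disjoint_image unfolding is_matching_def by blast
  moreover have "card (f ` A) = 2" if "A \<in> C" for A
    using that C f unfolding is_matching_def
    by (metis Sup_upper card_image inj_on_subset)
  ultimately show ?thesis unfolding is_matching_def by auto
qed

context
  fixes C :: "'a set set"
  assumes C: "is_matching C"
begin

lemma swap_of_eq: "swap_of C x = y" if "{x, y} \<in> C"
  unfolding swap_of_def using that is_matching_unique[OF C] by (auto intro!: the_equality)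

lemma swap_of_block: "{x, swap_of C x} \<in> C" if "x \<in> \<Union>C"
proof -
  obtain y where "{x, y} \<in> C" using \<open>x \<in> \<Union>C\<close> is_matching_ex[OF C] by blast
  then show ?thesis using swap_of_eq by simp
qed

lemma swap_of_idem [simp]: "swap_of C (swap_of C x) = x"
proof (cases "x \<in> \<Union>C")
  case True
  then show ?thesis using swap_of_eq swap_of_block by (simp add: insert_commute)
qed (simp add: swap_of_def)

lemma swap_of_fixed: "swap_of C x = x \<longleftrightarrow> x \<notin> \<Union>C"
  using swap_of_block is_matching_neq[OF C] by (metis swap_of_def)

lemma swap_of_graph: "swap_of C x = y \<or> x = y" if "(x, y) \<in> block_graph C"
  using that is_matching_ex[OF C] swap_of_eq unfolding block_graph_def
  by (smt (verit, best) insert_iff mem_Collect_eq singletonD split_conv)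

lemma swap_of_permutes: "swap_of C permutes \<Union>C"
  unfolding permutes_def using swap_of_idem by (metis swap_of_def)

end

text \<open>
  The component of an end point \<open>x\<close> is a dihedral orbit: with \<open>a\<close>, \<open>b\<close> the two involutions and \<open>N\<close> the
  period of \<open>x\<close> under \<open>a \<circ> b\<close>, the involutions act on the exponents by \<open>k \<mapsto> N + 1 - k\<close> and
  \<open>k \<mapsto> N - k\<close>, and exactly one exponent in \<open>{0<..<N}\<close> is fixed by one of them.
\<close>

lemma dihedral_orbit:
  fixes a b T :: "'a \<Rightarrow> 'a"
  assumes T: "\<And>x. T x = a (b x)" and a: "\<And>x. a (a x) = x" and b: "\<And>x. b (b x) = x" and bx: "b x = x" and ax: "a x \<noteq> x"
    and P: "permutation T"
  shows "\<exists>!y. y \<noteq> x \<and> (\<exists>k. y = (T ^^ k) x) \<and> (a y = y \<or> b y = y)"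
    and "\<exists>m. a ((T ^^ k) x) = (T ^^ m) x"
    and "\<exists>m. b ((T ^^ k) x) = (T ^^ m) x"
proof -
  define N where "N = least_power T x"
  have N: "(T ^^ N) x = x" "N > 0"
    using least_power_of_permutation[OF P] unfolding N_def by auto
  have minN: "N dvd k" if "(T ^^ k) x = x" for k
    using least_power_minimal[OF that] unfolding N_def .
  have inj: "inj T" using a b T by (metis injI)
  have injk: "inj (T ^^ k)" for k using inj by (rule inj_fn)
  have modN: "(T ^^ k) x = (T ^^ (k mod N)) x" for k
  proof -
    have "(T ^^ (N * j)) x = x" for j
      using N(1) by (induction j) (auto simp: funpow_add simp del: o_apply, simp add: comp_def)
    moreover have "k = k mod N + N * (k div N)" by simp
    ultimately show ?thesis by (metis comp_apply funpow_add)
  qed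
  \<comment> \<open>\<open>b\<close> conjugates \<open>T\<close> to its inverse, hence
    \<open>T^k b T^k = b\<close>. Applied to \<open>x\<close>, which \<open>b\<close> fixes, this
    gives the reflections of the exponents below.\<close>
  have TbT: "(T ^^ k) (b ((T ^^ k) y)) = b y" for k y
  proof (induction k arbitrary: y)
    case (Suc k)
    have "(T ^^ Suc k) (b ((T ^^ Suc k) y)) = T ((T ^^ k) (b ((T ^^ k) (T y))))"
      by (simp add: funpow_swap1)
    also have "\<dots> = T (b (T y))" using Suc by simp
    also have "\<dots> = b y" using a b T by simp
    finally show ?case .
  qed simp
  have bT: "b ((T ^^ k) x) = (T ^^ (N - k)) x" if "k \<le> N" for k
  proof -
    have "(T ^^ k) (b ((T ^^ k) x)) = (T ^^ k) ((T ^^ (N - k)) x)"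
      using TbT[of k x] bx N that by (metis comp_apply funpow_add le_add_diff_inverse)
    then show ?thesis using injk by (meson injD)
  qed
  have aT: "a ((T ^^ k) x) = (T ^^ (Suc N - k)) x" if "k \<le> N" for k
    using bT[OF that] b that T by (metis Suc_diff_le comp_apply funpow.simps(2))
  have uniq: "i = j" if "(T ^^ i) x = (T ^^ j) x" "i < N" "j < N" for i j
    using that
  proof (induction i j rule: linorder_wlog)
    case (le i j)
    have "(T ^^ i) x = (T ^^ i) ((T ^^ (j - i)) x)"
      using le by (metis comp_apply funpow_add le_add_diff_inverse)
    then have "(T ^^ (j - i)) x = x" using injk by (metis injD)
    then have "N dvd j - i" by (rule minN)
    then show ?case using le by (meson dvd_imp_le le_less_trans less_imp_diff_less not_le zero_less_diff order_antisym_conv)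
  qed auto
  have "N \<noteq> 1" using N ax bx T by auto
  then have N2: "N \<ge> 2" using N by auto
  \<comment> \<open>The exponent fixed by a reflection solves \<open>2 * k = N\<close> or
    \<open>2 * k = N + 1\<close>; rounding up half of \<open>N\<close> covers both parities.\<close>
  define h where "h = Suc N div 2"
  have h: "0 < h" "h < N" using N2 unfolding h_def by auto
  have fix_h: "a ((T ^^ h) x) = (T ^^ h) x \<or> b ((T ^^ h) x) = (T ^^ h) x"
  proof (cases "even N")
    case True
    then have "N - h = h" unfolding h_def by (auto elim!: evenE)
    then show ?thesis using bT[of h] h by simp
  next
    case False
    then have "Suc N - h = h" unfolding h_def by (auto elim!: oddE)
    then show ?thesis using aT[of h] h by simp
  qed
  show "\<exists>!y. y \<noteq> x \<and> (\<exists>k. y = (T ^^ k) x) \<and> (a y = y \<or> b y = y)"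
  proof (rule ex1I[of _ "(T ^^ h) x"])
    show "(T ^^ h) x \<noteq> x \<and> (\<exists>k. (T ^^ h) x = (T ^^ k) x)
      \<and> (a ((T ^^ h) x) = (T ^^ h) x \<or> b ((T ^^ h) x) = (T ^^ h) x)"
      using fix_h uniq[of h 0] h N by auto
  next
    fix y assume y: "y \<noteq> x \<and> (\<exists>k. y = (T ^^ k) x) \<and> (a y = y \<or> b y = y)"
    then obtain k' where k': "y = (T ^^ k') x" by auto
    define k where "k = k' mod N"
    have k: "y = (T ^^ k) x" "k < N" using k' modN N unfolding k_def by auto
    then have k0: "k > 0" using y by (cases k) auto
    from y have "a y = y \<or> b y = y" by auto
    then have "k = h"
    proof
      assume "b y = y"
      then have "N - k = k" using bT[of k] uniq[of "N - k" k] k k0 by auto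
      then show "k = h" unfolding h_def by auto
    next
      assume ay: "a y = y"
      show "k = h"
      proof (cases "k = 1")
        \<comment> \<open>For \<open>k = 1\<close> the reflected exponent is \<open>N\<close>,
          outside the range where \<open>uniq\<close> applies; there \<open>T x = x\<close>
          contradicts \<open>N \<ge> 2\<close>.\<close>
        case True
        then have "(T ^^ 1) x = x" using aT[of k] ay k N by simp
        then have False using uniq[of 1 0] N2 by simp
        then show ?thesis ..
      next
        case False
        then have "Suc N - k = k" using aT[of k] uniq[of "Suc N - k" k] ay k k0 by auto
        then show "k = h" unfolding h_def by auto
      qed
    qed
    then show "y = (T ^^ h) x" using k by simp
  qed
  show "\<exists>m. b ((T ^^ k) x) = (T ^^ m) x"
    using bT[of "k mod N"] modN[of k] N by (metis mod_le_divisor)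
  show "\<exists>m. a ((T ^^ k) x) = (T ^^ m) x"
    using aT[of "k mod N"] modN[of k] N by (metis mod_le_divisor)
qed

text \<open>A component of the union of two matchings is a path or a cycle, and a point covered only
  once is the end of a path. Reachability from \<open>x\<close> is identified with the orbit of
  \<open>x\<close> under \<open>T\<close>: both involutions preserve that orbit, and each edge
  applies one of them. The ends are the fixed points counted in
  \<open>dihedral_orbit\<close>.\<close>

lemma two_matchings_end:
  assumes C: "is_matching C" and D: "is_matching D" and fin: "finite (\<Union>C)" "finite (\<Union>D)"
    and x: "x \<in> \<Union>C" "x \<notin> \<Union>D"
  shows "\<exists>!y. y \<noteq> x \<and> (x, y) \<in> (block_graph (C \<union> D))\<^sup>* \<and> (y \<in> \<Union>C) \<noteq> (y \<in> \<Union>D)"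
proof -
  let ?a = "swap_of C" and ?b = "swap_of D" and ?G = "block_graph (C \<union> D)"
  define T where "T = ?a \<circ> ?b"
  have T: "T x = ?a (?b x)" for x by (simp add: T_def)
  have perm: "permutation T"
    using swap_of_permutes[OF C] swap_of_permutes[OF D] fin
    unfolding T_def by (intro permutation_compose) (auto simp: permutation_permutes)
  have bx: "?b x = x" "?a x \<noteq> x" using swap_of_fixed[OF C] swap_of_fixed[OF D] x by auto
  note orb = dihedral_orbit[of T ?a ?b x, OF T swap_of_idem[OF C] swap_of_idem[OF D] bx perm]
  have step: "(u, ?a u) \<in> ?G\<^sup>*" "(u, ?b u) \<in> ?G\<^sup>*" for u
  proof -
    show "(u, ?a u) \<in> ?G\<^sup>*"
    proof (cases "u \<in> \<Union>C")
      case True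
      then show ?thesis using swap_of_block[OF C True] unfolding block_graph_def by blast
    qed (simp add: swap_of_def)
    show "(u, ?b u) \<in> ?G\<^sup>*"
    proof (cases "u \<in> \<Union>D")
      case True
      then show ?thesis using swap_of_block[OF D True] unfolding block_graph_def by blast
    qed (simp add: swap_of_def)
  qed
  have "(x, (T ^^ k) x) \<in> ?G\<^sup>*" for k
  proof (induction k)
    case (Suc k)
    then have "(x, T ((T ^^ k) x)) \<in> ?G\<^sup>*"
      unfolding T by (meson step rtrancl_trans)
    then show ?case by simp
  qed simp
  moreover have "\<exists>k. y = (T ^^ k) x" if "(x, y) \<in> ?G\<^sup>*" for y
    using that
  proof induction
    case base
    show ?case by (rule exI[of _ 0]) simp
  next
    case (step u v)
    then obtain k where k: "u = (T ^^ k) x" by auto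
    have "(u, v) \<in> block_graph C \<or> (u, v) \<in> block_graph D"
      using step by (auto simp: block_graph_def)
    then have "v = u \<or> v = ?a u \<or> v = ?b u"
      using swap_of_graph[OF C] swap_of_graph[OF D] by blast
    then show ?case using k orb(2,3) by auto
  qed
  ultimately have orbit: "(x, y) \<in> ?G\<^sup>* \<longleftrightarrow> (\<exists>k. y = (T ^^ k) x)" for y by auto
  have CD: "y \<in> \<Union>C \<or> y \<in> \<Union>D" if "(x, y) \<in> ?G\<^sup>*" for y
    using that x by (cases rule: rtrancl.cases) (auto simp: block_graph_def)
  have "(y \<in> \<Union>C) \<noteq> (y \<in> \<Union>D) \<longleftrightarrow> ?a y = y \<or> ?b y = y" if "(x, y) \<in> ?G\<^sup>*" for y
    using CD[OF that] swap_of_fixed[OF C] swap_of_fixed[OF D] by auto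
  then show ?thesis using orb(1) orbit by (smt (verit, ccfv_SIG))
qed

section \<open>The Brauer monoid\<close>

text \<open>Eliminates the points outside \<open>V\<close> from a path: only \<open>R\<close> leads
  there, so each excursion starts and ends in \<open>V\<close> and becomes one step of
  \<open>R\<^sup>*\<close>. Associativity uses it to hide a middle row.\<close>

lemma rtrancl_restrict:
  assumes S: "S \<subseteq> V \<times> V" and pq: "(p, q) \<in> (S \<union> R)\<^sup>*" and p: "p \<in> V" and q: "q \<in> V"
  shows "(p, q) \<in> (S \<union> R\<^sup>* \<inter> V \<times> V)\<^sup>*"
proof -
  let ?W = "S \<union> R\<^sup>* \<inter> V \<times> V"
  have "\<exists>v \<in> V. (p, v) \<in> ?W\<^sup>* \<and> (v, q) \<in> R\<^sup>*"
    using pq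
  proof induction
    case base
    show ?case using p by auto
  next
    case (step u w)
    then obtain v where v: "v \<in> V" "(p, v) \<in> ?W\<^sup>*" "(v, u) \<in> R\<^sup>*" by auto
    show ?case
    proof (cases "(u, w) \<in> S")
      case True
      then have "u \<in> V" "w \<in> V" using S by auto
      then have "(v, u) \<in> ?W" "(u, w) \<in> ?W" using v True by auto
      then have "(p, w) \<in> ?W\<^sup>*" using v by (meson rtrancl.rtrancl_into_rtrancl)
      then show ?thesis using \<open>w \<in> V\<close> by blast
    next
      case False
      then have "(v, w) \<in> R\<^sup>*" using step v by (auto intro: rtrancl_into_rtrancl)
      then show ?thesis using v by auto
    qed
  qed
  then obtain v where "v \<in> V" "(p, v) \<in> ?W\<^sup>*" "(v, q) \<in> R\<^sup>*" by auto
  moreover from this have "(v, q) \<in> ?W" using q by auto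
  ultimately show ?thesis by (meson rtrancl.rtrancl_into_rtrancl)
qed

locale brauer_monoid =
  fixes n :: nat
begin

abbreviation B :: "diagram set" where "B \<equiv> carrier (brauer n)"

abbreviation dm :: "diagram \<Rightarrow> diagram \<Rightarrow> diagram" (infixl "\<bullet>" 70) where
  "\<alpha> \<bullet> \<beta> \<equiv> \<alpha> \<otimes>\<^bsub>brauer n\<^esub> \<beta>"

lemma mem_B: "\<alpha> \<in> B \<longleftrightarrow> is_matching \<alpha> \<and> \<Union>\<alpha> = points n"
proof -
  have "card A = 2 \<Longrightarrow> A \<noteq> {}" for A :: "point set" by auto
  then show ?thesis
    by (auto simp: brauer_def partition_monoid_def partition_on_def is_matching_def)
qed

lemma mult_eq: "\<alpha> \<bullet> \<beta> = diagram_mult n \<alpha> \<beta>"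
  by (simp add: brauer_def partition_monoid_def)

lemma points_simps [simp]:
  "Upper i \<in> points n \<longleftrightarrow> i \<in> {1..n}" "Lower i \<in> points n \<longleftrightarrow> i \<in> {1..n}" "Middle i \<notin> points n"
  by (auto simp: points_def)

lemma pointsE: assumes "x \<in> points n"
  obtains i where "i \<in> {1..n}" "x = Upper i" | i where "i \<in> {1..n}" "x = Lower i"
  using assms by (auto simp: points_def)

lemma B_unique: "y = w" if "\<alpha> \<in> B" "{x, y} \<in> \<alpha>" "{x, w} \<in> \<alpha>"
  using that is_matching_unique by (auto simp: mem_B)

lemma B_neq: "x \<noteq> y" if "\<alpha> \<in> B" "{x, y} \<in> \<alpha>"
  using that is_matching_neq[of \<alpha> x y] mem_B by blast

lemma B_points: "x \<in> points n" "y \<in> points n" if "\<alpha> \<in> B" "{x, y} \<in> \<alpha>"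
  using that unfolding mem_B by blast+

lemma B_ex: "\<exists>y. {x, y} \<in> \<alpha>" if "\<alpha> \<in> B" "x \<in> points n"
  using that is_matching_ex unfolding mem_B by (metis UnionE)

lemma B_block: "\<exists>x y. A = {x, y} \<and> x \<noteq> y \<and> x \<in> points n \<and> y \<in> points n"
  if "\<alpha> \<in> B" "A \<in> \<alpha>"
proof -
  have "card A = 2" using that by (auto simp: mem_B is_matching_def)
  then obtain x y where "A = {x, y}" "x \<noteq> y" by (auto simp: card_2_iff)
  then show ?thesis using that B_points by blast
qed

text \<open>Both sides are perfect matchings of the same points, so one inclusion suffices: a
  further block would share a point with an existing one.\<close>

lemma B_eqI: "\<alpha> = \<gamma>" if \<alpha>: "\<alpha> \<in> B" and \<gamma>: "\<gamma> \<in> B" and sub: "\<And>x y. {x, y} \<in> \<gamma> \<Longrightarrow> {x, y} \<in> \<alpha>"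
proof
  show "\<gamma> \<subseteq> \<alpha>"
  proof
    fix A assume A: "A \<in> \<gamma>"
    from B_block[OF \<gamma> A] obtain x y where "A = {x, y}" by blast
    then show "A \<in> \<alpha>" using A sub by simp
  qed
  show "\<alpha> \<subseteq> \<gamma>"
  proof
    fix A assume A: "A \<in> \<alpha>"
    from B_block[OF \<alpha> A] obtain x y where xy: "A = {x, y}" "x \<in> points n" by blast
    from B_ex[OF \<gamma> xy(2)] obtain w where w: "{x, w} \<in> \<gamma>" by blast
    have "{x, y} \<in> \<alpha>" using A xy by simp
    then have "w = y" using sub[OF w] B_unique[OF \<alpha>] by blast
    then show "A \<in> \<gamma>" using w xy by simp
  qed
qed

abbreviation connected_via :: "diagram \<Rightarrow> diagram \<Rightarrow> (point \<times> point) set" where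
  "connected_via \<alpha> \<beta> \<equiv> (product_graph \<alpha> \<beta>)\<^sup>*"

lemma product_graph_block_graph:
  "product_graph \<alpha> \<beta> = block_graph ((`) lower_to_middle ` \<alpha> \<union> (`) upper_to_middle ` \<beta>)"
  by (simp add: product_graph_def block_graph_def)

lemma sym_block_graph: "sym (block_graph C)"
  by (auto simp: sym_def block_graph_def)

lemma sym_connected: "sym (connected_via \<alpha> \<beta>)"
  by (simp add: product_graph_block_graph sym_block_graph sym_rtrancl)

text \<open>After renaming, a middle point is covered by both matchings and every point of the
  product by exactly one. So these points are the path ends, and \<open>two_matchings_end\<close>
  pairs them.\<close>

lemma product_partner:
  assumes \<alpha>: "\<alpha> \<in> B" and \<beta>: "\<beta> \<in> B" and x: "x \<in> points n"
  shows "\<exists>!y. y \<noteq> x \<and> y \<in> points n \<and> (x, y) \<in> connected_via \<alpha> \<beta>"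
proof -
  let ?C = "(`) lower_to_middle ` \<alpha>" and ?D = "(`) upper_to_middle ` \<beta>"
  have inj: "inj_on lower_to_middle (points n)" "inj_on upper_to_middle (points n)"
    by (auto simp: points_def inj_on_def)
  have UC: "\<Union>?C = Upper ` {1..n} \<union> Middle ` {1..n}"
  proof -
    have "\<Union>?C = lower_to_middle ` \<Union>\<alpha>" by auto
    then show ?thesis using \<alpha> by (auto simp: mem_B points_def image_Un image_image)
  qed
  have UD: "\<Union>?D = Middle ` {1..n} \<union> Lower ` {1..n}"
  proof -
    have "\<Union>?D = upper_to_middle ` \<Union>\<beta>" by auto
    then show ?thesis using \<beta> by (auto simp: mem_B points_def image_Un image_image)
  qed
  have C: "is_matching ?C" and D: "is_matching ?D"
    using \<alpha> \<beta> inj by (auto simp: mem_B intro!: is_matching_image)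
  have fin: "finite (\<Union>?C)" "finite (\<Union>?D)" unfolding UC UD by auto
  have ends: "(y \<in> \<Union>?C) \<noteq> (y \<in> \<Union>?D) \<longleftrightarrow> y \<in> points n" for y
    unfolding UC UD by (auto simp: points_def)
  show ?thesis
  proof (cases "x \<in> \<Union>?C")
    case True
    then have nD: "x \<notin> \<Union>?D" using ends x by blast
    show ?thesis
      using two_matchings_end[OF C D fin True nD] unfolding ends product_graph_block_graph
      by (simp only: conj_commute conj_left_commute)
  next
    case False
    then have xD: "x \<in> \<Union>?D" using ends x by blast
    have ends': "(y \<in> \<Union>?D) \<noteq> (y \<in> \<Union>?C) \<longleftrightarrow> y \<in> points n" for y
      by (subst neq_commute) (rule ends)
    show ?thesis
      using two_matchings_end[OF D C fin(2,1) xD False]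
      unfolding ends' product_graph_block_graph Un_commute[of ?C]
      by (simp only: conj_commute conj_left_commute)
  qed
qed

lemma
  assumes \<alpha>: "\<alpha> \<in> B" and \<beta>: "\<beta> \<in> B"
  shows mult_closed: "\<alpha> \<bullet> \<beta> \<in> B"
    and mult_block_iff: "{x, y} \<in> \<alpha> \<bullet> \<beta> \<longleftrightarrow>
      x \<in> points n \<and> y \<in> points n \<and> x \<noteq> y \<and> (x, y) \<in> connected_via \<alpha> \<beta>"
proof -
  define r where "r = {(x, y) \<in> points n \<times> points n. (x, y) \<in> connected_via \<alpha> \<beta>}"
  have r: "equiv (points n) r"
  proof (rule equivI)
    show "r \<subseteq> points n \<times> points n" "refl_on (points n) r" by (auto simp: r_def refl_on_def)
    show "sym r" using symD[OF sym_connected] by (auto simp: r_def intro!: symI)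
    show "trans r" by (auto simp: r_def intro!: transI intro: rtrancl_trans)
  qed
  have m: "\<alpha> \<bullet> \<beta> = points n // r" unfolding mult_eq diagram_mult_def r_def ..
  have cls: "\<exists>y. r `` {x} = {x, y} \<and> y \<noteq> x" if x: "x \<in> points n" for x
  proof -
    from product_partner[OF \<alpha> \<beta> x]
    obtain y where y: "y \<noteq> x \<and> y \<in> points n \<and> (x, y) \<in> connected_via \<alpha> \<beta>"
      and u: "\<forall>y'. y' \<noteq> x \<and> y' \<in> points n \<and> (x, y') \<in> connected_via \<alpha> \<beta> \<longrightarrow> y' = y"
      by (rule ex1E)
    have "(x, w) \<in> r \<longleftrightarrow> w = x \<or> w = y" for w
      using y u x unfolding r_def by (metis (no_types, lifting) case_prodI mem_Collect_eq mem_Sigma_iff rtrancl.rtrancl_refl case_prodD)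
    then have "r `` {x} = {x, y}" by auto
    then show ?thesis using y by auto
  qed
  have part: "partition_on (points n) (\<alpha> \<bullet> \<beta>)" unfolding m by (rule partition_on_quotient[OF r])
  have "card A = 2" if A: "A \<in> \<alpha> \<bullet> \<beta>" for A
  proof -
    obtain x where "x \<in> points n" "A = r `` {x}" using A unfolding m by (rule quotientE)
    then obtain y where "A = {x, y}" "y \<noteq> x" using cls by blast
    then show ?thesis by simp
  qed
  then show "\<alpha> \<bullet> \<beta> \<in> B" using part by (simp add: mem_B is_matching_def partition_on_def)
  show "{x, y} \<in> \<alpha> \<bullet> \<beta> \<longleftrightarrow>
      x \<in> points n \<and> y \<in> points n \<and> x \<noteq> y \<and> (x, y) \<in> connected_via \<alpha> \<beta>"
  proof
    assume "{x, y} \<in> \<alpha> \<bullet> \<beta>"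
    then have A: "{x, y} \<in> points n // r" and "x \<noteq> y"
      using B_neq[OF \<open>\<alpha> \<bullet> \<beta> \<in> B\<close>] unfolding m by auto
    have "(x, y) \<in> r" using quotient_eq_iff[OF r A A] by blast
    then show "x \<in> points n \<and> y \<in> points n \<and> x \<noteq> y \<and> (x, y) \<in> connected_via \<alpha> \<beta>"
      using \<open>x \<noteq> y\<close> by (auto simp: r_def)
  next
    assume a: "x \<in> points n \<and> y \<in> points n \<and> x \<noteq> y \<and> (x, y) \<in> connected_via \<alpha> \<beta>"
    then obtain y' where "r `` {x} = {x, y'}" using cls by blast
    moreover have "y \<in> r `` {x}" using a by (auto simp: r_def)
    ultimately have "r `` {x} = {x, y}" using a by auto
    then show "{x, y} \<in> \<alpha> \<bullet> \<beta>" using a unfolding m by (metis quotientI)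
  qed
qed

text \<open>By \<open>B_eqI\<close> it is enough to exhibit a path for every block of the expected
  product; nothing has to be said about other paths.\<close>

lemma mult_eqI:
  assumes "\<alpha> \<in> B" "\<beta> \<in> B" "\<gamma> \<in> B"
    and "\<And>x y. {x, y} \<in> \<gamma> \<Longrightarrow> (x, y) \<in> connected_via \<alpha> \<beta>"
  shows "\<alpha> \<bullet> \<beta> = \<gamma>"
  using assms by (intro B_eqI) (auto simp: mult_closed mult_block_iff B_points B_neq)

section \<open>Associativity: product graphs on numbered rows\<close>

fun at_layers :: "nat \<Rightarrow> nat \<Rightarrow> nat \<Rightarrow> point \<Rightarrow> nat \<times> nat" where
  "at_layers l m r (Upper i) = (l, i)"
| "at_layers l m r (Middle i) = (m, i)"
| "at_layers l m r (Lower i) = (r, i)"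

definition from_layers :: "nat \<Rightarrow> nat \<Rightarrow> nat \<times> nat \<Rightarrow> point" where
  "from_layers l m p =
     (if fst p = l then Upper (snd p) else if fst p = m then Middle (snd p) else Lower (snd p))"

text \<open>Three factors need four rows of points, more than \<open>point\<close> offers, so rows
  are numbered and a diagram can be placed between any two of them.\<close>

definition layer_rel :: "diagram \<Rightarrow> nat \<Rightarrow> nat \<Rightarrow> ((nat \<times> nat) \<times> (nat \<times> nat)) set" where
  "layer_rel \<alpha> l r = {(at_layers l l r x, at_layers l l r y) | x y. \<exists>A \<in> \<alpha>. x \<in> A \<and> y \<in> A}"

lemma layer_relI:
  "A \<in> \<alpha> \<Longrightarrow> x \<in> A \<Longrightarrow> y \<in> A \<Longrightarrow> (at_layers l l r x, at_layers l l r y) \<in> layer_rel \<alpha> l r"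
  unfolding layer_rel_def by blast

lemma at_layers_to_middle:
  assumes "x \<in> points n"
  shows "at_layers l m r (lower_to_middle x) = at_layers l l m x"
    and "at_layers l m r (upper_to_middle x) = at_layers m m r x"
    and "at_layers l m r x = at_layers l l r x"
  using assms by (auto elim: pointsE)

lemma from_layers_at_layers:
  assumes "x \<in> points n" "distinct [l, m, r]"
  shows "from_layers l m (at_layers l l m x) = lower_to_middle x"
    and "from_layers l m (at_layers m m r x) = upper_to_middle x"
    and "from_layers l m (at_layers l l r x) = x"
  using assms by (auto elim!: pointsE simp: from_layers_def)

lemma connected_to_layers:
  assumes \<alpha>: "\<alpha> \<in> B" and \<beta>: "\<beta> \<in> B" and "(x, y) \<in> connected_via \<alpha> \<beta>"
  shows "(at_layers l m r x, at_layers l m r y) \<in> (layer_rel \<alpha> l m \<union> layer_rel \<beta> m r)\<^sup>*"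
  using assms(3)
proof induction
  case (step y w)
  have "(at_layers l m r y, at_layers l m r w) \<in> layer_rel \<alpha> l m \<union> layer_rel \<beta> m r"
  proof -
    consider A u v where "A \<in> \<alpha>" "u \<in> A" "v \<in> A" "y = lower_to_middle u" "w = lower_to_middle v"
      | A u v where "A \<in> \<beta>" "u \<in> A" "v \<in> A" "y = upper_to_middle u" "w = upper_to_middle v"
      using step(2) unfolding product_graph_def by auto
    then show ?thesis
    proof cases
      case 1
      then have "u \<in> points n" "v \<in> points n" using \<alpha> by (auto simp: mem_B)
      then show ?thesis using 1 layer_relI by (simp add: at_layers_to_middle(1))
    next
      case 2
      then have "u \<in> points n" "v \<in> points n" using \<beta> by (auto simp: mem_B)
      then show ?thesis using 2 layer_relI by (simp add: at_layers_to_middle(2))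
    qed
  qed
  then show ?case by (rule rtrancl_into_rtrancl[OF step(3)])
qed simp

lemma connected_from_layers:
  assumes \<alpha>: "\<alpha> \<in> B" and \<beta>: "\<beta> \<in> B" and d: "distinct [l, m, r]"
    and "(p, q) \<in> (layer_rel \<alpha> l m \<union> layer_rel \<beta> m r)\<^sup>*"
  shows "(from_layers l m p, from_layers l m q) \<in> connected_via \<alpha> \<beta>"
  using assms(4)
proof induction
  case (step p q)
  have "(from_layers l m p, from_layers l m q) \<in> product_graph \<alpha> \<beta>"
  proof -
    consider A u v where "A \<in> \<alpha>" "u \<in> A" "v \<in> A" "p = at_layers l l m u" "q = at_layers l l m v"
      | A u v where "A \<in> \<beta>" "u \<in> A" "v \<in> A" "p = at_layers m m r u" "q = at_layers m m r v"
      using step(2) unfolding layer_rel_def by auto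
    then show ?thesis
    proof cases
      case 1
      then have "u \<in> points n" "v \<in> points n" using \<alpha> by (auto simp: mem_B)
      then show ?thesis using 1 from_layers_at_layers(1)[OF _ d]
        by (auto simp: product_graph_def intro: imageI)
    next
      case 2
      then have "u \<in> points n" "v \<in> points n" using \<beta> by (auto simp: mem_B)
      then show ?thesis using 2 from_layers_at_layers(2)[OF _ d]
        by (auto simp: product_graph_def intro: imageI)
    qed
  qed
  then show ?case by (rule rtrancl_into_rtrancl[OF step(3)])
qed simp

lemma layer_rel_mult:
  assumes \<alpha>: "\<alpha> \<in> B" and \<beta>: "\<beta> \<in> B"
  shows "layer_rel (\<alpha> \<bullet> \<beta>) l r \<subseteq> (layer_rel \<alpha> l m \<union> layer_rel \<beta> m r)\<^sup>*"
proof
  fix e assume "e \<in> layer_rel (\<alpha> \<bullet> \<beta>) l r"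
  then obtain A u v where e: "e = (at_layers l l r u, at_layers l l r v)" "A \<in> \<alpha> \<bullet> \<beta>" "u \<in> A" "v \<in> A"
    unfolding layer_rel_def by auto
  have pts: "u \<in> points n" "v \<in> points n"
    using e mult_closed[OF \<alpha> \<beta>] by (auto simp: mem_B)
  have "u = v \<or> {u, v} \<in> \<alpha> \<bullet> \<beta>"
  proof -
    from B_block[OF mult_closed[OF \<alpha> \<beta>] e(2)] obtain x y where "A = {x, y}" by blast
    then show ?thesis using e by (auto simp: insert_commute)
  qed
  then have "(u, v) \<in> connected_via \<alpha> \<beta>" using mult_block_iff[OF \<alpha> \<beta>] by auto
  then show "e \<in> (layer_rel \<alpha> l m \<union> layer_rel \<beta> m r)\<^sup>*"
    using connected_to_layers[OF \<alpha> \<beta>, of u v l m r] at_layers_to_middle(3) pts e by metis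
qed

lemma layer_rel_points:
  assumes "\<alpha> \<in> B" "(p, q) \<in> layer_rel \<alpha> l r"
  shows "p \<in> {l, r} \<times> {1..n}" "q \<in> {l, r} \<times> {1..n}"
proof -
  obtain A u v where A: "p = at_layers l l r u" "q = at_layers l l r v" "A \<in> \<alpha>" "u \<in> A" "v \<in> A"
    using assms unfolding layer_rel_def by auto
  then have "u \<in> points n" "v \<in> points n" using assms by (auto simp: mem_B)
  then show "p \<in> {l, r} \<times> {1..n}" "q \<in> {l, r} \<times> {1..n}" using A by (auto elim!: pointsE)
qed

lemma mult_assoc:
  assumes \<alpha>: "\<alpha> \<in> B" and \<beta>: "\<beta> \<in> B" and \<gamma>: "\<gamma> \<in> B"
  shows "\<alpha> \<bullet> \<beta> \<bullet> \<gamma> = \<alpha> \<bullet> (\<beta> \<bullet> \<gamma>)"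
proof (rule mult_eqI[symmetric])
  fix x y assume xy: "{x, y} \<in> \<alpha> \<bullet> \<beta> \<bullet> \<gamma>"
  \<comment> \<open>Rows 0 to 3 lie around the three factors. \<open>?V\<close> omits row 2, the row
    hidden in \<open>\<beta> \<bullet> \<gamma>\<close>; contracting the excursions into that row
    leaves a path for \<open>\<alpha> \<bullet> (\<beta> \<bullet> \<gamma>)\<close>.\<close>
  let ?S = "layer_rel \<alpha> 0 1" and ?R = "layer_rel \<beta> 1 2 \<union> layer_rel \<gamma> 2 3"
    and ?V = "{p :: nat \<times> nat. fst p \<noteq> 2}"
  have conn: "(x, y) \<in> connected_via (\<alpha> \<bullet> \<beta>) \<gamma>" and x: "x \<in> points n" and y: "y \<in> points n"
    using xy mult_block_iff[OF mult_closed[OF \<alpha> \<beta>] \<gamma>] by auto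
  have "layer_rel (\<alpha> \<bullet> \<beta>) 0 2 \<union> layer_rel \<gamma> 2 3 \<subseteq> (?S \<union> ?R)\<^sup>*"
    using layer_rel_mult[OF \<alpha> \<beta>, of 0 2 1] rtrancl_mono[of "?S \<union> layer_rel \<beta> 1 2" "?S \<union> ?R"]
    by fastforce
  then have "(layer_rel (\<alpha> \<bullet> \<beta>) 0 2 \<union> layer_rel \<gamma> 2 3)\<^sup>* \<subseteq> (?S \<union> ?R)\<^sup>*"
    by (rule rtrancl_subset_rtrancl)
  then have "(at_layers 0 2 3 x, at_layers 0 2 3 y) \<in> (?S \<union> ?R)\<^sup>*"
    using connected_to_layers[OF mult_closed[OF \<alpha> \<beta>] \<gamma> conn, of 0 2 3] by blast
  then have "(at_layers 0 0 3 x, at_layers 0 0 3 y) \<in> (?S \<union> ?R)\<^sup>*"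
    using x y by (metis at_layers_to_middle(3))
  moreover have "?S \<subseteq> ?V \<times> ?V"
    using layer_rel_points[OF \<alpha>, of _ _ 0 1] by fastforce
  moreover have "at_layers 0 0 3 x \<in> ?V" "at_layers 0 0 3 y \<in> ?V" using x y by (auto elim!: pointsE)
  ultimately have 1: "(at_layers 0 0 3 x, at_layers 0 0 3 y) \<in> (?S \<union> ?R\<^sup>* \<inter> ?V \<times> ?V)\<^sup>*"
    by (intro rtrancl_restrict)
  have "(v, w) \<in> (layer_rel (\<beta> \<bullet> \<gamma>) 1 3)\<^sup>=" if vw: "(v, w) \<in> ?R\<^sup>* \<inter> ?V \<times> ?V" for v w
  proof (cases "v = w")
    case False
    have R: "p \<in> {1, 2, 3} \<times> {1..n} \<and> q \<in> {1, 2, 3} \<times> {1..n}" if "(p, q) \<in> ?R" for p q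
      using that layer_rel_points[OF \<beta>, of p q 1 2] layer_rel_points[OF \<gamma>, of p q 2 3] by auto
    have "v \<in> {1, 2, 3} \<times> {1..n}" "w \<in> {1, 2, 3} \<times> {1..n}"
      using vw False R by (metis IntD1 converse_rtranclE, metis IntD1 rtranclE)
    then have vw': "v \<in> {1, 3} \<times> {1..n}" "w \<in> {1, 3} \<times> {1..n}" using vw by auto
    define x' where "x' = from_layers 1 2 v"
    define y' where "y' = from_layers 1 2 w"
    have pts: "x' \<in> points n" "y' \<in> points n" and v: "v = at_layers 1 1 3 x'" and w: "w = at_layers 1 1 3 y'"
      using vw' by (auto simp: x'_def y'_def from_layers_def)
    have "(x', y') \<in> connected_via \<beta> \<gamma>"
      using connected_from_layers[OF \<beta> \<gamma>, of 1 2 3 v w] vw unfolding x'_def y'_def by auto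
    then have "{x', y'} \<in> \<beta> \<bullet> \<gamma>" using mult_block_iff[OF \<beta> \<gamma>] pts v w False by auto
    then show ?thesis unfolding v w layer_rel_def by blast
  qed simp
  then have "?S \<union> ?R\<^sup>* \<inter> ?V \<times> ?V \<subseteq> (?S \<union> layer_rel (\<beta> \<bullet> \<gamma>) 1 3)\<^sup>*" by fastforce
  then have "(at_layers 0 0 3 x, at_layers 0 0 3 y) \<in> (?S \<union> layer_rel (\<beta> \<bullet> \<gamma>) 1 3)\<^sup>*"
    using 1 rtrancl_subset_rtrancl by blast
  then have "(from_layers 0 1 (at_layers 0 0 3 x), from_layers 0 1 (at_layers 0 0 3 y))
      \<in> connected_via \<alpha> (\<beta> \<bullet> \<gamma>)"
    by (intro connected_from_layers[OF \<alpha> mult_closed[OF \<beta> \<gamma>], of 0 1 3]) auto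
  then show "(x, y) \<in> connected_via \<alpha> (\<beta> \<bullet> \<gamma>)"
    using from_layers_at_layers(3)[of _ 0 1 3] x y by simp
qed (auto simp: mult_closed \<alpha> \<beta> \<gamma>)

lemma connected_symm: "(x, y) \<in> connected_via \<alpha> \<beta> \<Longrightarrow> (y, x) \<in> connected_via \<alpha> \<beta>"
  using sym_connected by (rule symD)

lemma product_graphI1:
  assumes "A \<in> \<alpha>" "u \<in> A" "v \<in> A"
  shows "(lower_to_middle u, lower_to_middle v) \<in> product_graph \<alpha> \<beta>"
proof -
  have "lower_to_middle ` A \<in> (`) lower_to_middle ` \<alpha> \<union> (`) upper_to_middle ` \<beta>"
    using assms by simp
  moreover have "lower_to_middle u \<in> lower_to_middle ` A" "lower_to_middle v \<in> lower_to_middle ` A"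
    using assms by simp_all
  ultimately show ?thesis unfolding product_graph_def by (intro CollectI case_prodI bexI[where x = "lower_to_middle ` A"] conjI)
qed

lemma product_graphI2:
  assumes "A \<in> \<beta>" "u \<in> A" "v \<in> A"
  shows "(upper_to_middle u, upper_to_middle v) \<in> product_graph \<alpha> \<beta>"
proof -
  have "upper_to_middle ` A \<in> (`) lower_to_middle ` \<alpha> \<union> (`) upper_to_middle ` \<beta>"
    using assms by simp
  moreover have "upper_to_middle u \<in> upper_to_middle ` A" "upper_to_middle v \<in> upper_to_middle ` A"
    using assms by simp_all
  ultimately show ?thesis unfolding product_graph_def by (intro CollectI case_prodI bexI[where x = "upper_to_middle ` A"] conjI)
qed

lemma connected_edge1:
  "{x, y} \<in> \<alpha> \<Longrightarrow> (lower_to_middle x, lower_to_middle y) \<in> connected_via \<alpha> \<beta>"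
  by (rule r_into_rtrancl, rule product_graphI1) auto

lemma connected_edge2:
  "{x, y} \<in> \<beta> \<Longrightarrow> (upper_to_middle x, upper_to_middle y) \<in> connected_via \<alpha> \<beta>"
  by (rule r_into_rtrancl, rule product_graphI2) auto

lemmas connected_trans = rtrancl_trans[where r = "product_graph \<alpha> \<beta>" for \<alpha> \<beta>]

section \<open>The involution on diagrams\<close>

lemma inj_flip: "inj flip"
  by (rule injI) (metis flip.elims flip.simps)

lemma flip_flip [simp]: "flip (flip x) = x"
  by (cases x) auto

lemma flip_points [simp]: "flip x \<in> points n \<longleftrightarrow> x \<in> points n"
  by (cases x) auto

lemma star_star [simp]: "star (star \<alpha>) = \<alpha>"
  by (simp add: star_def image_image)

lemma star_block_iff: "{x, y} \<in> star \<alpha> \<longleftrightarrow> {flip x, flip y} \<in> \<alpha>"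
proof
  assume "{x, y} \<in> star \<alpha>"
  then obtain A where A: "A \<in> \<alpha>" "{x, y} = flip ` A" by (auto simp: star_def)
  have "flip ` {x, y} = A" unfolding A by (simp add: image_image)
  then have "A = {flip x, flip y}" by auto
  then show "{flip x, flip y} \<in> \<alpha>" using A by simp
next
  assume "{flip x, flip y} \<in> \<alpha>"
  then have "flip ` {flip x, flip y} \<in> star \<alpha>" unfolding star_def by (rule imageI)
  then show "{x, y} \<in> star \<alpha>" by simp
qed

lemma star_closed [simp]: "star \<alpha> \<in> B" if "\<alpha> \<in> B"
proof -
  have "\<Union>(star \<alpha>) = flip ` \<Union>\<alpha>" by (auto simp: star_def)
  also have "\<dots> = points n"
    using that by (auto simp: mem_B points_def image_Un image_image)
  finally have "\<Union>(star \<alpha>) = points n" .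
  moreover have "is_matching (star \<alpha>)"
    unfolding star_def using that inj_flip
    by (intro is_matching_image) (auto simp: mem_B intro: inj_on_subset)
  ultimately show ?thesis by (simp add: mem_B)
qed

lemma star_mult:
  assumes \<alpha>: "\<alpha> \<in> B" and \<beta>: "\<beta> \<in> B"
  shows "star (\<alpha> \<bullet> \<beta>) = star \<beta> \<bullet> star \<alpha>"
proof (rule mult_eqI[symmetric])
  fix x y assume "{x, y} \<in> star (\<alpha> \<bullet> \<beta>)"
  then have "(flip x, flip y) \<in> connected_via \<alpha> \<beta>"
    using mult_block_iff[OF \<alpha> \<beta>] by (simp add: star_block_iff)
  then have "(flip (flip x), flip (flip y)) \<in> connected_via (star \<beta>) (star \<alpha>)"
  proof induction
    case (step y w)
    have "(flip y, flip w) \<in> product_graph (star \<beta>) (star \<alpha>)"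
    proof -
      have fl: "flip (lower_to_middle u) = upper_to_middle (flip u)"
        "flip (upper_to_middle u) = lower_to_middle (flip u)" for u by (cases u; simp)+
      consider A u v where "A \<in> \<alpha>" "u \<in> A" "v \<in> A" "y = lower_to_middle u" "w = lower_to_middle v"
        | A u v where "A \<in> \<beta>" "u \<in> A" "v \<in> A" "y = upper_to_middle u" "w = upper_to_middle v"
        using step(2) unfolding product_graph_def by auto
      then show ?thesis
      proof cases
        case 1
        then have "flip ` A \<in> star \<alpha>" "flip u \<in> flip ` A" "flip v \<in> flip ` A" by (auto simp: star_def)
        then show ?thesis unfolding 1 fl by (rule product_graphI2)
      next
        case 2
        then have "flip ` A \<in> star \<beta>" "flip u \<in> flip ` A" "flip v \<in> flip ` A" by (auto simp: star_def)
        then show ?thesis unfolding 2 fl by (rule product_graphI1)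
      qed
    qed
    then show ?case using step by auto
  qed simp
  then show "(x, y) \<in> connected_via (star \<beta>) (star \<alpha>)" by simp
qed (use \<alpha> \<beta> mult_closed in auto)

subsection \<open>Upper and lower patterns\<close>

definition up :: "diagram \<Rightarrow> nat set set" where "up \<alpha> = {A. Upper ` A \<in> \<alpha>}"
definition low :: "diagram \<Rightarrow> nat set set" where "low \<alpha> = {A. Lower ` A \<in> \<alpha>}"

definition pattern :: "nat set set \<Rightarrow> bool" where
  "pattern D \<longleftrightarrow> is_matching D \<and> \<Union>D \<subseteq> {1..n}"

definition rest :: "nat set set \<Rightarrow> nat set" where "rest D = {1..n} - \<Union>D"

text \<open>\<open>f\<close> is read only on \<open>rest D\<close>, so diagrams with the same
  patterns agree as soon as their bijections agree there. With bijections between the two rests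
  these are exactly the elements of the monoid (\<open>mk_closed\<close>,
  \<open>mk_through\<close>).\<close>

definition mk :: "nat set set \<Rightarrow> nat set set \<Rightarrow> (nat \<Rightarrow> nat) \<Rightarrow> diagram" where
  "mk D D' f = (`) Upper ` D \<union> (`) Lower ` D' \<union> (\<lambda>i. {Upper i, Lower (f i)}) ` rest D"

lemma inj_Upper: "inj Upper" and inj_Lower: "inj Lower" by (auto intro: injI)

lemma finite_rest [simp]: "finite (rest D)" by (simp add: rest_def)

lemma pattern_finite: "finite D" if "pattern D"
proof -
  have "D \<subseteq> Pow {1..n}" using that by (auto simp: pattern_def)
  then show ?thesis by (rule finite_subset) simp
qed

lemma pattern_card2: "card A = 2" if "pattern D" "A \<in> D"
  using that by (auto simp: pattern_def is_matching_def)

lemma card_rest: "card (rest D) + 2 * card D = n" if "pattern D"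
proof -
  have "card (\<Union>D) = sum card D"
    using that by (intro card_Union_disjoint) (auto simp: pattern_def is_matching_def intro: card_ge_0_finite)
  also have "\<dots> = 2 * card D" using that pattern_card2 by (simp add: mult.commute)
  finally have "card (\<Union>D) = 2 * card D" .
  moreover have "card (rest D) = n - card (\<Union>D)"
    using that unfolding rest_def pattern_def by (subst card_Diff_subset) (auto intro: finite_subset)
  moreover have "card (\<Union>D) \<le> n"
    using that card_mono[of "{1..n}" "\<Union>D"] by (auto simp: pattern_def)
  ultimately show ?thesis by simp
qed

lemma pattern_unique: "j = k" if "pattern D" "{i, j} \<in> D" "{i, k} \<in> D"
  using that is_matching_unique unfolding pattern_def by metis

lemma pattern_neq: "i \<noteq> j" if "pattern D" "{i, j} \<in> D"
  using that is_matching_neq[of D i j] by (auto simp: pattern_def)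

lemma pattern_range: "i \<in> {1..n}" "j \<in> {1..n}" if "pattern D" "{i, j} \<in> D"
  using that unfolding pattern_def by blast+

lemma pattern_ex: "\<exists>j. {i, j} \<in> D" if "pattern D" "i \<in> \<Union>D"
  using that is_matching_ex unfolding pattern_def by (metis UnionE)

lemma pattern_block: "\<exists>i j. A = {i, j} \<and> {i, j} \<in> D" if "pattern D" "A \<in> D"
  using pattern_card2[OF that] that by (metis card_2_iff)

lemma pattern_subset: "pattern D" if "pattern D'" "D \<subseteq> D'"
  using that is_matching_subset[of D' D] unfolding pattern_def by blast

lemma pattern_rest: "i \<in> rest D \<longleftrightarrow> i \<in> {1..n} \<and> (\<forall>j. {i, j} \<notin> D)" if "pattern D"
  using pattern_ex[OF that] unfolding rest_def by blast

lemma pattern_empty: "pattern {}" "rest {} = {1..n}"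
  by (auto simp: pattern_def is_matching_def rest_def)

lemma pattern_insert:
  assumes D: "pattern D" and ij: "i \<in> rest D" "j \<in> rest D" "i \<noteq> j"
  shows "pattern (insert {i, j} D)" "rest (insert {i, j} D) = rest D - {i, j}" "{i, j} \<notin> D"
    "card (insert {i, j} D) = Suc (card D)"
proof -
  show nin: "{i, j} \<notin> D" using ij by (auto simp: rest_def)
  then show "card (insert {i, j} D) = Suc (card D)" using pattern_finite[OF D] by simp
  show "rest (insert {i, j} D) = rest D - {i, j}" by (auto simp: rest_def)
  have "\<Union>(insert {i, j} D) \<subseteq> {1..n}" using D ij by (auto simp: pattern_def rest_def)
  moreover have "disjoint (insert {i, j} D)"
    using D ij by (auto simp: pattern_def is_matching_def pairwise_insert disjnt_def rest_def)
  moreover have "\<forall>A \<in> insert {i, j} D. card A = 2" using pattern_card2[OF D] ij by auto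
  ultimately show "pattern (insert {i, j} D)" by (auto simp: pattern_def is_matching_def)
qed

lemma up_block: "{i, j} \<in> up \<alpha> \<longleftrightarrow> {Upper i, Upper j} \<in> \<alpha>" by (simp add: up_def)
lemma low_block: "{i, j} \<in> low \<alpha> \<longleftrightarrow> {Lower i, Lower j} \<in> \<alpha>" by (simp add: low_def)

lemma up_star [simp]: "up (star \<alpha>) = low \<alpha>"
proof -
  have "Upper ` A \<in> star \<alpha> \<longleftrightarrow> Lower ` A \<in> \<alpha>" for A
  proof
    assume "Upper ` A \<in> star \<alpha>"
    then obtain X where X: "X \<in> \<alpha>" "Upper ` A = flip ` X" by (auto simp: star_def)
    have "flip ` (Upper ` A) = X" unfolding X by (simp add: image_image)
    moreover have "flip ` (Upper ` A) = Lower ` A" by (simp add: image_image)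
    ultimately show "Lower ` A \<in> \<alpha>" using X by metis
  next
    assume "Lower ` A \<in> \<alpha>"
    then have "flip ` (Lower ` A) \<in> star \<alpha>" unfolding star_def by (rule imageI)
    then show "Upper ` A \<in> star \<alpha>" by (simp add: image_image)
  qed
  then show ?thesis by (auto simp: up_def low_def)
qed

lemma low_star [simp]: "low (star \<alpha>) = up \<alpha>"
  using up_star[of "star \<alpha>"] by simp

lemma pattern_up: "pattern (up \<alpha>)" if "\<alpha> \<in> B"
proof -
  have "is_matching (up \<alpha>)"
    unfolding is_matching_def
  proof
    show "disjoint (up \<alpha>)"
    proof (rule pairwiseI)
      fix A A' assume "A \<in> up \<alpha>" "A' \<in> up \<alpha>" "A \<noteq> A'"
      then have "Upper ` A \<inter> Upper ` A' = {}"
        using \<open>\<alpha> \<in> B\<close> disjointD[of \<alpha> "Upper ` A" "Upper ` A'"] inj_image_eq_iff[OF inj_Upper]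
        by (auto simp: up_def mem_B is_matching_def)
      then show "disjnt A A'" by (auto simp: disjnt_def)
    qed
    show "\<forall>A \<in> up \<alpha>. card A = 2"
      using that card_image[of Upper] inj_Upper by (auto simp: up_def mem_B is_matching_def inj_on_def)
  qed
  moreover have "i \<in> {1..n}" if "A \<in> up \<alpha>" "i \<in> A" for A i
  proof -
    have "Upper i \<in> \<Union>\<alpha>" using that by (auto simp: up_def)
    then have "Upper i \<in> points n" using \<open>\<alpha> \<in> B\<close> unfolding mem_B by metis
    then show ?thesis by simp
  qed
  ultimately show ?thesis by (auto simp: pattern_def)
qed

lemma pattern_low: "pattern (low \<alpha>)" if "\<alpha> \<in> B"
  using pattern_up[OF star_closed[OF that]] by simp

lemma rest_up: "i \<in> rest (up \<alpha>) \<longleftrightarrow> (\<exists>j. {Upper i, Lower j} \<in> \<alpha>)" if \<alpha>: "\<alpha> \<in> B"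
proof
  assume i: "i \<in> rest (up \<alpha>)"
  then have "Upper i \<in> points n" by (simp add: rest_def)
  then obtain y where y: "{Upper i, y} \<in> \<alpha>" using B_ex[OF \<alpha>] by blast
  have "y \<noteq> Upper j" for j using i y by (auto simp: rest_def up_block[symmetric])
  moreover have "y \<in> points n" using B_points[OF \<alpha> y] by simp
  ultimately obtain j where "y = Lower j" by (cases y) auto
  then show "\<exists>j. {Upper i, Lower j} \<in> \<alpha>" using y by auto
next
  assume "\<exists>j. {Upper i, Lower j} \<in> \<alpha>"
  then obtain j where j: "{Upper i, Lower j} \<in> \<alpha>" by blast
  then have "{i, k} \<notin> up \<alpha>" for k using B_unique[OF \<alpha> j] by (auto simp: up_block)
  then show "i \<in> rest (up \<alpha>)"
    using pattern_rest[OF pattern_up[OF \<alpha>]] B_points(1)[OF \<alpha> j] by auto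
qed

lemma rest_low: "j \<in> rest (low \<alpha>) \<longleftrightarrow> (\<exists>i. {Upper i, Lower j} \<in> \<alpha>)" if \<alpha>: "\<alpha> \<in> B"
  using rest_up[OF star_closed[OF \<alpha>], of j] by (simp add: star_block_iff insert_commute)

lemma mk_block_iff:
  "{Upper i, Upper j} \<in> mk D D' f \<longleftrightarrow> {i, j} \<in> D"
  "{Lower i, Lower j} \<in> mk D D' f \<longleftrightarrow> {i, j} \<in> D'"
  "{Upper i, Lower j} \<in> mk D D' f \<longleftrightarrow> i \<in> rest D \<and> j = f i"
proof -
  have im: "{Upper i, Upper j} = Upper ` {i, j}" "{Lower i, Lower j} = Lower ` {i, j}" for i j by auto
  have ne: "{Upper i, Upper j} \<noteq> Lower ` A" "{Lower i, Lower j} \<noteq> Upper ` A"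
    "{Upper i, Lower j} \<noteq> Upper ` A" "{Upper i, Lower j} \<noteq> Lower ` A"
    "{Upper i, Upper j} \<noteq> {Upper k, Lower l}" "{Lower i, Lower j} \<noteq> {Upper k, Lower l}"
    for i j k l A by (auto simp: doubleton_eq_iff)
  show "{Upper i, Upper j} \<in> mk D D' f \<longleftrightarrow> {i, j} \<in> D"
    unfolding mk_def using ne inj_image_eq_iff[OF inj_Upper] by (auto simp: im simp del: image_insert)
  show "{Lower i, Lower j} \<in> mk D D' f \<longleftrightarrow> {i, j} \<in> D'"
    unfolding mk_def using ne inj_image_eq_iff[OF inj_Lower] by (auto simp: im simp del: image_insert)
  show "{Upper i, Lower j} \<in> mk D D' f \<longleftrightarrow> i \<in> rest D \<and> j = f i"
    unfolding mk_def using ne by (auto simp: doubleton_eq_iff)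
qed

lemma mk_closed:
  assumes D: "pattern D" and D': "pattern D'" and f: "bij_betw f (rest D) (rest D')"
  shows "mk D D' f \<in> B"
proof -
  let ?T = "(\<lambda>i. {Upper i, Lower (f i)}) ` rest D"
  have m: "is_matching ((`) Upper ` D)" "is_matching ((`) Lower ` D')"
    using D D' inj_Upper inj_Lower
    by (auto simp: pattern_def inj_on_def intro!: is_matching_image)
  have T: "is_matching ?T"
  proof -
    have "{Upper i, Lower (f i)} \<inter> {Upper j, Lower (f j)} = {}"
      if "i \<in> rest D" "j \<in> rest D" "i \<noteq> j" for i j
      using f that by (auto simp: bij_betw_def inj_on_def)
    then have "disjoint ?T" by (auto simp: pairwise_def disjnt_def)
    then show ?thesis by (auto simp: is_matching_def)
  qed
  have U: "\<Union>((`) Upper ` D) = Upper ` \<Union>D" "\<Union>((`) Lower ` D') = Lower ` \<Union>D'"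
    "\<Union>?T = Upper ` rest D \<union> Lower ` rest D'"
    using f by (auto simp: bij_betw_def)
  have "disjoint (mk D D' f)"
    unfolding mk_def
  proof (intro disjoint_union)
    show "disjoint ((`) Upper ` D)" "disjoint ((`) Lower ` D')" "disjoint ?T"
      using m T by (auto simp: is_matching_def)
    show "\<Union>((`) Upper ` D) \<inter> \<Union>((`) Lower ` D') = {}" unfolding U by auto
    show "\<Union>((`) Upper ` D \<union> (`) Lower ` D') \<inter> \<Union>?T = {}"
      unfolding Union_Un_distrib U by (auto simp: rest_def)
  qed
  then have "is_matching (mk D D' f)"
    using m T by (auto simp: is_matching_def mk_def)
  moreover have "\<Union>(mk D D' f) = Upper ` (\<Union>D \<union> rest D) \<union> Lower ` (\<Union>D' \<union> rest D')"
    unfolding mk_def Union_Un_distrib U by auto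
  moreover have "\<Union>D \<union> rest D = {1..n}" "\<Union>D' \<union> rest D' = {1..n}"
    using D D' by (auto simp: pattern_def rest_def)
  ultimately show ?thesis by (simp add: mem_B points_def)
qed

lemma up_mk: "up (mk D D' f) = D" and low_mk: "low (mk D D' f) = D'"
  if "pattern D" "pattern D'" "bij_betw f (rest D) (rest D')"
proof -
  note p = pattern_up[OF mk_closed[OF that]] pattern_low[OF mk_closed[OF that]]
  show "up (mk D D' f) = D"
    using pattern_block[OF p(1)] pattern_block[OF that(1)] by (metis mk_block_iff(1) up_block subsetI subset_antisym)
  show "low (mk D D' f) = D'"
    using pattern_block[OF p(2)] pattern_block[OF that(2)] by (metis mk_block_iff(2) low_block subsetI subset_antisym)
qed

definition through :: "diagram \<Rightarrow> nat \<Rightarrow> nat" where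
  "through \<alpha> i = (THE j. {Upper i, Lower j} \<in> \<alpha>)"

lemma through_eq: "through \<alpha> i = j" if "\<alpha> \<in> B" "{Upper i, Lower j} \<in> \<alpha>"
  unfolding through_def using that B_unique[OF that(1)] by (blast intro: the_equality)

lemma through_block: "{Upper i, Lower (through \<alpha> i)} \<in> \<alpha>" if "\<alpha> \<in> B" "i \<in> rest (up \<alpha>)"
  using that rest_up through_eq by metis

lemma through_bij: "bij_betw (through \<alpha>) (rest (up \<alpha>)) (rest (low \<alpha>))" if \<alpha>: "\<alpha> \<in> B"
proof (rule bij_betw_imageI)
  show "inj_on (through \<alpha>) (rest (up \<alpha>))"
  proof (rule inj_onI)
    fix i j assume "i \<in> rest (up \<alpha>)" "j \<in> rest (up \<alpha>)" "through \<alpha> i = through \<alpha> j"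
    then have "{Lower (through \<alpha> i), Upper i} \<in> \<alpha>" "{Lower (through \<alpha> i), Upper j} \<in> \<alpha>"
      using through_block[OF \<alpha>] by (metis insert_commute)+
    then show "i = j" using B_unique[OF \<alpha>] by blast
  qed
  show "through \<alpha> ` rest (up \<alpha>) = rest (low \<alpha>)"
  proof
    show "through \<alpha> ` rest (up \<alpha>) \<subseteq> rest (low \<alpha>)"
      using through_block[OF \<alpha>] rest_low[OF \<alpha>] by blast
    show "rest (low \<alpha>) \<subseteq> through \<alpha> ` rest (up \<alpha>)"
      using through_eq[OF \<alpha>] rest_low[OF \<alpha>] rest_up[OF \<alpha>] by (metis imageI subsetI)
  qed
qed

lemma mk_through: "\<alpha> = mk (up \<alpha>) (low \<alpha>) (through \<alpha>)" if \<alpha>: "\<alpha> \<in> B"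
proof (rule B_eqI[OF \<alpha>])
  show "mk (up \<alpha>) (low \<alpha>) (through \<alpha>) \<in> B"
    using mk_closed pattern_up pattern_low through_bij \<alpha> by blast
  fix x y assume xy: "{x, y} \<in> mk (up \<alpha>) (low \<alpha>) (through \<alpha>)"
  have sub: "Upper ` A \<in> \<alpha>" if "A \<in> up \<alpha>" for A using that by (simp add: up_def)
  have sub': "Lower ` A \<in> \<alpha>" if "A \<in> low \<alpha>" for A using that by (simp add: low_def)
  show "{x, y} \<in> \<alpha>" using xy sub sub' through_block[OF \<alpha>] unfolding mk_def by auto
qed

lemma mk_eqI: "\<alpha> = mk D D' f"
  if "\<alpha> \<in> B" "up \<alpha> = D" "low \<alpha> = D'" "\<And>i. i \<in> rest D \<Longrightarrow> {Upper i, Lower (f i)} \<in> \<alpha>"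
proof -
  have "mk D D' f = mk D D' (through \<alpha>)"
    unfolding mk_def using through_eq[OF \<open>\<alpha> \<in> B\<close>] that by (metis (no_types, lifting) image_cong)
  then show ?thesis using mk_through[OF \<open>\<alpha> \<in> B\<close>] that by simp
qed

lemma mk_star:
  assumes D: "pattern D" and D': "pattern D'" and f: "bij_betw f (rest D) (rest D')"
  shows "star (mk D D' f) = mk D' D (the_inv_into (rest D) f)"
proof (rule mk_eqI)
  show "star (mk D D' f) \<in> B" using mk_closed[OF assms] by simp
  show "up (star (mk D D' f)) = D'" "low (star (mk D D' f)) = D"
    using up_mk[OF assms] low_mk[OF assms] by auto
  fix i assume "i \<in> rest D'"
  then have "the_inv_into (rest D) f i \<in> rest D" "f (the_inv_into (rest D) f i) = i"
    using f by (auto simp: bij_betw_def intro: the_inv_into_into f_the_inv_into_f)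
  then have "{Upper (the_inv_into (rest D) f i), Lower i} \<in> mk D D' f" by (simp add: mk_block_iff)
  then show "{Upper i, Lower (the_inv_into (rest D) f i)} \<in> star (mk D D' f)"
    by (simp add: star_block_iff insert_commute)
qed

text \<open>A block inside the upper row does not meet the middle row, so it survives. This is why
  patterns grow and ranks fall under multiplication.\<close>

lemma mult_upper: "up \<alpha> \<subseteq> up (\<alpha> \<bullet> \<beta>)" if \<alpha>: "\<alpha> \<in> B" and \<beta>: "\<beta> \<in> B"
proof
  fix A assume "A \<in> up \<alpha>"
  then obtain i j where A: "A = {i, j}" "{i, j} \<in> up \<alpha>" using pattern_block[OF pattern_up[OF \<alpha>]] by blast
  then have "{Upper i, Upper j} \<in> \<alpha>" by (simp add: up_block)
  then have "{Upper i, Upper j} \<in> \<alpha> \<bullet> \<beta>"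
    using connected_edge1[of "Upper i" "Upper j" \<alpha> \<beta>] B_points[OF \<alpha>] B_neq[OF \<alpha>] mult_block_iff[OF \<alpha> \<beta>]
    by (metis lower_to_middle.simps(2))
  then show "A \<in> up (\<alpha> \<bullet> \<beta>)" by (simp add: up_block A)
qed

lemma mult_lower: "low \<beta> \<subseteq> low (\<alpha> \<bullet> \<beta>)" if \<alpha>: "\<alpha> \<in> B" and \<beta>: "\<beta> \<in> B"
  using mult_upper[OF star_closed[OF \<beta>] star_closed[OF \<alpha>]] star_mult[OF \<alpha> \<beta>] by (metis up_star)

text \<open>When the inner patterns agree, a transversal of the first factor meets one of the second
  directly in the middle row, while the pairs of \<open>D2\<close> meet themselves; so the
  bijections compose.\<close>

lemma mk_mult:
  assumes D: "pattern D1" "pattern D2" "pattern D3"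
    and f: "bij_betw f (rest D1) (rest D2)" and g: "bij_betw g (rest D2) (rest D3)"
  shows "mk D1 D2 f \<bullet> mk D2 D3 g = mk D1 D3 (g \<circ> f)"
proof (rule mult_eqI)
  let ?\<alpha> = "mk D1 D2 f" and ?\<beta> = "mk D2 D3 g"
  show "?\<alpha> \<in> B" "?\<beta> \<in> B" "mk D1 D3 (g \<circ> f) \<in> B"
    using assms mk_closed bij_betw_trans by blast+
  fix x y assume "{x, y} \<in> mk D1 D3 (g \<circ> f)"
  then consider A where "A \<in> D1" "{x, y} = Upper ` A" | A where "A \<in> D3" "{x, y} = Lower ` A"
    | i where "i \<in> rest D1" "{x, y} = {Upper i, Lower (g (f i))}"
    unfolding mk_def by auto
  then show "(x, y) \<in> connected_via ?\<alpha> ?\<beta>"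
  proof cases
    case 1
    then have "{x, y} \<in> ?\<alpha>" by (auto simp: mk_def)
    moreover have "lower_to_middle x = x" "lower_to_middle y = y" using 1 by (metis image_iff insertI1 insertI2 lower_to_middle.simps(2))+
    ultimately show ?thesis using connected_edge1[of x y ?\<alpha> ?\<beta>] by simp
  next
    case 2
    then have "{x, y} \<in> ?\<beta>" by (auto simp: mk_def)
    moreover have "upper_to_middle x = x" "upper_to_middle y = y" using 2 by (metis image_iff insertI1 insertI2 upper_to_middle.simps(2))+
    ultimately show ?thesis using connected_edge2[of x y ?\<beta> ?\<alpha>] by simp
  next
    case 3
    have "{Upper i, Lower (f i)} \<in> ?\<alpha>" using 3 by (simp add: mk_block_iff)
    then have 1: "(Upper i, Middle (f i)) \<in> connected_via ?\<alpha> ?\<beta>"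
      using connected_edge1[of "Upper i" "Lower (f i)"] by simp
    have "f i \<in> rest D2" using f 3 by (auto simp: bij_betw_def)
    then have "{Upper (f i), Lower (g (f i))} \<in> ?\<beta>" by (simp add: mk_block_iff)
    then have 2: "(Middle (f i), Lower (g (f i))) \<in> connected_via ?\<alpha> ?\<beta>"
      using connected_edge2[of "Upper (f i)" "Lower (g (f i))"] by simp
    have "(Upper i, Lower (g (f i))) \<in> connected_via ?\<alpha> ?\<beta>"
      using 1 2 by (rule connected_trans)
    then show ?thesis using 3 connected_symm by (auto simp: doubleton_eq_iff)
  qed
qed

subsection \<open>Projections and hooks\<close>

text \<open>These are the idempotents fixed by \<open>star\<close>;
  \<open>\<alpha> \<bullet> star \<alpha>\<close> is one of them, and \<open>proj {}\<close> is the
  identity.\<close>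

definition proj :: "nat set set \<Rightarrow> diagram" where "proj D = mk D D id"

lemma proj_simps [simp]:
  assumes "pattern D"
  shows "proj D \<in> B" "up (proj D) = D" "low (proj D) = D"
  using mk_closed up_mk low_mk assms by (auto simp: proj_def)

lemma proj_through: "{Upper i, Lower i} \<in> proj D" if "i \<in> rest D"
  using that by (simp add: proj_def mk_block_iff)

lemma star_proj [simp]: "star (proj D) = proj D" if "pattern D"
proof -
  have "star (proj D) = mk D D (the_inv_into (rest D) id)"
    unfolding proj_def using that by (intro mk_star) auto
  also have "\<dots> = mk D D id"
    unfolding mk_def using the_inv_into_f_f[of id "rest D"] by (auto intro!: image_cong)
  finally show ?thesis by (simp add: proj_def)
qed

lemma one_eq: "\<one>\<^bsub>brauer n\<^esub> = proj {}"
  by (auto simp: brauer_def partition_monoid_def proj_def mk_def pattern_empty)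

lemma one_closed [simp]: "\<one>\<^bsub>brauer n\<^esub> \<in> B"
  by (simp add: one_eq pattern_empty)

lemma connected_proj:
  assumes "pattern D" "x \<in> points n" "\<And>i. x = Upper i \<Longrightarrow> i \<in> rest D"
  shows "(x, upper_to_middle x) \<in> connected_via (proj D) \<beta>"
  using assms(2)
proof (cases rule: pointsE)
  case (1 i)
  then have "{Upper i, Lower i} \<in> proj D" using assms(3) by (intro proj_through) auto
  then show ?thesis using connected_edge1[of "Upper i" "Lower i"] 1 by simp
qed simp

lemma connected_proj_block:
  assumes D: "pattern D" and xy: "{x, y} \<in> \<beta>" "x \<in> points n" "y \<in> points n"
    and "\<And>i. x = Upper i \<Longrightarrow> i \<in> rest D" "\<And>i. y = Upper i \<Longrightarrow> i \<in> rest D"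
  shows "(x, y) \<in> connected_via (proj D) \<beta>"
  using connected_proj[OF D xy(2), of \<beta>] connected_proj[OF D xy(3), of \<beta>] assms(5,6)
    connected_edge2[OF xy(1), of "proj D"] connected_symm connected_trans by metis

lemma proj_mult:
  assumes \<beta>: "\<beta> \<in> B" and D: "D \<subseteq> up \<beta>"
  shows "proj D \<bullet> \<beta> = \<beta>"
proof (rule mult_eqI)
  have pD: "pattern D" using pattern_subset[OF pattern_up[OF \<beta>] D] .
  show "proj D \<in> B" "\<beta> \<in> B" "\<beta> \<in> B" using pD \<beta> by auto
  \<comment> \<open>An upper point covered by \<open>D\<close> does not pass straight through the
    projection, but its partner in \<open>\<beta>\<close> is its partner in \<open>D\<close>, so the
    edge is already present in the left factor.\<close>
  have cov: "(x, y) \<in> connected_via (proj D) \<beta>" if xy: "{x, y} \<in> \<beta>" and x: "x = Upper i" "i \<notin> rest D" for x y i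
  proof -
    have "i \<in> {1..n}" using B_points(1)[OF \<beta> xy] x by simp
    then have "i \<in> \<Union>D" using x by (simp add: rest_def)
    then obtain k where k: "{i, k} \<in> D" using pattern_ex[OF pD] by blast
    then have "{Upper i, Upper k} \<in> \<beta>" using D by (auto simp: up_block[symmetric])
    then have "y = Upper k" using B_unique[OF \<beta>] xy x by blast
    moreover have "{Upper i, Upper k} \<in> proj D" using k by (simp add: proj_def mk_block_iff)
    ultimately show ?thesis using x connected_edge1[of "Upper i" "Upper k"] by simp
  qed
  fix x y assume xy: "{x, y} \<in> \<beta>"
  then have yx: "{y, x} \<in> \<beta>" by (simp add: insert_commute)
  show "(x, y) \<in> connected_via (proj D) \<beta>"
    using cov[OF xy] cov[OF yx] connected_symm connected_proj_block[OF pD xy B_points[OF \<beta> xy]] by blast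
qed

lemma mult_proj: "\<beta> \<bullet> proj D = \<beta>" if \<beta>: "\<beta> \<in> B" and D: "D \<subseteq> low \<beta>"
proof -
  have pD: "pattern D" using pattern_subset[OF pattern_low[OF \<beta>] D] .
  have "star (proj D \<bullet> star \<beta>) = star (star \<beta>)" using proj_mult[of "star \<beta>" D] that by simp
  then show ?thesis using star_mult[of "proj D" "star \<beta>"] pD \<beta> by simp
qed

lemma one_left [simp]: "\<one>\<^bsub>brauer n\<^esub> \<bullet> \<beta> = \<beta>" and one_right [simp]: "\<beta> \<bullet> \<one>\<^bsub>brauer n\<^esub> = \<beta>" if "\<beta> \<in> B"
  using that proj_mult mult_proj by (simp_all add: one_eq)

lemma
  assumes \<alpha>: "\<alpha> \<in> B" and \<beta>: "\<beta> \<in> B"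
  shows mult_UL: "{Upper x, Lower i} \<in> \<alpha> \<Longrightarrow> {Upper i, Lower y} \<in> \<beta> \<Longrightarrow> {Upper x, Lower y} \<in> \<alpha> \<bullet> \<beta>"
    and mult_UU: "{Upper x, Lower i} \<in> \<alpha> \<Longrightarrow> {Upper y, Lower j} \<in> \<alpha> \<Longrightarrow> {Upper i, Upper j} \<in> \<beta> \<Longrightarrow>
      {Upper x, Upper y} \<in> \<alpha> \<bullet> \<beta>"
    and mult_LL: "{Lower i, Lower j} \<in> \<alpha> \<Longrightarrow> {Upper i, Lower x} \<in> \<beta> \<Longrightarrow> {Upper j, Lower y} \<in> \<beta> \<Longrightarrow>
      {Lower x, Lower y} \<in> \<alpha> \<bullet> \<beta>"
proof -
  assume a: "{Upper x, Lower i} \<in> \<alpha>" "{Upper i, Lower y} \<in> \<beta>"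
  have "(Upper x, Lower y) \<in> connected_via \<alpha> \<beta>"
  proof (rule connected_trans)
    show "(Upper x, Middle i) \<in> connected_via \<alpha> \<beta>" "(Middle i, Lower y) \<in> connected_via \<alpha> \<beta>"
      using connected_edge1[OF a(1), of \<beta>] connected_edge2[OF a(2), of \<alpha>] by simp_all
  qed
  then show "{Upper x, Lower y} \<in> \<alpha> \<bullet> \<beta>"
    using B_points[OF \<alpha> a(1)] B_points[OF \<beta> a(2)] mult_block_iff[OF \<alpha> \<beta>] by simp
next
  assume a: "{Upper x, Lower i} \<in> \<alpha>" "{Upper y, Lower j} \<in> \<alpha>" "{Upper i, Upper j} \<in> \<beta>"
  have "i \<noteq> j" using B_neq[OF \<beta> a(3)] by auto
  then have "x \<noteq> y" using B_unique[OF \<alpha>] a by blast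
  moreover have "(Upper x, Upper y) \<in> connected_via \<alpha> \<beta>"
  proof -
    have "(Upper x, Middle i) \<in> connected_via \<alpha> \<beta>" "(Upper y, Middle j) \<in> connected_via \<alpha> \<beta>"
      "(Middle i, Middle j) \<in> connected_via \<alpha> \<beta>"
      using connected_edge1[OF a(1), of \<beta>] connected_edge1[OF a(2), of \<beta>] connected_edge2[OF a(3), of \<alpha>]
      by simp_all
    then show ?thesis by (meson connected_symm connected_trans)
  qed
  ultimately show "{Upper x, Upper y} \<in> \<alpha> \<bullet> \<beta>"
    using B_points[OF \<alpha> a(1)] B_points[OF \<alpha> a(2)] mult_block_iff[OF \<alpha> \<beta>] by simp
next
  assume a: "{Lower i, Lower j} \<in> \<alpha>" "{Upper i, Lower x} \<in> \<beta>" "{Upper j, Lower y} \<in> \<beta>"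
  have "i \<noteq> j" using B_neq[OF \<alpha> a(1)] by auto
  then have "x \<noteq> y" using B_unique[OF \<beta>, of "Lower x"] a by (metis insert_commute point.inject(1))
  moreover have "(Lower x, Lower y) \<in> connected_via \<alpha> \<beta>"
  proof -
    have "(Middle i, Middle j) \<in> connected_via \<alpha> \<beta>" "(Middle i, Lower x) \<in> connected_via \<alpha> \<beta>"
      "(Middle j, Lower y) \<in> connected_via \<alpha> \<beta>"
      using connected_edge1[OF a(1), of \<beta>] connected_edge2[OF a(2), of \<alpha>] connected_edge2[OF a(3), of \<alpha>]
      by simp_all
    then show ?thesis by (meson connected_symm connected_trans)
  qed
  ultimately show "{Lower x, Lower y} \<in> \<alpha> \<bullet> \<beta>"
    using B_points[OF \<beta> a(2)] B_points[OF \<beta> a(3)] mult_block_iff[OF \<alpha> \<beta>] by simp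
qed

definition hook :: "nat \<Rightarrow> nat \<Rightarrow> diagram" where "hook i j = proj {{i, j}}"

lemma pattern_pair: "pattern {{i, j}}" "rest {{i, j}} = {1..n} - {i, j}"
  if "i \<in> {1..n}" "j \<in> {1..n}" "i \<noteq> j"
  using pattern_insert[OF pattern_empty(1), of i j] that by (auto simp: pattern_empty)

lemma hook_simps [simp]:
  assumes "i \<in> {1..n}" "j \<in> {1..n}" "i \<noteq> j"
  shows "hook i j \<in> B" "star (hook i j) = hook i j"
  using pattern_pair[OF assms] by (simp_all add: hook_def)

context
  fixes i j and \<alpha> :: diagram
  assumes ij: "i \<in> {1..n}" "j \<in> {1..n}" "i \<noteq> j" and \<alpha>: "\<alpha> \<in> B"
begin

lemma hook_new: "{i, j} \<in> up (hook i j \<bullet> \<alpha>)"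
  using mult_upper[of "hook i j" \<alpha>] pattern_pair[OF ij] \<alpha> by (auto simp: hook_def)

lemma hook_old: "{x, y} \<in> hook i j \<bullet> \<alpha>"
  if xy: "{x, y} \<in> \<alpha>" and "x \<noteq> Upper i" "x \<noteq> Upper j" "y \<noteq> Upper i" "y \<noteq> Upper j"
proof -
  have "k \<in> rest {{i, j}}" if "Upper k \<in> points n" "Upper k \<noteq> Upper i" "Upper k \<noteq> Upper j" for k
    using that pattern_pair[OF ij] by auto
  then have "(x, y) \<in> connected_via (hook i j) \<alpha>"
    unfolding hook_def using that B_points[OF \<alpha> xy]
    by (intro connected_proj_block[OF pattern_pair(1)[OF ij] xy B_points[OF \<alpha> xy]]) simp_all
  then show ?thesis using mult_block_iff[of "hook i j" \<alpha>] ij \<alpha> B_points[OF \<alpha> xy] B_neq[OF \<alpha> xy] by simp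
qed

text \<open>The lower block of the hook links the middle copies of \<open>i\<close> and
  \<open>j\<close>, so their partners in \<open>\<alpha>\<close> become partners of each other. The
  side condition excludes that \<open>i\<close> and \<open>j\<close> are already paired in
  \<open>\<alpha>\<close>, where the middle row closes a cycle instead.\<close>

lemma hook_join: "{x, y} \<in> hook i j \<bullet> \<alpha>" if x: "{Upper i, x} \<in> \<alpha>" and y: "{Upper j, y} \<in> \<alpha>" and "x \<noteq> Upper j"
proof -
  have "x \<noteq> Upper i" "y \<noteq> Upper j" using B_neq[OF \<alpha>] x y by blast+
  moreover have "y \<noteq> Upper i" using B_unique[OF \<alpha>, of "Upper i" x "Upper j"] that by (auto simp: insert_commute)
  moreover have "x \<noteq> y" using B_unique[OF \<alpha>, of x "Upper i" "Upper j"] x y ij by (auto simp: insert_commute)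
  ultimately have ne: "x \<noteq> Upper i" "x \<noteq> Upper j" "y \<noteq> Upper i" "y \<noteq> Upper j" "x \<noteq> y" using that by auto
  have pts: "x \<in> points n" "y \<in> points n" using B_points[OF \<alpha>] x y by auto
  have r: "k \<in> rest {{i, j}}" if "Upper k \<in> points n" "Upper k \<noteq> Upper i" "Upper k \<noteq> Upper j" for k
    using that pattern_pair[OF ij] by auto
  let ?c = "connected_via (proj {{i, j}}) \<alpha>"
  have "(x, upper_to_middle x) \<in> ?c" "(y, upper_to_middle y) \<in> ?c"
    using connected_proj[OF pattern_pair(1)[OF ij]] r ne pts by blast+
  moreover have "(Middle i, upper_to_middle x) \<in> ?c" "(Middle j, upper_to_middle y) \<in> ?c"
    using connected_edge2[OF x] connected_edge2[OF y] by simp_all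
  moreover have "{Lower i, Lower j} \<in> proj {{i, j}}" by (simp add: proj_def mk_block_iff)
  then have "(Middle i, Middle j) \<in> ?c" using connected_edge1[of "Lower i" "Lower j"] by simp
  ultimately have "(x, y) \<in> ?c" by (meson connected_symm connected_trans)
  then show ?thesis using mult_block_iff[OF hook_simps(1)[OF ij] \<alpha>] pts ne by (simp add: hook_def)
qed

lemma hook_absorb: "hook i j \<bullet> \<alpha> = \<alpha>" if "{i, j} \<in> up \<alpha>"
  unfolding hook_def using that \<alpha> by (intro proj_mult) auto

end

subsection \<open>Rank\<close>

lemma rank_eq: "rank \<alpha> = card (rest (up \<alpha>))" if \<alpha>: "\<alpha> \<in> B"
proof -
  have "{A \<in> \<alpha>. A \<inter> range Upper \<noteq> {} \<and> A \<inter> range Lower \<noteq> {}}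
      = (\<lambda>i. {Upper i, Lower (through \<alpha> i)}) ` rest (up \<alpha>)" (is "?L = ?R")
  proof
    show "?R \<subseteq> ?L" using through_block[OF \<alpha>] by auto
    show "?L \<subseteq> ?R"
    proof
      fix A assume A: "A \<in> ?L"
      then obtain i j where ij: "Upper i \<in> A" "Lower j \<in> A" by auto
      obtain x y where "A = {x, y}" using B_block[OF \<alpha>] A by blast
      then have "A = {Upper i, Lower j}" using ij by auto
      then show "A \<in> ?R" using A rest_up[OF \<alpha>] through_eq[OF \<alpha>] by blast
    qed
  qed
  moreover have "inj_on (\<lambda>i. {Upper i, Lower (through \<alpha> i)}) (rest (up \<alpha>))"
    by (auto simp: inj_on_def doubleton_eq_iff)
  ultimately show ?thesis by (simp add: rank_def card_image)
qed

lemma rank_up: "rank \<alpha> + 2 * card (up \<alpha>) = n" if "\<alpha> \<in> B"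
  using card_rest[OF pattern_up[OF that]] rank_eq[OF that] by simp

lemma rank_star [simp]: "rank (star \<alpha>) = rank \<alpha>" if "\<alpha> \<in> B"
  using rank_eq[OF star_closed[OF that]] rank_eq[OF that] bij_betw_same_card[OF through_bij[OF that]] by simp

lemma rank_low: "rank \<alpha> + 2 * card (low \<alpha>) = n" if "\<alpha> \<in> B"
  using rank_up[OF star_closed[OF that]] rank_star[OF that] by simp

lemma rank_eq_low: "rank \<alpha> = card (rest (low \<alpha>))" if "\<alpha> \<in> B"
  using rank_eq[OF star_closed[OF that]] rank_star[OF that] by simp

lemma rank_mod: "rank \<alpha> mod 2 = n mod 2" if "\<alpha> \<in> B"
  using rank_up[OF that] by (metis mod_mult_self2)

lemma rank_ge: "n mod 2 \<le> rank \<alpha>" if "\<alpha> \<in> B"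
  using rank_mod[OF that] by (metis mod_less_eq_dividend)

lemma rank_le: "rank \<alpha> \<le> n" if "\<alpha> \<in> B"
  using rank_up[OF that] by simp

lemma rank_proj: "rank (proj D) = card (rest D)" if "pattern D"
  using rank_eq[of "proj D"] that by simp

lemma finite_up [simp]: "finite (up \<alpha>)" if "\<alpha> \<in> B"
  using pattern_finite[OF pattern_up[OF that]] .

lemma finite_low [simp]: "finite (low \<alpha>)" if "\<alpha> \<in> B"
  using pattern_finite[OF pattern_low[OF that]] .

lemma rank_anti_up: "up \<alpha> \<subseteq> up \<beta> \<Longrightarrow> rank \<beta> \<le> rank \<alpha>" if "\<alpha> \<in> B" "\<beta> \<in> B"
  using card_mono[of "up \<beta>" "up \<alpha>"] rank_up[OF that(1)] rank_up[OF that(2)] that by simp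

lemma rank_less_up: "up \<alpha> \<subset> up \<beta> \<Longrightarrow> rank \<beta> < rank \<alpha>" if "\<alpha> \<in> B" "\<beta> \<in> B"
  using psubset_card_mono[of "up \<beta>" "up \<alpha>"] rank_up[OF that(1)] rank_up[OF that(2)] that by simp

text \<open>By \<open>rank_up\<close> the rank and the number of pairs determine each other, so an
  inclusion together with a rank bound forces equality.\<close>

lemma up_eqI: "up \<alpha> = up \<beta>" if "\<alpha> \<in> B" "\<beta> \<in> B" "up \<alpha> \<subseteq> up \<beta>" "rank \<alpha> \<le> rank \<beta>"
  using card_subset_eq[of "up \<beta>" "up \<alpha>"] rank_up[OF that(1)] rank_up[OF that(2)] that
    card_mono[of "up \<beta>" "up \<alpha>"] by simp

lemma low_eqI: "low \<alpha> = low \<beta>" if "\<alpha> \<in> B" "\<beta> \<in> B" "low \<alpha> \<subseteq> low \<beta>" "rank \<alpha> \<le> rank \<beta>"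
  using up_eqI[of "star \<alpha>" "star \<beta>"] that by simp

lemma rank_mult_left: "rank (\<alpha> \<bullet> \<beta>) \<le> rank \<alpha>" if "\<alpha> \<in> B" "\<beta> \<in> B"
  using rank_anti_up[OF that(1) mult_closed[OF that]] mult_upper[OF that] by simp

lemma rank_mult_right: "rank (\<alpha> \<bullet> \<beta>) \<le> rank \<beta>" if "\<alpha> \<in> B" "\<beta> \<in> B"
  using rank_mult_left[of "star \<beta>" "star \<alpha>"] star_mult[OF that] that
  by (metis mult_closed rank_star star_closed)

lemma up_mult_eq: "up (\<alpha> \<bullet> \<beta>) = up \<alpha>" if "\<alpha> \<in> B" "\<beta> \<in> B" "rank \<alpha> \<le> rank (\<alpha> \<bullet> \<beta>)"
  using up_eqI[OF that(1) mult_closed[OF that(1,2)] mult_upper[OF that(1,2)] that(3)] by simp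

lemma low_mult_eq: "low (\<alpha> \<bullet> \<beta>) = low \<beta>" if "\<alpha> \<in> B" "\<beta> \<in> B" "rank \<beta> \<le> rank (\<alpha> \<bullet> \<beta>)"
  using low_eqI[OF that(2) mult_closed[OF that(1,2)] mult_lower[OF that(1,2)] that(3)] by simp

lemma mult_star_self: "\<alpha> \<bullet> star \<alpha> = proj (up \<alpha>)" if \<alpha>: "\<alpha> \<in> B"
proof -
  let ?f = "through \<alpha>" and ?D = "up \<alpha>" and ?E = "low \<alpha>"
  note p = pattern_up[OF \<alpha>] pattern_low[OF \<alpha>] through_bij[OF \<alpha>]
  have "star \<alpha> = mk ?E ?D (the_inv_into (rest ?D) ?f)"
    using mk_star[OF p] mk_through[OF \<alpha>] by simp
  then have "\<alpha> \<bullet> star \<alpha> = mk ?D ?D (the_inv_into (rest ?D) ?f \<circ> ?f)"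
    using mk_mult[OF p(1,2,1,3) bij_betw_the_inv_into[OF p(3)]] mk_through[OF \<alpha>] by simp
  also have "\<dots> = proj ?D"
    unfolding proj_def mk_def using the_inv_into_f_f[of ?f "rest ?D"] p(3)
    by (auto simp: bij_betw_def intro!: image_cong)
  finally show ?thesis .
qed

lemma star_mult_self: "star \<alpha> \<bullet> \<alpha> = proj (low \<alpha>)" if "\<alpha> \<in> B"
  using mult_star_self[OF star_closed[OF that]] by simp

lemma
  assumes "\<alpha> \<in> B"
  shows proj_up_mult: "proj (up \<alpha>) \<bullet> \<alpha> = \<alpha>" and mult_proj_low: "\<alpha> \<bullet> proj (low \<alpha>) = \<alpha>"
  using proj_mult mult_proj assms by auto

text \<open>\<open>star \<alpha> \<bullet> \<alpha>\<close> is the projection with the lower pattern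
  of \<open>\<alpha>\<close>, which \<open>\<beta>\<close> absorbs if the inner patterns agree. So
  either factor can be cancelled, hence the rank cannot drop, and equal rank leaves no room for
  larger patterns.\<close>

lemma matched_mult:
  assumes \<alpha>: "\<alpha> \<in> B" and \<beta>: "\<beta> \<in> B" and m: "low \<alpha> = up \<beta>"
  shows "up (\<alpha> \<bullet> \<beta>) = up \<alpha>" "low (\<alpha> \<bullet> \<beta>) = low \<beta>" "rank (\<alpha> \<bullet> \<beta>) = rank \<alpha>"
    "star \<alpha> \<bullet> (\<alpha> \<bullet> \<beta>) = \<beta>" "\<alpha> \<bullet> \<beta> \<bullet> star \<beta> = \<alpha>"
proof -
  show 1: "star \<alpha> \<bullet> (\<alpha> \<bullet> \<beta>) = \<beta>"
    using mult_assoc[of "star \<alpha>" \<alpha> \<beta>] star_mult_self[OF \<alpha>] m proj_up_mult[OF \<beta>] \<alpha> \<beta> by simp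
  show 2: "\<alpha> \<bullet> \<beta> \<bullet> star \<beta> = \<alpha>"
    using mult_assoc[of \<alpha> \<beta> "star \<beta>"] mult_star_self[OF \<beta>] m[symmetric] mult_proj_low[OF \<alpha>] \<alpha> \<beta> by simp
  have "rank \<alpha> \<le> rank (\<alpha> \<bullet> \<beta>)" "rank \<beta> \<le> rank (\<alpha> \<bullet> \<beta>)"
    using rank_mult_left[of "\<alpha> \<bullet> \<beta>" "star \<beta>"] rank_mult_right[of "star \<alpha>" "\<alpha> \<bullet> \<beta>"] 1 2 \<alpha> \<beta> mult_closed
    by auto
  then show "up (\<alpha> \<bullet> \<beta>) = up \<alpha>" "low (\<alpha> \<bullet> \<beta>) = low \<beta>" "rank (\<alpha> \<bullet> \<beta>) = rank \<alpha>"
    using up_mult_eq[OF \<alpha> \<beta>] low_mult_eq[OF \<alpha> \<beta>] rank_mult_left[OF \<alpha> \<beta>] by auto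
qed

lemma ex_diagram:
  assumes D: "pattern D" and D': "pattern D'" and c: "card D = card D'"
  shows "\<exists>\<alpha> \<in> B. up \<alpha> = D \<and> low \<alpha> = D'"
proof -
  have "card (rest D) = card (rest D')" using card_rest[OF D] card_rest[OF D'] c by simp
  then obtain f where "bij_betw f (rest D) (rest D')" using finite_same_card_bij[of "rest D" "rest D'"] by auto
  then show ?thesis using mk_closed[OF D D'] up_mk[OF D D'] low_mk[OF D D'] by blast
qed

text \<open>An \<open>s\<close> with patterns \<open>up \<beta>\<close> and
  \<open>up \<alpha>\<close> exists because the ranks agree. Then
  \<open>s \<bullet> \<alpha>\<close> has the upper pattern of \<open>\<beta>\<close>, and
  \<open>t\<close> corrects the rest, since the product of \<open>s \<bullet> \<alpha>\<close> with
  its star is a projection absorbed by \<open>\<beta>\<close>.\<close>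

lemma J_related:
  assumes \<alpha>: "\<alpha> \<in> B" and \<beta>: "\<beta> \<in> B" and r: "rank \<alpha> = rank \<beta>"
  shows "\<exists>s \<in> B. \<exists>t \<in> B. \<beta> = s \<bullet> \<alpha> \<bullet> t"
proof -
  have "card (up \<beta>) = card (up \<alpha>)" using rank_up[OF \<alpha>] rank_up[OF \<beta>] r by simp
  then obtain s where s: "s \<in> B" "up s = up \<beta>" "low s = up \<alpha>"
    using ex_diagram[OF pattern_up[OF \<beta>] pattern_up[OF \<alpha>]] by blast
  define t where "t = star (s \<bullet> \<alpha>) \<bullet> \<beta>"
  have c: "s \<bullet> \<alpha> \<in> B" using s \<alpha> mult_closed by simp
  have t: "t \<in> B" using c \<beta> mult_closed by (simp add: t_def)
  have "s \<bullet> \<alpha> \<bullet> t = proj (up (s \<bullet> \<alpha>)) \<bullet> \<beta>"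
    unfolding t_def using mult_assoc[of "s \<bullet> \<alpha>" "star (s \<bullet> \<alpha>)" \<beta>] mult_star_self[OF c] c \<beta> by simp
  also have "up (s \<bullet> \<alpha>) = up \<beta>" using matched_mult(1)[OF s(1) \<alpha> s(3)] s by simp
  finally have "\<beta> = s \<bullet> \<alpha> \<bullet> t" using proj_up_mult[OF \<beta>] by simp
  then show ?thesis using s t by blast
qed

lemma up_eq_factor: "\<exists>w \<in> B. \<beta> = \<alpha> \<bullet> w" if \<alpha>: "\<alpha> \<in> B" and \<beta>: "\<beta> \<in> B" and "up \<alpha> = up \<beta>"
proof (rule bexI)
  show "\<beta> = \<alpha> \<bullet> (star \<alpha> \<bullet> \<beta>)"
    using mult_assoc[of \<alpha> "star \<alpha>" \<beta>] mult_star_self[OF \<alpha>] proj_up_mult[OF \<beta>] that by simp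
  show "star \<alpha> \<bullet> \<beta> \<in> B" using that mult_closed by simp
qed

text \<open>Equal upper patterns make each element a right multiple of the other
  (\<open>up_eq_factor\<close>), and left multiplication preserves this.\<close>

lemma up_left_cong: "up (s \<bullet> \<alpha>) = up (s \<bullet> \<beta>)" if s: "s \<in> B" and \<alpha>: "\<alpha> \<in> B" and \<beta>: "\<beta> \<in> B" and "up \<alpha> = up \<beta>"
proof -
  have "up (s \<bullet> \<alpha>) \<subseteq> up (s \<bullet> \<beta>)" if eq: "\<alpha> \<in> B" "\<beta> \<in> B" "up \<alpha> = up \<beta>" for \<alpha> \<beta>
  proof -
    obtain w where "w \<in> B" "\<beta> = \<alpha> \<bullet> w" using up_eq_factor[OF eq] by blast
    then show ?thesis using mult_upper[of "s \<bullet> \<alpha>" w] mult_assoc[OF s \<open>\<alpha> \<in> B\<close>, of w] s that mult_closed by simp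
  qed
  then show ?thesis using that by blast
qed

text \<open>The set \<open>X\<close> controls where the new pairs are placed;
  \<open>drop_below\<close> uses it to keep two chosen points free.\<close>

lemma ex_pattern_extend:
  assumes "pattern D" "X \<subseteq> rest D" "2 * m \<le> card X"
  shows "\<exists>D'. pattern D' \<and> D \<subseteq> D' \<and> card D' = card D + m \<and> \<Union>D' \<subseteq> \<Union>D \<union> X"
  using assms
proof (induction m arbitrary: D X)
  case (Suc m)
  have fin: "finite X" using Suc.prems(2) finite_rest finite_subset by blast
  have "2 \<le> card X" using Suc.prems(3) by simp
  then obtain P where "P \<subseteq> X" "card P = 2" using obtain_subset_with_card_n by metis
  then obtain i j where ij: "i \<in> X" "j \<in> X" "i \<noteq> j" by (auto simp: card_2_iff)
  then have r: "i \<in> rest D" "j \<in> rest D" using Suc.prems by auto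
  note ins = pattern_insert[OF Suc.prems(1) r ij(3)]
  have "card (X - {i, j}) = card X - 2" using ij fin by (simp add: card_Diff_subset)
  then have "2 * m \<le> card (X - {i, j})" using Suc.prems(3) by simp
  moreover have "X - {i, j} \<subseteq> rest (insert {i, j} D)" using ins(2) Suc.prems by auto
  ultimately obtain D' where "pattern D'" "insert {i, j} D \<subseteq> D'" "card D' = card (insert {i, j} D) + m"
    "\<Union>D' \<subseteq> \<Union>(insert {i, j} D) \<union> (X - {i, j})" using Suc.IH[OF ins(1)] by blast
  then show ?case using ij ins(4) by (intro exI[of _ D']) auto
qed auto

subsection \<open>Elements of minimal rank\<close>

lemma rest_zero_unique: "i = j" if "card (rest D) \<le> 1" "i \<in> rest D" "j \<in> rest D"
  using that card_le_Suc0_iff_eq[of "rest D"] by auto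

text \<open>At most one point is free on each side, so the patterns leave no choice for the
  transversal.\<close>

lemma min_eqI:
  assumes \<alpha>: "\<alpha> \<in> B" and \<beta>: "\<beta> \<in> B" and r: "rank \<alpha> = n mod 2" and ud: "up \<alpha> = up \<beta>" "low \<alpha> = low \<beta>"
  shows "\<alpha> = \<beta>"
proof -
  have c: "card (rest (low \<alpha>)) \<le> 1" using r rank_eq_low[OF \<alpha>] by simp
  have "\<alpha> = mk (up \<beta>) (low \<beta>) (through \<beta>)"
  proof (rule mk_eqI[OF \<alpha>])
    fix i assume i: "i \<in> rest (up \<beta>)"
    then have "through \<alpha> i \<in> rest (low \<alpha>)" "through \<beta> i \<in> rest (low \<alpha>)"
      using through_bij[OF \<alpha>] through_bij[OF \<beta>] ud by (auto simp: bij_betw_def)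
    then have "through \<beta> i = through \<alpha> i" using rest_zero_unique[OF c] by blast
    then show "{Upper i, Lower (through \<beta> i)} \<in> \<alpha>" using through_block[OF \<alpha>] i ud by simp
  qed (use ud in auto)
  then show ?thesis using mk_through[OF \<beta>] by simp
qed

text \<open>The minimal ideal is a rectangular band in the coordinates upper pattern and lower
  pattern: together with \<open>min_eqI\<close> this computes every product in it.\<close>

lemma
  assumes \<alpha>: "\<alpha> \<in> B" and \<beta>: "\<beta> \<in> B"
  shows min_mult_left: "rank \<alpha> = n mod 2 \<Longrightarrow> rank (\<alpha> \<bullet> \<beta>) = n mod 2 \<and> up (\<alpha> \<bullet> \<beta>) = up \<alpha>"
    and min_mult_right: "rank \<beta> = n mod 2 \<Longrightarrow> rank (\<alpha> \<bullet> \<beta>) = n mod 2 \<and> low (\<alpha> \<bullet> \<beta>) = low \<beta>"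
  using rank_mult_left[OF assms] rank_mult_right[OF assms] rank_ge[OF mult_closed[OF assms]]
    up_mult_eq[OF assms] low_mult_eq[OF assms] by auto

subsection \<open>Hooks acting on patterns\<close>

lemma up_hook_old: "A \<in> up (hook i j \<bullet> \<alpha>)"
  if ij: "i \<in> {1..n}" "j \<in> {1..n}" "i \<noteq> j" and \<alpha>: "\<alpha> \<in> B" and A: "A \<in> up \<alpha>" "i \<notin> A" "j \<notin> A"
proof -
  obtain a b where ab: "A = {a, b}" "{a, b} \<in> up \<alpha>" using pattern_block[OF pattern_up[OF \<alpha>] A(1)] by blast
  then have "{Upper a, Upper b} \<in> \<alpha>" by (simp add: up_block)
  then have "{Upper a, Upper b} \<in> hook i j \<bullet> \<alpha>" using ab A by (intro hook_old[OF ij \<alpha>]) auto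
  then show ?thesis using ab by (simp add: up_block)
qed

lemma low_hook: "low (\<alpha> \<bullet> hook i j) = up (hook i j \<bullet> star \<alpha>)"
  if ij: "i \<in> {1..n}" "j \<in> {1..n}" "i \<noteq> j" and \<alpha>: "\<alpha> \<in> B"
  using star_mult[OF \<alpha> hook_simps(1)[OF ij]] ij by (metis hook_simps(2) up_star)

lemma low_hook_old: "A \<in> low (\<alpha> \<bullet> hook i j)"
  if ij: "i \<in> {1..n}" "j \<in> {1..n}" "i \<noteq> j" and \<alpha>: "\<alpha> \<in> B" and A: "A \<in> low \<alpha>" "i \<notin> A" "j \<notin> A"
  using up_hook_old[OF ij star_closed[OF \<alpha>]] A low_hook[OF ij \<alpha>] by simp

lemma hook_absorb_right: "\<alpha> \<bullet> hook i j = \<alpha>" if \<alpha>: "\<alpha> \<in> B" and "{i, j} \<in> low \<alpha>"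
  unfolding hook_def using that by (intro mult_proj) auto

lemma rank_hook_drop: "rank (hook i j \<bullet> \<alpha>) < rank \<alpha>"
  if \<alpha>: "\<alpha> \<in> B" and r: "i \<in> rest (up \<alpha>)" "j \<in> rest (up \<alpha>)" and ne: "i \<noteq> j"
proof (rule rank_less_up[OF \<alpha>])
  have ij: "i \<in> {1..n}" "j \<in> {1..n}" using r by (auto simp: rest_def)
  show "hook i j \<bullet> \<alpha> \<in> B" using ij ne \<alpha> mult_closed by simp
  have "A \<in> up (hook i j \<bullet> \<alpha>)" if "A \<in> up \<alpha>" for A
    using up_hook_old[OF ij ne \<alpha> that] that r by (auto simp: rest_def)
  moreover have "{i, j} \<in> up (hook i j \<bullet> \<alpha>)" using hook_new[OF ij ne \<alpha>] .
  moreover have "{i, j} \<notin> up \<alpha>" using r by (auto simp: rest_def)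
  ultimately show "up \<alpha> \<subset> up (hook i j \<bullet> \<alpha>)" by blast
qed

text \<open>The hook takes \<open>c\<close> and \<open>k\<close> as a pair, so the transversal that
  started at \<open>c\<close> now starts at \<open>i\<close>, the former partner of
  \<open>k\<close>; no transversal is lost.\<close>

lemma rank_hook_keep: "rank (hook c k \<bullet> \<alpha>) = rank \<alpha>"
  if \<alpha>: "\<alpha> \<in> B" and c: "c \<in> rest (up \<alpha>)" and k: "{k, i} \<in> up \<alpha>"
proof -
  have ne: "c \<noteq> k" using c k by (auto simp: rest_def)
  have ck: "c \<in> {1..n}" "k \<in> {1..n}"
    using c pattern_range[OF pattern_up[OF \<alpha>] k] by (auto simp: rest_def)
  let ?\<beta> = "hook c k \<bullet> \<alpha>"
  have \<beta>: "?\<beta> \<in> B" using ck ne \<alpha> mult_closed by simp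
  have kU: "{Upper k, Upper i} \<in> \<alpha>" using k by (simp add: up_block)
  have "v \<in> rest (low ?\<beta>)" if v: "v \<in> rest (low \<alpha>)" for v
  proof -
    obtain a where a: "{Upper a, Lower v} \<in> \<alpha>" using v rest_low[OF \<alpha>] by blast
    have "a \<noteq> k" using B_unique[OF \<alpha> kU] a by auto
    show ?thesis
    proof (cases "a = c")
      case True
      have "{Lower v, Upper i} \<in> ?\<beta>" using hook_join[OF ck ne \<alpha> _ kU, of "Lower v"] a True by simp
      then show ?thesis using rest_low[OF \<beta>] by (metis insert_commute)
    next
      case False
      then have "{Upper a, Lower v} \<in> ?\<beta>" using hook_old[OF ck ne \<alpha> a] \<open>a \<noteq> k\<close> by auto
      then show ?thesis using rest_low[OF \<beta>] by blast
    qed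
  qed
  then have "rank \<alpha> \<le> rank ?\<beta>"
    using card_mono[of "rest (low ?\<beta>)" "rest (low \<alpha>)"] rank_eq_low[OF \<alpha>] rank_eq_low[OF \<beta>] by auto
  then show ?thesis using rank_mult_right[of "hook c k" \<alpha>] ck ne \<alpha> by simp
qed

text \<open>A further pair would consist of two points that are free in \<open>F\<close>.\<close>

lemma pattern_maximal: "F = G" if G: "pattern G" and F: "F \<subseteq> G" and c: "card (rest F) \<le> 1"
proof (rule ccontr)
  assume "F \<noteq> G"
  then obtain A where A: "A \<in> G" "A \<notin> F" using F by blast
  then obtain i j where ij: "A = {i, j}" "{i, j} \<in> G" using pattern_block[OF G] by blast
  have "A \<inter> A' = {}" if "A' \<in> F" for A'
    using G A that F disjointD[of G A A'] unfolding pattern_def is_matching_def by blast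
  then have "i \<in> rest F" "j \<in> rest F" using ij pattern_range[OF G ij(2)] by (auto simp: rest_def)
  then show False using rest_zero_unique[OF c] pattern_neq[OF G ij(2)] by blast
qed

text \<open>The displayed pairs survive or are created by the hook, and since they leave at most one
  point free, \<open>pattern_maximal\<close> leaves no room for others.\<close>

lemma low_hook_switch:
  assumes w: "w \<in> B" "rank w = n mod 2" and ik: "{i, k} \<in> low w" and jl: "{j, l} \<in> low w" and ne: "i \<noteq> j" "k \<noteq> j"
  shows "low (w \<bullet> hook i j) = (low w - {{i, k}, {j, l}}) \<union> {{i, j}, {k, l}}"
proof -
  note p = pattern_low[OF w(1)]
  have ij: "i \<in> {1..n}" "j \<in> {1..n}" using pattern_range[OF p] ik jl by auto
  have wB: "w \<bullet> hook i j \<in> B" using w ij ne mult_closed by simp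
  let ?F = "(low w - {{i, k}, {j, l}}) \<union> {{i, j}, {k, l}}"
  have low_hook': "low (w \<bullet> hook i j) = up (hook i j \<bullet> star w)" using low_hook[OF ij ne(1) w(1)] .
  have sub: "?F \<subseteq> low (w \<bullet> hook i j)"
  proof -
    have "{i, j} \<in> low (w \<bullet> hook i j)" unfolding low_hook' using hook_new[OF ij ne(1)] w by simp
    moreover have "{k, l} \<in> low (w \<bullet> hook i j)"
      unfolding low_hook' up_block
      using hook_join[OF ij ne(1), of "star w" "Upper k" "Upper l"] ik jl w ne by (simp add: star_block_iff low_block)
    moreover have "A \<in> low (w \<bullet> hook i j)" if A: "A \<in> low w" "A \<noteq> {i, k}" "A \<noteq> {j, l}" for A
    proof -
      have "A \<inter> {i, k} = {}" "A \<inter> {j, l} = {}"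
        using p A ik jl disjointD[of "low w"] unfolding pattern_def is_matching_def by blast+
      then show ?thesis using low_hook_old[OF ij ne(1) w(1) A(1)] by auto
    qed
    ultimately show ?thesis by blast
  qed
  have "\<Union>?F = \<Union>(low w - {{i, k}, {j, l}}) \<union> {i, k} \<union> {j, l}" by auto
  also have "\<dots> = \<Union>(low w)" using ik jl by blast
  finally have "rest ?F = rest (low w)" by (simp add: rest_def)
  then have "card (rest ?F) \<le> 1" using w rank_eq_low[OF w(1)] by simp
  then show ?thesis using pattern_maximal[OF pattern_low[OF wB] sub] by simp
qed

text \<open>Here \<open>c\<close> is the free point of a minimal element, so the hook takes
  \<open>d\<close> from its partner \<open>k\<close>, and \<open>k\<close> becomes the new free
  point. For odd \<open>n\<close> such moves are the elementary steps between lower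
  patterns.\<close>

lemma low_hook_move:
  assumes w: "w \<in> B" "rank w = n mod 2" and c: "c \<in> rest (low w)" and dk: "{d, k} \<in> low w"
  shows "low (w \<bullet> hook c d) = insert {c, d} (low w - {{d, k}})" "k \<in> rest (low (w \<bullet> hook c d))"
proof -
  note p = pattern_low[OF w(1)]
  have ne: "c \<noteq> d" using c dk by (auto simp: rest_def)
  have kd: "k \<noteq> d" using pattern_neq[OF p dk] by auto
  have kc: "k \<noteq> c" using c dk by (auto simp: rest_def)
  have cd: "c \<in> {1..n}" "d \<in> {1..n}" "k \<in> {1..n}" using pattern_range[OF p dk] c by (auto simp: rest_def)
  have wB: "w \<bullet> hook c d \<in> B" using w cd ne mult_closed by simp
  let ?F = "insert {c, d} (low w - {{d, k}})"
  have low_hook': "low (w \<bullet> hook c d) = up (hook c d \<bullet> star w)" using low_hook[OF cd(1,2) ne w(1)] .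
  have sub: "?F \<subseteq> low (w \<bullet> hook c d)"
  proof -
    have "{c, d} \<in> low (w \<bullet> hook c d)" unfolding low_hook' using hook_new[OF cd(1,2) ne] w by simp
    moreover have "A \<in> low (w \<bullet> hook c d)" if A: "A \<in> low w" "A \<noteq> {d, k}" for A
    proof -
      have "A \<inter> {d, k} = {}"
        using p A dk disjointD[of "low w"] unfolding pattern_def is_matching_def by blast
      moreover have "c \<notin> A" using A c by (auto simp: rest_def)
      ultimately show ?thesis using low_hook_old[OF cd(1,2) ne w(1) A(1)] by auto
    qed
    ultimately show ?thesis by blast
  qed
  have cr: "card (rest (low w)) \<le> 1" using w rank_eq_low[OF w(1)] by simp
  have "x = k" if x: "x \<in> rest ?F" for x
  proof -
    have "x \<notin> rest (low w)" using rest_zero_unique[OF cr c] x by (auto simp: rest_def)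
    then obtain A where A: "A \<in> low w" "x \<in> A" using x by (auto simp: rest_def)
    then have "A = {d, k}" using x by (auto simp: rest_def)
    then show "x = k" using A x by (auto simp: rest_def)
  qed
  then have "rest ?F \<subseteq> {k}" by blast
  then have "card (rest ?F) \<le> 1" using card_mono[of "{k}" "rest ?F"] by simp
  then show 1: "low (w \<bullet> hook c d) = ?F" using pattern_maximal[OF pattern_low[OF wB] sub] by simp
  have "k \<notin> A" if "A \<in> low w" "A \<noteq> {d, k}" for A
    using p that dk disjointD[of "low w" A "{d, k}"] unfolding pattern_def is_matching_def by blast
  then show "k \<in> rest (low (w \<bullet> hook c d))" unfolding 1 using cd kd kc by (auto simp: rest_def)
qed

lemma pattern_new_block:
  assumes E: "pattern E" and "D \<subset> E"
  shows "\<exists>i j. {i, j} \<in> E \<and> {i, j} \<notin> D \<and> i \<in> rest D \<and> j \<in> rest D \<and> i \<noteq> j"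
proof -
  obtain i j where ij: "{i, j} \<in> E" "{i, j} \<notin> D" using assms pattern_block[OF E] by blast
  have "A \<inter> {i, j} = {}" if "A \<in> D" for A
    using E ij that assms disjointD[of E A "{i, j}"] unfolding pattern_def is_matching_def by blast
  then have "i \<in> rest D" "j \<in> rest D" using pattern_range[OF E ij(1)] by (auto simp: rest_def)
  then show ?thesis using ij pattern_neq[OF E ij(1)] by blast
qed

section \<open>Congruences generated by a pair\<close>

lemma Cong_iff: "\<xi> \<in> Cong (brauer n) \<longleftrightarrow> equiv B \<xi> \<and>
    (\<forall>a b s. (a, b) \<in> \<xi> \<longrightarrow> s \<in> B \<longrightarrow> (s \<bullet> a, s \<bullet> b) \<in> \<xi> \<and> (a \<bullet> s, b \<bullet> s) \<in> \<xi>)"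
  unfolding Cong_def by blast

text \<open>The dual congruence: a statement proved for lower patterns and all congruences turns
  into one for upper patterns.\<close>

definition star_rel :: "(diagram \<times> diagram) set \<Rightarrow> (diagram \<times> diagram) set" where
  "star_rel \<xi> = {(star a, star b) | a b. (a, b) \<in> \<xi>}"

lemma star_rel_iff: "(a, b) \<in> star_rel \<xi> \<longleftrightarrow> (star a, star b) \<in> \<xi>"
proof
  assume "(a, b) \<in> star_rel \<xi>"
  then obtain a' b' where "a = star a'" "b = star b'" "(a', b') \<in> \<xi>" by (auto simp: star_rel_def)
  then show "(star a, star b) \<in> \<xi>" by simp
next
  assume "(star a, star b) \<in> \<xi>"
  then have "(star (star a), star (star b)) \<in> star_rel \<xi>" unfolding star_rel_def by blast
  then show "(a, b) \<in> star_rel \<xi>" by simp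
qed

context
  fixes \<xi> assumes \<xi>: "\<xi> \<in> Cong (brauer n)"
begin

lemma cong_equiv: "equiv B \<xi>" using \<xi> by (simp add: Cong_iff)

lemma cong_closed: "(a, b) \<in> \<xi> \<Longrightarrow> a \<in> B" "(a, b) \<in> \<xi> \<Longrightarrow> b \<in> B"
  using cong_equiv by (auto simp: equiv_def refl_on_def)

lemma cong_refl: "a \<in> B \<Longrightarrow> (a, a) \<in> \<xi>"
  using cong_equiv by (auto simp: equiv_def refl_on_def)

lemma cong_sym: "(a, b) \<in> \<xi> \<Longrightarrow> (b, a) \<in> \<xi>"
  using cong_equiv by (meson equiv_def symD)

lemma cong_trans: "(a, b) \<in> \<xi> \<Longrightarrow> (b, c) \<in> \<xi> \<Longrightarrow> (a, c) \<in> \<xi>"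
  using cong_equiv by (meson equiv_def transD)

lemma cong_left: "(a, b) \<in> \<xi> \<Longrightarrow> s \<in> B \<Longrightarrow> (s \<bullet> a, s \<bullet> b) \<in> \<xi>"
  and cong_right: "(a, b) \<in> \<xi> \<Longrightarrow> s \<in> B \<Longrightarrow> (a \<bullet> s, b \<bullet> s) \<in> \<xi>"
  using \<xi> by (simp_all add: Cong_iff)

lemma cong_both: "(a, b) \<in> \<xi> \<Longrightarrow> s \<in> B \<Longrightarrow> t \<in> B \<Longrightarrow> (s \<bullet> a \<bullet> t, s \<bullet> b \<bullet> t) \<in> \<xi>"
  using cong_left cong_right by blast

lemma star_rel_Cong: "star_rel \<xi> \<in> Cong (brauer n)"
  unfolding Cong_iff
proof (intro conjI allI impI)
  show "equiv B (star_rel \<xi>)"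
  proof (rule equivI)
    show "star_rel \<xi> \<subseteq> B \<times> B" using cong_closed by (auto simp: star_rel_def)
    show "refl_on B (star_rel \<xi>)" by (rule refl_onI) (simp add: star_rel_iff cong_refl)
    show "sym (star_rel \<xi>)" by (rule symI) (simp add: star_rel_iff cong_sym)
    show "trans (star_rel \<xi>)" by (rule transI) (auto simp: star_rel_iff intro: cong_trans)
  qed
  fix a b s assume ab: "(a, b) \<in> star_rel \<xi>" and s: "s \<in> B"
  have B: "a \<in> B" "b \<in> B" using ab cong_closed by (auto simp: star_rel_def)
  show "(s \<bullet> a, s \<bullet> b) \<in> star_rel \<xi>" "(a \<bullet> s, b \<bullet> s) \<in> star_rel \<xi>"
    using ab s B by (simp_all add: star_rel_iff star_mult cong_left cong_right)
qed

text \<open>As \<open>\<gamma>'\<close> absorbs \<open>hook i j\<close>, \<open>\<gamma>\<close> is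
  related to \<open>hook i j \<bullet> \<gamma>\<close>. If \<open>i\<close> is free in
  \<open>\<gamma>\<close> too, this hook already lowers the rank. Otherwise it moves the transversal
  at \<open>j\<close> to the partner \<open>k\<close> of \<open>i\<close>, and a second hook joining
  \<open>k\<close> to another free point \<open>c\<close> lowers the rank on that side only. The
  bound 2 on the rank provides \<open>c\<close>.\<close>

lemma drop_of_transversal:
  assumes \<gamma>: "(\<gamma>, \<gamma>') \<in> \<xi>" and r: "rank \<gamma>' = rank \<gamma>" "rank \<gamma> \<ge> 2"
    and j: "j \<in> rest (up \<gamma>)" and ij: "{i, j} \<in> up \<gamma>'"
  shows "\<exists>(\<alpha>, \<beta>) \<in> \<xi>. rank \<alpha> = rank \<gamma> \<and> rank \<beta> < rank \<gamma>"
proof -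
  have B: "\<gamma> \<in> B" "\<gamma>' \<in> B" using \<gamma> cong_closed by auto
  have ijn: "i \<in> {1..n}" "j \<in> {1..n}" "i \<noteq> j"
    using pattern_range[OF pattern_up ij] pattern_neq[OF pattern_up ij] B by auto
  let ?\<delta> = "hook i j \<bullet> \<gamma>"
  have hB: "hook i j \<in> B" "?\<delta> \<in> B" using ijn B mult_closed by auto
  have "(?\<delta>, \<gamma>') \<in> \<xi>" using cong_left[OF \<gamma> hB(1)] hook_absorb[OF ijn B(2) ij] by simp
  then have rel: "(\<gamma>, ?\<delta>) \<in> \<xi>" using \<gamma> cong_sym cong_trans by blast
  show ?thesis
  proof (cases "i \<in> rest (up \<gamma>)")
    case True
    then have "rank ?\<delta> < rank \<gamma>" using rank_hook_drop[OF B(1) True j ijn(3)] by simp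
    then show ?thesis using rel by blast
  next
    case False
    then obtain k where k: "{i, k} \<in> up \<gamma>" using pattern_rest[OF pattern_up[OF B(1)]] ijn by blast
    have kj: "k \<noteq> j" using j k by (auto simp: rest_def)
    obtain y where y: "{Upper j, Lower y} \<in> \<gamma>" using j rest_up[OF B(1)] by blast
    have "{Upper k, Lower y} \<in> ?\<delta>"
      using hook_join[OF ijn B(1) _ y, of "Upper k"] k kj by (simp add: up_block)
    then have kr: "k \<in> rest (up ?\<delta>)" using rest_up[OF hB(2)] by blast
    have "card (rest (up \<gamma>)) \<ge> 2" using r rank_eq[OF B(1)] by simp
    then have "\<not> rest (up \<gamma>) \<subseteq> {j}" using card_mono[of "{j}" "rest (up \<gamma>)"] by auto
    then obtain c where c: "c \<in> rest (up \<gamma>)" "c \<noteq> j" by blast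
    have ci: "c \<noteq> i" "c \<noteq> k" using c k by (auto simp: rest_def)
    obtain c' where c': "{Upper c, Lower c'} \<in> \<gamma>" using c rest_up[OF B(1)] by blast
    have "{Upper c, Lower c'} \<in> ?\<delta>" using hook_old[OF ijn B(1) c'] ci c by simp
    then have cr: "c \<in> rest (up ?\<delta>)" using rest_up[OF hB(2)] by blast
    have ck: "c \<in> {1..n}" "k \<in> {1..n}" using cr kr by (auto simp: rest_def)
    have "rank (hook c k \<bullet> ?\<delta>) < rank \<gamma>"
      using rank_hook_drop[OF hB(2) cr kr ci(2)] rank_mult_right[OF hB(1) B(1)] by simp
    moreover have "rank (hook c k \<bullet> \<gamma>) = rank \<gamma>"
      using rank_hook_keep[OF B(1) c(1), of k i] k by (simp add: insert_commute)
    moreover have "(hook c k \<bullet> \<gamma>, hook c k \<bullet> ?\<delta>) \<in> \<xi>" using cong_left[OF rel] ck ci by simp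
    ultimately show ?thesis by blast
  qed
qed

text \<open>A pair \<open>{i, j}\<close> of \<open>up \<beta>\<close> outside
  \<open>up \<alpha>\<close> gives a hook absorbed by \<open>\<beta>\<close>, so
  \<open>\<alpha>\<close> is related to \<open>hook i j \<bullet> \<alpha>\<close>. The aim is to
  reach the situation of \<open>drop_of_transversal\<close>.\<close>

lemma drop_of_up_neq:
  assumes \<alpha>\<beta>: "(\<alpha>, \<beta>) \<in> \<xi>" and r: "rank \<beta> = rank \<alpha>" "rank \<alpha> \<ge> 2" and ne: "up \<alpha> \<noteq> up \<beta>"
  shows "\<exists>(\<gamma>, \<delta>) \<in> \<xi>. rank \<gamma> = rank \<alpha> \<and> rank \<delta> < rank \<alpha>"
proof -
  have B: "\<alpha> \<in> B" "\<beta> \<in> B" using \<alpha>\<beta> cong_closed by auto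
  have "\<not> up \<beta> \<subseteq> up \<alpha>" using up_eqI[OF B(2,1)] r ne by auto
  then obtain i j where ij: "{i, j} \<in> up \<beta>" "{i, j} \<notin> up \<alpha>"
    using pattern_block[OF pattern_up[OF B(2)]] by blast
  have ijn: "i \<in> {1..n}" "j \<in> {1..n}" "i \<noteq> j"
    using pattern_range[OF pattern_up ij(1)] pattern_neq[OF pattern_up ij(1)] B by auto
  have hB: "hook i j \<in> B" "hook i j \<bullet> \<alpha> \<in> B" using ijn B mult_closed by auto
  let ?\<alpha>' = "hook i j \<bullet> \<alpha>"
  have "(?\<alpha>', \<beta>) \<in> \<xi>" using cong_left[OF \<alpha>\<beta> hB(1)] hook_absorb[OF ijn B(2) ij(1)] by simp
  then have rel: "(\<alpha>, ?\<alpha>') \<in> \<xi>" using \<alpha>\<beta> cong_sym cong_trans by blast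
  consider "rank ?\<alpha>' < rank \<alpha>" | "i \<in> rest (up \<alpha>)" | "j \<in> rest (up \<alpha>)"
    | k l where "rank ?\<alpha>' = rank \<alpha>" "{i, k} \<in> up \<alpha>" "{j, l} \<in> up \<alpha>"
    using rank_mult_right[OF hB(1) B(1)] pattern_rest[OF pattern_up[OF B(1)]] ijn by (metis le_neq_implies_less)
  then show ?thesis
  proof cases
    case 1
    then show ?thesis using rel by blast
  next
    case 2
    then show ?thesis using drop_of_transversal[OF \<alpha>\<beta> r, of i j] ij by (simp add: insert_commute)
  next
    case 3
    then show ?thesis using drop_of_transversal[OF \<alpha>\<beta> r, of j i] ij by simp
  next
    \<comment> \<open>Both ends lie in upper pairs \<open>{i, k}\<close> and \<open>{j, l}\<close>
      of \<open>\<alpha>\<close>, and the rank has not dropped. A hook from a free point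
      \<open>c\<close> to \<open>j\<close> makes \<open>i\<close> free on the side where
      \<open>{i, j}\<close> is a pair, while \<open>{i, k}\<close> survives on the other.\<close>
    case 4
    have ne': "k \<noteq> j" "i \<noteq> l" using ij 4 by (auto simp: insert_commute)
    have "card (rest (up \<alpha>)) \<ge> 2" using r rank_eq[OF B(1)] by simp
    then obtain c where c: "c \<in> rest (up \<alpha>)" by (metis card.empty equals0I not_numeral_le_zero)
    then obtain c' where c': "{Upper c, Lower c'} \<in> \<alpha>" using rest_up[OF B(1)] by blast
    have cn: "c \<in> {1..n}" "c \<noteq> i" "c \<noteq> j" "c \<noteq> k" using c 4 by (auto simp: rest_def)
    have hc: "hook c j \<in> B" using cn ijn by simp
    have gB: "hook c j \<bullet> \<alpha> \<in> B" "hook c j \<bullet> ?\<alpha>' \<in> B" using hc hB B mult_closed by auto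
    have c'': "{Upper c, Lower c'} \<in> ?\<alpha>'" using hook_old[OF ijn B(1) c'] cn by simp
    have ij': "{Upper j, Upper i} \<in> ?\<alpha>'"
      using hook_new[OF ijn B(1)] by (simp add: up_block insert_commute)
    have "{Lower c', Upper i} \<in> hook c j \<bullet> ?\<alpha>'"
      using hook_join[OF cn(1) ijn(2) cn(3) hB(2) c'' ij'] by simp
    then have "{Upper i, Lower c'} \<in> hook c j \<bullet> ?\<alpha>'" by (simp add: insert_commute)
    then have ir: "i \<in> rest (up (hook c j \<bullet> ?\<alpha>'))" using rest_up[OF gB(2)] by blast
    have ki: "{k, i} \<in> up (hook c j \<bullet> \<alpha>)"
      using up_hook_old[OF cn(1) ijn(2) cn(3) B(1) 4(2)] cn ijn ne' by (auto simp: insert_commute)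
    have r1: "rank (hook c j \<bullet> \<alpha>) = rank \<alpha>" using rank_hook_keep[OF B(1) c 4(3)] .
    have "c \<in> rest (up ?\<alpha>')" using rest_up[OF hB(2)] c'' by blast
    then have r2: "rank (hook c j \<bullet> ?\<alpha>') = rank \<alpha>"
      using rank_hook_keep[OF hB(2), of c j i] ij' 4 by (simp add: up_block)
    have "(hook c j \<bullet> ?\<alpha>', hook c j \<bullet> \<alpha>) \<in> \<xi>" using cong_left[OF cong_sym[OF rel] hc] .
    from drop_of_transversal[OF this _ _ ir ki] show ?thesis using r1 r2 r by simp
  qed
qed

text \<open>Right multiplication by \<open>star \<gamma>\<close> turns \<open>\<gamma>\<close> into
  its projection. The extra left factor \<open>proj (up \<gamma>)\<close> makes the partner
  \<open>g\<close> contain \<open>D\<close> in both patterns, properly because its rank is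
  smaller.\<close>

lemma drop_projection:
  assumes "(\<gamma>, \<delta>) \<in> \<xi>" "rank \<delta> < rank \<gamma>"
  shows "\<exists>D g. pattern D \<and> card (rest D) = rank \<gamma> \<and> (proj D, g) \<in> \<xi> \<and> D \<subset> up g \<and> D \<subset> low g"
proof -
  have B: "\<gamma> \<in> B" "\<delta> \<in> B" using assms cong_closed by auto
  let ?P = "proj (up \<gamma>)" and ?g = "proj (up \<gamma>) \<bullet> (\<delta> \<bullet> star \<gamma>)"
  note p = pattern_up[OF B(1)]
  have d: "\<delta> \<bullet> star \<gamma> \<in> B" using B mult_closed by simp
  have g: "?g \<in> B" using d p mult_closed by simp
  have "(?P \<bullet> (\<gamma> \<bullet> star \<gamma>), ?g) \<in> \<xi>" using assms p B by (intro cong_left cong_right) auto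
  then have rel: "(?P, ?g) \<in> \<xi>"
    using mult_star_self[OF B(1)] proj_mult[of ?P "up \<gamma>"] p by simp
  have "rank ?g < rank \<gamma>"
    using rank_mult_right[of ?P "\<delta> \<bullet> star \<gamma>"] rank_mult_left[of \<delta> "star \<gamma>"] assms p d B by simp
  then have "card (up \<gamma>) < card (up ?g)" "card (up \<gamma>) < card (low ?g)"
    using rank_up[OF g] rank_low[OF g] rank_up[OF B(1)] by linarith+
  moreover have "up \<gamma> \<subseteq> up ?g" using mult_upper[of ?P "\<delta> \<bullet> star \<gamma>"] p d by simp
  moreover have "up \<gamma> \<subseteq> low ?g"
    using mult_lower[of ?P "\<delta> \<bullet> star \<gamma>"] mult_lower[of \<delta> "star \<gamma>"] p d B by auto
  ultimately show ?thesis using rel p rank_eq[OF B(1)] by (metis less_irrefl psubsetI)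
qed

text \<open>\<open>g\<close> has an upper pair \<open>{i, j}\<close> outside \<open>D\<close>.
  Enlarging \<open>D\<close> to a pattern that leaves \<open>i\<close>, \<open>j\<close> and
  \<open>k - 2\<close> further points free gives a projection of rank \<open>k\<close>, and its
  product with \<open>g\<close> acquires the pair \<open>{i, j}\<close>.\<close>

lemma drop_below:
  assumes drop: "(\<gamma>, \<delta>) \<in> \<xi>" "rank \<delta> < rank \<gamma>" and k: "2 \<le> k" "k \<le> rank \<gamma>" "k mod 2 = n mod 2"
  shows "\<exists>(s, s') \<in> \<xi>. rank s = k \<and> rank s' < k"
proof -
  obtain D g where D: "pattern D" "card (rest D) = rank \<gamma>" "(proj D, g) \<in> \<xi>" "D \<subset> up g"
    using drop_projection[OF drop] by blast
  have g: "g \<in> B" using D cong_closed by blast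
  obtain i j where ij: "{i, j} \<in> up g" "i \<in> rest D" "j \<in> rest D" "i \<noteq> j"
    using pattern_new_block[OF pattern_up[OF g] D(4)] by blast
  let ?X = "rest D - {i, j}"
  have B\<gamma>: "\<gamma> \<in> B" using drop cong_closed by blast
  have "even (rank \<gamma> - k)" using k rank_mod[OF B\<gamma>] by presburger
  then obtain m where m: "rank \<gamma> - k = 2 * m" by blast
  have "card ?X = rank \<gamma> - 2" using ij D(2) by (simp add: card_Diff_subset)
  then have "2 * m \<le> card ?X" using m k by simp
  then obtain D' where D': "pattern D'" "D \<subseteq> D'" "card D' = card D + m" "\<Union>D' \<subseteq> \<Union>D \<union> ?X"
    using ex_pattern_extend[OF D(1), of ?X m] by blast
  have r: "i \<in> rest D'" "j \<in> rest D'" using ij D'(4) by (auto simp: rest_def)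
  have rk: "rank (proj D') = k"
    using rank_proj[OF D'(1)] card_rest[OF D'(1)] card_rest[OF D(1)] D'(3) D(2) m k by simp
  have s: "proj D' \<in> B" using D' by simp
  have "(proj D' \<bullet> proj D, proj D' \<bullet> g) \<in> \<xi>" using cong_left[OF D(3) s] .
  then have rel: "(proj D', proj D' \<bullet> g) \<in> \<xi>" using mult_proj[OF s, of D] D' by simp
  have "{Upper i, Upper j} \<in> proj D' \<bullet> g"
    using mult_UU[OF s g proj_through[OF r(1)] proj_through[OF r(2)]] ij by (simp add: up_block)
  then have "{i, j} \<in> up (proj D' \<bullet> g)" "{i, j} \<notin> D'" using r by (auto simp: up_block rest_def)
  then have "up (proj D') \<subset> up (proj D' \<bullet> g)" using mult_upper[OF s g] D' by auto
  then have "rank (proj D' \<bullet> g) < k" using rank_less_up[OF s mult_closed[OF s g]] rk by simp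
  then show ?thesis using rel rk by blast
qed

text \<open>Drops exist at every rank that occurs between 2 and the rank of \<open>\<gamma>\<close>,
  and by \<open>J_related\<close> every element of such a rank takes part in one; this allows a
  descent by induction.\<close>

lemma drop_to_minimal:
  assumes drop: "(\<gamma>, \<delta>) \<in> \<xi>" "rank \<delta> < rank \<gamma>" and \<alpha>: "\<alpha> \<in> B" "rank \<alpha> \<le> rank \<gamma>"
  shows "\<exists>x. rank x = n mod 2 \<and> (\<alpha>, x) \<in> \<xi>"
  using \<alpha>
proof (induction "rank \<alpha>" arbitrary: \<alpha> rule: less_induct)
  case less
  show ?case
  proof (cases "rank \<alpha> = n mod 2")
    case True
    then show ?thesis using cong_refl less.prems by blast
  next
    case False
    then have "rank \<alpha> \<ge> 2" using rank_mod[OF less.prems(1)] by (metis mod_less not_less)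
    then obtain s s' where s: "(s, s') \<in> \<xi>" "rank s = rank \<alpha>" "rank s' < rank \<alpha>"
      using drop_below[OF drop, of "rank \<alpha>"] less.prems rank_mod by blast
    have sB: "s \<in> B" "s' \<in> B" using s cong_closed by auto
    obtain a b where ab: "a \<in> B" "b \<in> B" "\<alpha> = a \<bullet> s \<bullet> b"
      using J_related[OF sB(1) less.prems(1) s(2)] by blast
    have rel: "(\<alpha>, a \<bullet> s' \<bullet> b) \<in> \<xi>" using cong_both[OF s(1) ab(1,2)] ab by simp
    have c: "a \<bullet> s' \<in> B" "a \<bullet> s' \<bullet> b \<in> B" using ab sB mult_closed by auto
    have "rank (a \<bullet> s' \<bullet> b) < rank \<alpha>"
      using rank_mult_left[OF c(1) ab(2)] rank_mult_right[OF ab(1) sB(2)] s by simp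
    moreover from this have "rank (a \<bullet> s' \<bullet> b) \<le> rank \<gamma>" using less.prems by simp
    ultimately obtain x where "rank x = n mod 2" "(a \<bullet> s' \<bullet> b, x) \<in> \<xi>"
      using less.hyps[OF _ c(2)] by blast
    then show ?thesis using rel cong_trans by blast
  qed
qed

text \<open>The new lower pair \<open>{k, l}\<close> of \<open>g\<close> conflicts with a pair
  \<open>{k, m}\<close>, and rank 3 provides the third free point \<open>m\<close>. Completing
  \<open>D\<close> and \<open>{k, m}\<close> to a maximal pattern gives a projection whose product
  with \<open>g\<close> contains \<open>{k, l}\<close>.\<close>

lemma drop_low_neq:
  assumes drop: "(\<gamma>, \<delta>) \<in> \<xi>" "rank \<delta> < rank \<gamma>" and r: "rank \<gamma> \<ge> 3"
  shows "\<exists>(x, y) \<in> \<xi>. rank x = n mod 2 \<and> rank y = n mod 2 \<and> low x \<noteq> low y"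
proof -
  obtain D g where D: "pattern D" "card (rest D) = rank \<gamma>" "(proj D, g) \<in> \<xi>" "D \<subset> low g"
    using drop_projection[OF drop] by blast
  have g: "g \<in> B" using D cong_closed by blast
  obtain k l where kl: "{k, l} \<in> low g" "k \<in> rest D" "l \<in> rest D" "k \<noteq> l"
    using pattern_new_block[OF pattern_low[OF g] D(4)] by blast
  have "card {k, l} < card (rest D)" using kl D r by simp
  then have "\<not> rest D \<subseteq> {k, l}" using card_mono[of "{k, l}" "rest D"] by auto
  then obtain m where m: "m \<in> rest D" "m \<noteq> k" "m \<noteq> l" by blast
  have km: "k \<noteq> m" using m by simp
  note D1 = pattern_insert[OF D(1) kl(2) m(1) km]
  let ?D1 = "insert {k, m} D"
  obtain D' where D': "pattern D'" "?D1 \<subseteq> D'" "card D' = card ?D1 + card (rest ?D1) div 2"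
    using ex_pattern_extend[OF D1(1), of "rest ?D1" "card (rest ?D1) div 2"] by auto
  let ?x = "proj D'"
  have x: "?x \<in> B" using D' by simp
  have "card (rest D') + 2 * (card ?D1 + card (rest ?D1) div 2) = card (rest ?D1) + 2 * card ?D1"
    using card_rest[OF D'(1)] card_rest[OF D1(1)] D'(3) by simp
  then have "card (rest D') < 2" by presburger
  then have rx: "rank ?x = n mod 2" using rank_proj[OF D'(1)] rank_mod[OF x] by simp
  have "(?x \<bullet> proj D, ?x \<bullet> g) \<in> \<xi>" using cong_left[OF D(3) x] .
  then have rel: "(?x, ?x \<bullet> g) \<in> \<xi>" using mult_proj[OF x, of D] D' by auto
  have "{k, l} \<in> low (?x \<bullet> g)" using mult_lower[OF x g] kl by blast
  moreover have "{k, m} \<in> low ?x" using D' by auto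
  ultimately have "low ?x \<noteq> low (?x \<bullet> g)"
    using pattern_unique[OF pattern_low[OF mult_closed[OF x g]]] m by metis
  then show ?thesis using rel rx min_mult_left[OF x g rx] by blast
qed

end

section \<open>Spreading one related pair over the minimal ideal\<close>

lemma rest_remove: "rest (G - {A}) = rest G \<union> A" if G: "pattern G" "A \<in> G"
proof -
  have "A \<inter> A' = {}" if "A' \<in> G" "A' \<noteq> A" for A'
    using G that disjointD[of G A A'] unfolding pattern_def is_matching_def by blast
  then show ?thesis using G by (auto simp: rest_def pattern_def)
qed

context
  fixes \<xi> assumes \<xi>: "\<xi> \<in> Cong (brauer n)"
begin

text \<open>\<open>t\<close> carries the lower patterns of \<open>x\<close> and \<open>x'\<close> to
  those of \<open>w\<close> and \<open>v\<close>; left multiplication by \<open>w\<close> then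
  resets the upper pattern, and \<open>min_eqI\<close> identifies the products with \<open>w\<close>
  and \<open>v\<close>.\<close>

lemma transport_minimal:
  assumes x: "(x, x') \<in> \<xi>" "rank x = n mod 2" "rank x' = n mod 2"
    and t: "t \<in> B" and w: "w \<in> B" "rank w = n mod 2" and v: "v \<in> B" "rank v = n mod 2" "up v = up w"
    and low: "low w \<subseteq> low (x \<bullet> t)" "low v \<subseteq> low (x' \<bullet> t)"
  shows "(w, v) \<in> \<xi>"
proof -
  have B: "x \<in> B" "x' \<in> B" using x cong_closed[OF \<xi>] by auto
  have c: "x \<bullet> t \<in> B" "x' \<bullet> t \<in> B" using B t mult_closed by auto
  have r: "rank (x \<bullet> t) = n mod 2" "rank (x' \<bullet> t) = n mod 2"
    using min_mult_left[OF B(1) t] min_mult_left[OF B(2) t] x by auto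
  have eq: "low w = low (x \<bullet> t)" "low v = low (x' \<bullet> t)"
    using low_eqI[OF w(1) c(1)] low_eqI[OF v(1) c(2)] low r w v by auto
  have "w \<bullet> (x \<bullet> t) = w"
    using min_mult_left[OF w(1) c(1) w(2)] min_mult_right[OF w(1) c(1) r(1)] eq
    by (intro min_eqI) (simp_all add: w c mult_closed)
  moreover have "w \<bullet> (x' \<bullet> t) = v"
    using min_mult_left[OF w(1) c(2) w(2)] min_mult_right[OF w(1) c(2) r(2)] eq v
    by (intro min_eqI) (simp_all add: w c mult_closed)
  ultimately show ?thesis
    using cong_left[OF \<xi> cong_right[OF \<xi> x(1) t] w(1)] by simp
qed

text \<open>One related switch of two lower pairs yields every other one, in any minimal element:
  relabel the four points and replace the remaining pairs.\<close>

lemma switch_related: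
  assumes x: "x \<in> B" "rank x = n mod 2" and w: "w \<in> B" "rank w = n mod 2" and ev: "even n"
    and ij: "{i, k} \<in> low x" "{j, l} \<in> low x" "i \<noteq> j" "k \<noteq> j" and rel: "(x, x \<bullet> hook i j) \<in> \<xi>"
    and ij': "{i', k'} \<in> low w" "{j', l'} \<in> low w" "i' \<noteq> j'" "k' \<noteq> j'"
  shows "(w, w \<bullet> hook i' j') \<in> \<xi>"
proof -
  have dist: "distinct [i, j, k, l] \<and> i \<in> {1..n} \<and> j \<in> {1..n} \<and> {j, l} \<in> low x - {{i, k}}"
    if x: "x \<in> B" and ij: "{i, k} \<in> low x" "{j, l} \<in> low x" "i \<noteq> j" "k \<noteq> j" for x i j k l
  proof -
    note p = pattern_low[OF x]
    have "i \<noteq> k" "j \<noteq> l" using pattern_neq[OF p] ij by auto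
    moreover have "i \<noteq> l" using pattern_unique[OF p, of i k j] ij by (auto simp: insert_commute)
    moreover have "k \<noteq> l" using pattern_unique[OF p, of k i j] ij by (auto simp: insert_commute)
    ultimately show ?thesis using ij pattern_range[OF p] by (auto simp: doubleton_eq_iff)
  qed
  note d = dist[OF x(1) ij] and d' = dist[OF w(1) ij']
  have rest0: "rest (low x) = {}" "rest (low w) = {}"
    using x w ev rank_eq_low[OF x(1)] rank_eq_low[OF w(1)] by auto
  define R where "R = low x - {{i, k}} - {{j, l}}"
  define R' where "R' = low w - {{i', k'}} - {{j', l'}}"
  have pR: "pattern R" "pattern (low x - {{i, k}})" "pattern R'" "pattern (low w - {{i', k'}})"
    using pattern_subset pattern_low x w unfolding R_def R'_def by (meson Diff_subset order_trans)+
  have rR: "rest R = {i, k, j, l}" "rest R' = {i', k', j', l'}"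
    unfolding R_def R'_def
    using rest_remove[OF pattern_low[OF x(1)] ij(1)] rest_remove[OF pR(2)] d rest0
      rest_remove[OF pattern_low[OF w(1)] ij'(1)] rest_remove[OF pR(4)] d' by auto
  define f where "f m = (if m = i then i' else if m = j then j' else if m = k then k' else l')" for m
  have f: "f i = i'" "f j = j'" "f k = k'" "f l = l'" using d by (auto simp: f_def)
  have bij: "bij_betw f (rest R) (rest R')"
  proof (rule bij_betw_imageI)
    have "distinct [i, j, k, l]" "distinct [i', j', k', l']" using d d' by blast+
    then show "inj_on f (rest R)" unfolding rR by (auto simp: inj_on_def f)
    show "f ` rest R = rest R'" unfolding rR by (simp add: f)
  qed
  \<comment> \<open>\<open>t\<close> has transversals exactly at the four points of the switch; its
    other blocks close off the remaining pairs \<open>R\<close> of \<open>x\<close> and impose the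
    pairs \<open>R'\<close> of \<open>w\<close>.\<close>
  define t where "t = mk R R' f"
  have t: "t \<in> B" unfolding t_def using mk_closed[OF pR(1,3) bij] .
  have tb: "{Upper i, Lower i'} \<in> t" "{Upper j, Lower j'} \<in> t" "{Upper k, Lower k'} \<in> t" "{Upper l, Lower l'} \<in> t"
    using rR f by (simp_all add: t_def mk_block_iff)
  have lt: "R' \<subseteq> low (y \<bullet> t)" if "y \<in> B" for y
    using mult_lower[OF that t] low_mk[OF pR(1,3) bij] by (simp add: t_def)
  have hB: "hook i j \<in> B" "hook i' j' \<in> B" using d d' by simp_all
  have c: "x \<bullet> hook i j \<in> B" "w \<bullet> hook i' j' \<in> B" using x w hB mult_closed by auto
  note sw = low_hook_switch[OF x ij] and sw' = low_hook_switch[OF w ij']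
  show ?thesis
  proof (rule transport_minimal[OF rel x(2) _ t w c(2)])
    show "rank (x \<bullet> hook i j) = n mod 2" "rank (w \<bullet> hook i' j') = n mod 2" "up (w \<bullet> hook i' j') = up w"
      using min_mult_left[OF x(1) hB(1) x(2)] min_mult_left[OF w(1) hB(2) w(2)] by auto
    have "{i', k'} \<in> low (x \<bullet> t)" "{j', l'} \<in> low (x \<bullet> t)"
      using mult_LL[OF x(1) t] tb ij by (simp_all add: low_block)
    then show "low w \<subseteq> low (x \<bullet> t)" using lt[OF x(1)] by (auto simp: R'_def)
    have "{i, j} \<in> low (x \<bullet> hook i j)" "{k, l} \<in> low (x \<bullet> hook i j)" unfolding sw by auto
    then have "{i', j'} \<in> low (x \<bullet> hook i j \<bullet> t)" "{k', l'} \<in> low (x \<bullet> hook i j \<bullet> t)"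
      using mult_LL[OF c(1) t] tb by (simp_all add: low_block)
    then show "low (w \<bullet> hook i' j') \<subseteq> low (x \<bullet> hook i j \<bullet> t)"
      unfolding sw' using lt[OF c(1)] by (auto simp: R'_def)
  qed
qed

text \<open>The analogue for a free point and one pair, the situation of odd \<open>n\<close>: three
  points are relabelled instead of four.\<close>

lemma move_related:
  assumes x: "x \<in> B" "rank x = n mod 2" and w: "w \<in> B" "rank w = n mod 2"
    and c: "c \<in> rest (low x)" and dk: "{d, k} \<in> low x" and rel: "(x, x \<bullet> hook c d) \<in> \<xi>"
    and c': "c' \<in> rest (low w)" and dk': "{d', k'} \<in> low w"
  shows "(w, w \<bullet> hook c' d') \<in> \<xi>"
proof -
  have dist: "distinct [c, d, k] \<and> c \<in> {1..n} \<and> d \<in> {1..n} \<and> rest (low x) = {c}"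
    if x: "x \<in> B" "rank x = n mod 2" and c: "c \<in> rest (low x)" and dk: "{d, k} \<in> low x" for x c d k
  proof -
    note p = pattern_low[OF x(1)]
    have "card (rest (low x)) \<le> 1" using x rank_eq_low[OF x(1)] by simp
    from rest_zero_unique[OF this _ c] have "rest (low x) = {c}" using c by blast
    moreover have "c \<in> {1..n}" "c \<noteq> d" "c \<noteq> k" using c dk by (auto simp: rest_def)
    ultimately show ?thesis using pattern_neq[OF p dk] pattern_range[OF p dk] by simp
  qed
  note d = dist[OF x c dk] and d' = dist[OF w c' dk']
  define R where "R = low x - {{d, k}}"
  define R' where "R' = low w - {{d', k'}}"
  have pR: "pattern R" "pattern R'"
    using pattern_subset pattern_low x w unfolding R_def R'_def by (meson Diff_subset)+
  have rR: "rest R = {c, d, k}" "rest R' = {c', d', k'}"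
    unfolding R_def R'_def
    using rest_remove[OF pattern_low[OF x(1)] dk] d rest_remove[OF pattern_low[OF w(1)] dk'] d' by auto
  define f where "f m = (if m = c then c' else if m = d then d' else k')" for m
  have f: "f c = c'" "f d = d'" "f k = k'" using d by (auto simp: f_def)
  have bij: "bij_betw f (rest R) (rest R')"
    unfolding rR bij_betw_def inj_on_def using d d' f by auto
  define t where "t = mk R R' f"
  have t: "t \<in> B" unfolding t_def using mk_closed[OF pR bij] .
  have tb: "{Upper c, Lower c'} \<in> t" "{Upper d, Lower d'} \<in> t" "{Upper k, Lower k'} \<in> t"
    using rR f by (simp_all add: t_def mk_block_iff)
  have lt: "R' \<subseteq> low (y \<bullet> t)" if "y \<in> B" for y
    using mult_lower[OF that t] low_mk[OF pR bij] by (simp add: t_def)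
  have hB: "hook c d \<in> B" "hook c' d' \<in> B" using d d' by simp_all
  have cl: "x \<bullet> hook c d \<in> B" "w \<bullet> hook c' d' \<in> B" using x w hB mult_closed by auto
  note mv = low_hook_move(1)[OF x c dk] and mv' = low_hook_move(1)[OF w c' dk']
  show ?thesis
  proof (rule transport_minimal[OF rel x(2) _ t w cl(2)])
    show "rank (x \<bullet> hook c d) = n mod 2" "rank (w \<bullet> hook c' d') = n mod 2" "up (w \<bullet> hook c' d') = up w"
      using min_mult_left[OF x(1) hB(1) x(2)] min_mult_left[OF w(1) hB(2) w(2)] by auto
    have "{d', k'} \<in> low (x \<bullet> t)"
      using mult_LL[OF x(1) t] tb dk by (simp add: low_block)
    then show "low w \<subseteq> low (x \<bullet> t)" using lt[OF x(1)] by (auto simp: R'_def)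
    have "{c, d} \<in> low (x \<bullet> hook c d)" unfolding mv by auto
    then have "{c', d'} \<in> low (x \<bullet> hook c d \<bullet> t)"
      using mult_LL[OF cl(1) t] tb by (simp add: low_block)
    then show "low (w \<bullet> hook c' d') \<subseteq> low (x \<bullet> hook c d \<bullet> t)"
      unfolding mv' using lt[OF cl(1)] by (auto simp: R'_def)
  qed
qed

text \<open>Minimal rank 0 means that every point is paired. A difference between
  \<open>low x\<close> and \<open>low y\<close> therefore yields a related switch, and a hook acts
  on a minimal element either trivially or as a switch.\<close>

lemma hook_related_even:
  assumes ev: "even n" and xy: "(x, y) \<in> \<xi>" "rank x = n mod 2" "rank y = n mod 2" "low x \<noteq> low y"
    and w: "w \<in> B" "rank w = n mod 2" and ij': "i' \<in> {1..n}" "j' \<in> {1..n}" "i' \<noteq> j'"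
  shows "(w, w \<bullet> hook i' j') \<in> \<xi>"
proof -
  have B: "x \<in> B" "y \<in> B" using xy cong_closed[OF \<xi>] by auto
  have full: "\<exists>k. {i, k} \<in> low u" if "u \<in> B" "rank u = n mod 2" "i \<in> {1..n}" for u i
    using that ev rank_eq_low[OF that(1)] pattern_rest[OF pattern_low[OF that(1)], of i] by auto
  have "x \<bullet> x = x"
    using min_mult_left[OF B(1,1) xy(2)] min_mult_right[OF B(1,1) xy(2)]
    by (intro min_eqI) (simp_all add: B mult_closed)
  then have xy': "(x, x \<bullet> y) \<in> \<xi>" using cong_left[OF \<xi> xy(1) B(1)] by simp
  have lxy: "low (x \<bullet> y) = low y" using min_mult_right[OF B xy(3)] by simp
  have "\<not> low y \<subseteq> low x" using low_eqI[OF B(2,1)] xy by auto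
  then obtain i j where ij: "{i, j} \<in> low y" "{i, j} \<notin> low x"
    using pattern_block[OF pattern_low[OF B(2)]] by blast
  have ijn: "i \<in> {1..n}" "j \<in> {1..n}" "i \<noteq> j"
    using pattern_range[OF pattern_low ij(1)] pattern_neq[OF pattern_low ij(1)] B by auto
  have hB: "hook i j \<in> B" using ijn by simp
  have c: "x \<bullet> y \<in> B" using B mult_closed by simp
  have "(x \<bullet> hook i j, x \<bullet> y) \<in> \<xi>"
    using cong_right[OF \<xi> xy' hB] hook_absorb_right[OF c, of i j] lxy ij by simp
  then have rel: "(x, x \<bullet> hook i j) \<in> \<xi>" using xy' cong_sym[OF \<xi>] cong_trans[OF \<xi>] by blast
  obtain k l where kl: "{i, k} \<in> low x" "{j, l} \<in> low x" using full[OF B(1) xy(2)] ijn by blast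
  have kj: "k \<noteq> j" using kl ij by auto
  show ?thesis
  proof (cases "{i', j'} \<in> low w")
    case True
    then show ?thesis using hook_absorb_right[OF w(1) True] cong_refl[OF \<xi> w(1)] by simp
  next
    case False
    obtain k' l' where kl': "{i', k'} \<in> low w" "{j', l'} \<in> low w" using full[OF w] ij' by blast
    have "k' \<noteq> j'" using kl' False by auto
    then show ?thesis
      using switch_related[OF B(1) xy(2) w ev kl ijn(3) kj rel kl' ij'(3)] by simp
  qed
qed

lemma ex_transversal_odd: "\<exists>c. rest (low u) = {c}" if "odd n" "u \<in> B" "rank u = n mod 2"
  using that rank_eq_low[OF that(2)] by (auto simp: card_1_singleton_iff odd_iff_mod_2_eq_one)

text \<open>If the free points differ, the free point \<open>c\<close> of \<open>x\<close> is paired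
  with some \<open>d\<close> in \<open>y\<close>, so \<open>x \<bullet> y\<close> absorbs
  \<open>hook c d\<close>, while on \<open>x\<close> this hook is a move.\<close>

lemma ex_move_related:
  assumes od: "odd n" and xy: "(x, y) \<in> \<xi>" "rank x = n mod 2" "rank y = n mod 2" "rest (low x) \<noteq> rest (low y)"
  shows "\<exists>x c d k. x \<in> B \<and> rank x = n mod 2 \<and> c \<in> rest (low x) \<and> {d, k} \<in> low x \<and> (x, x \<bullet> hook c d) \<in> \<xi>"
proof -
  have B: "x \<in> B" "y \<in> B" using xy cong_closed[OF \<xi>] by auto
  obtain c where c: "rest (low x) = {c}" using ex_transversal_odd[OF od B(1) xy(2)] by blast
  obtain c' where c': "rest (low y) = {c'}" using ex_transversal_odd[OF od B(2) xy(3)] by blast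
  have "c \<noteq> c'" using c c' xy by auto
  moreover have cn: "c \<in> {1..n}" using c by (auto simp: rest_def)
  ultimately obtain d where d: "{c, d} \<in> low y" using pattern_rest[OF pattern_low[OF B(2)], of c] c' by auto
  have dn: "d \<in> {1..n}" "c \<noteq> d"
    using pattern_range[OF pattern_low[OF B(2)] d] pattern_neq[OF pattern_low[OF B(2)] d] by auto
  then obtain k where k: "{d, k} \<in> low x" using pattern_rest[OF pattern_low[OF B(1)], of d] c by auto
  have hB: "hook c d \<in> B" using cn dn by simp
  have "x \<bullet> x = x"
    using min_mult_left[OF B(1,1) xy(2)] min_mult_right[OF B(1,1) xy(2)]
    by (intro min_eqI) (simp_all add: B mult_closed)
  then have xy': "(x, x \<bullet> y) \<in> \<xi>" using cong_left[OF \<xi> xy(1) B(1)] by simp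
  have lxy: "low (x \<bullet> y) = low y" using min_mult_right[OF B xy(3)] by simp
  have "x \<bullet> y \<in> B" using B mult_closed by simp
  then have "(x \<bullet> hook c d, x \<bullet> y) \<in> \<xi>"
    using cong_right[OF \<xi> xy' hB] hook_absorb_right[of "x \<bullet> y" c d] lxy d by simp
  then have "(x, x \<bullet> hook c d) \<in> \<xi>" using xy' cong_sym[OF \<xi>] cong_trans[OF \<xi>] by blast
  then show ?thesis using B xy c k by blast
qed

text \<open>If the free points agree, hook the common one \<open>c\<close> to an end
  \<open>j\<close> of a pair \<open>{i, j}\<close> of \<open>y\<close> that \<open>x\<close> lacks:
  in \<open>y\<close> the point \<open>i\<close> becomes free, in \<open>x\<close> the partner of
  \<open>j\<close>, which is not \<open>i\<close>.\<close>

lemma ex_transversal_neq: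
  assumes od: "odd n" and xy: "(x, y) \<in> \<xi>" "rank x = n mod 2" "rank y = n mod 2" "low x \<noteq> low y"
  shows "\<exists>(x, y) \<in> \<xi>. rank x = n mod 2 \<and> rank y = n mod 2 \<and> rest (low x) \<noteq> rest (low y)"
proof (cases "rest (low x) = rest (low y)")
  case True
  have B: "x \<in> B" "y \<in> B" using xy cong_closed[OF \<xi>] by auto
  obtain c where c: "rest (low x) = {c}" using ex_transversal_odd[OF od B(1) xy(2)] by blast
  have "\<not> low y \<subseteq> low x" using low_eqI[OF B(2,1)] xy by auto
  then obtain i j where ij: "{i, j} \<in> low y" "{i, j} \<notin> low x"
    using pattern_block[OF pattern_low[OF B(2)]] by blast
  have ijn: "i \<in> {1..n}" "j \<in> {1..n}" "i \<noteq> j"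
    using pattern_range[OF pattern_low ij(1)] pattern_neq[OF pattern_low ij(1)] B by auto
  have cj: "c \<noteq> j" using ij c True by (auto simp: rest_def)
  then obtain l where l: "{j, l} \<in> low x" using pattern_rest[OF pattern_low[OF B(1)], of j] c ijn by auto
  have li: "l \<noteq> i" using l ij by (auto simp: insert_commute)
  have cn: "c \<in> {1..n}" using c by (auto simp: rest_def)
  have hB: "hook c j \<in> B" using cn ijn cj by simp
  have cB: "x \<bullet> hook c j \<in> B" using B hB mult_closed by simp
  have r: "rank (x \<bullet> hook c j) = n mod 2" "rank (y \<bullet> hook c j) = n mod 2"
    using min_mult_left[OF B(1) hB xy(2)] min_mult_left[OF B(2) hB xy(3)] by auto
  have "l \<in> rest (low (x \<bullet> hook c j))" using low_hook_move(2)[OF B(1) xy(2) _ l] c by simp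
  moreover have "i \<in> rest (low (y \<bullet> hook c j))"
    using low_hook_move(2)[OF B(2) xy(3), of c j i] c True ij by (simp add: insert_commute)
  ultimately have "rest (low (x \<bullet> hook c j)) \<noteq> rest (low (y \<bullet> hook c j))"
    using ex_transversal_odd[OF od cB r(1)] li by auto
  then show ?thesis using cong_right[OF \<xi> xy(1) hB] r by blast
qed (use xy in blast)

text \<open>A hook acts trivially, as a move or as a switch. All moves are related once one is, and
  a switch is composed of moves through the free point.\<close>

lemma hook_related_odd:
  assumes od: "odd n" and xy: "(x, y) \<in> \<xi>" "rank x = n mod 2" "rank y = n mod 2" "low x \<noteq> low y"
    and w: "w \<in> B" "rank w = n mod 2" and ij: "i \<in> {1..n}" "j \<in> {1..n}" "i \<noteq> j"
  shows "(w, w \<bullet> hook i j) \<in> \<xi>"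
proof -
  have hc: "hook i j = hook j i" by (simp add: hook_def insert_commute)
  obtain x1 c1 d1 k1 where x1: "x1 \<in> B" "rank x1 = n mod 2" "c1 \<in> rest (low x1)" "{d1, k1} \<in> low x1"
    "(x1, x1 \<bullet> hook c1 d1) \<in> \<xi>"
    using ex_transversal_neq[OF od xy] ex_move_related[OF od] by blast
  have move: "(w, w \<bullet> hook c d) \<in> \<xi>" if "w \<in> B" "rank w = n mod 2" "c \<in> rest (low w)" "{d, k} \<in> low w" for w c d k
    using move_related[OF x1(1,2) that(1,2) x1(3-5) that(3,4)] .
  obtain c where c: "rest (low w) = {c}" using ex_transversal_odd[OF od w] by blast
  note p = pattern_low[OF w(1)]
  have cn: "c \<in> {1..n}" using c by (auto simp: rest_def)
  have nb: "\<exists>k. {m, k} \<in> low w" if "m \<in> {1..n}" "m \<noteq> c" for m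
    using pattern_rest[OF p, of m] that c by auto
  consider "{i, j} \<in> low w" | "i = c" | "j = c" | "{i, j} \<notin> low w" "i \<noteq> c" "j \<noteq> c" by blast
  then show ?thesis
  proof cases
    case 1
    then show ?thesis using hook_absorb_right[OF w(1)] cong_refl[OF \<xi> w(1)] by simp
  next
    case 2
    then obtain k where "{j, k} \<in> low w" using nb[of j] ij by auto
    then show ?thesis using move[OF w, of c j k] c 2 by simp
  next
    case 3
    then obtain k where "{i, k} \<in> low w" using nb[of i] ij by auto
    then show ?thesis using move[OF w, of c i k] c 3 hc by simp
  next
    case 4
    obtain k l where k: "{i, k} \<in> low w" and l: "{j, l} \<in> low w" using nb ij 4 by blast
    have kj: "k \<noteq> j" using k 4 by auto
    have ki: "{k, i} \<in> low w" using k by (simp add: insert_commute)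
    have ne: "k \<noteq> i" "l \<noteq> j" using pattern_neq[OF p k] pattern_neq[OF p l] by auto
    have il: "i \<noteq> l" using l 4 by (auto simp: insert_commute)
    have kl: "k \<noteq> l" using pattern_unique[OF p, of k i j] k l ij by (auto simp: insert_commute)
    have ck: "c \<noteq> k" "c \<noteq> l" using c k l by (auto simp: rest_def)
    have kn: "k \<in> {1..n}" "l \<in> {1..n}" using pattern_range[OF p] k l by auto
    \<comment> \<open>Three moves make the switch: \<open>c\<close> takes \<open>k\<close> and frees
      \<open>i\<close>, then \<open>i\<close> takes \<open>j\<close> and frees \<open>l\<close>,
      then \<open>l\<close> takes \<open>k\<close> from \<open>c\<close>, which is free
      again.\<close>
    let ?w1 = "w \<bullet> hook c k" let ?w2 = "?w1 \<bullet> hook i j" let ?w3 = "?w2 \<bullet> hook l k"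
    have h: "hook c k \<in> B" "hook i j \<in> B" "hook l k \<in> B" using cn kn ij ck kl by simp_all
    have b: "?w1 \<in> B" "?w2 \<in> B" "?w3 \<in> B" using h w mult_closed by auto
    have r1: "rank ?w1 = n mod 2" "up ?w1 = up w" using min_mult_left[OF w(1) h(1) w(2)] by auto
    have r2: "rank ?w2 = n mod 2" "up ?w2 = up w" using min_mult_left[OF b(1) h(2) r1(1)] r1 by auto
    have r3: "rank ?w3 = n mod 2" "up ?w3 = up w" using min_mult_left[OF b(2) h(3) r2(1)] r2 by auto
    have s1: "(w, ?w1) \<in> \<xi>" using move[OF w _ ki] c by simp
    have l1: "low ?w1 = insert {c, k} (low w - {{k, i}})" "i \<in> rest (low ?w1)"
      using low_hook_move[OF w, of c k i] c ki by auto
    have jl1: "{j, l} \<in> low ?w1" unfolding l1 using l il ij by (auto simp: doubleton_eq_iff)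
    have s2: "(?w1, ?w2) \<in> \<xi>" using move[OF b(1) r1(1) l1(2) jl1] .
    have l2: "low ?w2 = insert {i, j} (low ?w1 - {{j, l}})" "l \<in> rest (low ?w2)"
      using low_hook_move[OF b(1) r1(1) l1(2) jl1] by auto
    have kc2: "{k, c} \<in> low ?w2" unfolding l2(1) l1(1) using kj 4 by (auto simp: doubleton_eq_iff)
    have s3: "(?w2, ?w3) \<in> \<xi>" using move[OF b(2) r2(1) l2(2) kc2] .
    have l3: "low ?w3 = insert {l, k} (low ?w2 - {{k, c}})"
      using low_hook_move[OF b(2) r2(1) l2(2) kc2] by auto
    have hw: "w \<bullet> hook i j \<in> B" "rank (w \<bullet> hook i j) = n mod 2" "up (w \<bullet> hook i j) = up w"
      using min_mult_left[OF w(1) h(2) w(2)] w h mult_closed by auto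
    have "low (w \<bullet> hook i j) \<subseteq> low ?w3"
    proof
      fix A assume "A \<in> low (w \<bullet> hook i j)"
      then consider "A \<in> low w" "A \<noteq> {i, k}" "A \<noteq> {j, l}" | "A = {i, j}" | "A = {k, l}"
        using low_hook_switch[OF w k l ij(3) kj] by auto
      then show "A \<in> low ?w3"
      proof cases
        case 1
        have "c \<notin> A" using 1(1) c by (auto simp: rest_def)
        then have "A \<noteq> {k, c}" by auto
        then show ?thesis using 1 unfolding l3 l2(1) l1(1) by (simp add: insert_commute)
      next
        case 2
        have "{i, j} \<noteq> {k, c}" using 4 by (auto simp: doubleton_eq_iff)
        then show ?thesis using 2 unfolding l3 l2(1) by simp
      qed (simp add: l3 insert_commute)
    qed
    then have "low (w \<bullet> hook i j) = low ?w3" using low_eqI[OF hw(1) b(3)] hw r3 by simp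
    then have "w \<bullet> hook i j = ?w3" using hw r3 b by (intro min_eqI) auto
    then show ?thesis using s1 s2 s3 cong_trans[OF \<xi>] by metis
  qed
qed

text \<open>\<open>u\<close> is turned into \<open>v\<close> by one hook for each pair of
  \<open>low v\<close>. These pairs are disjoint, so later hooks keep what earlier ones created, and
  each hook stays within the congruence class.\<close>

lemma minimal_collapse:
  assumes xy: "(x, y) \<in> \<xi>" "rank x = n mod 2" "rank y = n mod 2" "low x \<noteq> low y"
    and u: "u \<in> B" "rank u = n mod 2" and v: "v \<in> B" "rank v = n mod 2" "up u = up v"
  shows "(u, v) \<in> \<xi>"
proof -
  note p = pattern_low[OF v(1)]
  have hook_rel: "(w, w \<bullet> hook i j) \<in> \<xi>"
    if "w \<in> B" "rank w = n mod 2" "i \<in> {1..n}" "j \<in> {1..n}" "i \<noteq> j" for w i j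
    using hook_related_even[OF _ xy that] hook_related_odd[OF _ xy that] by blast
  have "\<exists>w \<in> B. rank w = n mod 2 \<and> (u, w) \<in> \<xi> \<and> up w = up u \<and> F \<subseteq> low w" if "finite F" "F \<subseteq> low v" for F
    using that
  proof (induction F)
    case empty
    then show ?case using u cong_refl[OF \<xi>] by auto
  next
    case (insert A F)
    then obtain w where w: "w \<in> B" "rank w = n mod 2" "(u, w) \<in> \<xi>" "up w = up u" "F \<subseteq> low w" by auto
    obtain i j where ij: "A = {i, j}" "{i, j} \<in> low v" using pattern_block[OF p] insert.prems by blast
    note ijn = pattern_range[OF p ij(2)] pattern_neq[OF p ij(2)]
    have hB: "hook i j \<in> B" using ijn by simp
    have "A' \<in> low (w \<bullet> hook i j)" if A': "A' \<in> F" for A'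
    proof -
      have "A' \<inter> A = {}"
        using p A' insert ij disjointD[of "low v" A' A] unfolding pattern_def is_matching_def by blast
      then show ?thesis using low_hook_old[OF ijn w(1)] A' w(5) ij by auto
    qed
    moreover have "A \<in> low (w \<bullet> hook i j)"
      using hook_new[OF ijn star_closed[OF w(1)]] low_hook[OF ijn w(1)] ij by simp
    moreover have "(u, w \<bullet> hook i j) \<in> \<xi>" using hook_rel[OF w(1,2) ijn] w(3) cong_trans[OF \<xi>] by blast
    ultimately show ?case
      using min_mult_left[OF w(1) hB w(2)] mult_closed[OF w(1) hB] w(4)
      by (intro bexI[of _ "w \<bullet> hook i j"]) auto
  qed
  from this[of "low v"] obtain w where w: "w \<in> B" "rank w = n mod 2" "(u, w) \<in> \<xi>" "up w = up u" "low v \<subseteq> low w"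
    using v by auto
  have "low v = low w" using low_eqI[OF v(1) w(1,5)] v w by simp
  then have "v = w" using v w by (intro min_eqI) auto
  then show ?thesis using w by simp
qed

end

end

section \<open>Maximal subgroups and the relations \<open>\<nu>\<close>\<close>

lemma sym_group_simps [simp]:
  "\<sigma> \<otimes>\<^bsub>sym_group q\<^esub> \<tau> = \<sigma> \<circ> \<tau>" "\<one>\<^bsub>sym_group q\<^esub> = id"
  by (simp_all add: sym_group_mult sym_group_one)

lemma normal_sym_group_iff: "N \<lhd> sym_group q \<longleftrightarrow>
    (\<forall>\<sigma> \<in> N. \<sigma> permutes {1..q}) \<and> id \<in> N \<and> (\<forall>\<sigma> \<in> N. \<forall>\<tau> \<in> N. \<sigma> \<circ> \<tau> \<in> N) \<and> (\<forall>\<sigma> \<in> N. inv' \<sigma> \<in> N) \<and>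
    (\<forall>\<tau>. \<tau> permutes {1..q} \<longrightarrow> (\<forall>\<sigma> \<in> N. \<tau> \<circ> \<sigma> \<circ> inv' \<tau> \<in> N))" (is "_ \<longleftrightarrow> ?R")
proof -
  interpret group "sym_group q" by (rule sym_group_is_group)
  have inv: "inv\<^bsub>sym_group q\<^esub> \<sigma> = inv' \<sigma>" if "\<sigma> permutes {1..q}" for \<sigma>
    using that by (simp add: sym_group_inv_equality sym_group_carrier)
  show ?thesis
  proof
    assume N: "N \<lhd> sym_group q"
    then have S: "subgroup N (sym_group q)" and c: "\<And>\<tau> \<sigma>. \<tau> \<in> carrier (sym_group q) \<Longrightarrow> \<sigma> \<in> N \<Longrightarrow>
        \<tau> \<otimes>\<^bsub>sym_group q\<^esub> \<sigma> \<otimes>\<^bsub>sym_group q\<^esub> inv\<^bsub>sym_group q\<^esub> \<tau> \<in> N"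
      by (auto simp: normal_inv_iff)
    have p: "\<sigma> permutes {1..q}" if "\<sigma> \<in> N" for \<sigma>
      using subgroup.mem_carrier[OF S that] by (simp add: sym_group_carrier)
    show ?R
    proof (intro conjI ballI allI impI)
      show "\<sigma> permutes {1..q}" if "\<sigma> \<in> N" for \<sigma> using p[OF that] .
      show "id \<in> N" using subgroup.one_closed[OF S] by simp
      show "\<sigma> \<circ> \<tau> \<in> N" if "\<sigma> \<in> N" "\<tau> \<in> N" for \<sigma> \<tau> using subgroup.m_closed[OF S that] by simp
      show "inv' \<sigma> \<in> N" if "\<sigma> \<in> N" for \<sigma>
        using subgroup.m_inv_closed[OF S that] inv[OF p[OF that]] by simp
      show "\<tau> \<circ> \<sigma> \<circ> inv' \<tau> \<in> N" if "\<tau> permutes {1..q}" "\<sigma> \<in> N" for \<tau> \<sigma>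
        using c[of \<tau> \<sigma>] inv[OF that(1)] that by (simp add: sym_group_carrier)
    qed
  next
    assume R: ?R
    have "subgroup N (sym_group q)"
    proof (rule subgroupI)
      show "N \<subseteq> carrier (sym_group q)" using R by (auto simp: sym_group_carrier)
      show "N \<noteq> {}" using R by blast
      show "inv\<^bsub>sym_group q\<^esub> \<sigma> \<in> N" if "\<sigma> \<in> N" for \<sigma> using that R inv by simp
      show "\<sigma> \<otimes>\<^bsub>sym_group q\<^esub> \<tau> \<in> N" if "\<sigma> \<in> N" "\<tau> \<in> N" for \<sigma> \<tau> using that R by simp
    qed
    moreover have "\<tau> \<otimes>\<^bsub>sym_group q\<^esub> \<sigma> \<otimes>\<^bsub>sym_group q\<^esub> inv\<^bsub>sym_group q\<^esub> \<tau> \<in> N"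
      if "\<tau> \<in> carrier (sym_group q)" "\<sigma> \<in> N" for \<tau> \<sigma>
      using that R inv by (simp add: sym_group_carrier)
    ultimately show "N \<lhd> sym_group q" by (simp add: normal_inv_iff)
  qed
qed

context
  fixes N q assumes N: "N \<lhd> sym_group q"
begin

lemma normal_permutes: "\<sigma> \<in> N \<Longrightarrow> \<sigma> permutes {1..q}"
  and normal_id: "id \<in> N"
  and normal_comp: "\<sigma> \<in> N \<Longrightarrow> \<tau> \<in> N \<Longrightarrow> \<sigma> \<circ> \<tau> \<in> N"
  and normal_inv: "\<sigma> \<in> N \<Longrightarrow> inv' \<sigma> \<in> N"
  and normal_conj: "\<tau> permutes {1..q} \<Longrightarrow> \<sigma> \<in> N \<Longrightarrow> \<tau> \<circ> \<sigma> \<circ> inv' \<tau> \<in> N"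
  using N unfolding normal_sym_group_iff by blast+

text \<open>The composite splits as a conjugate of \<open>\<sigma>\<close> times
  \<open>\<kappa> \<circ> \<eta>\<close>. It serves when two factorisations of one diagram differ by
  \<open>\<eta>\<close> on the left and \<open>\<kappa>\<close> on the right.\<close>

lemma normal_conj': "\<kappa> \<circ> \<sigma> \<circ> \<eta> \<in> N"
  if k: "\<kappa> permutes {1..q}" and \<sigma>: "\<sigma> \<in> N" and ke: "\<kappa> \<circ> \<eta> \<in> N"
proof -
  have "\<kappa> \<circ> \<sigma> \<circ> inv' \<kappa> \<circ> (\<kappa> \<circ> \<eta>) \<in> N" using normal_comp[OF normal_conj[OF k \<sigma>] ke] .
  moreover have "inv' \<kappa> \<circ> \<kappa> = id" using permutes_inv_o(2)[OF k] .
  ultimately show ?thesis by (metis comp_assoc comp_id)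
qed

end

context brauer_monoid
begin

text \<open>The pairs \<open>{q + 1, q + 2}\<close>, \<open>{q + 3, q + 4}\<close> and so on, shared
  by both rows of every \<open>bar n q \<sigma>\<close>; oddness of \<open>j - q\<close> selects the
  left ends.\<close>

definition std :: "nat \<Rightarrow> nat set set" where
  "std q = (\<lambda>j. {j, Suc j}) ` {j. q < j \<and> j < n \<and> odd (j - q)}"

lemma bar_eq_mk: "bar n q \<sigma> = mk (std q) (std q) \<sigma>" if r: "rest (std q) = {1..q}"
proof -
  have "{{Upper i, Lower (\<sigma> i)} | i. i \<in> {1..q}} = (\<lambda>i. {Upper i, Lower (\<sigma> i)}) ` rest (std q)"
    unfolding r by blast
  moreover have "{{Upper j, Upper (j + 1)} | j. q < j \<and> j < n \<and> odd (j - q)} = (`) Upper ` std q"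
    unfolding std_def image_image by auto
  moreover have "{{Lower j, Lower (j + 1)} | j. q < j \<and> j < n \<and> odd (j - q)} = (`) Lower ` std q"
    unfolding std_def image_image by auto
  ultimately show ?thesis unfolding bar_def mk_def by (simp only: Un_ac)
qed

context
  fixes q assumes q: "q \<le> n" "q mod 2 = n mod 2"
begin

lemma Union_std: "\<Union>(std q) = {q<..n}"
proof
  show "\<Union>(std q) \<subseteq> {q<..n}" by (auto simp: std_def)
  show "{q<..n} \<subseteq> \<Union>(std q)"
  proof
    fix x assume x: "x \<in> {q<..n}"
    show "x \<in> \<Union>(std q)"
    proof (cases "odd (x - q)")
      case True
      have "x \<noteq> n" using True x q by presburger
      then have "{x, Suc x} \<in> std q" using True x by (auto simp: std_def)
      then show ?thesis by blast
    next
      case False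
      have "q < x" "x \<le> n" using x by auto
      then have "q < x - 1" "odd (x - 1 - q)" "Suc (x - 1) = x" using False by presburger+
      then have "{x - 1, x} \<in> std q" using x by (auto simp: std_def image_iff intro!: exI[of _ "x - 1"])
      then show ?thesis by blast
    qed
  qed
qed

lemma pattern_std: "pattern (std q)"
proof -
  have "{i, Suc i} \<inter> {j, Suc j} = {}" if "odd (i - q)" "odd (j - q)" "q < i" "q < j" "i \<noteq> j" for i j
  proof -
    have "i \<noteq> Suc j" "j \<noteq> Suc i" using that by presburger+
    then show ?thesis using that by auto
  qed
  then have "disjoint (std q)" by (auto simp: std_def pairwise_def disjnt_def)
  moreover have "\<forall>A \<in> std q. card A = 2" by (auto simp: std_def)
  ultimately show ?thesis unfolding pattern_def is_matching_def Union_std by auto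
qed

lemma rest_std: "rest (std q) = {1..q}"
  unfolding rest_def Union_std using q by auto

lemmas bar_mk = bar_eq_mk[OF rest_std]

lemma permutes_bij_rest: "\<sigma> permutes {1..q} \<Longrightarrow> bij_betw \<sigma> (rest (std q)) (rest (std q))"
  unfolding rest_std by (rule permutes_imp_bij)

lemma bar_facts:
  assumes "\<sigma> permutes {1..q}"
  shows "bar n q \<sigma> \<in> B" "up (bar n q \<sigma>) = std q" "low (bar n q \<sigma>) = std q" "rank (bar n q \<sigma>) = q"
proof -
  note b = permutes_bij_rest[OF assms]
  show 1: "bar n q \<sigma> \<in> B" "up (bar n q \<sigma>) = std q" "low (bar n q \<sigma>) = std q"
    unfolding bar_mk using mk_closed up_mk low_mk pattern_std b by auto
  show "rank (bar n q \<sigma>) = q" using rank_eq[OF 1(1)] 1 rest_std by simp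
qed

lemma bar_id: "bar n q id = proj (std q)" unfolding bar_mk proj_def ..

lemma bar_mult: "bar n q \<sigma> \<bullet> bar n q \<tau> = bar n q (\<tau> \<circ> \<sigma>)"
  if "\<sigma> permutes {1..q}" "\<tau> permutes {1..q}"
  unfolding bar_mk using mk_mult pattern_std permutes_bij_rest that by blast

lemma star_bar: "star (bar n q \<sigma>) = bar n q (inv' \<sigma>)" if \<sigma>: "\<sigma> permutes {1..q}"
proof -
  have "star (bar n q \<sigma>) = mk (std q) (std q) (the_inv_into (rest (std q)) \<sigma>)"
    unfolding bar_mk using mk_star pattern_std permutes_bij_rest \<sigma> by blast
  also have "\<dots> = mk (std q) (std q) (inv' \<sigma>)"
  proof -
    have "the_inv_into (rest (std q)) \<sigma> i = inv' \<sigma> i" if "i \<in> rest (std q)" for i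
    proof (rule the_inv_into_f_eq)
      show "inj_on \<sigma> (rest (std q))" using permutes_bij_rest[OF \<sigma>] by (simp add: bij_betw_def)
      show "\<sigma> (inv' \<sigma> i) = i" using permutes_inverses(1)[OF \<sigma>] .
      show "inv' \<sigma> i \<in> rest (std q)" using that permutes_in_image[OF permutes_inv[OF \<sigma>]] rest_std by auto
    qed
    then show ?thesis unfolding mk_def by (metis (no_types, lifting) image_cong)
  qed
  finally show ?thesis unfolding bar_mk .
qed

lemma bar_inj: "\<sigma> = \<tau>" if \<sigma>: "\<sigma> permutes {1..q}" and \<tau>: "\<tau> permutes {1..q}" and eq: "bar n q \<sigma> = bar n q \<tau>"
proof
  fix i
  show "\<sigma> i = \<tau> i"
  proof (cases "i \<in> {1..q}")
    case True
    then have "{Upper i, Lower (\<sigma> i)} \<in> bar n q \<sigma>" unfolding bar_mk mk_block_iff(3) rest_std by blast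
    then have "{Upper i, Lower (\<sigma> i)} \<in> bar n q \<tau>" using eq by simp
    then show ?thesis unfolding bar_mk by (simp add: mk_block_iff)
  next
    case False
    then show ?thesis using \<sigma> \<tau> by (simp add: permutes_def)
  qed
qed

lemma bar_cases: "\<exists>\<sigma>. \<sigma> permutes {1..q} \<and> \<alpha> = bar n q \<sigma>" if \<alpha>: "\<alpha> \<in> B" "up \<alpha> = std q" "low \<alpha> = std q"
proof -
  define \<sigma> where "\<sigma> i = (if i \<in> {1..q} then through \<alpha> i else i)" for i
  have "bij_betw (through \<alpha>) {1..q} {1..q}" using through_bij[OF \<alpha>(1)] \<alpha> rest_std by simp
  moreover have "bij_betw \<sigma> {1..q} {1..q} \<longleftrightarrow> bij_betw (through \<alpha>) {1..q} {1..q}"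
    by (rule bij_betw_cong) (simp add: \<sigma>_def)
  ultimately have "\<sigma> permutes {1..q}" by (intro bij_imp_permutes) (auto simp: \<sigma>_def)
  moreover have "\<alpha> = bar n q \<sigma>"
    unfolding bar_mk using \<alpha> through_block[OF \<alpha>(1)] rest_std by (intro mk_eqI) (auto simp: \<sigma>_def)
  ultimately show ?thesis by blast
qed

lemma mult_bar_id: "s \<bullet> bar n q id = s" if "s \<in> B" "low s = std q"
  using that mult_proj by (simp add: bar_id)

text \<open>Factors an element of rank \<open>q\<close> through the pattern \<open>std q\<close>.
  Inserting \<open>bar n q \<sigma>\<close> between \<open>s\<close> and \<open>t\<close> then runs
  through the elements with the same patterns, as in a Rees matrix semigroup.\<close>

lemma coordinates: "\<exists>s \<in> B. \<exists>t \<in> B. low s = std q \<and> up t = std q \<and> \<alpha> = s \<bullet> t \<and> up s = up \<alpha> \<and> low t = low \<alpha>"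
  if \<alpha>: "\<alpha> \<in> B" and r: "rank \<alpha> = q"
proof -
  have "card (std q) = card (up \<alpha>)" using card_rest[OF pattern_std] rest_std rank_up[OF \<alpha>] r by simp
  then obtain s where s: "s \<in> B" "up s = up \<alpha>" "low s = std q"
    using ex_diagram[OF pattern_up[OF \<alpha>] pattern_std] by auto
  let ?t = "star s \<bullet> \<alpha>"
  have m: "low (star s) = up \<alpha>" using s by simp
  note t = matched_mult[OF star_closed[OF s(1)] \<alpha> m]
  have "s \<bullet> ?t = \<alpha>" using t(4) by simp
  then have "low s = std q \<and> up ?t = std q \<and> \<alpha> = s \<bullet> ?t \<and> up s = up \<alpha> \<and> low ?t = low \<alpha>"
    using s t by simp
  then show ?thesis using s mult_closed[OF star_closed[OF s(1)] \<alpha>] by blast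
qed

end

lemma ex_rank: "\<exists>\<alpha> \<in> B. rank \<alpha> = q" if "q \<le> n" "q mod 2 = n mod 2"
  using bar_facts[OF that permutes_id] by blast

subsection \<open>Ideals and J-classes\<close>

text \<open>For the harder inclusion, extend \<open>up \<alpha>\<close> to a pattern
  \<open>D\<close> with as many pairs as \<open>up \<beta>\<close>. Then
  \<open>proj D = proj D \<bullet> \<alpha> \<bullet> star \<alpha>\<close> lies in the ideal of
  \<open>\<alpha>\<close>, and it has the rank of \<open>\<beta>\<close>.\<close>

lemma two_sided_eq: "two_sided (brauer n) \<alpha> = {\<beta> \<in> B. rank \<beta> \<le> rank \<alpha>}" if \<alpha>: "\<alpha> \<in> B"
proof
  show "two_sided (brauer n) \<alpha> \<subseteq> {\<beta> \<in> B. rank \<beta> \<le> rank \<alpha>}"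
  proof
    fix \<beta> assume "\<beta> \<in> two_sided (brauer n) \<alpha>"
    then obtain s t where st: "\<beta> = s \<bullet> \<alpha> \<bullet> t" "s \<in> B" "t \<in> B" by (auto simp: two_sided_def)
    then have c: "s \<bullet> \<alpha> \<in> B" using \<alpha> mult_closed by simp
    show "\<beta> \<in> {\<beta> \<in> B. rank \<beta> \<le> rank \<alpha>}"
      using rank_mult_left[OF c st(3)] rank_mult_right[OF st(2) \<alpha>] mult_closed[OF c st(3)] st by simp
  qed
  show "{\<beta> \<in> B. rank \<beta> \<le> rank \<alpha>} \<subseteq> two_sided (brauer n) \<alpha>"
  proof
    fix \<beta> assume "\<beta> \<in> {\<beta> \<in> B. rank \<beta> \<le> rank \<alpha>}"
    then have \<beta>: "\<beta> \<in> B" "rank \<beta> \<le> rank \<alpha>" by auto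
    note p = pattern_up[OF \<alpha>]
    have le: "2 * (card (up \<beta>) - card (up \<alpha>)) \<le> card (rest (up \<alpha>))" "card (up \<alpha>) \<le> card (up \<beta>)"
      using rank_up[OF \<alpha>] rank_up[OF \<beta>(1)] \<beta>(2) rank_eq[OF \<alpha>] by linarith+
    obtain D where D: "pattern D" "up \<alpha> \<subseteq> D" "card D = card (up \<beta>)"
      using ex_pattern_extend[OF p subset_refl le(1)] le(2) by auto
    have P: "proj D \<in> B" "rank (proj D) = rank \<beta>"
      using D rank_up[of "proj D"] rank_up[OF \<beta>(1)] by auto
    have e: "proj D \<bullet> \<alpha> \<bullet> star \<alpha> = proj D"
      using mult_assoc[OF P(1) \<alpha> star_closed[OF \<alpha>]] mult_star_self[OF \<alpha>] mult_proj[OF P(1), of "up \<alpha>"] D by simp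
    obtain s t where st: "s \<in> B" "t \<in> B" "\<beta> = s \<bullet> proj D \<bullet> t" using J_related[OF P(1) \<beta>(1) P(2)] by blast
    have "\<beta> = (s \<bullet> proj D) \<bullet> \<alpha> \<bullet> (star \<alpha> \<bullet> t)"
      unfolding st(3) using st(1,2) P \<alpha> by (subst e[symmetric]) (simp add: mult_assoc mult_closed)
    moreover have "s \<bullet> proj D \<in> B" "star \<alpha> \<bullet> t \<in> B" using st P \<alpha> mult_closed by auto
    ultimately show "\<beta> \<in> two_sided (brauer n) \<alpha>" unfolding two_sided_def by blast
  qed
qed

lemma greenJ_iff: "(\<alpha>, \<beta>) \<in> greenJ (brauer n) \<longleftrightarrow> \<alpha> \<in> B \<and> \<beta> \<in> B \<and> rank \<alpha> = rank \<beta>"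
proof -
  have "rank \<alpha> = rank \<beta>" if "\<alpha> \<in> B" "\<beta> \<in> B" "two_sided (brauer n) \<alpha> = two_sided (brauer n) \<beta>"
    using that two_sided_eq by (metis (no_types, lifting) le_antisym mem_Collect_eq order_refl)
  then show ?thesis using two_sided_eq by (auto simp: greenJ_def)
qed

section \<open>The relations nu in coordinates\<close>

definition rel_nu :: "nat \<Rightarrow> (nat \<Rightarrow> nat) set \<Rightarrow> (diagram \<times> diagram) set" where
  "rel_nu q N = nu (brauer n) (bar n q ` N)"

text \<open>For \<open>r = n\<close> the family of congruences refers to rank \<open>n + 2\<close>,
  where no diagram exists; with the trivial group the relation is then empty, so one definition
  covers all \<open>r\<close>.\<close>

lemma rel_nu_out: "rel_nu q {id} = {}" if "q > n"
proof -
  have "bar n q id \<notin> B"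
  proof
    assume "bar n q id \<in> B"
    moreover have "{Upper q, Lower q} \<in> bar n q id" using that by (auto simp: bar_def)
    ultimately have "Upper q \<in> points n" using B_points by blast
    then show False using that by simp
  qed
  then have "greenJ (brauer n) `` (bar n q ` {id}) = {}" by (auto simp: greenJ_iff)
  then show ?thesis by (simp add: rel_nu_def nu_def)
qed

context
  fixes q N assumes q: "q \<le> n" "q mod 2 = n mod 2" and N: "N \<lhd> sym_group q"
begin

lemma rel_nu_iff: "(\<alpha>, \<beta>) \<in> rel_nu q N \<longleftrightarrow> rank \<alpha> = q \<and> rank \<beta> = q \<and>
    (\<exists>s \<in> B. \<exists>t \<in> B. \<exists>x \<in> N. \<exists>y \<in> N. \<alpha> = s \<bullet> bar n q x \<bullet> t \<and> \<beta> = s \<bullet> bar n q y \<bullet> t)"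
proof -
  have bB: "bar n q x \<in> B" "rank (bar n q x) = q" if "x \<in> N" for x
    using bar_facts[OF q normal_permutes[OF N that]] by auto
  have J: "\<alpha> \<in> greenJ (brauer n) `` (bar n q ` N) \<longleftrightarrow> \<alpha> \<in> B \<and> rank \<alpha> = q" for \<alpha>
    using bB normal_id[OF N] by (auto simp: Image_iff greenJ_iff)
  show ?thesis
  proof
    assume "(\<alpha>, \<beta>) \<in> rel_nu q N"
    then show "rank \<alpha> = q \<and> rank \<beta> = q \<and>
        (\<exists>s \<in> B. \<exists>t \<in> B. \<exists>x \<in> N. \<exists>y \<in> N. \<alpha> = s \<bullet> bar n q x \<bullet> t \<and> \<beta> = s \<bullet> bar n q y \<bullet> t)"
      unfolding rel_nu_def nu_def using J by blast
  next
    assume h: "rank \<alpha> = q \<and> rank \<beta> = q \<and>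
        (\<exists>s \<in> B. \<exists>t \<in> B. \<exists>x \<in> N. \<exists>y \<in> N. \<alpha> = s \<bullet> bar n q x \<bullet> t \<and> \<beta> = s \<bullet> bar n q y \<bullet> t)"
    then obtain s t x y where st: "s \<in> B" "t \<in> B" "x \<in> N" "y \<in> N" "\<alpha> = s \<bullet> bar n q x \<bullet> t"
        "\<beta> = s \<bullet> bar n q y \<bullet> t" by blast
    then have "\<alpha> \<in> B" "\<beta> \<in> B" using bB mult_closed by auto
    then have "\<alpha> \<in> greenJ (brauer n) `` (bar n q ` N)" "\<beta> \<in> greenJ (brauer n) `` (bar n q ` N)"
      using J h by auto
    then show "(\<alpha>, \<beta>) \<in> rel_nu q N" unfolding rel_nu_def nu_def using st by blast
  qed
qed

text \<open>The permutation \<open>x\<close> can be shifted into \<open>s\<close>, which leaves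
  \<open>w = y \<circ> inv' x\<close> in \<open>N\<close>; since the rank is \<open>q\<close>, the
  inner patterns are forced to be \<open>std q\<close>.\<close>

lemma rel_nuE:
  assumes "(\<alpha>, \<beta>) \<in> rel_nu q N"
  shows "\<exists>s \<in> B. \<exists>t \<in> B. \<exists>y \<in> N. low s = std q \<and> up t = std q \<and> \<alpha> = s \<bullet> t \<and> \<beta> = s \<bullet> bar n q y \<bullet> t"
proof -
  obtain s t x y where st: "s \<in> B" "t \<in> B" "x \<in> N" "y \<in> N" "\<alpha> = s \<bullet> bar n q x \<bullet> t" "\<beta> = s \<bullet> bar n q y \<bullet> t"
    and r: "rank \<alpha> = q" using assms unfolding rel_nu_iff by blast
  have px: "x permutes {1..q}" "y permutes {1..q}" using st normal_permutes[OF N] by auto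
  note bx = bar_facts[OF q px(1)] and bi = bar_facts[OF q permutes_id]
  define w where "w = y \<circ> inv' x"
  have w: "w \<in> N" using st normal_comp[OF N] normal_inv[OF N] by (simp add: w_def)
  have pw: "w permutes {1..q}" using normal_permutes[OF N w] .
  note bw = bar_facts[OF q pw]
  let ?s = "s \<bullet> bar n q x" and ?t = "bar n q id \<bullet> t"
  have c: "?s \<in> B" "?t \<in> B" using st bx bi mult_closed by auto
  have "q \<le> rank ?s" using rank_mult_left[OF c(1) st(2)] r st by simp
  then have ls: "low ?s = std q" using low_mult_eq[OF st(1) bx(1)] bx by simp
  then have si: "?s \<bullet> bar n q id = ?s" using mult_bar_id[OF q c(1)] by simp
  have \<alpha>: "\<alpha> = ?s \<bullet> ?t" using si mult_assoc[OF c(1) bi(1) st(2)] st by simp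
  then have "q \<le> rank ?t" using rank_mult_right[OF c] r by simp
  then have ut: "up ?t = std q" using up_mult_eq[OF bi(1) st(2)] bi by simp
  have "bar n q x \<bullet> bar n q w = bar n q y"
  proof -
    have "w \<circ> x = y" using permutes_inv_o(2)[OF px(1)] by (simp add: w_def comp_assoc)
    then show ?thesis using bar_mult[OF q px(1) pw] by simp
  qed
  moreover have "bar n q w \<bullet> bar n q id = bar n q w" using bar_mult[OF q pw permutes_id] by simp
  ultimately have "\<beta> = ?s \<bullet> bar n q w \<bullet> ?t"
    using st bx bw bi mult_closed by (simp add: mult_assoc) (metis mult_assoc)
  then show ?thesis using \<alpha> c w ls ut by blast
qed

lemma rel_nuI: "(s \<bullet> t, s \<bullet> bar n q y \<bullet> t) \<in> rel_nu q N"
  if "s \<in> B" "t \<in> B" "y \<in> N" "low s = std q" "up t = std q"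
proof -
  note b = bar_facts[OF q normal_permutes[OF N that(3)]]
  have m: "low s = up (bar n q y)" using that b by simp
  note sy = matched_mult[OF that(1) b(1) m]
  have c: "s \<bullet> bar n q y \<in> B" using that b mult_closed by simp
  have m': "low (s \<bullet> bar n q y) = up t" using sy b that by simp
  have "rank s = q" using rank_eq_low[OF that(1)] that rest_std[OF q] by simp
  then have "rank (s \<bullet> t) = q" "rank (s \<bullet> bar n q y \<bullet> t) = q"
    using matched_mult(3)[OF that(1,2)] matched_mult(3)[OF c that(2) m'] sy that by auto
  then show ?thesis unfolding rel_nu_iff using that normal_id[OF N] mult_bar_id[OF q that(1,4)] by metis
qed

lemma rel_nu_H:
  assumes "(\<alpha>, \<beta>) \<in> rel_nu q N"
  shows "\<alpha> \<in> B" "\<beta> \<in> B" "rank \<alpha> = q" "rank \<beta> = q" "up \<alpha> = up \<beta>" "low \<alpha> = low \<beta>"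
proof -
  obtain s t y where st: "s \<in> B" "t \<in> B" "y \<in> N" "low s = std q" "up t = std q" "\<alpha> = s \<bullet> t" "\<beta> = s \<bullet> bar n q y \<bullet> t"
    using rel_nuE[OF assms] by blast
  note b = bar_facts[OF q normal_permutes[OF N st(3)]]
  have m: "low s = up (bar n q y)" using st b by simp
  note sy = matched_mult[OF st(1) b(1) m]
  have c: "s \<bullet> bar n q y \<in> B" using st b mult_closed by simp
  have m': "low (s \<bullet> bar n q y) = up t" using sy b st by simp
  show "\<alpha> \<in> B" "\<beta> \<in> B" using st c mult_closed by auto
  show "rank \<alpha> = q" "rank \<beta> = q" using assms by (auto simp: rel_nu_iff)
  show "up \<alpha> = up \<beta>" "low \<alpha> = low \<beta>"
    using matched_mult(1,2)[OF st(1,2)] matched_mult(1,2)[OF c st(2) m'] sy st by auto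
qed

lemma rel_nu_sym: "(\<beta>, \<alpha>) \<in> rel_nu q N" if "(\<alpha>, \<beta>) \<in> rel_nu q N"
  using that unfolding rel_nu_iff by blast

lemma group_coordinates:
  assumes "s \<in> B" "s' \<in> B" "low s = std q" "low s' = std q" "up s = up s'"
  shows "\<exists>\<eta>. \<eta> permutes {1..q} \<and> s' = s \<bullet> bar n q \<eta>"
proof -
  have m: "low (star s) = up s'" using assms by simp
  note h = matched_mult[OF star_closed[OF assms(1)] assms(2) m]
  obtain \<eta> where \<eta>: "\<eta> permutes {1..q}" "star s \<bullet> s' = bar n q \<eta>"
    using bar_cases[OF q mult_closed[OF star_closed[OF assms(1)] assms(2)]] h assms by auto
  have "s \<bullet> (star s \<bullet> s') = s'" using h(4) by simp
  then show ?thesis using \<eta> by auto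
qed

lemma group_coordinates':
  assumes "t \<in> B" "t' \<in> B" "up t = std q" "up t' = std q" "low t = low t'"
  shows "\<exists>\<kappa>. \<kappa> permutes {1..q} \<and> t' = bar n q \<kappa> \<bullet> t"
proof -
  obtain \<eta> where \<eta>: "\<eta> permutes {1..q}" "star t' = star t \<bullet> bar n q \<eta>"
    using group_coordinates[of "star t" "star t'"] assms by auto
  have "t' = bar n q (inv' \<eta>) \<bullet> t"
    using \<eta> star_mult[of "star t" "bar n q \<eta>"] star_bar[OF q \<eta>(1)] bar_facts(1)[OF q \<eta>(1)] assms(1)
    by (metis star_closed star_star)
  then show ?thesis using permutes_inv[OF \<eta>(1)] by blast
qed

text \<open>\<open>star s\<close> and \<open>star t\<close> undo the outer factors, because all
  inner patterns are \<open>std q\<close>.\<close>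

lemma sandwich_cancel:
  assumes "s \<in> B" "t \<in> B" "low s = std q" "up t = std q" "\<sigma> permutes {1..q}" "\<tau> permutes {1..q}"
    and eq: "s \<bullet> bar n q \<sigma> \<bullet> t = s \<bullet> bar n q \<tau> \<bullet> t"
  shows "\<sigma> = \<tau>"
proof -
  have "star s \<bullet> (s \<bullet> bar n q \<sigma> \<bullet> t) \<bullet> star t = bar n q \<sigma>" if "\<sigma> permutes {1..q}" for \<sigma>
  proof -
    note b = bar_facts[OF q that]
    have m: "low s = up (bar n q \<sigma>)" using assms b by simp
    note sy = matched_mult[OF assms(1) b(1) m]
    have c: "s \<bullet> bar n q \<sigma> \<in> B" using assms b mult_closed by simp
    have m': "low (s \<bullet> bar n q \<sigma>) = up t" using sy b assms by simp
    have "s \<bullet> bar n q \<sigma> \<bullet> t \<bullet> star t = s \<bullet> bar n q \<sigma>" using matched_mult(5)[OF c assms(2) m'] .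
    then show ?thesis using sy(4) c assms mult_closed by (simp add: mult_assoc)
  qed
  then have "bar n q \<sigma> = bar n q \<tau>" using assms(5,6) eq by metis
  then show ?thesis using bar_inj[OF q assms(5,6)] by simp
qed

text \<open>The middle element has two factorisations, which differ by permutations
  \<open>\<eta>\<close> and \<open>\<kappa>\<close>. Cancellation gives
  \<open>y = \<kappa> \<circ> \<eta>\<close>, so \<open>\<kappa> \<circ> \<eta>\<close> is in
  \<open>N\<close>, and normality puts \<open>\<kappa> \<circ> y' \<circ> \<eta>\<close> in
  \<open>N\<close>.\<close>

lemma rel_nu_trans:
  assumes "(\<alpha>, \<beta>) \<in> rel_nu q N" "(\<beta>, \<gamma>) \<in> rel_nu q N"
  shows "(\<alpha>, \<gamma>) \<in> rel_nu q N"
proof -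
  obtain s t y where st: "s \<in> B" "t \<in> B" "y \<in> N" "low s = std q" "up t = std q" "\<alpha> = s \<bullet> t" "\<beta> = s \<bullet> bar n q y \<bullet> t"
    using rel_nuE[OF assms(1)] by blast
  obtain s' t' y' where st': "s' \<in> B" "t' \<in> B" "y' \<in> N" "low s' = std q" "up t' = std q" "\<beta> = s' \<bullet> t'" "\<gamma> = s' \<bullet> bar n q y' \<bullet> t'"
    using rel_nuE[OF assms(2)] by blast
  have "up s = up s'" "low t = low t'"
    using matched_mult(1,2)[OF st(1,2)] matched_mult(1,2)[OF st'(1,2)] st st' rel_nu_H[OF assms(1)] by auto
  then obtain \<eta> \<kappa> where h: "\<eta> permutes {1..q}" "s' = s \<bullet> bar n q \<eta>" and k: "\<kappa> permutes {1..q}" "t' = bar n q \<kappa> \<bullet> t"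
    using group_coordinates[OF st(1) st'(1) st(4) st'(4)] group_coordinates'[OF st(2) st'(2) st(5) st'(5)] by blast
  note py = normal_permutes[OF N st(3)] and py' = normal_permutes[OF N st'(3)]
  note b = bar_facts(1)[OF q h(1)] bar_facts(1)[OF q k(1)] bar_facts(1)[OF q py']
  have ke: "\<kappa> \<circ> \<eta> permutes {1..q}" using permutes_compose[OF h(1) k(1)] .
  have "\<beta> = s \<bullet> (bar n q \<eta> \<bullet> bar n q \<kappa>) \<bullet> t"
    unfolding st'(6) h(2) k(2) using st(1,2) b by (simp add: mult_assoc mult_closed)
  then have "s \<bullet> bar n q y \<bullet> t = s \<bullet> bar n q (\<kappa> \<circ> \<eta>) \<bullet> t" using bar_mult[OF q h(1) k(1)] st(7) by simp
  then have "y = \<kappa> \<circ> \<eta>" using sandwich_cancel[OF st(1,2,4,5) py ke] by simp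
  then have z: "\<kappa> \<circ> y' \<circ> \<eta> \<in> N" using normal_conj'[OF N k(1) st'(3)] st(3) by simp
  have "\<gamma> = s \<bullet> (bar n q \<eta> \<bullet> bar n q y' \<bullet> bar n q \<kappa>) \<bullet> t"
    unfolding st'(7) h(2) k(2) using st(1,2) b by (simp add: mult_assoc mult_closed)
  also have "bar n q \<eta> \<bullet> bar n q y' \<bullet> bar n q \<kappa> = bar n q (\<kappa> \<circ> y' \<circ> \<eta>)"
    using bar_mult[OF q h(1) py'] bar_mult[OF q permutes_compose[OF h(1) py'] k(1)] by (simp add: comp_assoc)
  finally show ?thesis unfolding st(6) using rel_nuI[OF st(1,2) z st(4,5)] by simp
qed

text \<open>Makes \<open>N\<close> recoverable from the relation, so that distinct normal subgroups
  give distinct congruences. A factorisation of \<open>bar n q id\<close> through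
  \<open>std q\<close> consists of two mutually inverse group elements, so \<open>\<sigma>\<close>
  is a conjugate of an element of \<open>N\<close>.\<close>

lemma rel_nu_bar_iff: "(bar n q id, bar n q \<sigma>) \<in> rel_nu q N \<longleftrightarrow> \<sigma> \<in> N" if \<sigma>: "\<sigma> permutes {1..q}"
proof
  assume "(bar n q id, bar n q \<sigma>) \<in> rel_nu q N"
  then obtain s t y where st: "s \<in> B" "t \<in> B" "y \<in> N" "low s = std q" "up t = std q" "bar n q id = s \<bullet> t"
      "bar n q \<sigma> = s \<bullet> bar n q y \<bullet> t"
    using rel_nuE by blast
  note bi = bar_facts[OF q permutes_id] and py = normal_permutes[OF N st(3)]
  have "up s = std q" "low t = std q" using matched_mult(1,2)[OF st(1,2)] st bi by auto
  then obtain \<eta> \<kappa> where h: "\<eta> permutes {1..q}" "s = bar n q \<eta>" and k: "\<kappa> permutes {1..q}" "t = bar n q \<kappa>"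
    using bar_cases[OF q st(1)] bar_cases[OF q st(2)] st by blast
  have "bar n q id = bar n q (\<kappa> \<circ> \<eta>)" using st(6) h k bar_mult[OF q h(1) k(1)] by simp
  then have "id = \<kappa> \<circ> \<eta>" using bar_inj[OF q permutes_id permutes_compose[OF h(1) k(1)]] by simp
  then have "\<kappa> \<circ> y \<circ> \<eta> \<in> N" using normal_conj'[OF N k(1) st(3)] normal_id[OF N] by simp
  moreover have "bar n q \<sigma> = bar n q (\<kappa> \<circ> y \<circ> \<eta>)"
    using st(7) h k bar_mult[OF q h(1) py] bar_mult[OF q permutes_compose[OF h(1) py] k(1)] by (simp add: comp_assoc)
  then have "\<sigma> = \<kappa> \<circ> y \<circ> \<eta>"
    using bar_inj[OF q \<sigma>] permutes_compose[OF permutes_compose[OF h(1) py] k(1)] by (simp add: comp_assoc)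
  ultimately show "\<sigma> \<in> N" by simp
next
  assume "\<sigma> \<in> N"
  then have "(bar n q id \<bullet> bar n q id, bar n q id \<bullet> bar n q \<sigma> \<bullet> bar n q id) \<in> rel_nu q N"
    using bar_facts[OF q permutes_id] by (intro rel_nuI) auto
  then show "(bar n q id, bar n q \<sigma>) \<in> rel_nu q N"
    using bar_mult[OF q permutes_id permutes_id] bar_mult[OF q permutes_id \<sigma>] bar_mult[OF q \<sigma> permutes_id] by simp
qed

text \<open>As the upper patterns stay equal, multiplication by \<open>u\<close> lowers both ranks
  equally: a pair either stays in the relation or leaves this rank as a whole.\<close>

lemma rel_nu_left:
  assumes \<alpha>: "(\<alpha>, \<beta>) \<in> rel_nu q N" and u: "u \<in> B"
  shows "rank (u \<bullet> \<alpha>) = rank (u \<bullet> \<beta>)" "rank (u \<bullet> \<alpha>) = q \<Longrightarrow> (u \<bullet> \<alpha>, u \<bullet> \<beta>) \<in> rel_nu q N"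
    "up (u \<bullet> \<alpha>) = up (u \<bullet> \<beta>)"
proof -
  note H = rel_nu_H[OF \<alpha>]
  show 3: "up (u \<bullet> \<alpha>) = up (u \<bullet> \<beta>)" using up_left_cong[OF u H(1,2,5)] .
  show 1: "rank (u \<bullet> \<alpha>) = rank (u \<bullet> \<beta>)"
    using 3 rank_eq[OF mult_closed[OF u H(1)]] rank_eq[OF mult_closed[OF u H(2)]] by simp
  obtain s t x y where st: "s \<in> B" "t \<in> B" "x \<in> N" "y \<in> N" "\<alpha> = s \<bullet> bar n q x \<bullet> t" "\<beta> = s \<bullet> bar n q y \<bullet> t"
    using \<alpha> unfolding rel_nu_iff by blast
  have b: "bar n q x \<in> B" "bar n q y \<in> B" using bar_facts(1)[OF q] normal_permutes[OF N] st by auto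
  have "u \<bullet> \<alpha> = u \<bullet> s \<bullet> bar n q x \<bullet> t" "u \<bullet> \<beta> = u \<bullet> s \<bullet> bar n q y \<bullet> t"
    using st u b by (simp_all add: mult_assoc mult_closed)
  then show "(u \<bullet> \<alpha>, u \<bullet> \<beta>) \<in> rel_nu q N" if "rank (u \<bullet> \<alpha>) = q"
    unfolding rel_nu_iff using that 1 st u mult_closed by metis
qed

lemma rel_nu_star: "(star \<alpha>, star \<beta>) \<in> rel_nu q N" if \<alpha>: "(\<alpha>, \<beta>) \<in> rel_nu q N"
proof -
  obtain s t y where st: "s \<in> B" "t \<in> B" "y \<in> N" "low s = std q" "up t = std q" "\<alpha> = s \<bullet> t" "\<beta> = s \<bullet> bar n q y \<bullet> t"
    using rel_nuE[OF \<alpha>] by blast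
  note py = normal_permutes[OF N st(3)]
  note b = bar_facts(1)[OF q py]
  have "star \<alpha> = star t \<bullet> star s" using star_mult st by simp
  moreover have "star \<beta> = star t \<bullet> bar n q (inv' y) \<bullet> star s"
    using star_mult[of "s \<bullet> bar n q y" t] star_mult[of s "bar n q y"] star_bar[OF q py] st b
    by (simp add: mult_closed mult_assoc bar_facts(1)[OF q permutes_inv[OF py]])
  ultimately show ?thesis using rel_nuI[of "star t" "star s" "inv' y"] st normal_inv[OF N] by simp
qed

end

end

lemma parity_gap: "k + 2 \<le> m" if "k < m" "k mod 2 = m mod 2" for k m :: nat
proof -
  have "k + 1 \<noteq> m" using that(2) by presburger
  then show ?thesis using that(1) by simp
qed

context brauer_monoid
begin

section \<open>A parametrised family of congruences\<close>

text \<open>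
  The retraction of an element of rank at most 2 onto the minimal ideal has the patterns \<open>uh \<alpha>\<close> and
  \<open>lh \<alpha>\<close>. All congruences of the list have the form \<open>family cu cl r N\<close>: the flags say whether the
  restriction to \<open>I\<^sub>r\<close> respects upper (lower) patterns, so that \<open>R\<close>, \<open>\<lambda>\<close>, \<open>\<rho>\<close>, \<open>\<mu>\<close> have no flag, only
  \<open>cl\<close>, only \<open>cu\<close>, and both flags.
\<close>

definition uh :: "diagram \<Rightarrow> nat set set" where
  "uh \<alpha> = up \<alpha> \<union> (if card (rest (up \<alpha>)) = 2 then {rest (up \<alpha>)} else {})"

definition lh :: "diagram \<Rightarrow> nat set set" where "lh \<alpha> = uh (star \<alpha>)"

definition kappa :: "bool \<Rightarrow> bool \<Rightarrow> nat \<Rightarrow> (diagram \<times> diagram) set" where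
  "kappa cu cl r = {(x, y) \<in> B \<times> B. rank x \<le> r \<and> rank y \<le> r \<and> (cu \<longrightarrow> uh x = uh y) \<and> (cl \<longrightarrow> lh x = lh y)}"

definition family :: "bool \<Rightarrow> bool \<Rightarrow> nat \<Rightarrow> (nat \<Rightarrow> nat) set \<Rightarrow> (diagram \<times> diagram) set" where
  "family cu cl r N = Id_on B \<union> rel_nu (r + 2) N \<union> kappa cu cl r"

text \<open>The condition \<open>|xN| = |Nx| = 1\<close> of a retractable pair. The comparison is
  with \<open>bar n q id\<close> because this idempotent need not fix \<open>m\<close>.\<close>

definition acts_trivially :: "nat \<Rightarrow> (nat \<Rightarrow> nat) set \<Rightarrow> bool" where
  "acts_trivially q N \<longleftrightarrow> (\<forall>m \<in> B. rank m = n mod 2 \<longrightarrow> (\<forall>\<sigma> \<in> N.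
     m \<bullet> bar n q \<sigma> = m \<bullet> bar n q id \<and> bar n q \<sigma> \<bullet> m = bar n q id \<bullet> m))"

text \<open>\<open>r = n\<close> leaves no rank above, so \<open>N\<close> is pinned to the trivial
  group to keep the parameters unique. A flag requires a retraction of the ideal, hence
  \<open>r \<le> 2\<close>, and a group acting trivially on the minimal ideal.\<close>

definition valid :: "bool \<Rightarrow> bool \<Rightarrow> nat \<Rightarrow> (nat \<Rightarrow> nat) set \<Rightarrow> bool" where
  "valid cu cl r N \<longleftrightarrow> r \<le> n \<and> r mod 2 = n mod 2 \<and> (if r = n then N = {id} else N \<lhd> sym_group (r + 2)) \<and>
     (cu \<or> cl \<longrightarrow> r \<le> 2 \<and> r < n \<and> acts_trivially (r + 2) N)"

lemma rel_nu_mono: "rel_nu q N \<subseteq> rel_nu q N'" if "N \<subseteq> N'"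
proof -
  have sub: "bar n q ` N \<subseteq> bar n q ` N'" using that by blast
  note J = Image_mono[OF order_refl[of "greenJ (brauer n)"] sub]
  show ?thesis
  proof
    fix p assume p: "p \<in> rel_nu q N"
    then obtain s t x y where st: "p = (s \<bullet> x \<bullet> t, s \<bullet> y \<bullet> t)" "s \<in> B" "t \<in> B" "x \<in> bar n q ` N" "y \<in> bar n q ` N"
      unfolding rel_nu_def nu_def by blast
    have "x \<in> bar n q ` N'" "y \<in> bar n q ` N'" using st sub by auto
    moreover have "p \<in> greenJ (brauer n) `` (bar n q ` N') \<times> greenJ (brauer n) `` (bar n q ` N')"
      using p Sigma_mono[OF J J] unfolding rel_nu_def nu_def by blast
    ultimately show "p \<in> rel_nu q N'"
      unfolding rel_nu_def nu_def using st(1-3) by (intro IntI CollectI exI conjI) assumption+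
  qed
qed

lemma uh_facts:
  assumes \<alpha>: "\<alpha> \<in> B" and r: "rank \<alpha> \<le> 2"
  shows "pattern (uh \<alpha>)" "up \<alpha> \<subseteq> uh \<alpha>" "card (rest (uh \<alpha>)) \<le> 1"
proof -
  have c: "card (rest (up \<alpha>)) \<le> 2" using r rank_eq[OF \<alpha>] by simp
  show "up \<alpha> \<subseteq> uh \<alpha>" by (auto simp: uh_def)
  have "pattern (uh \<alpha>) \<and> card (rest (uh \<alpha>)) \<le> 1"
  proof (cases "card (rest (up \<alpha>)) = 2")
    case True
    then obtain a b where ab: "rest (up \<alpha>) = {a, b}" "a \<noteq> b" by (auto simp: card_2_iff)
    have u: "uh \<alpha> = insert {a, b} (up \<alpha>)" using True ab by (simp add: uh_def)
    have "a \<in> rest (up \<alpha>)" "b \<in> rest (up \<alpha>)" using ab by auto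
    note pattern_insert[OF pattern_up[OF \<alpha>] this ab(2)]
    then show ?thesis using ab by (simp add: u)
  next
    case False
    then show ?thesis using c pattern_up[OF \<alpha>] by (auto simp: uh_def)
  qed
  then show "pattern (uh \<alpha>)" "card (rest (uh \<alpha>)) \<le> 1" by auto
qed

text \<open>At most two points are free, so a pattern that extends \<open>up \<alpha>\<close> and
  leaves at most one point free is forced. The later facts on \<open>uh\<close> follow from this
  uniqueness.\<close>

lemma uh_unique:
  assumes \<alpha>: "\<alpha> \<in> B" and r: "rank \<alpha> \<le> 2" and G: "pattern G" "up \<alpha> \<subseteq> G" "card (rest G) \<le> 1"
  shows "uh \<alpha> = G"
proof (cases "card (rest (up \<alpha>)) = 2")
  case True
  then have "up \<alpha> \<subset> G" using G by auto
  from pattern_new_block[OF G(1) this] obtain i j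
    where ij: "{i, j} \<in> G" "i \<in> rest (up \<alpha>)" "j \<in> rest (up \<alpha>)" "i \<noteq> j" by blast
  have "rest (up \<alpha>) = {i, j}" using card_subset_eq[of "rest (up \<alpha>)" "{i, j}"] ij True by simp
  then have "uh \<alpha> \<subseteq> G" using True ij G by (auto simp: uh_def)
  then show ?thesis using pattern_maximal[OF G(1) _ uh_facts(3)[OF \<alpha> r]] by simp
next
  case False
  have c: "card (rest (up \<alpha>)) \<le> 1" using r rank_eq[OF \<alpha>] False by simp
  then show ?thesis using pattern_maximal[OF G(1,2) c] False by (simp add: uh_def)
qed

lemma uh_minimal: "uh \<alpha> = up \<alpha>" if "\<alpha> \<in> B" "rank \<alpha> = n mod 2"
proof -
  have "card (rest (up \<alpha>)) \<noteq> 2" using rank_eq[OF that(1)] that by simp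
  then show ?thesis by (simp add: uh_def)
qed

lemma lh_minimal: "lh \<alpha> = low \<alpha>" if "\<alpha> \<in> B" "rank \<alpha> = n mod 2"
  using uh_minimal[of "star \<alpha>"] that by (simp add: lh_def)

text \<open>Right multiplication only enlarges the upper pattern, so the completion for the product
  is also one for \<open>up \<alpha>\<close>.\<close>

lemma uh_mult: "uh (\<alpha> \<bullet> s) = uh \<alpha>" if \<alpha>: "\<alpha> \<in> B" "rank \<alpha> \<le> 2" and s: "s \<in> B"
proof -
  note c = mult_closed[OF \<alpha>(1) s]
  have r: "rank (\<alpha> \<bullet> s) \<le> 2" using rank_mult_left[OF \<alpha>(1) s] \<alpha> by simp
  have "up \<alpha> \<subseteq> uh (\<alpha> \<bullet> s)" using mult_upper[OF \<alpha>(1) s] uh_facts(2)[OF c r] by blast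
  then show ?thesis using uh_unique[OF \<alpha> uh_facts(1)[OF c r] _ uh_facts(3)[OF c r]] by simp
qed

lemma lh_mult: "lh (s \<bullet> \<alpha>) = lh \<alpha>" if \<alpha>: "\<alpha> \<in> B" "rank \<alpha> \<le> 2" and s: "s \<in> B"
  using uh_mult[of "star \<alpha>" "star s"] that star_mult[OF s \<alpha>(1)] by (simp add: lh_def)

text \<open>Expresses the completed pattern by a product with an arbitrary minimal element, a form
  to which congruences apply.\<close>

lemma uh_up_mult: "uh \<alpha> = up (\<alpha> \<bullet> m)" if \<alpha>: "\<alpha> \<in> B" "rank \<alpha> \<le> 2" and m: "m \<in> B" "rank m = n mod 2"
  using uh_mult[OF \<alpha> m(1)] uh_minimal[OF mult_closed[OF \<alpha>(1) m(1)]] min_mult_right[OF \<alpha>(1) m] by simp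

lemma lh_low_mult: "lh \<alpha> = low (m \<bullet> \<alpha>)" if \<alpha>: "\<alpha> \<in> B" "rank \<alpha> \<le> 2" and m: "m \<in> B" "rank m = n mod 2"
  using lh_mult[OF \<alpha> m(1)] lh_minimal[OF mult_closed[OF m(1) \<alpha>(1)]] min_mult_left[OF m(1) \<alpha>(1) m(2)] by simp

lemma ex_minimal: "\<exists>m \<in> B. rank m = n mod 2"
  using ex_rank[of "n mod 2"] by (metis mod_less_eq_dividend mod_mod_trivial)

text \<open>\<open>x\<close> and \<open>y\<close> become equal after right multiplication by a
  minimal \<open>m\<close>, and this persists under left multiplication.\<close>

lemma uh_left_cong:
  assumes x: "x \<in> B" "rank x \<le> 2" and y: "y \<in> B" "rank y \<le> 2" and s: "s \<in> B" and eq: "uh x = uh y"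
  shows "uh (s \<bullet> x) = uh (s \<bullet> y)"
proof -
  obtain m where m: "m \<in> B" "rank m = n mod 2" using ex_minimal by blast
  have "x \<bullet> m = y \<bullet> m"
    using min_mult_right[OF x(1) m] min_mult_right[OF y(1) m] uh_up_mult[OF x m] uh_up_mult[OF y m] eq
      mult_closed x y m by (intro min_eqI) auto
  moreover have "uh (s \<bullet> x) = up (s \<bullet> x \<bullet> m)" "uh (s \<bullet> y) = up (s \<bullet> y \<bullet> m)"
    using uh_up_mult[OF mult_closed[OF s x(1)] _ m] uh_up_mult[OF mult_closed[OF s y(1)] _ m]
      rank_mult_right[OF s x(1)] rank_mult_right[OF s y(1)] x y by auto
  ultimately show ?thesis using mult_assoc[OF s x(1) m(1)] mult_assoc[OF s y(1) m(1)] by simp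
qed

lemma kappa_star: "(star x, star y) \<in> kappa cl cu r \<longleftrightarrow> (x, y) \<in> kappa cu cl r" if "x \<in> B" "y \<in> B"
  using that by (auto simp: kappa_def lh_def)

section \<open>Members of the family are congruences\<close>

context
  fixes cu cl r N assumes v: "valid cu cl r N"
begin

lemma valid_parity: "r \<le> n" "r mod 2 = n mod 2" "n mod 2 \<le> r"
proof -
  show p: "r \<le> n" "r mod 2 = n mod 2" using v by (auto simp: valid_def)
  then show "n mod 2 \<le> r" by (metis mod_less_eq_dividend)
qed

lemma valid_normal: "N \<lhd> sym_group (r + 2)" "r + 2 \<le> n" "(r + 2) mod 2 = n mod 2" if "r \<noteq> n"
proof -
  show "N \<lhd> sym_group (r + 2)" using v that by (simp add: valid_def)
  show "(r + 2) mod 2 = n mod 2" using valid_parity(2) by simp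
  show "r + 2 \<le> n" using parity_gap[of r n] valid_parity(1,2) that by simp
qed

lemma rel_nu_empty: "rel_nu (r + 2) N = {}" if "r = n"
  using v that rel_nu_out[of "r + 2"] by (simp add: valid_def)

lemma rel_nu_valid:
  assumes "(a, b) \<in> rel_nu (r + 2) N"
  shows "r \<noteq> n" "a \<in> B" "b \<in> B" "rank a = r + 2" "rank b = r + 2" "up a = up b" "low a = low b"
proof -
  show "r \<noteq> n" using assms rel_nu_empty by auto
  note q = valid_normal(2,3,1)[OF this]
  show "a \<in> B" "b \<in> B" "rank a = r + 2" "rank b = r + 2" "up a = up b" "low a = low b"
    using rel_nu_H[OF q assms] by auto
qed

lemma family_cases:
  assumes "(a, b) \<in> family cu cl r N"
  obtains "a \<in> B" "a = b" | "(a, b) \<in> rel_nu (r + 2) N" | "(a, b) \<in> kappa cu cl r"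
  using assms unfolding family_def by blast

lemma family_closed: "a \<in> B" "b \<in> B" if "(a, b) \<in> family cu cl r N"
proof -
  have "a \<in> B \<and> b \<in> B"
    using that by (cases rule: family_cases) (use rel_nu_valid in \<open>auto simp: kappa_def\<close>)
  then show "a \<in> B" "b \<in> B" by auto
qed

lemma valid_swap: "valid cl cu r N"
  using v unfolding valid_def by (auto split: if_splits)

lemma family_star: "(star a, star b) \<in> family cl cu r N" if "(a, b) \<in> family cu cl r N"
  using that
proof (cases rule: family_cases)
  case 1
  then show ?thesis by (auto simp: family_def)
next
  case 2
  have "r \<noteq> n" using rel_nu_valid(1)[OF 2] .
  then show ?thesis using rel_nu_star[OF valid_normal(2,3,1) 2] by (auto simp: family_def)
next
  case 3
  then show ?thesis using kappa_star[of a b cl cu r] by (auto simp: family_def kappa_def)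
qed

text \<open>The delicate case is a pair of \<open>rel_nu (r + 2) N\<close> whose rank drops, for it
  lands in \<open>kappa\<close>. Its upper patterns agree by \<open>up_left_cong\<close>; if
  \<open>cl\<close> holds, the completed lower ones agree because \<open>N\<close> acts trivially on
  the minimal ideal.\<close>

lemma family_left: "(u \<bullet> a, u \<bullet> b) \<in> family cu cl r N" if ab: "(a, b) \<in> family cu cl r N" and u: "u \<in> B"
  using ab
proof (cases rule: family_cases)
  case 1
  then show ?thesis using u mult_closed by (auto simp: family_def)
next
  case 2
  note H = rel_nu_valid[OF 2]
  note q = valid_normal(2,3,1)[OF H(1)]
  note L = rel_nu_left[OF q 2 u]
  show ?thesis
  proof (cases "rank (u \<bullet> a) = r + 2")
    case True
    then show ?thesis using L(2) by (simp add: family_def)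
  next
    case False
    have c: "u \<bullet> a \<in> B" "u \<bullet> b \<in> B" using u H mult_closed by auto
    have "rank (u \<bullet> a) < r + 2" using rank_mult_right[OF u H(2)] H(4) False by simp
    then have "rank (u \<bullet> a) \<le> r" using parity_gap[of "rank (u \<bullet> a)" "r + 2"] rank_mod[OF c(1)] q(2) by simp
    then have le: "rank (u \<bullet> a) \<le> r" "rank (u \<bullet> b) \<le> r" using L(1) by simp_all
    have "lh (u \<bullet> a) = lh (u \<bullet> b)" if cl
    proof -
      have v': "r \<le> 2" "acts_trivially (r + 2) N" using v \<open>cl\<close> by (auto simp: valid_def)
      obtain s t y where st: "s \<in> B" "t \<in> B" "y \<in> N" "low s = std (r + 2)" "a = s \<bullet> t" "b = s \<bullet> bar n (r + 2) y \<bullet> t"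
        using rel_nuE[OF q 2] by blast
      have y: "bar n (r + 2) y \<in> B" using bar_facts(1)[OF q(1,2)] normal_permutes[OF q(3) st(3)] by simp
      obtain m where m: "m \<in> B" "rank m = n mod 2" using ex_minimal by blast
      \<comment> \<open>A minimal left factor keeps every product minimal, so
        \<open>m \<bullet> u \<bullet> s\<close> is an element on which \<open>N\<close> acts
        trivially.\<close>
      have mus: "m \<bullet> u \<bullet> s \<in> B" "rank (m \<bullet> u \<bullet> s) = n mod 2"
        using min_mult_left[OF m(1) u m(2)] min_mult_left[OF _ st(1), of "m \<bullet> u"] mult_closed m u st by auto
      have "m \<bullet> u \<bullet> s \<bullet> bar n (r + 2) y = m \<bullet> u \<bullet> s \<bullet> bar n (r + 2) id"
        using v'(2) mus st(3) by (simp add: acts_trivially_def)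
      also have "\<dots> = m \<bullet> u \<bullet> (s \<bullet> bar n (r + 2) id)"
        using m u st bar_facts(1)[OF q(1,2) permutes_id] by (simp add: mult_assoc mult_closed)
      also have "\<dots> = m \<bullet> u \<bullet> s" using mult_bar_id[OF q(1,2) st(1,4)] by simp
      finally have "m \<bullet> u \<bullet> s \<bullet> bar n (r + 2) y \<bullet> t = m \<bullet> u \<bullet> s \<bullet> t" by simp
      then have "m \<bullet> (u \<bullet> b) = m \<bullet> (u \<bullet> a)"
        using m u st y by (simp add: mult_assoc mult_closed)
      then show ?thesis using lh_low_mult[OF c(1) _ m] lh_low_mult[OF c(2) _ m] le v'(1) by simp
    qed
    moreover have "uh (u \<bullet> a) = uh (u \<bullet> b)" using L(3) by (simp add: uh_def)
    ultimately show ?thesis using c le by (simp add: family_def kappa_def)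
  qed
next
  case 3
  then have ab: "a \<in> B" "b \<in> B" "rank a \<le> r" "rank b \<le> r" and f: "cu \<Longrightarrow> uh a = uh b" "cl \<Longrightarrow> lh a = lh b"
    by (auto simp: kappa_def)
  have r2: "r \<le> 2" if "cu \<or> cl" using v that by (auto simp: valid_def)
  have "uh (u \<bullet> a) = uh (u \<bullet> b)" if cu using uh_left_cong[OF ab(1) _ ab(2) _ u f(1)] r2 that ab by simp
  moreover have "lh (u \<bullet> a) = lh (u \<bullet> b)" if cl
    using lh_mult[OF ab(1) _ u] lh_mult[OF ab(2) _ u] f(2) r2 that ab by simp
  ultimately show ?thesis
    using rank_mult_right[OF u ab(1)] rank_mult_right[OF u ab(2)] ab u mult_closed
    by (simp add: family_def kappa_def)
qed

lemma family_sym: "(b, a) \<in> family cu cl r N" if "(a, b) \<in> family cu cl r N"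
  using that
proof (cases rule: family_cases)
  case 2
  then show ?thesis
    using rel_nu_sym[OF valid_normal(2,3,1)[OF rel_nu_valid(1)[OF 2]] 2] by (simp add: family_def)
qed (auto simp: family_def kappa_def)

lemma family_trans:
  assumes ab: "(a, b) \<in> family cu cl r N" and bc: "(b, c) \<in> family cu cl r N"
  shows "(a, c) \<in> family cu cl r N"
  using ab
proof (cases rule: family_cases)
  case 1
  then show ?thesis using bc by simp
next
  case 2
  note nu = 2
  show ?thesis using bc
  proof (cases rule: family_cases)
    case 1
    then show ?thesis using ab by simp
  next
    case 2
    then show ?thesis
      using rel_nu_trans[OF valid_normal(2,3,1)[OF rel_nu_valid(1)[OF nu]] nu 2] by (simp add: family_def)
  next
    case 3
    then show ?thesis using rel_nu_valid[OF nu] by (simp add: kappa_def)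
  qed
next
  case 3
  note ka = 3
  show ?thesis using bc
  proof (cases rule: family_cases)
    case 1
    then show ?thesis using ab by simp
  next
    case 2
    then show ?thesis using rel_nu_valid[OF 2] ka by (simp add: kappa_def)
  next
    case 3
    then show ?thesis using ka by (auto simp: family_def kappa_def)
  qed
qed

end

lemma star_rel_family: "star_rel (family cu cl r N) = family cl cu r N" if v: "valid cu cl r N"
proof -
  have "(a, b) \<in> star_rel (family cu cl r N) \<longleftrightarrow> (a, b) \<in> family cl cu r N" for a b
    using family_star[OF v, of "star a" "star b"] family_star[OF valid_swap[OF v], of a b]
    by (auto simp: star_rel_iff)
  then show ?thesis by auto
qed

text \<open>Right compatibility is left compatibility of the member with swapped flags, read through
  \<open>star\<close>.\<close>

lemma family_Cong: "family cu cl r N \<in> Cong (brauer n)" if v: "valid cu cl r N"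
  unfolding Cong_iff
proof (intro conjI allI impI)
  show "equiv B (family cu cl r N)"
  proof (rule equivI)
    show "family cu cl r N \<subseteq> B \<times> B"
    proof (rule subrelI)
      fix a b assume "(a, b) \<in> family cu cl r N"
      then show "(a, b) \<in> B \<times> B" using family_closed[OF v, of a b] by simp
    qed
    show "refl_on B (family cu cl r N)" by (rule refl_onI) (simp add: family_def Id_on_iff)
    show "sym (family cu cl r N)" using family_sym[OF v] by (rule symI)
    show "trans (family cu cl r N)" using family_trans[OF v] by (rule transI)
  qed
  fix a b s assume ab: "(a, b) \<in> family cu cl r N" and s: "s \<in> B"
  show "(s \<bullet> a, s \<bullet> b) \<in> family cu cl r N" using family_left[OF v ab s] .
  have B: "a \<in> B" "b \<in> B" using family_closed[OF v ab] by auto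
  have "(star (star s \<bullet> star a), star (star s \<bullet> star b)) \<in> family cu cl r N"
    using family_star[OF valid_swap[OF v] family_left[OF valid_swap[OF v] family_star[OF v ab] star_closed[OF s]]] .
  then show "(a \<bullet> s, b \<bullet> s) \<in> family cu cl r N" using star_mult[of "star s"] B s by simp
qed

section \<open>Comparing members of the family\<close>

lemma ex_low_neq: "\<exists>x \<in> B. \<exists>y \<in> B. rank x = n mod 2 \<and> rank y = n mod 2 \<and> up x = up y \<and> low x \<noteq> low y"
  if "n \<ge> 3"
proof -
  \<comment> \<open>\<open>n \<ge> 3\<close> provides two pairs that share the point 1, so patterns
    completing them must differ.\<close>
  have ext: "\<exists>D. pattern D \<and> {{1, j}} \<subseteq> D \<and> card D = n div 2" if "j \<in> {2, 3}" for j
  proof -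
    have j: "1 \<in> {1..n}" "j \<in> {1..n}" "1 \<noteq> j" using that \<open>n \<ge> 3\<close> by auto
    note p = pattern_pair[OF j]
    have "card (rest {{1, j}}) = n - 2" using card_rest[OF p(1)] by simp
    moreover have "2 * (n div 2 - 1) \<le> n - 2" "1 + (n div 2 - 1) = n div 2" using \<open>n \<ge> 3\<close> by presburger+
    ultimately show ?thesis using ex_pattern_extend[OF p(1) subset_refl, of "n div 2 - 1"] by auto
  qed
  obtain D where D: "pattern D" "{1, 2} \<in> D" "card D = n div 2" using ext[of 2] by auto
  obtain E where E: "pattern E" "{1, 3} \<in> E" "card E = n div 2" using ext[of 3] by auto
  have ne: "D \<noteq> E" using pattern_unique[OF D(1,2), of 3] E by auto
  obtain x where x: "x \<in> B" "up x = D" "low x = D" using ex_diagram[OF D(1) D(1)] by auto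
  obtain y where y: "y \<in> B" "up y = D" "low y = E" using ex_diagram[OF D(1) E(1)] D E by auto
  have "rank x = n mod 2" "rank y = n mod 2"
    using rank_up[OF x(1)] rank_up[OF y(1)] x y D by (simp_all add: minus_mult_div_eq_mod[symmetric])
  then show ?thesis using x y ne by blast
qed

lemma family_le_low:
  assumes n3: "n \<ge> 3" and v: "valid cu cl r N" and v': "valid cu' cl' r' N'"
    and le: "family cu cl r N \<subseteq> family cu' cl' r' N'" and cl': cl'
  shows cl
proof (rule ccontr)
  assume "\<not> cl"
  obtain x y where xy: "x \<in> B" "y \<in> B" "rank x = n mod 2" "rank y = n mod 2" "up x = up y" "low x \<noteq> low y"
    using ex_low_neq[OF n3] by blast
  have "uh x = uh y" using uh_minimal xy by metis
  then have "(x, y) \<in> kappa cu cl r" using xy \<open>\<not> cl\<close> valid_parity(3)[OF v] by (simp add: kappa_def)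
  then have "(x, y) \<in> family cu' cl' r' N'" using le by (auto simp: family_def)
  then show False
  proof (cases rule: family_cases[OF v', consumes 1])
    case 1
    then show ?thesis using xy by simp
  next
    case 2
    then show ?thesis using rel_nu_valid(4)[OF v' 2] xy by (metis add_cancel_right_right le_add2 le_antisym mod_less_divisor not_less zero_less_numeral)
  next
    case 3
    then show ?thesis using cl' xy lh_minimal by (auto simp: kappa_def)
  qed
qed

text \<open>Left to right, each parameter is recovered from the relation: the flags by minimal
  elements differing in one pattern, \<open>r\<close> by relating an element of rank
  \<open>r\<close> to the minimal ideal, and \<open>N\<close> by \<open>rel_nu_bar_iff\<close>.
  Right to left, \<open>r < r'\<close> suffices whatever \<open>N\<close> is, because rank
  \<open>r + 2\<close> then lies within \<open>r'\<close> and \<open>rel_nu\<close> keeps both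
  patterns.\<close>

lemma family_le_iff:
  assumes n3: "n \<ge> 3" and v: "valid cu cl r N" and v': "valid cu' cl' r' N'"
  shows "family cu cl r N \<subseteq> family cu' cl' r' N' \<longleftrightarrow>
    (cu' \<longrightarrow> cu) \<and> (cl' \<longrightarrow> cl) \<and> (r < r' \<or> r = r' \<and> N \<subseteq> N')"
proof
  assume le: "family cu cl r N \<subseteq> family cu' cl' r' N'"
  have "star_rel (family cu cl r N) \<subseteq> star_rel (family cu' cl' r' N')" using le by (auto simp: star_rel_def)
  then have le': "family cl cu r N \<subseteq> family cl' cu' r' N'" using star_rel_family v v' by simp
  have flags: "cl' \<longrightarrow> cl" "cu' \<longrightarrow> cu"
    using family_le_low[OF n3 v v' le] family_le_low[OF n3 valid_swap[OF v] valid_swap[OF v'] le'] by auto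
  have rr: "r \<le> r'"
  proof (rule ccontr)
    assume "\<not> r \<le> r'"
    then have r: "r > r'" by simp
    obtain \<alpha> where \<alpha>: "\<alpha> \<in> B" "rank \<alpha> = r" using ex_rank valid_parity[OF v] by blast
    \<comment> \<open>\<open>x\<close> is the retraction of \<open>\<alpha>\<close> when a flag is
      set; without flags every minimal element is related to \<open>\<alpha>\<close>.\<close>
    have "\<exists>x \<in> B. rank x = n mod 2 \<and> (cu \<or> cl \<longrightarrow> uh \<alpha> = up x \<and> lh \<alpha> = low x)"
    proof (cases "cu \<or> cl")
      case True
      then have r2: "rank \<alpha> \<le> 2" "rank (star \<alpha>) \<le> 2" using v \<alpha> by (auto simp: valid_def)
      note u = uh_facts[OF \<alpha>(1) r2(1)] and l = uh_facts[OF star_closed[OF \<alpha>(1)] r2(2), folded lh_def]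
      have "card (uh \<alpha>) = card (lh \<alpha>)" using card_rest[OF u(1)] card_rest[OF l(1)] u(3) l(3) by presburger
      then obtain x where x: "x \<in> B" "up x = uh \<alpha>" "low x = lh \<alpha>" using ex_diagram[OF u(1) l(1)] by blast
      have "rank x \<le> 1" using rank_eq[OF x(1)] x u by simp
      then have "rank x = n mod 2" using rank_mod[OF x(1)] by (cases "rank x") auto
      then show ?thesis using x by blast
    qed (use ex_minimal in blast)
    then obtain x where x: "x \<in> B" "rank x = n mod 2" "cu \<or> cl \<longrightarrow> uh \<alpha> = up x \<and> lh \<alpha> = low x" by blast
    then have "(\<alpha>, x) \<in> kappa cu cl r"
      using \<alpha> valid_parity(3)[OF v] uh_minimal[OF x(1,2)] lh_minimal[OF x(1,2)] by (auto simp: kappa_def)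
    then have "(\<alpha>, x) \<in> family cu' cl' r' N'" using le by (auto simp: family_def)
    moreover have "rank \<alpha> \<noteq> rank x" using \<alpha> x r valid_parity(3)[OF v'] by simp
    ultimately have "(\<alpha>, x) \<in> kappa cu' cl' r'"
      using rel_nu_valid[OF v', of \<alpha> x] by (auto simp: family_def)
    then show False using r \<alpha> by (simp add: kappa_def)
  qed
  have "N \<subseteq> N'" if "r = r'"
  proof (cases "r = n")
    case True
    then show ?thesis using v v' that by (simp add: valid_def)
  next
    case False
    note q = valid_normal(2,3,1)[OF v False] and q' = valid_normal(2,3,1)[OF v' False[unfolded that]]
    show ?thesis
    proof
      fix \<sigma> assume \<sigma>: "\<sigma> \<in> N"
      note p = normal_permutes[OF q(3) \<sigma>]
      have "(bar n (r + 2) id, bar n (r + 2) \<sigma>) \<in> rel_nu (r + 2) N"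
        using rel_nu_bar_iff[OF q p] \<sigma> by simp
      then have "(bar n (r + 2) id, bar n (r + 2) \<sigma>) \<in> family cu' cl' r' N'" using le by (auto simp: family_def)
      then show "\<sigma> \<in> N'"
      proof (cases rule: family_cases[OF v', consumes 1])
        case 1
        then have "id = \<sigma>" by (intro bar_inj[OF q(1,2) permutes_id p])
        then show ?thesis using normal_id[OF q'(3)] by simp
      next
        case 2
        then show ?thesis using rel_nu_bar_iff[OF q'] p that by simp
      next
        case 3
        then show ?thesis using bar_facts(4)[OF q(1,2) permutes_id] that by (simp add: kappa_def)
      qed
    qed
  qed
  then show "(cu' \<longrightarrow> cu) \<and> (cl' \<longrightarrow> cl) \<and> (r < r' \<or> r = r' \<and> N \<subseteq> N')" using flags rr by auto
next
  assume h: "(cu' \<longrightarrow> cu) \<and> (cl' \<longrightarrow> cl) \<and> (r < r' \<or> r = r' \<and> N \<subseteq> N')"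
  show "family cu cl r N \<subseteq> family cu' cl' r' N'"
  proof (rule subrelI)
    fix a b assume "(a, b) \<in> family cu cl r N"
    then show "(a, b) \<in> family cu' cl' r' N'"
    proof (cases rule: family_cases[OF v, consumes 1])
      case 1
      then show ?thesis by (auto simp: family_def)
    next
      case 2
      note H = rel_nu_valid[OF v 2]
      show ?thesis
      proof (cases "r = r'")
        case True
        then have "N \<subseteq> N'" "r' \<noteq> n" using h H(1) by auto
        then have "(a, b) \<in> rel_nu (r' + 2) N'"
          using 2 True rel_nu_mono[OF \<open>N \<subseteq> N'\<close>, of "r + 2"] by auto
        then show ?thesis by (simp add: family_def)
      next
        case False
        then have "r < r'" using h by blast
        then have "r + 2 \<le> r'"
          using parity_gap[of r r'] valid_parity(2)[OF v] valid_parity(2)[OF v'] by simp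
        moreover have "uh a = uh b" "lh a = lh b" using H by (auto simp: uh_def lh_def)
        ultimately show ?thesis using H by (simp add: family_def kappa_def)
      qed
    next
      case 3
      then show ?thesis using h by (auto simp: family_def kappa_def)
    qed
  qed
qed

lemma family_eq_iff:
  assumes "n \<ge> 3" "valid cu cl r N" "valid cu' cl' r' N'"
  shows "family cu cl r N = family cu' cl' r' N' \<longleftrightarrow> cu = cu' \<and> cl = cl' \<and> r = r' \<and> N = N'"
proof -
  have "family cu cl r N = family cu' cl' r' N' \<longleftrightarrow>
      family cu cl r N \<subseteq> family cu' cl' r' N' \<and> family cu' cl' r' N' \<subseteq> family cu cl r N"
    by (rule set_eq_subset)
  then show ?thesis unfolding family_le_iff[OF assms] family_le_iff[OF assms(1,3,2)] by auto
qed

section \<open>Every congruence belongs to the family\<close>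

lemma rank_hook_ge: "rank \<alpha> \<le> rank (hook i j \<bullet> \<alpha>) + 2"
  if \<alpha>: "\<alpha> \<in> B" and r: "i \<in> rest (up \<alpha>)" "j \<in> rest (up \<alpha>)" and ne: "i \<noteq> j"
proof -
  have ij: "i \<in> {1..n}" "j \<in> {1..n}" using r by (auto simp: rest_def)
  let ?\<beta> = "hook i j \<bullet> \<alpha>"
  have \<beta>: "?\<beta> \<in> B" using ij ne \<alpha> mult_closed by simp
  have "v \<in> rest (low ?\<beta>)" if v: "v \<in> rest (low \<alpha>) - {through \<alpha> i, through \<alpha> j}" for v
  proof -
    obtain a where a: "{Upper a, Lower v} \<in> \<alpha>" using v rest_low[OF \<alpha>] by blast
    then have "a \<noteq> i" "a \<noteq> j" using v through_eq[OF \<alpha> a] by auto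
    then have "{Upper a, Lower v} \<in> ?\<beta>" using hook_old[OF ij ne \<alpha> a] by simp
    then show ?thesis using rest_low[OF \<beta>] by blast
  qed
  then have "card (rest (low \<alpha>) - {through \<alpha> i, through \<alpha> j}) \<le> card (rest (low ?\<beta>))"
    by (intro card_mono) auto
  moreover have "card (rest (low \<alpha>)) \<le> card (rest (low \<alpha>) - {through \<alpha> i, through \<alpha> j}) + card {through \<alpha> i, through \<alpha> j}"
    using diff_card_le_card_Diff[of "{through \<alpha> i, through \<alpha> j}" "rest (low \<alpha>)"] by simp
  moreover have "card {through \<alpha> i, through \<alpha> j} \<le> 2" by (simp add: card_insert_if)
  ultimately show ?thesis using rank_eq_low[OF \<alpha>] rank_eq_low[OF \<beta>] by simp
qed

lemma hook_low_join: "{through \<alpha> i, through \<alpha> j} \<in> low (hook i j \<bullet> \<alpha>)"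
  if \<alpha>: "\<alpha> \<in> B" and r: "i \<in> rest (up \<alpha>)" "j \<in> rest (up \<alpha>)" and ne: "i \<noteq> j"
proof -
  have ij: "i \<in> {1..n}" "j \<in> {1..n}" using r by (auto simp: rest_def)
  show ?thesis
    using hook_join[OF ij ne \<alpha> through_block[OF \<alpha> r(1)] through_block[OF \<alpha> r(2)]] by (simp add: low_block)
qed

text \<open>The transversals of the two elements differ at some \<open>i\<close>. Hooking
  \<open>i\<close> to a suitable \<open>j\<close> joins the images of \<open>i\<close> and
  \<open>j\<close> in the lower rows, and these two lower pairs are different. An element containing
  both would have lost four from the rank, but the hook takes away only two.\<close>

lemma hook_separates:
  assumes \<alpha>: "\<alpha> \<in> B" and \<beta>: "\<beta> \<in> B" and H: "up \<alpha> = up \<beta>" "low \<alpha> = low \<beta>" and ne: "\<alpha> \<noteq> \<beta>" and r: "rank \<alpha> \<ge> 3"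
  shows "\<exists>s \<in> B. rank (s \<bullet> \<alpha>) + 2 = rank \<alpha> \<and> rank (s \<bullet> \<beta>) + 2 = rank \<alpha> \<and> low (s \<bullet> \<alpha>) \<noteq> low (s \<bullet> \<beta>)"
proof -
  let ?f = "through \<alpha>" and ?g = "through \<beta>" and ?X = "rest (up \<alpha>)"
  have "\<exists>i \<in> ?X. ?f i \<noteq> ?g i"
  proof (rule ccontr)
    assume "\<not> ?thesis"
    then have "mk (up \<alpha>) (low \<alpha>) ?f = mk (up \<alpha>) (low \<alpha>) ?g" unfolding mk_def by (metis (no_types, lifting) image_cong)
    then show False using mk_through[OF \<alpha>] mk_through[OF \<beta>] H ne by simp
  qed
  then obtain i where i: "i \<in> ?X" "?f i \<noteq> ?g i" by blast
  have f: "bij_betw ?f ?X (rest (low \<alpha>))" and g: "bij_betw ?g ?X (rest (low \<alpha>))"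
    using through_bij[OF \<alpha>] through_bij[OF \<beta>] H by auto
  \<comment> \<open>\<open>i'\<close> is the point that \<open>\<beta>\<close> sends to the image of
    \<open>i\<close> under \<open>\<alpha>\<close>; avoiding it keeps that image out of the second
    lower pair. Rank 3 leaves a \<open>j\<close> different from \<open>i\<close> and
    \<open>i'\<close>.\<close>
  obtain i' where i': "i' \<in> ?X" "?g i' = ?f i" using f g i(1) by (metis bij_betw_def imageE imageI)
  have "card {i, i'} < card ?X" using r rank_eq[OF \<alpha>] card_insert_le_m1[of 2 "{i'}" i] by (simp add: card_insert_if)
  then have "\<not> ?X \<subseteq> {i, i'}" using card_mono[of "{i, i'}" ?X] by auto
  then obtain j where j: "j \<in> ?X" "j \<noteq> i" "j \<noteq> i'" by blast
  have "?g j \<noteq> ?f i" using g j i' by (metis bij_betw_def inj_on_def)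
  then have sep: "{?f i, ?f j} \<noteq> {?g i, ?g j}" using i by (auto simp: doubleton_eq_iff)
  have ij: "i \<in> {1..n}" "j \<in> {1..n}" "i \<noteq> j" using i j by (auto simp: rest_def)
  let ?h = "hook i j"
  have h: "?h \<in> B" using ij by simp
  have rk: "rank (?h \<bullet> \<gamma>) + 2 = rank \<alpha>" if "\<gamma> \<in> B" "up \<gamma> = up \<alpha>" for \<gamma>
  proof -
    have x: "i \<in> rest (up \<gamma>)" "j \<in> rest (up \<gamma>)" using i j that by auto
    have "rank \<gamma> = rank \<alpha>" using rank_eq[OF that(1)] rank_eq[OF \<alpha>] that by simp
    then show ?thesis
      using parity_gap[OF rank_hook_drop[OF that(1) x ij(3)]] rank_hook_ge[OF that(1) x ij(3)]
        rank_mod[OF that(1)] rank_mod[OF mult_closed[OF h that(1)]] by simp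
  qed
  have "low (?h \<bullet> \<alpha>) \<noteq> low (?h \<bullet> \<beta>)"
  proof
    assume eq: "low (?h \<bullet> \<alpha>) = low (?h \<bullet> \<beta>)"
    have "i \<in> rest (up \<beta>)" "j \<in> rest (up \<beta>)" using i j H by auto
    then have in_low: "{?f i, ?f j} \<in> low (?h \<bullet> \<alpha>)" "{?g i, ?g j} \<in> low (?h \<bullet> \<alpha>)"
      using hook_low_join[OF \<alpha> i(1) j(1)] hook_low_join[OF \<beta>] ij(3) eq by auto
    have "?f i \<in> rest (low \<alpha>)" "?g i \<in> rest (low \<alpha>)" using f g i by (auto simp: bij_betw_def)
    then have notin: "{?f i, ?f j} \<notin> low \<alpha>" "{?g i, ?g j} \<notin> low \<alpha>" by (auto simp: rest_def)
    have "insert {?f i, ?f j} (insert {?g i, ?g j} (low \<alpha>)) \<subseteq> low (?h \<bullet> \<alpha>)"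
      using in_low mult_lower[OF h \<alpha>] by blast
    then have "card (insert {?f i, ?f j} (insert {?g i, ?g j} (low \<alpha>))) \<le> card (low (?h \<bullet> \<alpha>))"
      using mult_closed[OF h \<alpha>] by (intro card_mono) auto
    then have "card (low \<alpha>) + 2 \<le> card (low (?h \<bullet> \<alpha>))" using notin sep \<alpha> by simp
    then show False using rk[OF \<alpha>] rank_low[OF \<alpha>] rank_low[OF mult_closed[OF h \<alpha>]] by simp
  qed
  then show ?thesis using h rk[OF \<alpha>] rk[OF \<beta>] H by (intro bexI[of _ ?h]) auto
qed

lemma Cong_family:
  assumes n3: "n \<ge> 3" and \<xi>: "\<xi> \<in> Cong (brauer n)"
  shows "\<exists>cu cl r N. valid cu cl r N \<and> \<xi> = family cu cl r N"
proof -
  define z where "z = n mod 2"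
  define J where "J = {x \<in> B. rank x = z}"
  define cl where "cl \<longleftrightarrow> (\<forall>(x, y) \<in> \<xi>. x \<in> J \<longrightarrow> y \<in> J \<longrightarrow> low x = low y)"
  define cu where "cu \<longleftrightarrow> (\<forall>(x, y) \<in> \<xi>. x \<in> J \<longrightarrow> y \<in> J \<longrightarrow> up x = up y)"
  define R where "R = insert z (rank ` {a. \<exists>b. (a, b) \<in> \<xi> \<and> rank b < rank a})"
  define r where "r = Max R"
  note \<xi>' = star_rel_Cong[OF \<xi>]
  note sym = cong_sym[OF \<xi>] and trans = cong_trans[OF \<xi>]
  have zn: "z \<le> n" by (simp add: z_def)
  have "R \<subseteq> {..n}" using cong_closed[OF \<xi>] rank_le zn by (auto simp: R_def)
  then have finR: "finite R" by (rule finite_subset) simp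
  have rR: "r \<in> R" unfolding r_def using Max_in[OF finR] by (simp add: R_def)
  have maxR: "x \<in> R \<Longrightarrow> x \<le> r" for x unfolding r_def by (rule Max_ge[OF finR])
  have r: "r \<le> n" "r mod 2 = n mod 2" "z \<le> r"
  proof -
    show "r \<le> n" using rR \<open>R \<subseteq> {..n}\<close> by auto
    show "r mod 2 = n mod 2" using rR rank_mod cong_closed(1)[OF \<xi>] by (auto simp: R_def z_def)
    show "z \<le> r" using maxR by (simp add: R_def)
  qed
  have drop: "rank a \<le> r" if "(a, b) \<in> \<xi>" "rank b < rank a" for a b using that maxR by (auto simp: R_def)
  have ex_drop: "\<exists>(a, b) \<in> \<xi>. rank b < rank a \<and> rank a = r" if "r \<noteq> z" using rR that by (auto simp: R_def)
  have to_min: "\<exists>x \<in> J. (\<alpha>, x) \<in> \<xi>" if \<alpha>: "\<alpha> \<in> B" "rank \<alpha> \<le> r" for \<alpha>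
  proof (cases "r = z")
    case True
    then have "\<alpha> \<in> J" using \<alpha> rank_ge[OF \<alpha>(1)] by (simp add: J_def z_def)
    then show ?thesis using cong_refl[OF \<xi> \<alpha>(1)] by blast
  next
    case False
    then obtain a b where ab: "(a, b) \<in> \<xi>" "rank b < rank a" "rank a = r" using ex_drop by blast
    then obtain x where x: "rank x = z" "(\<alpha>, x) \<in> \<xi>"
      using drop_to_minimal[OF \<xi> ab(1,2) \<alpha>(1)] \<alpha> by (auto simp: z_def)
    then show ?thesis using cong_closed(2)[OF \<xi> x(2)] by (auto simp: J_def)
  qed
  have col_low: "(u, v) \<in> \<xi>" if "\<not> cl" "u \<in> J" "v \<in> J" "up u = up v" for u v
  proof -
    obtain x y where "(x, y) \<in> \<xi>" "x \<in> J" "y \<in> J" "low x \<noteq> low y" using \<open>\<not> cl\<close> by (auto simp: cl_def)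
    then show ?thesis using minimal_collapse[OF \<xi>, of x y u v] that by (auto simp: J_def z_def)
  qed
  have col_up: "(u, v) \<in> \<xi>" if "\<not> cu" "u \<in> J" "v \<in> J" "low u = low v" for u v
  proof -
    obtain x y where xy: "(x, y) \<in> \<xi>" "x \<in> J" "y \<in> J" "up x \<noteq> up y" using \<open>\<not> cu\<close> by (auto simp: cu_def)
    then have "(star x, star y) \<in> star_rel \<xi>" by (simp add: star_rel_iff)
    then have "(star u, star v) \<in> star_rel \<xi>"
      using minimal_collapse[OF \<xi>', of "star x" "star y" "star u" "star v"] that xy by (auto simp: J_def z_def)
    then show ?thesis by (simp add: star_rel_iff)
  qed
  \<comment> \<open>From rank 3 on, a drop produces related minimal elements with different lower
    patterns, and dually with different upper patterns, which refutes both flags.\<close>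
  have flags: "r \<le> 2" if "cu \<or> cl"
  proof (rule ccontr)
    assume "\<not> r \<le> 2"
    then have r3: "r \<ge> 3" "r \<noteq> z" by (auto simp: z_def)
    then obtain a b where ab: "(a, b) \<in> \<xi>" "rank b < rank a" "rank a = r" using ex_drop by blast
    have B: "a \<in> B" "b \<in> B" using ab cong_closed[OF \<xi>] by auto
    obtain x y where x: "(x, y) \<in> \<xi>" "rank x = z" "rank y = z" "low x \<noteq> low y"
      using drop_low_neq[OF \<xi> ab(1,2)] ab r3 by (auto simp: z_def)
    then have "\<not> cl" using cong_closed[OF \<xi> x(1)] by (auto simp: cl_def J_def)
    have "(star a, star b) \<in> star_rel \<xi>" using ab by (simp add: star_rel_iff)
    then obtain x y where x: "(x, y) \<in> star_rel \<xi>" "rank x = z" "rank y = z" "low x \<noteq> low y"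
      using drop_low_neq[OF \<xi>', of "star a" "star b"] ab r3 B by (auto simp: z_def)
    then have "(star x, star y) \<in> \<xi>" "star x \<in> J" "star y \<in> J" "up (star x) \<noteq> up (star y)"
      using cong_closed[OF \<xi>' x(1)] by (auto simp: star_rel_iff J_def)
    then have "\<not> cu" by (auto simp: cu_def)
    then show False using \<open>\<not> cl\<close> that by simp
  qed
  \<comment> \<open>\<open>x \<bullet> y\<close> has the upper pattern of \<open>x\<close> and the
    lower one of \<open>y\<close>, so it interpolates: each of the two steps changes one pattern
    only.\<close>
  have on_J: "(x, y) \<in> \<xi> \<longleftrightarrow> (cu \<longrightarrow> up x = up y) \<and> (cl \<longrightarrow> low x = low y)" if x: "x \<in> J" and y: "y \<in> J" for x y
  proof
    assume "(x, y) \<in> \<xi>"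
    then show "(cu \<longrightarrow> up x = up y) \<and> (cl \<longrightarrow> low x = low y)" using x y by (auto simp: cu_def cl_def)
  next
    assume h: "(cu \<longrightarrow> up x = up y) \<and> (cl \<longrightarrow> low x = low y)"
    have B: "x \<in> B" "y \<in> B" "rank x = n mod 2" "rank y = n mod 2" using x y by (auto simp: J_def z_def)
    have w: "x \<bullet> y \<in> J" "up (x \<bullet> y) = up x" "low (x \<bullet> y) = low y"
      using min_mult_left[OF B(1,2,3)] min_mult_right[OF B(1,2,4)] mult_closed[OF B(1,2)] by (auto simp: J_def z_def)
    have "(x, x \<bullet> y) \<in> \<xi>"
    proof (cases cl)
      case True
      then have "x = x \<bullet> y" using min_eqI[OF B(1) mult_closed[OF B(1,2)] B(3)] w h by simp
      then show ?thesis using cong_refl[OF \<xi> B(1)] by simp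
    qed (use col_low x w in auto)
    moreover have "(x \<bullet> y, y) \<in> \<xi>"
    proof (cases cu)
      case True
      then have "y = x \<bullet> y" using min_eqI[OF B(2) mult_closed[OF B(1,2)] B(4)] w h by simp
      then show ?thesis using cong_refl[OF \<xi> B(2)] by simp
    qed (use col_up y w in auto)
    ultimately show "(x, y) \<in> \<xi>" by (rule trans)
  qed
  \<comment> \<open>Multiplication by a minimal \<open>m\<close> moves a related pair into the
    minimal ideal, where the flag compares the patterns described by \<open>uh_up_mult\<close> and
    \<open>lh_low_mult\<close>.\<close>
  have shadow: "(cu \<longrightarrow> uh \<alpha> = up x) \<and> (cl \<longrightarrow> lh \<alpha> = low x)"
    if \<alpha>: "\<alpha> \<in> B" "rank \<alpha> \<le> r" and x: "x \<in> J" and rel: "(\<alpha>, x) \<in> \<xi>" for \<alpha> x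
  proof -
    have xB: "x \<in> B" "rank x = n mod 2" using x by (auto simp: J_def z_def)
    have x2: "rank x \<le> 2" using xB by simp
    obtain m where m: "m \<in> B" "rank m = n mod 2" using ex_minimal by blast
    have "uh \<alpha> = up x" if cu
    proof -
      have "(\<alpha> \<bullet> m, x \<bullet> m) \<in> \<xi>" using cong_right[OF \<xi> rel m(1)] .
      moreover have "\<alpha> \<bullet> m \<in> J" "x \<bullet> m \<in> J"
        using min_mult_right[OF \<alpha>(1) m] min_mult_right[OF xB(1) m] mult_closed \<alpha> xB m by (auto simp: J_def z_def)
      ultimately have "up (\<alpha> \<bullet> m) = up (x \<bullet> m)" using \<open>cu\<close> by (auto simp: cu_def)
      then show ?thesis using uh_up_mult[OF \<alpha>(1) _ m] min_mult_left[OF xB(1) m(1) xB(2)] flags \<alpha> \<open>cu\<close> by simp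
    qed
    moreover have "lh \<alpha> = low x" if cl
    proof -
      have "(m \<bullet> \<alpha>, m \<bullet> x) \<in> \<xi>" using cong_left[OF \<xi> rel m(1)] .
      moreover have "m \<bullet> \<alpha> \<in> J" "m \<bullet> x \<in> J"
        using min_mult_left[OF m(1) \<alpha>(1) m(2)] min_mult_left[OF m(1) xB(1) m(2)] mult_closed \<alpha> xB m
        by (auto simp: J_def z_def)
      ultimately have "low (m \<bullet> \<alpha>) = low (m \<bullet> x)" using \<open>cl\<close> by (auto simp: cl_def)
      then show ?thesis using lh_low_mult[OF \<alpha>(1) _ m] min_mult_right[OF m(1) xB] flags \<alpha> \<open>cl\<close> by simp
    qed
    ultimately show ?thesis by blast
  qed
  have on_I: "(\<alpha>, \<beta>) \<in> \<xi> \<longleftrightarrow> (\<alpha>, \<beta>) \<in> kappa cu cl r"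
    if \<alpha>: "\<alpha> \<in> B" "rank \<alpha> \<le> r" and \<beta>: "\<beta> \<in> B" "rank \<beta> \<le> r" for \<alpha> \<beta>
  proof -
    obtain x y where x: "x \<in> J" "(\<alpha>, x) \<in> \<xi>" and y: "y \<in> J" "(\<beta>, y) \<in> \<xi>" using to_min \<alpha> \<beta> by blast
    have "(\<alpha>, \<beta>) \<in> \<xi> \<longleftrightarrow> (x, y) \<in> \<xi>" using x(2) y(2) sym trans by blast
    then show ?thesis
      using on_J[OF x(1) y(1)] shadow[OF \<alpha> x] shadow[OF \<beta> y] \<alpha> \<beta> by (auto simp: kappa_def)
  qed
  \<comment> \<open>A difference of rank or of pattern would produce a drop from a rank above
    \<open>r\<close>.\<close>
  have same_H: "rank \<beta> = rank \<alpha> \<and> up \<alpha> = up \<beta> \<and> low \<alpha> = low \<beta>" if ab: "(\<alpha>, \<beta>) \<in> \<xi>" and big: "rank \<alpha> > r" for \<alpha> \<beta>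
  proof -
    have B: "\<alpha> \<in> B" "\<beta> \<in> B" using ab cong_closed[OF \<xi>] by auto
    have eq: "rank \<beta> = rank \<alpha>" using drop[OF ab] drop[OF sym[OF ab]] big by force
    have k2: "rank \<alpha> \<ge> 2" using parity_gap[of z "rank \<alpha>"] big r(3) rank_mod[OF B(1)] by (simp add: z_def)
    have "up \<alpha> = up \<beta>"
    proof (rule ccontr)
      assume "up \<alpha> \<noteq> up \<beta>"
      then obtain \<gamma> \<delta> where "(\<gamma>, \<delta>) \<in> \<xi>" "rank \<gamma> = rank \<alpha>" "rank \<delta> < rank \<alpha>"
        using drop_of_up_neq[OF \<xi> ab eq k2] by blast
      then show False using drop[of \<gamma> \<delta>] big by simp
    qed
    moreover have "low \<alpha> = low \<beta>"
    proof (rule ccontr)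
      assume "low \<alpha> \<noteq> low \<beta>"
      moreover have "(star \<alpha>, star \<beta>) \<in> star_rel \<xi>" using ab by (simp add: star_rel_iff)
      ultimately obtain \<gamma> \<delta> where d: "(\<gamma>, \<delta>) \<in> star_rel \<xi>" "rank \<gamma> = rank \<alpha>" "rank \<delta> < rank \<alpha>"
        using drop_of_up_neq[OF \<xi>', of "star \<alpha>" "star \<beta>"] eq k2 B by auto
      then have "(star \<gamma>, star \<delta>) \<in> \<xi>" "rank (star \<gamma>) = rank \<alpha>" "rank (star \<delta>) < rank \<alpha>"
        using cong_closed[OF \<xi>' d(1)] by (auto simp: star_rel_iff)
      then show False using drop[of "star \<gamma>" "star \<delta>"] big by simp
    qed
    ultimately show ?thesis using eq by simp
  qed
  \<comment> \<open>From rank \<open>r + 4\<close> on, a hook would separate the lower patterns of a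
    related pair whose rank is still above \<open>r\<close>, against \<open>same_H\<close>.\<close>
  have top: "rank \<alpha> = r + 2" if ab: "(\<alpha>, \<beta>) \<in> \<xi>" and big: "rank \<alpha> > r" and ne: "\<alpha> \<noteq> \<beta>" for \<alpha> \<beta>
  proof (rule ccontr)
    assume n2: "rank \<alpha> \<noteq> r + 2"
    have B: "\<alpha> \<in> B" "\<beta> \<in> B" using ab cong_closed[OF \<xi>] by auto
    have "r + 2 < rank \<alpha>" using parity_gap[OF big] n2 r(2) rank_mod[OF B(1)] by simp
    then have k: "rank \<alpha> \<ge> r + 4" using parity_gap[of "r + 2" "rank \<alpha>"] r(2) rank_mod[OF B(1)] by simp
    note H = same_H[OF ab big]
    obtain s where s: "s \<in> B" "rank (s \<bullet> \<alpha>) + 2 = rank \<alpha>" "low (s \<bullet> \<alpha>) \<noteq> low (s \<bullet> \<beta>)"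
      using hook_separates[OF B _ _ ne] H k by auto
    have "rank (s \<bullet> \<alpha>) > r" using s k by simp
    then show False using same_H[OF cong_left[OF \<xi> ab s(1)]] s by simp
  qed
  show ?thesis
  proof (cases "r = n")
    case True
    have "\<not> cu" "\<not> cl" using flags True n3 by auto
    then have v: "valid cu cl r {id}" using r True by (simp add: valid_def)
    have "(a, b) \<in> \<xi> \<longleftrightarrow> (a, b) \<in> family cu cl r {id}" for a b
    proof (cases "a \<in> B \<and> b \<in> B")
      case T: True
      then have "rank a \<le> r" "rank b \<le> r" using rank_le True by auto
      then show ?thesis
        using on_I[of a b] T rel_nu_empty[OF v True] by (auto simp: family_def kappa_def)
    next
      case False
      then show ?thesis using cong_closed[OF \<xi>] family_closed[OF v] by blast
    qed
    then have "\<xi> = family cu cl r {id}" by auto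
    then show ?thesis using v by blast
  next
    case False
    define q where "q = r + 2"
    have q: "q \<le> n" "q mod 2 = n mod 2" using parity_gap[of r n] r False unfolding q_def by simp_all
    define N where "N = {\<sigma>. \<sigma> permutes {1..q} \<and> (bar n q id, bar n q \<sigma>) \<in> \<xi>}"
    note bI = bar_facts(1)[OF q permutes_id]
    have N: "N \<lhd> sym_group q"
      unfolding normal_sym_group_iff
    proof (intro conjI ballI allI impI)
      show "\<sigma> permutes {1..q}" if "\<sigma> \<in> N" for \<sigma> using that by (simp add: N_def)
      show "id \<in> N" using cong_refl[OF \<xi> bI] by (simp add: N_def permutes_id)
      show "\<sigma> \<circ> \<tau> \<in> N" if "\<sigma> \<in> N" "\<tau> \<in> N" for \<sigma> \<tau>
      proof -
        have p: "\<sigma> permutes {1..q}" "\<tau> permutes {1..q}" using that by (auto simp: N_def)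
        have "(bar n q id \<bullet> bar n q \<sigma>, bar n q \<tau> \<bullet> bar n q \<sigma>) \<in> \<xi>"
          using cong_right[OF \<xi>, of "bar n q id" "bar n q \<tau>"] that bar_facts(1)[OF q p(1)] by (simp add: N_def)
        then have "(bar n q \<sigma>, bar n q (\<sigma> \<circ> \<tau>)) \<in> \<xi>"
          using bar_mult[OF q permutes_id p(1)] bar_mult[OF q p(2,1)] by simp
        then show ?thesis using that trans permutes_compose[OF p(2,1)] by (auto simp: N_def)
      qed
      show "inv' \<sigma> \<in> N" if "\<sigma> \<in> N" for \<sigma>
      proof -
        have p: "\<sigma> permutes {1..q}" using that by (auto simp: N_def)
        note pi = permutes_inv[OF p]
        have "(bar n q id \<bullet> bar n q (inv' \<sigma>), bar n q \<sigma> \<bullet> bar n q (inv' \<sigma>)) \<in> \<xi>"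
          using cong_right[OF \<xi>, of "bar n q id" "bar n q \<sigma>"] that bar_facts(1)[OF q pi] by (simp add: N_def)
        then have "(bar n q (inv' \<sigma>), bar n q id) \<in> \<xi>"
          using bar_mult[OF q permutes_id pi] bar_mult[OF q p pi] permutes_inv_o(2)[OF p] by simp
        then show ?thesis using sym pi by (auto simp: N_def)
      qed
      show "\<tau> \<circ> \<sigma> \<circ> inv' \<tau> \<in> N" if \<tau>: "\<tau> permutes {1..q}" and "\<sigma> \<in> N" for \<tau> \<sigma>
      proof -
        have p: "\<sigma> permutes {1..q}" using that by (auto simp: N_def)
        note pi = permutes_inv[OF \<tau>]
        have "(bar n q (inv' \<tau>) \<bullet> bar n q id \<bullet> bar n q \<tau>, bar n q (inv' \<tau>) \<bullet> bar n q \<sigma> \<bullet> bar n q \<tau>) \<in> \<xi>"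
          using cong_both[OF \<xi>, of "bar n q id" "bar n q \<sigma>"] that bar_facts(1)[OF q pi] bar_facts(1)[OF q \<tau>] by (simp add: N_def)
        then have "(bar n q id, bar n q (\<tau> \<circ> \<sigma> \<circ> inv' \<tau>)) \<in> \<xi>"
          using bar_mult[OF q pi permutes_id] bar_mult[OF q pi \<tau>] bar_mult[OF q pi p]
            bar_mult[OF q permutes_compose[OF pi p] \<tau>] permutes_inv_o(1)[OF \<tau>] by (simp add: comp_assoc)
        then show ?thesis
          using permutes_compose[OF permutes_compose[OF pi p] \<tau>] by (simp add: N_def comp_assoc)
      qed
    qed
    \<comment> \<open>Multiplying by \<open>star s\<close> and \<open>star t\<close> moves a related
      pair to the maximal subgroup; multiplying by \<open>s\<close> and \<open>t\<close> moves it
      back.\<close>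
    have on_top: "(\<alpha>, \<beta>) \<in> \<xi> \<longleftrightarrow> (\<alpha>, \<beta>) \<in> rel_nu q N"
      if \<alpha>: "\<alpha> \<in> B" "\<beta> \<in> B" "rank \<alpha> = q" for \<alpha> \<beta>
    proof
      assume ab: "(\<alpha>, \<beta>) \<in> \<xi>"
      have H: "rank \<beta> = rank \<alpha>" "up \<alpha> = up \<beta>" "low \<alpha> = low \<beta>" using same_H[OF ab] \<alpha> by (auto simp: q_def)
      obtain s t where st: "s \<in> B" "t \<in> B" "low s = std q" "up t = std q" "\<alpha> = s \<bullet> t" "up s = up \<alpha>" "low t = low \<alpha>"
        using coordinates[OF q \<alpha>(1,3)] by blast
      define \<gamma> where "\<gamma> = star s \<bullet> \<beta> \<bullet> star t"
      have m1: "low (star s) = up \<beta>" using st H by simp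
      note M1 = matched_mult[OF star_closed[OF st(1)] \<alpha>(2) m1]
      have c1: "star s \<bullet> \<beta> \<in> B" using st \<alpha> mult_closed by simp
      have m2: "low (star s \<bullet> \<beta>) = up (star t)" using M1 st H by simp
      note M2 = matched_mult[OF c1 star_closed[OF st(2)] m2]
      have "\<gamma> \<in> B" "up \<gamma> = std q" "low \<gamma> = std q"
        using M1 M2 st c1 mult_closed by (auto simp: \<gamma>_def)
      then obtain \<sigma> where \<sigma>: "\<sigma> permutes {1..q}" "\<gamma> = bar n q \<sigma>" using bar_cases[OF q] by blast
      have "star s \<bullet> \<alpha> \<bullet> star t = bar n q id"
        using matched_mult(4)[OF st(1,2)] mult_star_self[OF st(2)] st by (simp add: bar_id[OF q])
      then have "(bar n q id, bar n q \<sigma>) \<in> \<xi>"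
        using cong_both[OF \<xi> ab star_closed[OF st(1)] star_closed[OF st(2)]] \<sigma> by (simp add: \<gamma>_def)
      then have "\<sigma> \<in> N" using \<sigma> by (simp add: N_def)
      moreover have "\<beta> = s \<bullet> bar n q \<sigma> \<bullet> t"
      proof -
        have "s \<bullet> (star s \<bullet> \<beta> \<bullet> star t) \<bullet> t = (s \<bullet> star s) \<bullet> \<beta> \<bullet> (star t \<bullet> t)"
          using st \<alpha> by (simp add: mult_assoc mult_closed)
        also have "\<dots> = \<beta>"
          using mult_star_self[OF st(1)] star_mult_self[OF st(2)] st H proj_up_mult[OF \<alpha>(2)] mult_proj_low[OF \<alpha>(2)] by simp
        finally show ?thesis using \<sigma> by (simp add: \<gamma>_def)
      qed
      ultimately show "(\<alpha>, \<beta>) \<in> rel_nu q N" using rel_nuI[OF q N st(1,2) _ st(3,4)] st(5) by simp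
    next
      assume "(\<alpha>, \<beta>) \<in> rel_nu q N"
      then obtain s t y where st: "s \<in> B" "t \<in> B" "y \<in> N" "low s = std q" "up t = std q" "\<alpha> = s \<bullet> t" "\<beta> = s \<bullet> bar n q y \<bullet> t"
        using rel_nuE[OF q N] by blast
      have "(bar n q id, bar n q y) \<in> \<xi>" using st by (simp add: N_def)
      then show "(\<alpha>, \<beta>) \<in> \<xi>"
        using cong_both[OF \<xi> _ st(1,2), of "bar n q id" "bar n q y"] mult_bar_id[OF q st(1,4)] st by simp
    qed
    \<comment> \<open>Each flag yields only one of the two sides of \<open>acts_trivially\<close>;
      the other follows by applying \<open>star\<close>, as \<open>N\<close> is closed under
      inverses.\<close>
    have "acts_trivially q N" if "cu \<or> cl"
    proof -
      have one: "(cu \<longrightarrow> bar n q \<sigma> \<bullet> m = bar n q id \<bullet> m) \<and> (cl \<longrightarrow> m \<bullet> bar n q \<sigma> = m \<bullet> bar n q id)"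
        if m: "m \<in> B" "rank m = n mod 2" and \<sigma>: "\<sigma> \<in> N" for m \<sigma>
      proof -
        have s: "bar n q \<sigma> \<in> B" using bar_facts(1)[OF q] \<sigma> by (simp add: N_def)
        have rel: "(bar n q id, bar n q \<sigma>) \<in> \<xi>" using \<sigma> by (simp add: N_def)
        have J1: "bar n q id \<bullet> m \<in> J" "bar n q \<sigma> \<bullet> m \<in> J" "m \<bullet> bar n q id \<in> J" "m \<bullet> bar n q \<sigma> \<in> J"
          using min_mult_right[OF bI m] min_mult_right[OF s m] min_mult_left[OF m(1) bI m(2)] min_mult_left[OF m(1) s m(2)]
            mult_closed m bI s by (auto simp: J_def z_def)
        have "bar n q \<sigma> \<bullet> m = bar n q id \<bullet> m" if cu
        proof -
          have "up (bar n q \<sigma> \<bullet> m) = up (bar n q id \<bullet> m)"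
            using on_J[OF J1(1,2)] cong_right[OF \<xi> rel m(1)] that by simp
          then show ?thesis
            using min_mult_right[OF bI m] min_mult_right[OF s m] J1 by (intro min_eqI) (auto simp: J_def z_def)
        qed
        moreover have "m \<bullet> bar n q \<sigma> = m \<bullet> bar n q id" if cl
        proof -
          have "low (m \<bullet> bar n q \<sigma>) = low (m \<bullet> bar n q id)"
            using on_J[OF J1(3,4)] cong_left[OF \<xi> rel m(1)] that by simp
          then show ?thesis
            using min_mult_left[OF m(1) bI m(2)] min_mult_left[OF m(1) s m(2)] J1 by (intro min_eqI) (auto simp: J_def z_def)
        qed
        ultimately show ?thesis by blast
      qed
      have stars: "star (bar n q \<sigma> \<bullet> m) = star m \<bullet> bar n q (inv' \<sigma>)" "star (m \<bullet> bar n q \<sigma>) = bar n q (inv' \<sigma>) \<bullet> star m"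
        if "m \<in> B" "\<sigma> permutes {1..q}" for m \<sigma>
        using star_mult bar_facts(1)[OF q that(2)] star_bar[OF q that(2)] that by simp_all
      show ?thesis
        unfolding acts_trivially_def
      proof (intro ballI impI)
        fix m \<sigma> assume m: "m \<in> B" "rank m = n mod 2" and \<sigma>: "\<sigma> \<in> N"
        have p: "\<sigma> permutes {1..q}" using \<sigma> by (simp add: N_def)
        have m': "star m \<in> B" "rank (star m) = n mod 2" using m by auto
        note i = normal_inv[OF N \<sigma>]
        have "bar n q \<sigma> \<bullet> m = bar n q id \<bullet> m \<longleftrightarrow> star m \<bullet> bar n q (inv' \<sigma>) = star m \<bullet> bar n q id"
          using stars(1)[OF m(1) p] stars(1)[OF m(1) permutes_id] by (metis inv_id star_star)
        moreover have "m \<bullet> bar n q \<sigma> = m \<bullet> bar n q id \<longleftrightarrow> bar n q (inv' \<sigma>) \<bullet> star m = bar n q id \<bullet> star m"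
          using stars(2)[OF m(1) p] stars(2)[OF m(1) permutes_id] by (metis inv_id star_star)
        ultimately show "m \<bullet> bar n q \<sigma> = m \<bullet> bar n q id \<and> bar n q \<sigma> \<bullet> m = bar n q id \<bullet> m"
          using one[OF m \<sigma>] one[OF m' i] that by blast
      qed
    qed
    then have v: "valid cu cl r N" using r False N flags by (simp add: valid_def q_def)
    have "(a, b) \<in> \<xi> \<longleftrightarrow> (a, b) \<in> family cu cl r N" for a b
    proof (cases "a \<in> B \<and> b \<in> B")
      case T: True
      show ?thesis
      proof (cases "rank a \<le> r")
        case ra: True
        show ?thesis
        proof (cases "rank b \<le> r")
          case True
          then show ?thesis
            using on_I[of a b] T ra rel_nu_valid(4)[OF v, of a b] cong_refl[OF \<xi>]
            by (auto simp: family_def)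
        next
          case False
          have "(a, b) \<notin> \<xi>" using same_H[of b a] sym False ra by force
          moreover have "(a, b) \<notin> family cu cl r N"
            using False ra rel_nu_valid(4)[OF v, of a b] by (auto simp: family_def kappa_def)
          ultimately show ?thesis by simp
        qed
      next
        case False
        have "(a, b) \<in> \<xi> \<longleftrightarrow> a = b \<or> (a, b) \<in> rel_nu q N"
          using top[of a b] on_top[of a b] T False cong_refl[OF \<xi>] rel_nu_valid(4)[OF v, of a b]
          by (auto simp: q_def)
        then show ?thesis using T False by (auto simp: family_def kappa_def q_def)
      qed
    next
      case False
      then show ?thesis using cong_closed[OF \<xi>] family_closed[OF v] by blast
    qed
    then have "\<xi> = family cu cl r N" by auto
    then show ?thesis using v by blast
  qed
qed

end

section \<open>Normal subgroups of symmetric groups\<close>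

abbreviation three_cycle :: "nat \<Rightarrow> nat \<Rightarrow> nat \<Rightarrow> nat \<Rightarrow> nat" where
  "three_cycle a b c \<equiv> transpose a b \<circ> transpose b c"

lemma conj_transpose: "\<tau> \<circ> transpose a b \<circ> inv' \<tau> = transpose (\<tau> a) (\<tau> b)" if "\<tau> permutes S"
proof
  fix x
  have eq: "inv' \<tau> x = y \<longleftrightarrow> x = \<tau> y" for y using permutes_inv_eq[OF that] by metis
  show "(\<tau> \<circ> transpose a b \<circ> inv' \<tau>) x = transpose (\<tau> a) (\<tau> b) x"
    using eq[of a] eq[of b] permutes_inverses(1)[OF that] by (auto simp: transpose_def)
qed

lemma conj_comp: "\<tau> \<circ> (f \<circ> g) \<circ> inv' \<tau> = (\<tau> \<circ> f \<circ> inv' \<tau>) \<circ> (\<tau> \<circ> g \<circ> inv' \<tau>)" if "\<tau> permutes S"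
  using permutes_inv_o(2)[OF that] by (metis (no_types, lifting) comp_assoc comp_id)

lemma conj_transpose2: "\<tau> \<circ> (transpose a b \<circ> transpose c d) \<circ> inv' \<tau> = transpose (\<tau> a) (\<tau> b) \<circ> transpose (\<tau> c) (\<tau> d)"
  if "\<tau> permutes S"
  unfolding conj_comp[OF that] conj_transpose[OF that] ..

lemma conj_three_cycle: "\<tau> \<circ> three_cycle a b c \<circ> inv' \<tau> = three_cycle (\<tau> a) (\<tau> b) (\<tau> c)" if "\<tau> permutes S"
  by (rule conj_transpose2[OF that])

lemma ex_permutes_three:
  assumes abc: "distinct [a, b, c]" "{a, b, c} \<subseteq> {1..q}" and abc': "distinct [a', b', c']" "{a', b', c'} \<subseteq> {1..q}"
  shows "\<exists>\<tau>. \<tau> permutes {1..q} \<and> \<tau> a = a' \<and> \<tau> b = b' \<and> \<tau> c = (c' :: nat)"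
proof -
  have "card ({1..q} - {a, b, c}) = card ({1..q} - {a', b', c'})"
    using assms by (subst (1 2) card_Diff_subset) auto
  then obtain g where g: "bij_betw g ({1..q} - {a, b, c}) ({1..q} - {a', b', c'})"
    using finite_same_card_bij[of "{1..q} - {a, b, c}" "{1..q} - {a', b', c'}"] by auto
  define \<tau> where "\<tau> x = (if x = a then a' else if x = b then b' else if x = c then c' else if x \<in> {1..q} then g x else x)" for x
  have \<tau>: "\<tau> a = a'" "\<tau> b = b'" "\<tau> c = c'" using abc by (auto simp: \<tau>_def)
  have "bij_betw \<tau> {a, b, c} {a', b', c'}"
  proof (rule bij_betw_imageI)
    show "inj_on \<tau> {a, b, c}" using abc' by (auto simp: inj_on_def \<tau>)
    show "\<tau> ` {a, b, c} = {a', b', c'}" by (simp add: \<tau>)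
  qed
  moreover have "bij_betw \<tau> ({1..q} - {a, b, c}) ({1..q} - {a', b', c'})"
    using g by (rule bij_betw_cong[THEN iffD1, rotated]) (simp add: \<tau>_def)
  ultimately have "bij_betw \<tau> ({a, b, c} \<union> ({1..q} - {a, b, c})) ({a', b', c'} \<union> ({1..q} - {a', b', c'}))"
    by (rule bij_betw_combine) auto
  moreover have "{a, b, c} \<union> ({1..q} - {a, b, c}) = {1..q}" "{a', b', c'} \<union> ({1..q} - {a', b', c'}) = {1..q}"
    using abc(2) abc'(2) by auto
  ultimately have "bij_betw \<tau> {1..q} {1..q}" by simp
  then have "\<tau> permutes {1..q}" using abc(2) by (intro bij_imp_permutes) (auto simp: \<tau>_def)
  then show ?thesis using \<tau> by blast
qed

lemma three_cycles_eq: "three_cycles q = {three_cycle a b c | a b c. distinct [a, b, c] \<and> {a, b, c} \<subseteq> {1..q}}"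
proof
  show "three_cycles q \<subseteq> {three_cycle a b c | a b c. distinct [a, b, c] \<and> {a, b, c} \<subseteq> {1..q}}"
  proof
    fix p assume "p \<in> three_cycles q"
    then obtain cs where cs: "p = cycle_of_list cs" "distinct cs" "length cs = 3" "set cs \<subseteq> {1..q}" by blast
    obtain a b c where abc: "cs = [a, b, c]" using stupid_lemma[OF cs(3)] by blast
    then have "p = three_cycle a b c" "distinct [a, b, c]" "{a, b, c} \<subseteq> {1..q}" using cs by auto
    then show "p \<in> {three_cycle a b c | a b c. distinct [a, b, c] \<and> {a, b, c} \<subseteq> {1..q}}" by blast
  qed
  show "{three_cycle a b c | a b c. distinct [a, b, c] \<and> {a, b, c} \<subseteq> {1..q}} \<subseteq> three_cycles q"
  proof
    fix p assume "p \<in> {three_cycle a b c | a b c. distinct [a, b, c] \<and> {a, b, c} \<subseteq> {1..q}}"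
    then obtain a b c where "p = three_cycle a b c" "distinct [a, b, c]" "{a, b, c} \<subseteq> {1..q}" by blast
    then have "p = cycle_of_list [a, b, c]" "cycle [a, b, c]" "length [a, b, c] = 3" "set [a, b, c] \<subseteq> {1..q}" by auto
    then show "p \<in> three_cycles q" by blast
  qed
qed

context
  notes One_nat_def [simp del]
begin

section \<open>The Klein four-group\<close>

lemma klein4_simps:
  "\<sigma> \<in> klein4 \<longleftrightarrow> \<sigma> = id \<or> \<sigma> = transpose 1 2 \<circ> transpose 3 4 \<or> \<sigma> = transpose 1 3 \<circ> transpose 2 4
     \<or> \<sigma> = transpose 1 4 \<circ> transpose 2 3"
  by (auto simp: klein4_def)

lemma permutes_4_eqI: "\<sigma> = \<tau>" if "\<sigma> permutes {1..4 :: nat}" "\<tau> permutes {1..4}" "\<sigma> 1 = \<tau> 1" "\<sigma> 2 = \<tau> 2" "\<sigma> 3 = \<tau> 3" "\<sigma> 4 = \<tau> 4"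
proof
  fix x
  show "\<sigma> x = \<tau> x"
  proof (cases "x \<in> {1..4}")
    case True
    then have "x = 1 \<or> x = 2 \<or> x = 3 \<or> x = 4" by auto
    then show ?thesis using that by auto
  next
    case False
    then show ?thesis using that(1,2) by (simp add: permutes_not_in)
  qed
qed

lemma klein4_permutes: "\<sigma> permutes {1..4}" if "\<sigma> \<in> klein4"
  using that unfolding klein4_simps by (auto intro!: permutes_compose permutes_swap_id permutes_id)

lemma klein4I:
  assumes \<sigma>: "\<sigma> permutes {1..4 :: nat}"
    and e: "{\<sigma> 1, \<sigma> 2} \<in> {{1, 2}, {3, 4}}" "{\<sigma> 1, \<sigma> 3} \<in> {{1, 3}, {2, 4}}" "{\<sigma> 1, \<sigma> 4} \<in> {{1, 4}, {2, 3}}"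
  shows "\<sigma> \<in> klein4"
proof -
  have p: "transpose 1 2 \<circ> transpose 3 4 permutes {1..4 :: nat}" "transpose 1 3 \<circ> transpose 2 4 permutes {1..4 :: nat}"
    "transpose 1 4 \<circ> transpose 2 3 permutes {1..4 :: nat}"
    by (auto intro!: permutes_compose permutes_swap_id)
  consider "\<sigma> 1 = 1" | "\<sigma> 1 = 2" | "\<sigma> 1 = 3" | "\<sigma> 1 = 4" using e(1) by (auto simp: doubleton_eq_iff)
  then show ?thesis
  proof cases
    case 1
    then have "\<sigma> = id" using e by (intro permutes_4_eqI[OF \<sigma> permutes_id]) (auto simp: doubleton_eq_iff)
    then show ?thesis by (simp add: klein4_simps)
  next
    case 2
    then have "\<sigma> = transpose 1 2 \<circ> transpose 3 4"
      using e by (intro permutes_4_eqI[OF \<sigma> p(1)]) (auto simp: doubleton_eq_iff transpose_def)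
    then show ?thesis by (simp add: klein4_simps)
  next
    case 3
    then have "\<sigma> = transpose 1 3 \<circ> transpose 2 4"
      using e by (intro permutes_4_eqI[OF \<sigma> p(2)]) (auto simp: doubleton_eq_iff transpose_def)
    then show ?thesis by (simp add: klein4_simps)
  next
    case 4
    then have "\<sigma> = transpose 1 4 \<circ> transpose 2 3"
      using e by (intro permutes_4_eqI[OF \<sigma> p(3)]) (auto simp: doubleton_eq_iff transpose_def)
    then show ?thesis by (simp add: klein4_simps)
  qed
qed

lemma klein4_values:
  assumes "\<sigma> \<in> klein4"
  shows "\<sigma> 1 = 1 \<and> \<sigma> 2 = 2 \<and> \<sigma> 3 = 3 \<and> \<sigma> 4 = 4 \<or> \<sigma> 1 = 2 \<and> \<sigma> 2 = 1 \<and> \<sigma> 3 = 4 \<and> \<sigma> 4 = 3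
    \<or> \<sigma> 1 = 3 \<and> \<sigma> 2 = 4 \<and> \<sigma> 3 = 1 \<and> \<sigma> 4 = 2 \<or> \<sigma> 1 = 4 \<and> \<sigma> 2 = 3 \<and> \<sigma> 3 = 2 \<and> \<sigma> 4 = 1"
  using assms unfolding klein4_simps by (elim disjE) (simp_all add: transpose_def)

lemma atLeastAtMost_4: "{1..4} = {1, 2, 3, 4 :: nat}" by auto

text \<open>A perfect matching is mapped to itself only if each of its pairs goes to itself or to a
  disjoint pair, and on an even number of points every pair belongs to some perfect matching. So
  this is the trace on \<open>{1..q}\<close> of acting trivially on the minimal ideal; for even
  \<open>q \<le> 4\<close> it is also sufficient.\<close>

definition pair_stable :: "(nat \<Rightarrow> nat) \<Rightarrow> nat set \<Rightarrow> bool" where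
  "pair_stable \<sigma> S \<longleftrightarrow> (\<forall>a \<in> S. \<forall>b \<in> S. a \<noteq> b \<longrightarrow> \<sigma> ` {a, b} = {a, b} \<or> \<sigma> ` {a, b} \<inter> {a, b} = {})"

text \<open>Characterises the group without naming its elements, which makes invariance under
  conjugation and the link to \<open>acts_trivially\<close> direct.\<close>

lemma klein4_iff: "\<sigma> \<in> klein4 \<longleftrightarrow> \<sigma> permutes {1..4} \<and> pair_stable \<sigma> {1..4}"
proof
  assume \<sigma>: "\<sigma> \<in> klein4"
  have "\<sigma> ` {a, b} = {a, b} \<or> \<sigma> ` {a, b} \<inter> {a, b} = {}"
    if "a = 1 \<or> a = 2 \<or> a = 3 \<or> a = 4" "b = 1 \<or> b = 2 \<or> b = 3 \<or> b = 4" "a \<noteq> b" for a b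
    using klein4_values[OF \<sigma>] that by (elim disjE) (simp_all add: insert_commute)
  then have "pair_stable \<sigma> {1..4}" unfolding pair_stable_def atLeastAtMost_4 by simp
  then show "\<sigma> permutes {1..4} \<and> pair_stable \<sigma> {1..4}" using klein4_permutes[OF \<sigma>] by simp
next
  assume h: "\<sigma> permutes {1..4} \<and> pair_stable \<sigma> {1..4}"
  then have p: "\<sigma> permutes {1..4}" by blast
  have pair: "{\<sigma> 1, \<sigma> x} \<in> {{1, x}, {y, z}}" if xyz: "{1..4} = {1, x, y, z}" "1 \<noteq> x" for x y z
  proof -
    have x: "(1 :: nat) \<in> {1..4}" "x \<in> {1..4}" unfolding xyz(1) by simp_all
    have st: "\<sigma> ` {1, x} = {1, x} \<or> \<sigma> ` {1, x} \<inter> {1, x} = {}"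
      using h[THEN conjunct2, unfolded pair_stable_def, rule_format, OF x xyz(2)] .
    have mem: "\<sigma> 1 \<in> {1, x, y, z}" "\<sigma> x \<in> {1, x, y, z}"
      using permutes_in_image[OF p, of 1] permutes_in_image[OF p, of x] x unfolding xyz(1) by simp_all
    have ne: "\<sigma> 1 \<noteq> \<sigma> x" using permutes_inj[OF p] xyz(2) by (auto dest: injD)
    from st show ?thesis
    proof
      assume "\<sigma> ` {1, x} \<inter> {1, x} = {}"
      then have "\<sigma> 1 = y \<or> \<sigma> 1 = z" "\<sigma> x = y \<or> \<sigma> x = z" using mem by simp_all
      then show ?thesis using ne by (elim disjE) (simp_all add: insert_commute)
    qed simp
  qed
  have "{1, 2, 3, 4} = {1, 3, 2, 4 :: nat}" "{1, 2, 3, 4} = {1, 4, 2, 3 :: nat}" by auto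
  then show "\<sigma> \<in> klein4"
    using pair[of 2 3 4] pair[of 3 2 4] pair[of 4 2 3] atLeastAtMost_4 by (intro klein4I[OF p]) simp_all
qed

text \<open>Conjugation permutes the pairs of points of \<open>{1..4}\<close>, so it preserves
  \<open>pair_stable\<close>; closure under products is a check of values.\<close>

lemma klein4_normal: "klein4 \<lhd> sym_group 4"
  unfolding normal_sym_group_iff
proof (intro conjI ballI allI impI)
  show "\<sigma> permutes {1..4}" if "\<sigma> \<in> klein4" for \<sigma> using klein4_permutes[OF that] .
  show "id \<in> klein4" by (simp add: klein4_simps)
  show "\<sigma> \<circ> \<tau> \<in> klein4" if "\<sigma> \<in> klein4" "\<tau> \<in> klein4" for \<sigma> \<tau>
  proof (rule klein4I)
    show "\<sigma> \<circ> \<tau> permutes {1..4}" using that klein4_permutes permutes_compose by blast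
    show "{(\<sigma> \<circ> \<tau>) 1, (\<sigma> \<circ> \<tau>) 2} \<in> {{1, 2}, {3, 4}}" "{(\<sigma> \<circ> \<tau>) 1, (\<sigma> \<circ> \<tau>) 3} \<in> {{1, 3}, {2, 4}}"
      "{(\<sigma> \<circ> \<tau>) 1, (\<sigma> \<circ> \<tau>) 4} \<in> {{1, 4}, {2, 3}}"
      using klein4_values[OF that(1)] klein4_values[OF that(2)] by (elim disjE; simp add: insert_commute)+
  qed
  show "\<tau> \<circ> \<sigma> \<circ> inv' \<tau> \<in> klein4" if \<tau>: "\<tau> permutes {1..4}" and "\<sigma> \<in> klein4" for \<tau> \<sigma>
  proof -
    have \<sigma>: "\<sigma> permutes {1..4}" "pair_stable \<sigma> {1..4}" using that klein4_iff by auto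
    note pi = permutes_inv[OF \<tau>]
    have "(\<tau> \<circ> \<sigma> \<circ> inv' \<tau>) ` {a, b} = {a, b} \<or> (\<tau> \<circ> \<sigma> \<circ> inv' \<tau>) ` {a, b} \<inter> {a, b} = {}"
      if "a \<in> {1..4}" "b \<in> {1..4}" "a \<noteq> b" for a b
    proof -
      let ?a = "inv' \<tau> a" and ?b = "inv' \<tau> b"
      have ab: "\<tau> ` {?a, ?b} = {a, b}" using permutes_inverses(1)[OF \<tau>] by simp
      have eq: "(\<tau> \<circ> \<sigma> \<circ> inv' \<tau>) ` {a, b} = \<tau> ` (\<sigma> ` {?a, ?b})" by simp
      have "?a \<in> {1..4}" "?b \<in> {1..4}" "?a \<noteq> ?b"
        using that permutes_in_image[OF pi] permutes_inj[OF pi] by (auto dest: injD)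
      then have "\<sigma> ` {?a, ?b} = {?a, ?b} \<or> \<sigma> ` {?a, ?b} \<inter> {?a, ?b} = {}" using \<sigma>(2) unfolding pair_stable_def by blast
      then show ?thesis
      proof
        assume "\<sigma> ` {?a, ?b} = {?a, ?b}"
        then have "\<tau> ` (\<sigma> ` {?a, ?b}) = {a, b}" by (simp only: ab)
        then show ?thesis unfolding eq by blast
      next
        assume "\<sigma> ` {?a, ?b} \<inter> {?a, ?b} = {}"
        then have "\<tau> ` (\<sigma> ` {?a, ?b}) \<inter> \<tau> ` {?a, ?b} = {}"
          using image_Int[OF permutes_inj[OF \<tau>], of "\<sigma> ` {?a, ?b}" "{?a, ?b}"] by simp
        then have "\<tau> ` (\<sigma> ` {?a, ?b}) \<inter> {a, b} = {}" by (simp only: ab)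
        then show ?thesis unfolding eq by blast
      qed
    qed
    then show ?thesis
      using permutes_compose[OF permutes_compose[OF pi \<sigma>(1)] \<tau>]
      unfolding klein4_iff pair_stable_def by (simp add: comp_assoc)
  qed
  have invol: "\<sigma> \<circ> \<sigma> = id" if "\<sigma> \<in> klein4" for \<sigma>
    using that unfolding klein4_simps by (auto simp: fun_eq_iff transpose_def)
  show "inv' \<sigma> \<in> klein4" if "\<sigma> \<in> klein4" for \<sigma>
    using inv_unique_comp[OF invol[OF that] invol[OF that]] that by simp
qed

section \<open>Normal subgroups and three-cycles\<close>

lemma finite_ex_notin: "\<exists>c \<in> {1..q :: nat}. c \<notin> set xs" if "length xs < q"
proof -
  have "card (set xs) < card {1..q}" using that card_length[of xs] by simp
  then have "\<not> {1..q} \<subseteq> set xs" using card_mono[of "set xs" "{1..q}"] by auto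
  then show ?thesis by blast
qed

context
  fixes N q assumes N: "N \<lhd> sym_group q"
begin

text \<open>This is the commutator of \<open>\<sigma>\<close> with the transposition of
  \<open>a\<close> and \<open>b\<close>: the conjugate transposition times the original one.\<close>

lemma normal_commutator:
  assumes \<sigma>: "\<sigma> \<in> N" and ab: "a \<in> {1..q}" "b \<in> {1..q}"
  shows "transpose (\<sigma> a) (\<sigma> b) \<circ> transpose a b \<in> N"
proof -
  note p = normal_permutes[OF N \<sigma>]
  let ?t = "transpose a b"
  have t: "?t permutes {1..q}" using ab by (rule permutes_swap_id)
  have "?t \<circ> inv' \<sigma> \<circ> inv' ?t \<in> N" using normal_conj[OF N t normal_inv[OF N \<sigma>]] .
  then have "\<sigma> \<circ> (?t \<circ> inv' \<sigma> \<circ> ?t) \<in> N" using normal_comp[OF N \<sigma>] by simp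
  moreover have "\<sigma> \<circ> (?t \<circ> inv' \<sigma> \<circ> ?t) = (\<sigma> \<circ> ?t \<circ> inv' \<sigma>) \<circ> ?t" by (simp add: comp_assoc)
  ultimately show ?thesis using conj_transpose[OF p] by simp
qed

text \<open>Choose the transposition so that it shares one point with its conjugate, for then their
  product is a three-cycle: use \<open>a\<close> and \<open>\<sigma> a\<close> if
  \<open>\<sigma>\<close> does not return to \<open>a\<close> after two steps, and \<open>a\<close>
  and a fixed point otherwise.\<close>

lemma normal_three_cycle_of_fixed:
  assumes \<sigma>: "\<sigma> \<in> N" and a: "\<sigma> a \<noteq> a" and "\<sigma> (\<sigma> a) \<noteq> a \<or> (\<exists>b \<in> {1..q}. \<sigma> b = b)"
  shows "\<exists>a b c. distinct [a, b, c] \<and> {a, b, c} \<subseteq> {1..q} \<and> three_cycle a b c \<in> N"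
proof -
  note p = normal_permutes[OF N \<sigma>]
  have inj: "\<sigma> x = \<sigma> y \<longleftrightarrow> x = y" for x y using permutes_inj[OF p] by (auto dest: injD)
  have aq: "a \<in> {1..q}" using a permutes_not_in[OF p] by blast
  have sq: "\<sigma> x \<in> {1..q} \<longleftrightarrow> x \<in> {1..q}" for x using permutes_in_image[OF p] .
  show ?thesis
  proof (cases "\<sigma> (\<sigma> a) = a")
    case False
    have "transpose (\<sigma> (\<sigma> a)) (\<sigma> a) \<circ> transpose (\<sigma> a) a \<in> N"
      using normal_commutator[OF \<sigma> aq, of "\<sigma> a"] sq aq by (simp add: transpose_commute)
    moreover have "distinct [\<sigma> (\<sigma> a), \<sigma> a, a]" using a False inj by auto
    moreover have "{\<sigma> (\<sigma> a), \<sigma> a, a} \<subseteq> {1..q}" using sq aq by auto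
    ultimately show ?thesis by blast
  next
    case True
    then obtain b where b: "b \<in> {1..q}" "\<sigma> b = b" using assms(3) by blast
    have "transpose (\<sigma> a) b \<circ> transpose b a \<in> N"
      using normal_commutator[OF \<sigma> aq b(1)] b(2) by (simp add: transpose_commute)
    moreover have "distinct [\<sigma> a, b, a]" using a b inj by auto
    moreover have "{\<sigma> a, b, a} \<subseteq> {1..q}" using sq aq b by auto
    ultimately show ?thesis by blast
  qed
qed

text \<open>If the previous lemma does not apply, \<open>\<sigma>\<close> is an involution without
  fixed points on \<open>{1..q}\<close>. For \<open>q = 4\<close> it is then in
  \<open>klein4\<close>; for larger \<open>q\<close> its commutator with a transposition is a double
  transposition, which fixes a fifth point and so falls under that lemma.\<close>

lemma normal_three_cycle:
  assumes q: "q \<ge> 3" and ne: "N \<noteq> {id}" and K: "q = 4 \<Longrightarrow> \<not> N \<subseteq> klein4"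
  shows "\<exists>a b c. distinct [a, b, c] \<and> {a, b, c} \<subseteq> {1..q} \<and> three_cycle a b c \<in> N"
proof -
  obtain \<sigma> where \<sigma>: "\<sigma> \<in> N" "\<sigma> \<noteq> id" "q = 4 \<Longrightarrow> \<sigma> \<notin> klein4"
  proof (cases "q = 4")
    case True
    then obtain \<sigma> where "\<sigma> \<in> N" "\<sigma> \<notin> klein4" using K by blast
    then show thesis using that by (auto simp: klein4_simps)
  next
    case False
    then show thesis using that ne normal_id[OF N] by blast
  qed
  note p = normal_permutes[OF N \<sigma>(1)]
  have inj: "\<sigma> x = \<sigma> y \<longleftrightarrow> x = y" for x y using permutes_inj[OF p] by (auto dest: injD)
  have sq: "\<sigma> x \<in> {1..q} \<longleftrightarrow> x \<in> {1..q}" for x using permutes_in_image[OF p] .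
  obtain a where a: "\<sigma> a \<noteq> a" using \<sigma>(2) by (auto simp: fun_eq_iff)
  have aq: "a \<in> {1..q}" using a permutes_not_in[OF p] by blast
  show ?thesis
  proof (cases "\<exists>a. \<sigma> a \<noteq> a \<and> (\<sigma> (\<sigma> a) \<noteq> a \<or> (\<exists>b \<in> {1..q}. \<sigma> b = b))")
    case True
    then show ?thesis using normal_three_cycle_of_fixed[OF \<sigma>(1)] by blast
  next
    case False
    then have nofix: "\<sigma> b \<noteq> b" if "b \<in> {1..q}" for b using a that by blast
    then have invol: "\<sigma> (\<sigma> b) = b" if "b \<in> {1..q}" for b using False that by blast
    obtain b where b: "b \<in> {1..q}" "b \<noteq> a" "b \<noteq> \<sigma> a" using finite_ex_notin[of "[a, \<sigma> a]" q] q by auto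
    have d: "distinct [a, b, \<sigma> a, \<sigma> b]"
      using a b nofix[OF b(1)] inj invol[OF aq] invol[OF b(1)] by auto
    have sub: "{a, b, \<sigma> a, \<sigma> b} \<subseteq> {1..q}" using aq b sq by auto
    have "card {a, b, \<sigma> a, \<sigma> b} = 4" using d by simp
    then have q4: "q \<ge> 4" using card_mono[OF _ sub] by simp
    show ?thesis
    proof (cases "q = 4")
      case True
      have s: "{\<sigma> 1, \<sigma> x} \<in> {{1, x}, {y, z}}" if xyz: "{1, x, y, z} = {1..4}" "distinct [1, x, y, z]" for x y z
      proof -
        have m: "1 \<in> {1..q}" "x \<in> {1..q}" "y \<in> {1..q}" "z \<in> {1..q}" using xyz(1) True by auto
        have "\<sigma> 1 \<in> {1, x, y, z}" "\<sigma> x \<in> {1, x, y, z}" using sq[of 1] sq[of x] m xyz(1) True by auto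
        moreover have "\<sigma> 1 \<noteq> \<sigma> x" "\<sigma> 1 \<noteq> 1" "\<sigma> x \<noteq> x" using inj[of 1 x] xyz(2) nofix[OF m(1)] nofix[OF m(2)] by auto
        moreover have "\<sigma> 1 = x \<longleftrightarrow> \<sigma> x = 1" using invol[OF m(1)] invol[OF m(2)] by metis
        ultimately show ?thesis by auto
      qed
      have "{1, 2, 3, 4} = {1, 3, 2, 4 :: nat}" "{1, 2, 3, 4} = {1, 4, 2, 3 :: nat}" by auto
      then have "\<sigma> \<in> klein4"
        using p True s[of 2 3 4] s[of 3 2 4] s[of 4 2 3] atLeastAtMost_4 by (intro klein4I) simp_all
      then show ?thesis using \<sigma> True by blast
    next
      case False
      let ?\<tau> = "transpose (\<sigma> a) (\<sigma> b) \<circ> transpose a b"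
      have \<tau>: "?\<tau> \<in> N" using normal_commutator[OF \<sigma>(1) aq b(1)] .
      obtain c where c: "c \<in> {1..q}" "c \<notin> {a, b, \<sigma> a, \<sigma> b}"
        using finite_ex_notin[of "[a, b, \<sigma> a, \<sigma> b]" q] q4 False by auto
      have "?\<tau> c = c" "?\<tau> a \<noteq> a" using c d by (auto simp: transpose_def)
      then show ?thesis using normal_three_cycle_of_fixed[OF \<tau>] c(1) by blast
    qed
  qed
qed

text \<open>Three-cycles are conjugate in the symmetric group and generate the alternating group, so
  one of them suffices.\<close>

lemma alt_group_le_normal:
  assumes "q \<ge> 3" "N \<noteq> {id}" "q = 4 \<Longrightarrow> \<not> N \<subseteq> klein4"
  shows "carrier (alt_group q) \<subseteq> N"
proof -
  obtain a b c where abc: "distinct [a, b, c]" "{a, b, c} \<subseteq> {1..q}" "three_cycle a b c \<in> N"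
    using normal_three_cycle[OF assms] by blast
  have cyc: "\<sigma> \<in> N" if "\<sigma> \<in> three_cycles q" for \<sigma>
  proof -
    obtain a' b' c' where abc': "\<sigma> = three_cycle a' b' c'" "distinct [a', b', c']" "{a', b', c'} \<subseteq> {1..q}"
      using \<open>\<sigma> \<in> three_cycles q\<close> unfolding three_cycles_eq by blast
    obtain \<tau> where \<tau>: "\<tau> permutes {1..q}" "\<tau> a = a'" "\<tau> b = b'" "\<tau> c = c'"
      using ex_permutes_three[OF abc(1,2) abc'(2,3)] by blast
    then show ?thesis using normal_conj[OF N \<tau>(1) abc(3)] conj_three_cycle[OF \<tau>(1)] abc'(1) by simp
  qed
  show ?thesis
  proof
    fix \<sigma> assume "\<sigma> \<in> carrier (alt_group q)"
    then have "\<sigma> \<in> generate (alt_group q) (three_cycles q)" using alt_group_carrier_as_three_cycles by simp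
    then show "\<sigma> \<in> N"
    proof induction
      case one
      show ?case unfolding alt_group_one by (rule normal_id[OF N])
    next
      case (incl h)
      then show ?case by (rule cyc)
    next
      case (inv h)
      then have "h \<in> carrier (alt_group q)" using three_cycles_incl by blast
      then show ?case using normal_inv[OF N cyc[OF inv]] alt_group_inv_equality by simp
    next
      case (eng h1 h2)
      show ?case unfolding alt_group_mult by (rule normal_comp[OF N eng(3,4)])
    qed
  qed
qed

lemma normal_ge_alt: "N = carrier (alt_group q) \<or> N = carrier (sym_group q)" if A: "carrier (alt_group q) \<subseteq> N"
proof (cases "N \<subseteq> carrier (alt_group q)")
  case False
  then obtain \<tau> where "\<tau> \<in> N" "\<tau> \<notin> carrier (alt_group q)" by blast
  then have \<tau>: "\<tau> \<in> N" "\<not> evenperm \<tau>" using normal_permutes[OF N] by (auto simp: alt_group_carrier)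
  have perm: "permutation \<sigma>" if "\<sigma> permutes {1..q}" for \<sigma> using that by (auto simp: permutation_permutes)
  note p = normal_permutes[OF N \<tau>(1)]
  have "\<sigma> \<in> N" if \<sigma>: "\<sigma> permutes {1..q}" for \<sigma>
  proof (cases "evenperm \<sigma>")
    case True
    then show ?thesis using A \<sigma> by (auto simp: alt_group_carrier)
  next
    case False
    have pi: "inv' \<tau> permutes {1..q}" using permutes_inv[OF p] .
    have "evenperm (inv' \<tau> \<circ> \<sigma>)"
      using evenperm_comp[OF perm[OF pi] perm[OF \<sigma>]] evenperm_inv[OF perm[OF p]] \<tau> False by simp
    then have "inv' \<tau> \<circ> \<sigma> \<in> N" using A permutes_compose[OF \<sigma> pi] by (auto simp: alt_group_carrier)
    then have "\<tau> \<circ> (inv' \<tau> \<circ> \<sigma>) \<in> N" using normal_comp[OF N \<tau>(1)] by simp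
    then show ?thesis using permutes_inv_o(1)[OF p] by (simp add: comp_assoc[symmetric])
  qed
  then show ?thesis using normal_permutes[OF N] by (auto simp: sym_group_carrier)
qed (use A in blast)

end

lemma alt_normal: "carrier (alt_group q) \<lhd> sym_group q"
proof -
  have perm: "permutation \<sigma>" if "\<sigma> permutes {1..q}" for \<sigma> using that by (auto simp: permutation_permutes)
  show ?thesis
    unfolding normal_sym_group_iff
  proof (intro conjI ballI allI impI)
    show "\<tau> \<circ> \<sigma> \<circ> inv' \<tau> \<in> carrier (alt_group q)" if \<tau>: "\<tau> permutes {1..q}" and "\<sigma> \<in> carrier (alt_group q)" for \<tau> \<sigma>
    proof -
      have \<sigma>: "\<sigma> permutes {1..q}" "evenperm \<sigma>" using that by (auto simp: alt_group_carrier)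
      note pi = permutes_inv[OF \<tau>]
      have "evenperm (\<tau> \<circ> \<sigma> \<circ> inv' \<tau>)"
        using evenperm_comp[OF perm[OF permutes_compose[OF \<sigma>(1) \<tau>]] perm[OF pi]]
          evenperm_comp[OF perm[OF \<tau>] perm[OF \<sigma>(1)]] evenperm_inv[OF perm[OF \<tau>]] \<sigma>(2) by auto
      then show ?thesis
        using permutes_compose[OF pi permutes_compose[OF \<sigma>(1) \<tau>]] by (simp add: alt_group_carrier)
    qed
  qed (auto simp: alt_group_carrier permutes_id permutes_compose permutes_inv evenperm_comp evenperm_inv perm)
qed

lemma sym_normal: "carrier (sym_group q) \<lhd> sym_group q"
  unfolding normal_sym_group_iff
  by (auto simp: sym_group_carrier permutes_id permutes_compose permutes_inv)

lemma trivial_normal: "{id} \<lhd> sym_group q"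
  unfolding normal_sym_group_iff using permutes_inv_o(1) by (auto simp: permutes_id)

lemma alt_ne_trivial: "carrier (alt_group q) \<noteq> {id}" if "q \<ge> 3"
proof -
  have "three_cycle 1 2 3 \<in> three_cycles q" unfolding three_cycles_eq using that by force
  then have "three_cycle 1 2 3 \<in> carrier (alt_group q)" using three_cycles_incl by blast
  moreover have "three_cycle 1 2 3 \<noteq> id"
  proof
    assume "three_cycle 1 2 3 = id"
    then have "three_cycle 1 2 3 3 = id 3" by (rule arg_cong)
    then show False by (simp add: transpose_def)
  qed
  ultimately show ?thesis by blast
qed

lemma alt_psubset_sym: "carrier (alt_group q) \<subset> carrier (sym_group q)" if "q \<ge> 2"
proof -
  have "transpose 1 2 \<in> carrier (sym_group q)" using that by (simp add: sym_group_carrier permutes_swap_id)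
  moreover have "transpose 1 2 \<notin> carrier (alt_group q)" by (simp add: alt_group_carrier evenperm_swap)
  moreover have "carrier (alt_group q) \<subseteq> carrier (sym_group q)" by (auto simp: alt_group_carrier sym_group_carrier)
  ultimately show ?thesis by blast
qed

lemma klein4_psubset_alt: "klein4 \<subset> carrier (alt_group 4)"
proof -
  have "klein4 \<subseteq> carrier (alt_group 4)"
  proof
    fix \<sigma> :: "nat \<Rightarrow> nat" assume \<sigma>: "\<sigma> \<in> klein4"
    have "evenperm \<sigma>"
      using \<sigma> unfolding klein4_simps
      by (elim disjE) (simp_all add: evenperm_comp permutation_swap_id evenperm_swap del: o_apply)
    then show "\<sigma> \<in> carrier (alt_group 4)" using klein4_permutes[OF \<sigma>] by (simp add: alt_group_carrier)
  qed
  moreover have "three_cycle 1 2 3 \<in> three_cycles 4" unfolding three_cycles_eq by force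
  then have "three_cycle 1 2 3 \<in> carrier (alt_group 4)" using three_cycles_incl by blast
  moreover have "three_cycle 1 2 3 \<notin> klein4"
  proof
    assume "three_cycle 1 2 3 \<in> klein4"
    from klein4_values[OF this] show False by (simp add: transpose_def)
  qed
  ultimately show ?thesis by blast
qed

lemma klein4_ne_trivial: "klein4 \<noteq> {id}"
proof -
  have "transpose 1 2 \<circ> transpose 3 4 \<in> klein4" by (simp add: klein4_simps)
  moreover have "transpose 1 2 \<circ> transpose 3 4 \<noteq> (id :: nat \<Rightarrow> nat)"
  proof
    assume "transpose 1 2 \<circ> transpose 3 4 = (id :: nat \<Rightarrow> nat)"
    then have "(transpose 1 2 \<circ> transpose 3 4) (1 :: nat) = id 1" by (rule arg_cong)
    then show False by (simp add: transpose_def)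
  qed
  ultimately show ?thesis by blast
qed

text \<open>The three double transpositions are conjugate, so a normal subgroup contains all or none
  of them.\<close>

lemma normal_le_klein4: "N = {id} \<or> N = klein4" if N: "N \<lhd> sym_group 4" and K: "N \<subseteq> klein4"
proof (rule disjCI)
  let ?a = "transpose 1 2 \<circ> transpose 3 4" and ?b = "transpose 1 3 \<circ> transpose 2 4" and ?c = "transpose 1 4 \<circ> transpose 2 3"
  assume "N \<noteq> klein4"
  show "N = {id}"
  proof (rule ccontr)
    assume "N \<noteq> {id}"
    then obtain \<sigma> where \<sigma>: "\<sigma> \<in> N" "\<sigma> \<noteq> id" using normal_id[OF N] by blast
    have p: "transpose 2 3 permutes {1..4 :: nat}" "transpose 2 4 permutes {1..4 :: nat}"
      "transpose 3 4 permutes {1..4 :: nat}" by (auto intro!: permutes_swap_id)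
    have conj: "transpose (\<tau> a) (\<tau> b) \<circ> transpose (\<tau> c) (\<tau> d) \<in> N"
      if "transpose a b \<circ> transpose c d \<in> N" "\<tau> permutes {1..4}" for \<tau> a b c d
      using normal_conj[OF N that(2,1)] conj_transpose2[OF that(2)] by simp
    have ab: "?b \<in> N" "?c \<in> N" if "?a \<in> N"
      using conj[OF that p(1)] conj[OF that p(2)] by (auto simp: transpose_def[of "2::nat"] transpose_commute)
    have ba: "?a \<in> N" if "?b \<in> N"
      using conj[OF that p(1)] by (auto simp: transpose_def[of "2::nat"] transpose_commute)
    have ca: "?a \<in> N" if "?c \<in> N"
      using conj[OF that p(2)] by (auto simp: transpose_def[of "2::nat"] transpose_commute)
    have "\<sigma> = ?a \<or> \<sigma> = ?b \<or> \<sigma> = ?c" using \<sigma> K unfolding klein4_simps[symmetric] by (auto simp: klein4_simps)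
    then have "?a \<in> N" using \<sigma>(1) ba ca by auto
    then have "klein4 \<subseteq> N" using ab normal_id[OF N] by (auto simp: klein4_simps)
    then show False using K \<open>N \<noteq> klein4\<close> by blast
  qed
qed

lemma normal_sym_2: "N = {id} \<or> N = carrier (sym_group 2)" if N: "N \<lhd> sym_group 2"
proof (rule disjCI)
  have two: "\<sigma> = id \<or> \<sigma> = transpose 1 2" if p: "\<sigma> permutes {1..2 :: nat}" for \<sigma>
  proof -
    have st: "{1..2 :: nat} = {1, 2}" by auto
    have "\<sigma> 1 \<in> {1, 2}" "\<sigma> 2 \<in> {1, 2}" "\<sigma> 1 \<noteq> \<sigma> 2"
      using permutes_in_image[OF p] permutes_inj[OF p] unfolding st by (auto dest: injD)
    then consider "\<sigma> 1 = 1" "\<sigma> 2 = 2" | "\<sigma> 1 = 2" "\<sigma> 2 = 1" by auto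
    moreover have other: "\<sigma> x = x" if "x \<noteq> 1" "x \<noteq> 2" for x using permutes_not_in[OF p[unfolded st], of x] that by simp
    ultimately show ?thesis
    proof cases
      case 1
      have "\<sigma> x = x" for x using 1 other by (cases "x = 1 \<or> x = 2") auto
      then show ?thesis by auto
    next
      case 2
      have "\<sigma> x = transpose 1 2 x" for x using 2 other by (cases "x = 1 \<or> x = 2") auto
      then show ?thesis by blast
    qed
  qed
  assume "N \<noteq> carrier (sym_group 2)"
  show "N = {id}"
  proof (rule ccontr)
    assume "N \<noteq> {id}"
    then obtain \<sigma> where \<sigma>: "\<sigma> \<in> N" "\<sigma> \<noteq> id" using normal_id[OF N] by blast
    then have "transpose 1 2 \<in> N" using two normal_permutes[OF N] by blast
    then have "carrier (sym_group 2) \<subseteq> N" using two normal_id[OF N] by (metis subsetI sym_group_carrier)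
    then show False using \<open>N \<noteq> carrier (sym_group 2)\<close> normal_permutes[OF N] by (auto simp: sym_group_carrier)
  qed
qed

lemma sym_ne_trivial: "carrier (sym_group q) \<noteq> {id}" if "q \<ge> 2"
proof -
  have "transpose 1 2 \<in> carrier (sym_group q)" using that by (simp add: sym_group_carrier permutes_swap_id)
  moreover have "transpose 1 (2 :: nat) \<noteq> id" by (simp add: transpose_eq_id_iff)
  ultimately show ?thesis by blast
qed

end

context brauer_monoid
begin

section \<open>Ideals, Green's relations and retractions\<close>

lemma rank_ideal_iff: "\<alpha> \<in> rank_ideal n q \<longleftrightarrow> \<alpha> \<in> B \<and> rank \<alpha> \<le> q"
  by (simp add: rank_ideal_def)

lemma ranks_iff: "q \<in> ranks (n mod 2) n \<longleftrightarrow> q \<le> n \<and> q mod 2 = n mod 2"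
  unfolding ranks_def using mod_less_eq_dividend[of q 2] by auto

lemma rank_ideal_ideal: "semigroup_ideal (brauer n) (rank_ideal n q)" if "q \<in> ranks (n mod 2) n"
proof -
  have "rank_ideal n q \<noteq> {}" using ex_rank[of q] that by (auto simp: ranks_iff rank_ideal_def)
  moreover have "s \<bullet> x \<in> rank_ideal n q" "x \<bullet> s \<in> rank_ideal n q" if "x \<in> rank_ideal n q" "s \<in> B" for x s
    using that rank_mult_left[of x s] rank_mult_right[of s x] mult_closed by (auto simp: rank_ideal_iff)
  ultimately show ?thesis by (auto simp: semigroup_ideal_def rank_ideal_iff)
qed

text \<open>An ideal is determined by the largest rank in it, since by \<open>two_sided_eq\<close>
  one element of that rank generates all elements of smaller or equal rank.\<close>

lemma ideal_iff: "semigroup_ideal (brauer n) I \<longleftrightarrow> (\<exists>q \<in> ranks (n mod 2) n. I = rank_ideal n q)"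
proof
  assume I: "semigroup_ideal (brauer n) I"
  then have ne: "I \<noteq> {}" and sub: "I \<subseteq> B" and cl: "\<And>x s. x \<in> I \<Longrightarrow> s \<in> B \<Longrightarrow> s \<bullet> x \<in> I \<and> x \<bullet> s \<in> I"
    by (auto simp: semigroup_ideal_def)
  define q where "q = Max (rank ` I)"
  have "rank ` I \<subseteq> {..n}" using sub rank_le by auto
  then have fin: "finite (rank ` I)" by (rule finite_subset) simp
  have "q \<in> rank ` I" unfolding q_def using fin ne by (intro Max_in) auto
  then obtain a where a: "a \<in> I" "rank a = q" by auto
  have le: "rank x \<le> q" if "x \<in> I" for x unfolding q_def using fin that by (intro Max_ge) auto
  have "rank_ideal n q \<subseteq> I"
  proof
    fix x assume "x \<in> rank_ideal n q"
    then have "x \<in> two_sided (brauer n) a" using two_sided_eq[of a] a sub by (auto simp: rank_ideal_iff)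
    then obtain s t where "x = s \<bullet> a \<bullet> t" "s \<in> B" "t \<in> B" by (auto simp: two_sided_def)
    then show "x \<in> I" using cl a by simp
  qed
  then have "I = rank_ideal n q" using le sub by (auto simp: rank_ideal_iff)
  moreover have "q \<in> ranks (n mod 2) n" using a sub rank_le rank_mod by (auto simp: ranks_iff)
  ultimately show "\<exists>q \<in> ranks (n mod 2) n. I = rank_ideal n q" by blast
qed (use rank_ideal_ideal in blast)

lemma min_rank_in_ranks: "n mod 2 \<in> ranks (n mod 2) n"
  by (simp add: ranks_iff)

lemma ranks_ge: "n mod 2 \<le> q" if "q \<in> ranks (n mod 2) n"
  using that by (simp add: ranks_def)

lemma minimal_ideal_eq: "minimal_ideal (brauer n) = rank_ideal n (n mod 2)"
  unfolding minimal_ideal_def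
proof (rule the_equality)
  let ?M = "rank_ideal n (n mod 2)"
  have least: "?M \<subseteq> I" if "semigroup_ideal (brauer n) I" for I
    using that ranks_ge unfolding ideal_iff by (auto simp: rank_ideal_def intro: order_trans)
  note M = rank_ideal_ideal[OF min_rank_in_ranks]
  show "semigroup_ideal (brauer n) ?M \<and> (\<forall>I. semigroup_ideal (brauer n) I \<and> I \<subseteq> ?M \<longrightarrow> I = ?M)"
    using M least by blast
  show "M = ?M" if "semigroup_ideal (brauer n) M \<and> (\<forall>I. semigroup_ideal (brauer n) I \<and> I \<subseteq> M \<longrightarrow> I = M)" for M
    using that M least by blast
qed

lemma minimal_ideal_iff: "x \<in> minimal_ideal (brauer n) \<longleftrightarrow> x \<in> B \<and> rank x = n mod 2"
  unfolding minimal_ideal_eq rank_ideal_iff using rank_ge by (auto intro: le_antisym)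

lemma greenR_iff: "(a, b) \<in> greenR (brauer n) \<longleftrightarrow> a \<in> B \<and> b \<in> B \<and> up a = up b"
proof -
  have le: "up b \<subseteq> up a" if "a \<in> B" "b \<in> B" "{a \<bullet> t | t. t \<in> B} \<subseteq> {b \<bullet> t | t. t \<in> B}" for a b
  proof -
    have "a \<bullet> \<one>\<^bsub>brauer n\<^esub> \<in> {a \<bullet> t | t. t \<in> B}" by (intro CollectI exI conjI) (rule refl, simp)
    then have "a \<bullet> \<one>\<^bsub>brauer n\<^esub> \<in> {b \<bullet> t | t. t \<in> B}" by (rule subsetD[OF that(3)])
    then have "a \<in> {b \<bullet> t | t. t \<in> B}" unfolding one_right[OF that(1)] .
    then obtain t where "a = b \<bullet> t" "t \<in> B" by blast
    then show ?thesis using mult_upper that by blast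
  qed
  have ge: "{a \<bullet> t | t. t \<in> B} \<subseteq> {b \<bullet> t | t. t \<in> B}" if ab: "a \<in> B" "b \<in> B" "up a = up b" for a b
  proof
    fix x assume "x \<in> {a \<bullet> t | t. t \<in> B}"
    then obtain t where t: "x = a \<bullet> t" "t \<in> B" by blast
    obtain w where w: "w \<in> B" "a = b \<bullet> w" using up_eq_factor[OF ab(2,1) ab(3)[symmetric]] by blast
    then have "x = b \<bullet> (w \<bullet> t)" "w \<bullet> t \<in> B" using t ab mult_assoc mult_closed by auto
    then show "x \<in> {b \<bullet> t | t. t \<in> B}" by blast
  qed
  have "{a \<bullet> t | t. t \<in> B} = {b \<bullet> t | t. t \<in> B} \<longleftrightarrow> up a = up b" if ab: "a \<in> B" "b \<in> B"
  proof
    assume e: "{a \<bullet> t | t. t \<in> B} = {b \<bullet> t | t. t \<in> B}"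
    show "up a = up b" using le[OF ab equalityD1[OF e]] le[OF ab(2,1) equalityD2[OF e]] by blast
  next
    assume e: "up a = up b"
    show "{a \<bullet> t | t. t \<in> B} = {b \<bullet> t | t. t \<in> B}" using ge[OF ab e] ge[OF ab(2,1) e[symmetric]] by (rule subset_antisym)
  qed
  then show ?thesis unfolding greenR_def by blast
qed

lemma greenL_iff: "(a, b) \<in> greenL (brauer n) \<longleftrightarrow> a \<in> B \<and> b \<in> B \<and> low a = low b"
proof -
  have le: "low b \<subseteq> low a" if "a \<in> B" "b \<in> B" "{s \<bullet> a | s. s \<in> B} \<subseteq> {s \<bullet> b | s. s \<in> B}" for a b
  proof -
    have "\<one>\<^bsub>brauer n\<^esub> \<bullet> a \<in> {s \<bullet> a | s. s \<in> B}" by (intro CollectI exI conjI) (rule refl, simp)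
    then have "\<one>\<^bsub>brauer n\<^esub> \<bullet> a \<in> {s \<bullet> b | s. s \<in> B}" by (rule subsetD[OF that(3)])
    then have "a \<in> {s \<bullet> b | s. s \<in> B}" unfolding one_left[OF that(1)] .
    then obtain s where "a = s \<bullet> b" "s \<in> B" by blast
    then show ?thesis using mult_lower that by blast
  qed
  have ge: "{s \<bullet> a | s. s \<in> B} \<subseteq> {s \<bullet> b | s. s \<in> B}" if ab: "a \<in> B" "b \<in> B" "low a = low b" for a b
  proof
    fix x assume "x \<in> {s \<bullet> a | s. s \<in> B}"
    then obtain s where s: "x = s \<bullet> a" "s \<in> B" by blast
    obtain w where w: "w \<in> B" "star a = star b \<bullet> w" using up_eq_factor[of "star b" "star a"] ab star_closed up_star by metis
    have "a = star w \<bullet> b" using star_mult[of "star b" w] w ab by (metis star_closed star_star)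
    then have "x = (s \<bullet> star w) \<bullet> b" "s \<bullet> star w \<in> B" using s w ab mult_assoc mult_closed by auto
    then show "x \<in> {s \<bullet> b | s. s \<in> B}" by blast
  qed
  have "{s \<bullet> a | s. s \<in> B} = {s \<bullet> b | s. s \<in> B} \<longleftrightarrow> low a = low b" if ab: "a \<in> B" "b \<in> B"
  proof
    assume e: "{s \<bullet> a | s. s \<in> B} = {s \<bullet> b | s. s \<in> B}"
    show "low a = low b" using le[OF ab equalityD1[OF e]] le[OF ab(2,1) equalityD2[OF e]] by blast
  next
    assume e: "low a = low b"
    show "{s \<bullet> a | s. s \<in> B} = {s \<bullet> b | s. s \<in> B}" using ge[OF ab e] ge[OF ab(2,1) e[symmetric]] by (rule subset_antisym)
  qed
  then show ?thesis unfolding greenL_def by blast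
qed

text \<open>\<open>x \<bullet> m\<close> and \<open>m \<bullet> x\<close> are minimal, hence fixed
  by \<open>f\<close>; multiplicativity then determines both patterns of \<open>f x\<close>. This is
  the uniqueness of the retraction, and it leaves \<open>the_retraction\<close> no freedom on the
  ideal.\<close>

lemma retraction_facts:
  assumes f: "retraction (brauer n) (rank_ideal n r) f" and x: "x \<in> B" "rank x \<le> r" and m: "m \<in> B" "rank m = n mod 2"
    and r: "n mod 2 \<le> r"
  shows "f x \<in> B" "rank (f x) = n mod 2" "up (f x) = up (x \<bullet> m)" "low (f x) = low (m \<bullet> x)"
proof -
  have hom: "f x \<in> minimal_ideal (brauer n)" "f (x \<bullet> y) = f x \<bullet> f y"
    if "x \<in> rank_ideal n r" "y \<in> rank_ideal n r" for x y
    using f that unfolding retraction_def hom_def by auto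
  have fixed: "f y = y" if "y \<in> B" "rank y = n mod 2" for y
    using f that minimal_ideal_iff unfolding retraction_def by auto
  have xI: "x \<in> rank_ideal n r" and mI: "m \<in> rank_ideal n r" using x m r by (auto simp: rank_ideal_iff)
  show 1: "f x \<in> B" "rank (f x) = n mod 2" using hom(1)[OF xI xI] by (auto simp: minimal_ideal_iff)
  have "f (x \<bullet> m) = x \<bullet> m" "f (m \<bullet> x) = m \<bullet> x"
    using fixed min_mult_right[OF x(1) m] min_mult_left[OF m(1) x(1) m(2)] mult_closed x m by auto
  then have "x \<bullet> m = f x \<bullet> m" "m \<bullet> x = m \<bullet> f x" using hom(2)[OF xI mI] hom(2)[OF mI xI] fixed[OF m] by auto
  then show "up (f x) = up (x \<bullet> m)" "low (f x) = low (m \<bullet> x)"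
    using min_mult_left[OF 1(1) m(1) 1(2)] min_mult_right[OF m(1) 1] by auto
qed

text \<open>By \<open>retraction_facts\<close> every retraction must produce these patterns, and
  \<open>min_eqI\<close> leaves only one diagram with them.\<close>

definition retract :: "diagram \<Rightarrow> diagram" where
  "retract \<alpha> = (SOME x. x \<in> B \<and> up x = uh \<alpha> \<and> low x = lh \<alpha>)"

lemma retract_facts:
  assumes \<alpha>: "\<alpha> \<in> B" "rank \<alpha> \<le> 2"
  shows "retract \<alpha> \<in> B" "up (retract \<alpha>) = uh \<alpha>" "low (retract \<alpha>) = lh \<alpha>" "rank (retract \<alpha>) = n mod 2"
proof -
  have s: "rank (star \<alpha>) \<le> 2" using \<alpha> by simp
  note u = uh_facts[OF \<alpha>] and l = uh_facts[OF star_closed[OF \<alpha>(1)] s, folded lh_def]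
  have "card (uh \<alpha>) = card (lh \<alpha>)" using card_rest[OF u(1)] card_rest[OF l(1)] u(3) l(3) by presburger
  then obtain x where "x \<in> B \<and> up x = uh \<alpha> \<and> low x = lh \<alpha>" using ex_diagram[OF u(1) l(1)] by blast
  then have "retract \<alpha> \<in> B \<and> up (retract \<alpha>) = uh \<alpha> \<and> low (retract \<alpha>) = lh \<alpha>"
    unfolding retract_def by (rule someI)
  then show 1: "retract \<alpha> \<in> B" "up (retract \<alpha>) = uh \<alpha>" "low (retract \<alpha>) = lh \<alpha>" by auto
  have "rank (retract \<alpha>) \<le> 1" using rank_eq[OF 1(1)] 1 u by simp
  then show "rank (retract \<alpha>) = n mod 2" using rank_mod[OF 1(1)] by (metis less_2_cases_iff le_antisym less_Suc_eq_le mod_less numeral_2_eq_2 One_nat_def)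
qed

lemma retraction_retract: "retraction (brauer n) (rank_ideal n r) retract" if r: "r \<le> 2"
proof -
  have mini: "retract x \<in> minimal_ideal (brauer n)" if "x \<in> rank_ideal n r" for x
    using retract_facts[of x] that r by (auto simp: rank_ideal_iff minimal_ideal_iff)
  moreover have "retract (x \<bullet> y) = retract x \<bullet> retract y" if "x \<in> rank_ideal n r" "y \<in> rank_ideal n r" for x y
  proof -
    have xy: "x \<in> B" "y \<in> B" "rank x \<le> 2" "rank y \<le> 2" using that r by (auto simp: rank_ideal_iff)
    have c: "x \<bullet> y \<in> B" "rank (x \<bullet> y) \<le> 2" using mult_closed rank_mult_left[of x y] xy by auto
    note fx = retract_facts[OF xy(1,3)] and fy = retract_facts[OF xy(2,4)] and fxy = retract_facts[OF c]
    show ?thesis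
      using min_mult_left[OF fx(1) fy(1) fx(4)] min_mult_right[OF fx(1) fy(1,4)] fx fy fxy mult_closed[OF fx(1) fy(1)]
        uh_mult[OF xy(1,3,2)] lh_mult[OF xy(2,4,1)] by (intro min_eqI) auto
  qed
  moreover have "retract x = x" if "x \<in> minimal_ideal (brauer n)" for x
  proof -
    have x: "x \<in> B" "rank x = n mod 2" using that by (auto simp: minimal_ideal_iff)
    then have "rank x \<le> 2" by simp
    then show ?thesis using retract_facts[OF x(1)] uh_minimal[OF x] lh_minimal[OF x] x by (intro min_eqI) auto
  qed
  ultimately show ?thesis unfolding retraction_def hom_def by simp
qed

lemma the_retraction_facts:
  assumes r: "r \<le> 2" "r \<in> ranks (n mod 2) n" and x: "x \<in> rank_ideal n r"
  shows "the_retraction (brauer n) (rank_ideal n r) x \<in> B"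
    "up (the_retraction (brauer n) (rank_ideal n r) x) = uh x"
    "low (the_retraction (brauer n) (rank_ideal n r) x) = lh x"
proof -
  have f: "retraction (brauer n) (rank_ideal n r) (the_retraction (brauer n) (rank_ideal n r))"
    unfolding the_retraction_def
    by (rule someI[of "retraction (brauer n) (rank_ideal n r)" retract, OF retraction_retract[OF r(1)]])
  obtain m where m: "m \<in> B" "rank m = n mod 2" using ex_minimal by blast
  have xB: "x \<in> B" "rank x \<le> r" "rank x \<le> 2" using x r by (auto simp: rank_ideal_iff)
  note R = retraction_facts[OF f xB(1,2) m ranks_ge[OF r(2)]]
  show "the_retraction (brauer n) (rank_ideal n r) x \<in> B" using R by simp
  show "up (the_retraction (brauer n) (rank_ideal n r) x) = uh x" using R uh_up_mult[OF xB(1,3) m] by simp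
  show "low (the_retraction (brauer n) (rank_ideal n r) x) = lh x" using R lh_low_mult[OF xB(1,3) m] by simp
qed

lemma ex_minimal_extension: "\<exists>D'. pattern D' \<and> D \<subseteq> D' \<and> card (rest D') = n mod 2" if D: "pattern D"
proof -
  obtain D' where D': "pattern D'" "D \<subseteq> D'" "card D' = card D + card (rest D) div 2"
    using ex_pattern_extend[OF D subset_refl, of "card (rest D) div 2"] by auto
  have "card (rest D') + 2 * (card D + card (rest D) div 2) = card (rest D) + 2 * card D"
    using card_rest[OF D'(1)] card_rest[OF D] D'(3) by simp
  then have "card (rest D') < 2" by presburger
  then have "card (rest D') = n mod 2" using rank_mod[of "proj D'"] rank_proj[OF D'(1)] D'(1) by simp
  then show ?thesis using D' by blast
qed

lemma ex_minimal_block: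
  assumes D: "pattern D" and ab: "a \<in> rest D" "b \<in> rest D" "a \<noteq> b"
  shows "\<exists>m \<in> B. rank m = n mod 2 \<and> D \<subseteq> up m \<and> {a, b} \<in> up m \<and> low m = up m"
proof -
  obtain D' where D': "pattern D'" "insert {a, b} D \<subseteq> D'" "card (rest D') = n mod 2"
    using ex_minimal_extension[OF pattern_insert(1)[OF D ab]] by blast
  then show ?thesis using rank_proj[OF D'(1)] by (intro bexI[of _ "proj D'"]) auto
qed

text \<open>For \<open>r \<ge> 3\<close> the idempotent \<open>bar n r id\<close> leaves 1, 2 and 3
  free. It is a left identity for some minimal elements whose upper pattern contains
  \<open>{1, 2}\<close> and for others with \<open>{1, 3}\<close>, so its image under a retraction
  would contain both pairs.\<close>

lemma retractable_iff: "retractable_ideal (brauer n) (rank_ideal n r) \<longleftrightarrow> r \<le> 2" if r: "r \<in> ranks (n mod 2) n"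
proof
  assume "retractable_ideal (brauer n) (rank_ideal n r)"
  then obtain f where f: "retraction (brauer n) (rank_ideal n r) f" by (auto simp: retractable_ideal_def)
  show "r \<le> 2"
  proof (rule ccontr)
    assume "\<not> r \<le> 2"
    have q: "r \<le> n" "r mod 2 = n mod 2" using r by (auto simp: ranks_iff)
    note e = bar_facts[OF q permutes_id]
    have "{1, j} \<in> up (f (bar n r id))" if j: "j \<in> {2, 3}" for j
    proof -
      have mem: "1 \<in> rest (std r)" "j \<in> rest (std r)" "1 \<noteq> j" using rest_std[OF q] j \<open>\<not> r \<le> 2\<close> by auto
      obtain m where m: "m \<in> B" "rank m = n mod 2" "std r \<subseteq> up m" "{1, j} \<in> up m"
        using ex_minimal_block[OF pattern_std[OF q] mem] by blast
      have "bar n r id \<bullet> m = m" unfolding bar_id[OF q] using proj_mult[OF m(1,3)] .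
      then show ?thesis using retraction_facts(3)[OF f e(1) _ m(1,2) ranks_ge[OF r]] e(4) m(4) by simp
    qed
    then have "{1, 2} \<in> up (f (bar n r id))" "{1, 3} \<in> up (f (bar n r id))" by auto
    moreover have "f (bar n r id) \<in> B"
      using ex_minimal retraction_facts(1)[OF f e(1) _ _ _ ranks_ge[OF r]] e(4) by auto
    ultimately show False using pattern_unique[OF pattern_up, of _ 1 2 3] by fastforce
  qed
qed (use rank_ideal_ideal[OF r] retraction_retract in \<open>auto simp: retractable_ideal_def\<close>)

section \<open>IN-pairs\<close>

abbreviation subgroup_monoid :: "diagram set \<Rightarrow> diagram \<Rightarrow> diagram monoid" where
  "subgroup_monoid G e \<equiv> (brauer n)\<lparr>carrier := G, one := e\<rparr>"

abbreviation bar_group :: "nat \<Rightarrow> diagram monoid" where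
  "bar_group q \<equiv> subgroup_monoid (bar_sym n q) (bar n q id)"

lemma bar_sym_iff: "x \<in> bar_sym n q \<longleftrightarrow> (\<exists>\<sigma>. \<sigma> permutes {1..q} \<and> x = bar n q \<sigma>)"
  unfolding bar_sym_def sym_group_def by auto

lemma bar_symI: "\<sigma> permutes {1..q} \<Longrightarrow> bar n q \<sigma> \<in> bar_sym n q"
  using bar_sym_iff by blast

lemma J_classes_iff: "J \<in> J_classes (brauer n) \<longleftrightarrow> (\<exists>k. k \<le> n \<and> k mod 2 = n mod 2 \<and> J = {\<beta> \<in> B. rank \<beta> = k})"
proof
  assume "J \<in> J_classes (brauer n)"
  then obtain \<alpha> where \<alpha>: "\<alpha> \<in> B" "J = greenJ (brauer n) `` {\<alpha>}" by (auto simp: J_classes_def elim: quotientE)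
  then have "J = {\<beta> \<in> B. rank \<beta> = rank \<alpha>}" by (auto simp: greenJ_iff)
  then show "\<exists>k. k \<le> n \<and> k mod 2 = n mod 2 \<and> J = {\<beta> \<in> B. rank \<beta> = k}" using rank_le rank_mod \<alpha>(1) by blast
next
  assume "\<exists>k. k \<le> n \<and> k mod 2 = n mod 2 \<and> J = {\<beta> \<in> B. rank \<beta> = k}"
  then obtain k where k: "k \<le> n" "k mod 2 = n mod 2" "J = {\<beta> \<in> B. rank \<beta> = k}" by blast
  obtain \<alpha> where \<alpha>: "\<alpha> \<in> B" "rank \<alpha> = k" using ex_rank[OF k(1,2)] by blast
  have "J = greenJ (brauer n) `` {\<alpha>}" using \<alpha> k(3) by (auto simp: greenJ_iff)
  then show "J \<in> J_classes (brauer n)" using \<alpha> by (auto simp: J_classes_def intro: quotientI)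
qed

lemma J_le_iff: "J_le (brauer n) {\<beta> \<in> B. rank \<beta> = k} {\<beta> \<in> B. rank \<beta> = l} \<longleftrightarrow> k \<le> l"
  if k: "k \<le> n" "k mod 2 = n mod 2" and l: "l \<le> n" "l mod 2 = n mod 2"
proof -
  obtain a where "a \<in> B" "rank a = k" using ex_rank[OF k] by blast
  moreover obtain b where "b \<in> B" "rank b = l" using ex_rank[OF l] by blast
  ultimately show ?thesis unfolding J_le_def using two_sided_eq by fastforce
qed

lemma regular_J: "regular_class (brauer n) {\<beta> \<in> B. rank \<beta> = k}"
  unfolding regular_class_def
proof
  fix a assume "a \<in> {\<beta> \<in> B. rank \<beta> = k}"
  then have a: "a \<in> B" by simp
  then have "a \<bullet> star a \<bullet> a = a" using mult_star_self[OF a] proj_up_mult[OF a] by simp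
  then show "\<exists>b \<in> B. a \<bullet> b \<bullet> a = a" using star_closed[OF a] by blast
qed

context
  fixes q assumes q: "q \<le> n" "q mod 2 = n mod 2"
begin

lemma bar_sym_group: "group (bar_group q)"
proof (rule groupI)
  show "x \<otimes>\<^bsub>bar_group q\<^esub> y \<in> carrier (bar_group q)"
    if "x \<in> carrier (bar_group q)" "y \<in> carrier (bar_group q)" for x y
    using that bar_mult[OF q] permutes_compose by (auto simp: bar_sym_iff) blast
  show "\<one>\<^bsub>bar_group q\<^esub> \<in> carrier (bar_group q)"
    using bar_symI[OF permutes_id] by simp
  show "x \<otimes>\<^bsub>bar_group q\<^esub> y \<otimes>\<^bsub>bar_group q\<^esub> w
      = x \<otimes>\<^bsub>bar_group q\<^esub> (y \<otimes>\<^bsub>bar_group q\<^esub> w)"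
    if "x \<in> carrier (bar_group q)" "y \<in> carrier (bar_group q)"
      "w \<in> carrier (bar_group q)" for x y w
    using that bar_facts(1)[OF q] mult_assoc by (auto simp: bar_sym_iff)
  show "\<one>\<^bsub>bar_group q\<^esub> \<otimes>\<^bsub>bar_group q\<^esub> x = x"
    if "x \<in> carrier (bar_group q)" for x
    using that bar_mult[OF q permutes_id] by (auto simp: bar_sym_iff)
  show "\<exists>y \<in> carrier (bar_group q).
      y \<otimes>\<^bsub>bar_group q\<^esub> x = \<one>\<^bsub>bar_group q\<^esub>"
    if "x \<in> carrier (bar_group q)" for x
  proof -
    have "x \<in> bar_sym n q" using that by simp
    then obtain \<sigma> where \<sigma>: "\<sigma> permutes {1..q}" "x = bar n q \<sigma>" unfolding bar_sym_iff by blast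
    then have "bar n q (inv' \<sigma>) \<bullet> x = bar n q id"
      using bar_mult[OF q permutes_inv[OF \<sigma>(1)] \<sigma>(1)] permutes_inv_o(1)[OF \<sigma>(1)] by simp
    moreover have "bar n q (inv' \<sigma>) \<in> bar_sym n q" using bar_symI[OF permutes_inv[OF \<sigma>(1)]] .
    ultimately show ?thesis by auto
  qed
qed

lemma bar_inverse: "inv\<^bsub>bar_group q\<^esub> (bar n q \<sigma>) = bar n q (inv' \<sigma>)"
  if \<sigma>: "\<sigma> permutes {1..q}"
proof -
  interpret group "bar_group q" by (rule bar_sym_group)
  show ?thesis
    using bar_mult[OF q permutes_inv[OF \<sigma>] \<sigma>] permutes_inv_o(1)[OF \<sigma>] bar_symI[OF permutes_inv[OF \<sigma>]] bar_symI[OF \<sigma>]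
    by (intro inv_equality) simp_all
qed

text \<open>An element of a group with identity \<open>e\<close> divides \<open>e\<close> and is
  fixed by \<open>e\<close> on both sides, so its patterns are squeezed between those of
  \<open>e\<close>. Hence any subgroup containing the idempotent lies in \<open>bar_sym n q\<close>,
  which is therefore maximal.\<close>

lemma subgroup_with_bar:
  assumes G: "group (subgroup_monoid G e)" "G \<subseteq> B" and id: "bar n q id \<in> G"
  shows "e = bar n q id" "G \<subseteq> bar_sym n q"
proof -
  interpret group "subgroup_monoid G e" by (rule G)
  have "bar n q id \<bullet> bar n q id = bar n q id" using bar_mult[OF q permutes_id permutes_id] by simp
  then show e: "e = bar n q id" using id l_cancel_one[of "bar n q id" "bar n q id"] by simp
  show "G \<subseteq> bar_sym n q"
  proof
    fix g assume g: "g \<in> G"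
    obtain h where h: "h \<in> G" "h \<bullet> g = e" using l_inv_ex[of g] g by auto
    have gh: "g \<bullet> h = e" using h g inv_comm[of h g] by simp
    have eg: "e \<bullet> g = g" "g \<bullet> e = g" using l_one[of g] r_one[of g] g by auto
    have B: "g \<in> B" "h \<in> B" "e \<in> B" using g h id e G(2) by auto
    have ue: "up e = std q" "low e = std q" using bar_facts[OF q permutes_id] e by auto
    have "up g = std q" using mult_upper[OF B(3,1)] mult_upper[OF B(1,2)] eg(1) gh ue by auto
    moreover have "low g = std q" using mult_lower[OF B(1,3)] mult_lower[OF B(2,1)] eg(2) h(2) ue by auto
    ultimately show "g \<in> bar_sym n q" using bar_cases[OF q B(1)] by (auto simp: bar_sym_iff)
  qed
qed

lemma bar_sym_maximal: "maximal_subgroup (brauer n) (bar_sym n q)"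
proof -
  have sub: "bar_sym n q \<subseteq> B" using bar_facts(1)[OF q] by (auto simp: bar_sym_iff)
  have "subgroup_of (brauer n) (bar_sym n q)"
    unfolding subgroup_of_def using sub bar_sym_group by blast
  moreover have "G = bar_sym n q" if G: "subgroup_of (brauer n) G" "bar_sym n q \<subseteq> G" for G
  proof -
    obtain e where e: "group (subgroup_monoid G e)" "G \<subseteq> B" using G(1) unfolding subgroup_of_def by blast
    have "bar n q id \<in> G" using G(2) bar_symI[OF permutes_id] by blast
    then show ?thesis using subgroup_with_bar(2)[OF e] G(2) by blast
  qed
  ultimately show ?thesis by (simp add: maximal_subgroup_def)
qed

lemma bar_normal: "bar n q ` N \<lhd> bar_group q" if N: "N \<lhd> sym_group q"
proof -
  interpret group "bar_group q" by (rule bar_sym_group)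
  note p = normal_permutes[OF N]
  show ?thesis
    unfolding normal_inv_iff
  proof (intro conjI ballI)
    show "subgroup (bar n q ` N) (bar_group q)"
    proof (rule subgroupI)
      show "bar n q ` N \<subseteq> carrier (bar_group q)"
        using bar_symI p by (simp add: image_subset_iff)
      show "bar n q ` N \<noteq> {}" using normal_id[OF N] by blast
      show "inv\<^bsub>bar_group q\<^esub> x \<in> bar n q ` N" if "x \<in> bar n q ` N" for x
        using that bar_inverse p normal_inv[OF N] by auto
      show "x \<otimes>\<^bsub>bar_group q\<^esub> y \<in> bar n q ` N" if "x \<in> bar n q ` N" "y \<in> bar n q ` N" for x y
        using that bar_mult[OF q] p normal_comp[OF N] by auto
    qed
    fix x h assume x: "x \<in> carrier (bar_group q)" and h: "h \<in> bar n q ` N"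
    have "x \<in> bar_sym n q" using x by simp
    then obtain \<tau> where \<tau>: "\<tau> permutes {1..q}" "x = bar n q \<tau>" unfolding bar_sym_iff by blast
    obtain \<sigma> where \<sigma>: "\<sigma> \<in> N" "h = bar n q \<sigma>" using h by blast
    note pi = permutes_inv[OF \<tau>(1)]
    have "inv' \<tau> \<circ> \<sigma> \<circ> inv' (inv' \<tau>) \<in> N" using normal_conj[OF N pi \<sigma>(1)] .
    then have "inv' \<tau> \<circ> (\<sigma> \<circ> \<tau>) \<in> N" using permutes_inv_inv[OF \<tau>(1)] by (simp add: comp_assoc)
    moreover have "x \<bullet> h \<bullet> bar n q (inv' \<tau>) = bar n q (inv' \<tau> \<circ> (\<sigma> \<circ> \<tau>))"
      using bar_mult[OF q \<tau>(1) p[OF \<sigma>(1)]] bar_mult[OF q permutes_compose[OF \<tau>(1) p[OF \<sigma>(1)]] pi] \<tau> \<sigma> by simp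
    ultimately show "x \<otimes>\<^bsub>bar_group q\<^esub> h
        \<otimes>\<^bsub>bar_group q\<^esub> inv\<^bsub>bar_group q\<^esub> x \<in> bar n q ` N"
      using bar_inverse[OF \<tau>(1)] \<tau>(2) by auto
  qed
qed

lemma normal_of_bar:
  assumes M: "M \<lhd> bar_group q"
  shows "\<exists>N. N \<lhd> sym_group q \<and> M = bar n q ` N"
proof -
  interpret group "bar_group q" by (rule bar_sym_group)
  have S: "subgroup M (bar_group q)"
    and conj: "\<And>x h. x \<in> bar_sym n q \<Longrightarrow> h \<in> M \<Longrightarrow> x \<bullet> h \<bullet> inv\<^bsub>bar_group q\<^esub> x \<in> M"
    using M by (auto simp: normal_inv_iff)
  define N where "N = {\<sigma>. \<sigma> permutes {1..q} \<and> bar n q \<sigma> \<in> M}"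
  have "M \<subseteq> bar_sym n q" using subgroup.subset[OF S] by simp
  then have "x \<in> bar n q ` N" if "x \<in> M" for x
    using that unfolding N_def subset_iff bar_sym_iff by blast
  then have MN: "M = bar n q ` N" unfolding N_def by blast
  have "N \<lhd> sym_group q"
    unfolding normal_sym_group_iff
  proof (intro conjI ballI allI impI)
    show "\<sigma> permutes {1..q}" if "\<sigma> \<in> N" for \<sigma> using that by (simp add: N_def)
    show "id \<in> N" using subgroup.one_closed[OF S] by (simp add: N_def permutes_id)
    show "\<sigma> \<circ> \<tau> \<in> N" if "\<sigma> \<in> N" "\<tau> \<in> N" for \<sigma> \<tau>
      using subgroup.m_closed[OF S, of "bar n q \<tau>" "bar n q \<sigma>"] that bar_mult[OF q, of \<tau> \<sigma>]
      by (simp add: N_def permutes_compose)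
    show "inv' \<sigma> \<in> N" if "\<sigma> \<in> N" for \<sigma>
      using subgroup.m_inv_closed[OF S, of "bar n q \<sigma>"] that bar_inverse[of \<sigma>] by (simp add: N_def permutes_inv)
    show "\<tau> \<circ> \<sigma> \<circ> inv' \<tau> \<in> N" if \<tau>: "\<tau> permutes {1..q}" and "\<sigma> \<in> N" for \<tau> \<sigma>
    proof -
      have \<sigma>: "\<sigma> permutes {1..q}" "bar n q \<sigma> \<in> M" using that by (auto simp: N_def)
      note pi = permutes_inv[OF \<tau>]
      have "bar n q (inv' \<tau>) \<bullet> bar n q \<sigma> \<bullet> inv\<^bsub>bar_group q\<^esub> (bar n q (inv' \<tau>)) \<in> M"
        using conj[OF bar_symI[OF pi] \<sigma>(2)] .
      then have "bar n q (inv' \<tau>) \<bullet> bar n q \<sigma> \<bullet> bar n q \<tau> \<in> M" using bar_inverse[OF pi] permutes_inv_inv[OF \<tau>] by simp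
      then have "bar n q (\<tau> \<circ> (\<sigma> \<circ> inv' \<tau>)) \<in> M"
        using bar_mult[OF q pi \<sigma>(1)] bar_mult[OF q permutes_compose[OF pi \<sigma>(1)] \<tau>] by simp
      then show ?thesis using permutes_compose[OF permutes_compose[OF pi \<sigma>(1)] \<tau>] by (simp add: N_def comp_assoc)
    qed
  qed
  then show ?thesis using MN by blast
qed

end

text \<open>A subgroup of \<open>bar_sym n q\<close> contains \<open>bar n q id\<close>, so the
  maximal subgroup \<open>G\<close> of the definition, whatever its identity \<open>e\<close>, is
  \<open>bar_sym n q\<close> itself, and its class consists of the elements of rank
  \<open>q\<close>. Minimality outside \<open>rank_ideal n r\<close> forces
  \<open>q = r + 2\<close>.\<close>

lemma IN_pair_iff: "IN_pair (brauer n) I M \<and> within_bar_sym n M \<longleftrightarrow>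
    (\<exists>r N. r < n \<and> r mod 2 = n mod 2 \<and> N \<lhd> sym_group (r + 2) \<and> I = rank_ideal n r \<and> M = bar n (r + 2) ` N)"
proof
  assume h: "IN_pair (brauer n) I M \<and> within_bar_sym n M"
  then obtain q where q: "q \<le> n" "q mod 2 = n mod 2" and Mq: "subgroup M (bar_group q)"
    by (auto simp: within_bar_sym_def)
  have id: "bar n q id \<in> M" using subgroup.one_closed[OF Mq] by simp
  have I: "semigroup_ideal (brauer n) I" using h unfolding IN_pair_def by (elim conjE)
  have "\<exists>G J. maximal_subgroup (brauer n) G \<and> (\<exists>e. M \<lhd> subgroup_monoid G e) \<and>
      G \<subseteq> J \<and> J \<in> J_classes (brauer n) \<and> regular_class (brauer n) J \<and> J \<subseteq> B - I \<and>
      (\<forall>J' \<in> J_classes (brauer n). J' \<subseteq> B - I \<and> J_le (brauer n) J' J \<longrightarrow> J' = J)"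
    using h unfolding IN_pair_def by (elim conjE)
  then obtain G J where GJ: "maximal_subgroup (brauer n) G \<and> (\<exists>e. M \<lhd> subgroup_monoid G e) \<and>
      G \<subseteq> J \<and> J \<in> J_classes (brauer n) \<and> regular_class (brauer n) J \<and> J \<subseteq> B - I \<and>
      (\<forall>J' \<in> J_classes (brauer n). J' \<subseteq> B - I \<and> J_le (brauer n) J' J \<longrightarrow> J' = J)"
    by (elim exE) (rule that)
  have G: "maximal_subgroup (brauer n) G" using GJ by (elim conjE)
  have J1: "G \<subseteq> J" using GJ by (elim conjE)
  have J2: "J \<in> J_classes (brauer n)" using GJ by (elim conjE)
  have J3: "J \<subseteq> B - I" using GJ by (elim conjE)
  note J = J1 J2 J3
  from GJ have min: "J' = J" if "J' \<in> J_classes (brauer n)" "J' \<subseteq> B - I" "J_le (brauer n) J' J" for J'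
    using that by (elim conjE) (drule (1) bspec, simp)
  from GJ have "\<exists>e. M \<lhd> subgroup_monoid G e" by (elim conjE)
  then obtain e where M: "M \<lhd> subgroup_monoid G e" by (elim exE) (rule that)
  have grp: "group (subgroup_monoid G e)" using normal.axioms(2)[OF M] .
  have MG: "M \<subseteq> G" using subgroup.subset[OF normal.axioms(1)[OF M]] by simp
  have GB: "G \<subseteq> B" using G by (simp add: maximal_subgroup_def subgroup_of_def)
  have idG: "bar n q id \<in> G" using id MG by blast
  note GG = subgroup_with_bar[OF q grp GB idG]
  have "subgroup_of (brauer n) (bar_sym n q)" using bar_sym_maximal[OF q] by (simp add: maximal_subgroup_def)
  then have Geq: "G = bar_sym n q" using G GG(2) by (auto simp: maximal_subgroup_def)
  obtain N where N: "N \<lhd> sym_group q" "M = bar n q ` N" using normal_of_bar[OF q] M GG(1) Geq by blast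
  obtain r where r: "r \<in> ranks (n mod 2) n" "I = rank_ideal n r" using I ideal_iff by blast
  obtain k where k: "k \<le> n" "k mod 2 = n mod 2" "J = {\<beta> \<in> B. rank \<beta> = k}" using J(2) J_classes_iff by blast
  have kq: "k = q" using idG J(1) k(3) bar_facts(4)[OF q permutes_id] by auto
  have rn: "r \<le> n" "r mod 2 = n mod 2" using r by (auto simp: ranks_iff)
  have out: "{\<beta> \<in> B. rank \<beta> = l} \<subseteq> B - I \<longleftrightarrow> r < l" if "l \<le> n" "l mod 2 = n mod 2" for l
    using ex_rank[OF that] unfolding r(2) by (auto simp: rank_ideal_iff)
  have rk: "r < q" using out[OF q] J(3) k(3) kq by simp
  have r2: "r + 2 \<le> q" using parity_gap[OF rk] rn q by simp
  then have r2n: "r + 2 \<le> n" "(r + 2) mod 2 = n mod 2" using q rn by auto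
  have "{\<beta> \<in> B. rank \<beta> = r + 2} \<in> J_classes (brauer n)" using J_classes_iff r2n by blast
  then have "{\<beta> \<in> B. rank \<beta> = r + 2} = J"
    using min out[OF r2n] J_le_iff[OF r2n q] r2 k(3) kq by auto
  moreover obtain \<beta> where "\<beta> \<in> B" "rank \<beta> = r + 2" using ex_rank[OF r2n] by blast
  ultimately have "q = r + 2" using k(3) kq by auto
  then show "\<exists>r N. r < n \<and> r mod 2 = n mod 2 \<and> N \<lhd> sym_group (r + 2) \<and> I = rank_ideal n r \<and> M = bar n (r + 2) ` N"
    using N r rn r2n by (intro exI[of _ r] exI[of _ N]) auto
next
  assume "\<exists>r N. r < n \<and> r mod 2 = n mod 2 \<and> N \<lhd> sym_group (r + 2) \<and> I = rank_ideal n r \<and> M = bar n (r + 2) ` N"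
  then obtain r N where r: "r < n" "r mod 2 = n mod 2" and N: "N \<lhd> sym_group (r + 2)"
    and I: "I = rank_ideal n r" and M: "M = bar n (r + 2) ` N" by blast
  have q: "r + 2 \<le> n" "(r + 2) mod 2 = n mod 2" using parity_gap[OF r] r by auto
  note nM = bar_normal[OF q N, folded M]
  let ?J = "{\<beta> \<in> B. rank \<beta> = r + 2}"
  have "IN_pair (brauer n) I M"
    unfolding IN_pair_def
  proof (intro conjI exI ballI impI)
    show "semigroup_ideal (brauer n) I" unfolding I using r by (intro rank_ideal_ideal) (simp add: ranks_iff)
    show "maximal_subgroup (brauer n) (bar_sym n (r + 2))" by (rule bar_sym_maximal[OF q])
    show "M \<lhd> bar_group (r + 2)" by (rule nM)
    show "bar_sym n (r + 2) \<subseteq> ?J" using bar_facts(1,4)[OF q] by (auto simp: bar_sym_iff)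
    show "?J \<in> J_classes (brauer n)" using J_classes_iff q by blast
    show "regular_class (brauer n) ?J" by (rule regular_J)
    show "?J \<subseteq> B - I" by (auto simp: I rank_ideal_iff)
    show "J' = ?J" if J': "J' \<in> J_classes (brauer n)" "J' \<subseteq> B - I \<and> J_le (brauer n) J' ?J" for J'
    proof -
      obtain k where k: "k \<le> n" "k mod 2 = n mod 2" "J' = {\<beta> \<in> B. rank \<beta> = k}" using J'(1) J_classes_iff by blast
      have "k \<le> r + 2" using J'(2) J_le_iff[OF k(1,2) q] k(3) by simp
      moreover obtain \<beta> where "\<beta> \<in> B" "rank \<beta> = k" using ex_rank[OF k(1,2)] by blast
      then have "r < k" using J'(2) k(3) by (auto simp: I rank_ideal_iff)
      then have "r + 2 \<le> k" using parity_gap[of r k] r k by simp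
      ultimately show ?thesis using k(3) by simp
    qed
  qed
  moreover have "within_bar_sym n M"
    unfolding within_bar_sym_def using q normal.axioms(1)[OF nM] by blast
  ultimately show "IN_pair (brauer n) I M \<and> within_bar_sym n M" by blast
qed

text \<open>Since \<open>N\<close> contains \<open>id\<close>, a coset is a singleton exactly if
  every element acts like \<open>bar n q id\<close>.\<close>

lemma coset_condition:
  assumes q: "q \<le> n" "q mod 2 = n mod 2" and N: "N \<lhd> sym_group q"
  shows "(\<forall>x \<in> minimal_ideal (brauer n). card (x <#\<^bsub>brauer n\<^esub> (bar n q ` N)) = 1 \<and> card ((bar n q ` N) #>\<^bsub>brauer n\<^esub> x) = 1)
    \<longleftrightarrow> acts_trivially q N"
proof -
  have one: "card (f ` N) = 1 \<longleftrightarrow> (\<forall>\<sigma> \<in> N. f \<sigma> = f id)" for f :: "(nat \<Rightarrow> nat) \<Rightarrow> diagram"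
  proof
    assume "card (f ` N) = 1"
    then obtain y where "f ` N = {y}" by (auto simp: card_1_singleton_iff)
    then show "\<forall>\<sigma> \<in> N. f \<sigma> = f id" using normal_id[OF N] by (metis imageI singletonD)
  next
    assume "\<forall>\<sigma> \<in> N. f \<sigma> = f id"
    then have "f ` N = (\<lambda>_. f id) ` N" by (intro image_cong) simp_all
    also have "\<dots> = {f id}" using image_constant[OF normal_id[OF N]] .
    finally have "f ` N = {f id}" .
    then show "card (f ` N) = 1" by simp
  qed
  have cosets: "x <#\<^bsub>brauer n\<^esub> (bar n q ` N) = (\<lambda>\<sigma>. x \<bullet> bar n q \<sigma>) ` N"
    "(bar n q ` N) #>\<^bsub>brauer n\<^esub> x = (\<lambda>\<sigma>. bar n q \<sigma> \<bullet> x) ` N" for x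
    by (auto simp: l_coset_def r_coset_def)
  show ?thesis unfolding acts_trivially_def cosets one Ball_def minimal_ideal_iff by blast
qed

lemma retractable_IN_pair_iff: "retractable_IN_pair (brauer n) I M \<and> within_bar_sym n M \<longleftrightarrow>
    (\<exists>r N. r < n \<and> r mod 2 = n mod 2 \<and> N \<lhd> sym_group (r + 2) \<and> r \<le> 2 \<and> acts_trivially (r + 2) N \<and>
      I = rank_ideal n r \<and> M = bar n (r + 2) ` N)" (is "?L \<longleftrightarrow> ?R")
proof -
  have key: "retractable_ideal (brauer n) (rank_ideal n r) \<and>
      (\<forall>x \<in> minimal_ideal (brauer n). card (x <#\<^bsub>brauer n\<^esub> (bar n (r + 2) ` N)) = 1 \<and> card ((bar n (r + 2) ` N) #>\<^bsub>brauer n\<^esub> x) = 1)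
      \<longleftrightarrow> r \<le> 2 \<and> acts_trivially (r + 2) N"
    if r: "r < n" "r mod 2 = n mod 2" "N \<lhd> sym_group (r + 2)" for r N
  proof -
    have q: "r + 2 \<le> n" "(r + 2) mod 2 = n mod 2" using parity_gap[OF r(1,2)] r by auto
    have "r \<in> ranks (n mod 2) n" using r by (simp add: ranks_iff)
    then show ?thesis using retractable_iff coset_condition[OF q r(3)] by simp
  qed
  show ?thesis
  proof
    assume L: ?L
    then have "IN_pair (brauer n) I M \<and> within_bar_sym n M" by (simp add: retractable_IN_pair_def)
    then obtain r N where rN: "r < n" "r mod 2 = n mod 2" "N \<lhd> sym_group (r + 2)" "I = rank_ideal n r" "M = bar n (r + 2) ` N"
      unfolding IN_pair_iff by blast
    have "r \<le> 2 \<and> acts_trivially (r + 2) N" using L key[OF rN(1-3)] unfolding retractable_IN_pair_def rN(4,5) by blast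
    then show ?R using rN by blast
  next
    assume ?R
    then obtain r N where rN: "r < n" "r mod 2 = n mod 2" "N \<lhd> sym_group (r + 2)" "I = rank_ideal n r" "M = bar n (r + 2) ` N"
      "r \<le> 2" "acts_trivially (r + 2) N" by blast
    have "IN_pair (brauer n) I M \<and> within_bar_sym n M" unfolding IN_pair_iff using rN by blast
    then show ?L using key[OF rN(1-3)] rN(6,7) unfolding retractable_IN_pair_def rN(4,5) by blast
  qed
qed

text \<open>For the trivial group the relation \<open>rel_nu\<close> lies in the diagonal, and for
  \<open>q = n\<close> it is empty.\<close>

lemma rees_family: "rees (brauer n) (rank_ideal n q) = family False False q {id}" if "q \<in> ranks (n mod 2) n"
proof -
  have nu: "rel_nu (q + 2) {id} \<subseteq> Id_on B"
  proof (cases "q = n")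
    case True
    then show ?thesis using rel_nu_out[of "q + 2"] by simp
  next
    case False
    then have q: "q + 2 \<le> n" "(q + 2) mod 2 = n mod 2" using that parity_gap[of q n] by (auto simp: ranks_iff)
    show ?thesis
    proof (rule subrelI)
      fix a b assume ab: "(a, b) \<in> rel_nu (q + 2) {id}"
      then have "a = b" using rel_nu_iff[OF q trivial_normal] by auto
      then show "(a, b) \<in> Id_on B" using rel_nu_H(1)[OF q trivial_normal ab] by auto
    qed
  qed
  have "kappa False False q = rank_ideal n q \<times> rank_ideal n q"
    by (auto simp: kappa_def rank_ideal_iff)
  then show ?thesis using nu by (auto simp: rees_def Delta_def family_def)
qed

lemma R_IN_family: "R_IN (brauer n) (rank_ideal n r) (bar n (r + 2) ` N) = family False False r N"
proof -
  have "kappa False False r = rank_ideal n r \<times> rank_ideal n r"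
    by (auto simp: kappa_def rank_ideal_iff)
  then show ?thesis by (simp add: R_IN_def Delta_def family_def rel_nu_def)
qed

text \<open>Green's relations compare patterns (\<open>greenL_iff\<close>,
  \<open>greenR_iff\<close>), so lambda keeps the lower patterns and rho the upper ones; the
  retraction replaces \<open>up\<close> and \<open>low\<close> by \<open>uh\<close> and
  \<open>lh\<close>.\<close>

lemma
  assumes r: "r \<le> 2" "r \<in> ranks (n mod 2) n"
  shows lambda_family: "lambda_IN (brauer n) (rank_ideal n r) (bar n (r + 2) ` N) = family False True r N"
    and rho_family: "rho_IN (brauer n) (rank_ideal n r) (bar n (r + 2) ` N) = family True False r N"
    and mu_family: "mu_IN (brauer n) (rank_ideal n r) (bar n (r + 2) ` N) = family True True r N"
proof -
  let ?I = "rank_ideal n r" and ?f = "the_retraction (brauer n) (rank_ideal n r)"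
  have f: "?f x \<in> B" "up (?f x) = uh x" "low (?f x) = lh x" if "x \<in> ?I" for x
    using the_retraction_facts[OF r that] by auto
  have "kappa False True r = {(x, y) \<in> ?I \<times> ?I. (?f x, ?f y) \<in> greenL (brauer n)}"
    using f by (auto simp: kappa_def greenL_iff rank_ideal_iff)
  then show "lambda_IN (brauer n) ?I (bar n (r + 2) ` N) = family False True r N"
    by (simp add: lambda_IN_def Delta_def family_def rel_nu_def)
  have "kappa True False r = {(x, y) \<in> ?I \<times> ?I. (?f x, ?f y) \<in> greenR (brauer n)}"
    using f by (auto simp: kappa_def greenR_iff rank_ideal_iff)
  then show "rho_IN (brauer n) ?I (bar n (r + 2) ` N) = family True False r N"
    by (simp add: rho_IN_def Delta_def family_def rel_nu_def)
  have "kappa True True r = {(x, y) \<in> ?I \<times> ?I. (?f x, ?f y) \<in> greenH (brauer n)}"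
    using f by (auto simp: kappa_def greenH_def greenL_iff greenR_iff rank_ideal_iff)
  then show "mu_IN (brauer n) ?I (bar n (r + 2) ` N) = family True True r N"
    by (simp add: mu_IN_def Delta_def family_def rel_nu_def)
qed

end

section \<open>Normal subgroups acting trivially on the minimal ideal\<close>

context brauer_monoid
begin

lemma bar_block: "{Upper i, Lower (\<sigma> i)} \<in> bar n q \<sigma>" if "i \<in> {1..q}"
  using that unfolding bar_def by blast

lemma pattern_disjoint: "A = C \<or> A \<inter> C = {}" if "pattern D" "A \<in> D" "C \<in> D"
  using that unfolding pattern_def is_matching_def disjoint_def by blast

context
  fixes q N assumes q: "q \<le> n" "q mod 2 = n mod 2" and N: "N \<lhd> sym_group q"
begin

lemma low_mult_bar: "{\<sigma> a, \<sigma> b} \<in> low (m \<bullet> bar n q \<sigma>)"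
  if \<sigma>: "\<sigma> permutes {1..q}" and m: "m \<in> B" and ab: "{a, b} \<in> low m" "a \<in> {1..q}" "b \<in> {1..q}"
  using mult_LL[OF m bar_facts(1)[OF q \<sigma>]] ab bar_block by (simp add: low_block)

text \<open>A minimal \<open>m\<close> whose lower pattern contains \<open>{a, b}\<close> and
  \<open>std q\<close> is fixed by \<open>bar n q id\<close>, hence by
  \<open>bar n q \<sigma>\<close>. So its lower pattern contains both \<open>{a, b}\<close> and the
  image of this pair, and blocks of a pattern are equal or disjoint.\<close>

lemma acts_trivially_pair_stable: "pair_stable \<sigma> {1..q}" if act: "acts_trivially q N" and \<sigma>: "\<sigma> \<in> N"
  unfolding pair_stable_def
proof (intro ballI impI)
  fix a b assume ab: "a \<in> {1..q}" "b \<in> {1..q}" "a \<noteq> b"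
  obtain m where m: "m \<in> B" "rank m = n mod 2" "std q \<subseteq> low m" "{a, b} \<in> low m"
    using ex_minimal_block[OF pattern_std[OF q], of a b] rest_std[OF q] ab by auto
  have "m \<bullet> bar n q \<sigma> = m"
    using act \<sigma> m(1,2) mult_proj[OF m(1,3)] bar_id[OF q] by (simp add: acts_trivially_def)
  then have "{\<sigma> a, \<sigma> b} \<in> low m" using low_mult_bar[OF normal_permutes[OF N \<sigma>] m(1,4) ab(1,2)] by simp
  then have "{\<sigma> a, \<sigma> b} = {a, b} \<or> {\<sigma> a, \<sigma> b} \<inter> {a, b} = {}"
    using pattern_disjoint[OF pattern_low[OF m(1)] _ m(4)] by blast
  then show "\<sigma> ` {a, b} = {a, b} \<or> \<sigma> ` {a, b} \<inter> {a, b} = {}" by simp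
qed

text \<open>The other side follows by \<open>star\<close>, which inverts \<open>\<sigma>\<close> and
  keeps the rank of \<open>m\<close>.\<close>

lemma acts_trivially_rightI:
  assumes "\<And>m \<sigma>. m \<in> B \<Longrightarrow> rank m = n mod 2 \<Longrightarrow> \<sigma> \<in> N \<Longrightarrow> m \<bullet> bar n q \<sigma> = m \<bullet> bar n q id"
  shows "acts_trivially q N"
  unfolding acts_trivially_def
proof (intro ballI impI conjI)
  fix m \<sigma> assume m: "m \<in> B" "rank m = n mod 2" and \<sigma>: "\<sigma> \<in> N"
  show "m \<bullet> bar n q \<sigma> = m \<bullet> bar n q id" using assms m \<sigma> .
  note p = normal_permutes[OF N \<sigma>]
  have "star m \<bullet> bar n q (inv' \<sigma>) = star m \<bullet> bar n q id"
    using assms[of "star m"] m normal_inv[OF N \<sigma>] by simp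
  then have "star (bar n q \<sigma> \<bullet> m) = star (bar n q id \<bullet> m)"
    using star_mult[OF bar_facts(1)[OF q p] m(1)] star_mult[OF bar_facts(1)[OF q permutes_id] m(1)]
      star_bar[OF q p] star_bar[OF q permutes_id] by simp
  then show "bar n q \<sigma> \<bullet> m = bar n q id \<bullet> m" by (metis star_star)
qed

text \<open>The lower pattern of \<open>x\<close> consists of \<open>std q\<close> and of pairs
  inside \<open>{1..q}\<close>, because for even \<open>n\<close> no point is free. With at most
  four points there, \<open>\<sigma>\<close> either maps a pair to itself or interchanges two of
  them, so the pattern is preserved.\<close>

lemma pair_stable_acts_trivially:
  assumes ev: "even n" and q4: "q \<le> 4" and st: "\<And>\<sigma>. \<sigma> \<in> N \<Longrightarrow> pair_stable \<sigma> {1..q}"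
  shows "acts_trivially q N"
proof (rule acts_trivially_rightI)
  fix m \<sigma> assume m: "m \<in> B" "rank m = n mod 2" and \<sigma>: "\<sigma> \<in> N"
  note p = normal_permutes[OF N \<sigma>]
  note b = bar_facts[OF q p] and b1 = bar_facts[OF q permutes_id]
  define x where "x = m \<bullet> bar n q id"
  have x: "x \<in> B" "rank x = n mod 2" using mult_closed[OF m(1) b1(1)] min_mult_left[OF m(1) b1(1) m(2)] by (auto simp: x_def)
  have eq: "m \<bullet> bar n q \<sigma> = x \<bullet> bar n q \<sigma>"
    using mult_assoc[OF m(1) b1(1) b(1)] bar_mult[OF q permutes_id p] by (simp add: x_def)
  have y: "x \<bullet> bar n q \<sigma> \<in> B" "rank (x \<bullet> bar n q \<sigma>) = n mod 2" "up (x \<bullet> bar n q \<sigma>) = up x"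
    using mult_closed[OF x(1) b(1)] min_mult_left[OF x(1) b(1) x(2)] by auto
  note L = pattern_low[OF x(1)]
  have std: "std q \<subseteq> low x" using mult_lower[OF m(1) b1(1)] b1(3) by (simp add: x_def)
  have std': "std q \<subseteq> low (x \<bullet> bar n q \<sigma>)" using mult_lower[OF x(1) b(1)] b(3) by simp
  have "card (rest (low x)) = 0" using rank_eq_low[OF x(1)] x(2) ev by simp
  then have rest: "rest (low x) = {}" by (simp add: rest_def)
  have inside: "A \<subseteq> {1..q}" if A: "A \<in> low x" "A \<notin> std q" for A
  proof -
    have "A \<inter> \<Union>(std q) = {}" using pattern_disjoint[OF L A(1)] std A(2) by blast
    moreover have "A \<subseteq> {1..n}" using L A(1) by (auto simp: pattern_def)
    ultimately show ?thesis unfolding Union_std[OF q] by force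
  qed
  have "low x \<subseteq> low (x \<bullet> bar n q \<sigma>)"
  proof
    fix A assume A: "A \<in> low x"
    show "A \<in> low (x \<bullet> bar n q \<sigma>)"
    proof (cases "A \<in> std q")
      case True
      then show ?thesis using std' by blast
    next
      case False
      obtain a b where ab: "A = {a, b}" using pattern_block[OF L A] by blast
      have ne: "a \<noteq> b" using pattern_neq[OF L] A ab by blast
      have mem: "a \<in> {1..q}" "b \<in> {1..q}" using inside[OF A False] ab by auto
      note im = low_mult_bar[OF p x(1) A[unfolded ab] mem]
      consider "\<sigma> ` {a, b} = {a, b}" | "\<sigma> ` {a, b} \<inter> {a, b} = {}"
        using st[OF \<sigma>] mem ne unfolding pair_stable_def by blast
      then show ?thesis
      proof cases
        case 1
        then show ?thesis using im ab by simp
      next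
        \<comment> \<open>The image of \<open>{a, b}\<close> is disjoint from it, so the two pairs
          exhaust \<open>{1..q}\<close>. Then \<open>{\<sigma> a, \<sigma> b}\<close> is itself a
          pair of \<open>x\<close>, and its image is \<open>{a, b}\<close>.\<close>
        case 2
        have s: "\<sigma> a \<in> {1..q}" "\<sigma> b \<in> {1..q}" using permutes_in_image[OF p] mem by auto
        have sne: "\<sigma> a \<noteq> \<sigma> b" using permutes_inj[OF p] ne by (auto dest: injD)
        have "card {a, b, \<sigma> a, \<sigma> b} = 4" using 2 ne sne by auto
        moreover have "{a, b, \<sigma> a, \<sigma> b} \<subseteq> {1..q}" using mem s by blast
        ultimately have all: "{a, b, \<sigma> a, \<sigma> b} = {1..q}"
          using q4 card_mono[of "{1..q}" "{a, b, \<sigma> a, \<sigma> b}"] by (intro card_subset_eq) simp_all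
        have "\<sigma> a \<notin> rest (low x)" using rest by simp
        moreover have "\<sigma> a \<in> {1..n}" using s q by auto
        ultimately obtain y where y: "{\<sigma> a, y} \<in> low x" using pattern_rest[OF L] by blast
        have "{\<sigma> a, y} \<notin> std q"
        proof
          assume "{\<sigma> a, y} \<in> std q"
          then have "\<sigma> a \<in> \<Union>(std q)" by blast
          then show False using s(1) unfolding Union_std[OF q] by simp
        qed
        then have "y \<in> {a, b, \<sigma> a, \<sigma> b}" using inside[OF y] all by blast
        moreover have "y \<notin> {a, b}"
        proof
          assume "y \<in> {a, b}"
          then have "{\<sigma> a, y} \<inter> {a, b} \<noteq> {}" by blast
          then have "{\<sigma> a, y} = {a, b}" using pattern_disjoint[OF L y A] unfolding ab by blast
          then have "\<sigma> a \<in> {a, b}" by blast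
          then show False using 2 by blast
        qed
        moreover have "y \<noteq> \<sigma> a" using pattern_neq[OF L y] by simp
        ultimately have "{\<sigma> a, \<sigma> b} \<in> low x" using y by auto
        from low_mult_bar[OF p x(1) this s]
        have "{\<sigma> (\<sigma> a), \<sigma> (\<sigma> b)} \<in> low (x \<bullet> bar n q \<sigma>)" .
        moreover have "{\<sigma> (\<sigma> a), \<sigma> (\<sigma> b)} = {a, b}"
        proof -
          have "\<sigma> (\<sigma> a) \<in> {a, b, \<sigma> a, \<sigma> b}" "\<sigma> (\<sigma> b) \<in> {a, b, \<sigma> a, \<sigma> b}"
            using permutes_in_image[OF p] s unfolding all by auto
          moreover have "\<sigma> u = \<sigma> v \<longleftrightarrow> u = v" for u v using permutes_inj[OF p] by (auto dest: injD)
          ultimately show ?thesis using 2 ne by auto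
        qed
        ultimately show ?thesis using ab by simp
      qed
    qed
  qed
  then have "low x = low (x \<bullet> bar n q \<sigma>)" using low_eqI[OF x(1) y(1)] x(2) y(2) by simp
  then show "m \<bullet> bar n q \<sigma> = m \<bullet> bar n q id"
    using min_eqI[OF y(1) x(1) y(2)] y(3) eq by (simp add: x_def)
qed

end

lemma acts_trivially_id: "acts_trivially q {id}"
  by (simp add: acts_trivially_def)

lemma acts_trivially_2: "acts_trivially 2 N" if "even n" "n \<ge> 2" "N \<lhd> sym_group 2"
proof (rule pair_stable_acts_trivially[OF _ _ that(3)])
  show "pair_stable \<sigma> {1..2}" if "\<sigma> \<in> N" for \<sigma>
  proof -
    have "\<sigma> ` {1..2} = {1..2}" using permutes_image[OF normal_permutes[OF \<open>N \<lhd> sym_group 2\<close> that]] .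
    moreover have "{a, b} = {1..2}" if "a \<in> {1..2}" "b \<in> {1..2}" "a \<noteq> b" for a b :: nat
      using that by auto
    ultimately show ?thesis unfolding pair_stable_def by metis
  qed
qed (use that in auto)

text \<open>Two pairs of a three-element set always meet, so \<open>pair_stable\<close> forces every
  pair to be mapped to itself, and every point is the intersection of two such pairs.\<close>

lemma acts_trivially_3_iff: "acts_trivially 3 N \<longleftrightarrow> N = {id}" if n: "odd n" "n \<ge> 3" and N: "N \<lhd> sym_group 3"
proof
  assume act: "acts_trivially 3 N"
  have q: "3 \<le> n" "3 mod 2 = n mod 2" using n by (auto simp: odd_iff_mod_2_eq_one)
  have "\<sigma> = id" if \<sigma>: "\<sigma> \<in> N" for \<sigma>
  proof
    note p = normal_permutes[OF N \<sigma>]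
    have three: "{1..3} = {1, 2, 3 :: nat}" by auto
    have im: "\<sigma> i \<in> {1, 2, 3}" if "i \<in> {1, 2, 3}" for i using permutes_in_image[OF p, of i] that unfolding three by simp
    have inj: "\<sigma> u = \<sigma> v \<longleftrightarrow> u = v" for u v using permutes_inj[OF p] by (auto dest: injD)
    have st: "{\<sigma> a, \<sigma> b} = {a, b}" if ab: "a \<in> {1, 2, 3}" "b \<in> {1, 2, 3}" "a \<noteq> b" for a b
    proof -
      have "{\<sigma> a, \<sigma> b} \<inter> {a, b} \<noteq> {}" using im[OF ab(1)] im[OF ab(2)] inj[of a b] ab by auto
      then show ?thesis
        using acts_trivially_pair_stable[OF q N act \<sigma>] ab unfolding three pair_stable_def image_insert image_empty by blast
    qed
    fix i
    show "\<sigma> i = id i"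
    proof (cases "i \<in> {1, 2, 3}")
      case True
      then show ?thesis using st[of 1 2] st[of 1 3] st[of 2 3] by (auto simp: doubleton_eq_iff)
    next
      case False
      then show ?thesis using permutes_not_in[OF p, of i] three by simp
    qed
  qed
  then show "N = {id}" using normal_id[OF N] by blast
qed (simp add: acts_trivially_id)

lemma acts_trivially_4_iff: "acts_trivially 4 N \<longleftrightarrow> N \<subseteq> klein4" if n: "even n" "n \<ge> 4" and N: "N \<lhd> sym_group 4"
proof -
  have q: "4 \<le> n" "4 mod 2 = n mod 2" using n by (auto simp: even_iff_mod_2_eq_zero)
  show ?thesis
    using acts_trivially_pair_stable[OF q N] pair_stable_acts_trivially[OF q N n(1) order_refl] normal_permutes[OF N]
    unfolding subset_iff klein4_iff by blast
qed

end

section \<open>The labelled congruences\<close>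

fun index_rank :: "index \<Rightarrow> nat" where
  "index_rank ix_1 = 1"
| "index_rank ix_0 = 0"
| "index_rank ix_S2 = 0"
| "index_rank ix_2 = 2"
| "index_rank ix_K = 2"

fun index_normal :: "index \<Rightarrow> (nat \<Rightarrow> nat) set" where
  "index_normal ix_S2 = carrier (sym_group 2)"
| "index_normal ix_K = klein4"
| "index_normal _ = {id}"

definition upper_flag :: "symb \<Rightarrow> bool" where "upper_flag a \<longleftrightarrow> a = Mu \<or> a = Rho"

definition lower_flag :: "symb \<Rightarrow> bool" where "lower_flag a \<longleftrightarrow> a = Mu \<or> a = Lambda"

lemma flags_simps [simp]:
  "upper_flag Mu" "upper_flag Rho" "\<not> upper_flag Lambda" "\<not> upper_flag Rees"
  "lower_flag Mu" "lower_flag Lambda" "\<not> lower_flag Rho" "\<not> lower_flag Rees"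
  by (simp_all add: upper_flag_def lower_flag_def)

text \<open>The diamond is the product of two two-element chains, one for each flag; a set flag
  gives the smaller congruence.\<close>

lemma diamond_le_flags: "diamond_le a b \<longleftrightarrow> (upper_flag b \<longrightarrow> upper_flag a) \<and> (lower_flag b \<longrightarrow> lower_flag a)"
  by (cases a; cases b) (simp_all add: diamond_le_def)

lemma flags_inj: "a = b" if "upper_flag a = upper_flag b" "lower_flag a = lower_flag b"
  using that by (cases a; cases b) simp_all

lemma pair_C_eq: "pair_C n i = (rank_ideal n (index_rank i), bar n (index_rank i + 2) ` index_normal i)"
  by (cases i) (simp_all add: bar_sym_def numeral_3_eq_3 numeral_Bit0)

text \<open>The chain is the lexicographic order of rank and normal subgroup, the order that
  \<open>family_le_iff\<close> attaches to these parameters.\<close>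

lemma index_chain: "index_rank i < index_rank j \<or> index_rank i = index_rank j \<and> index_normal i \<subseteq> index_normal j
    \<longleftrightarrow> chain_pos i \<le> chain_pos j" if "i \<in> indices n" "j \<in> indices n"
proof -
  have "id \<in> klein4" "id \<in> carrier (sym_group 2)" "\<not> klein4 \<subseteq> {id}" "\<not> carrier (sym_group 2) \<subseteq> {id}"
    using normal_id[OF klein4_normal] normal_id[OF sym_normal[of 2]] klein4_ne_trivial sym_ne_trivial[of 2] by blast+
  then show ?thesis using that by (cases i; cases j) (auto simp: indices_def split: if_splits)
qed

lemma chain_pos_inj: "i = j" if "i \<in> indices n" "j \<in> indices n" "chain_pos i = chain_pos j"
  using that by (cases i; cases j) (auto simp: indices_def split: if_splits)

lemma sorted_wrt_concat:
  assumes "sorted_wrt (<) qs" "\<And>q. q \<in> set qs \<Longrightarrow> sorted_wrt P (F q)"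
    and "\<And>q q' x y. q \<in> set qs \<Longrightarrow> q' \<in> set qs \<Longrightarrow> q < q' \<Longrightarrow> x \<in> set (F q) \<Longrightarrow> y \<in> set (F q') \<Longrightarrow> P x y"
  shows "sorted_wrt P (concat (map F qs))"
  using assms
proof (induction qs)
  case (Cons q qs)
  have "sorted_wrt P (concat (map F qs))" using Cons.prems(1,2) by (intro Cons.IH) (auto intro: Cons.prems(3))
  then show ?case using Cons.prems(1,2) by (auto simp: sorted_wrt_append intro!: Cons.prems(3)[of q])
qed simp

context brauer_monoid
begin

context
  assumes n3: "n \<ge> 3"
  notes add_2_eq_Suc [simp del] add_2_eq_Suc' [simp del]
begin

lemma even_ge_4: "n \<ge> 4" if "even n"
proof -
  have "n \<noteq> 3" using that by auto
  then show ?thesis using n3 by simp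
qed

lemma index_facts:
  assumes "i \<in> indices n"
  shows "index_rank i < n" "index_rank i mod 2 = n mod 2" "index_normal i \<lhd> sym_group (index_rank i + 2)"
    "index_rank i \<le> 2" "acts_trivially (index_rank i + 2) (index_normal i)"
proof -
  have "(index_rank i < n \<and> index_rank i mod 2 = n mod 2) \<and> index_normal i \<lhd> sym_group (index_rank i + 2) \<and>
    index_rank i \<le> 2 \<and> acts_trivially (index_rank i + 2) (index_normal i)"
  proof (cases "odd n")
    case True
    then have "i = ix_1" using assms by (simp add: indices_def)
    then show ?thesis using True n3 trivial_normal acts_trivially_id by (simp add: odd_iff_mod_2_eq_one)
  next
    case False
    note n4 = even_ge_4[OF False[simplified]]
    have n0: "n mod 2 = 0" using False by simp
    have four: "2 + 2 = (4 :: nat)" by simp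
    from False assms consider "i = ix_0" | "i = ix_S2" | "i = ix_2" | "i = ix_K" by (auto simp: indices_def)
    then show ?thesis
    proof cases
      case 2
      then show ?thesis using n4 n0 sym_normal[of 2] acts_trivially_2[OF _ _ sym_normal] False by simp
    next
      case 4
      then show ?thesis using n4 n0 klein4_normal acts_trivially_4_iff[OF _ n4 klein4_normal] False by (simp add: four)
    qed (use n4 n0 trivial_normal acts_trivially_id in simp_all)
  qed
  then show "index_rank i < n" "index_rank i mod 2 = n mod 2" "index_normal i \<lhd> sym_group (index_rank i + 2)"
    "index_rank i \<le> 2" "acts_trivially (index_rank i + 2) (index_normal i)" by auto
qed

lemma index_cases:
  assumes r: "r < n" "r mod 2 = n mod 2" "r \<le> 2" and N: "N \<lhd> sym_group (r + 2)" and act: "acts_trivially (r + 2) N"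
  shows "\<exists>i \<in> indices n. r = index_rank i \<and> N = index_normal i"
proof (cases "odd n")
  case True
  have "r \<noteq> 0" "r \<noteq> 2" using r(2) True by (auto simp: odd_iff_mod_2_eq_one)
  then have r1: "r = 1" using r(3) by simp
  have "r + 2 = 3" using r1 by simp
  then have "N = {id}" using acts_trivially_3_iff[OF True n3] N act by simp
  then show ?thesis using True r1 by (auto simp: indices_def)
next
  case False
  then have ev: "even n" by simp
  have "r \<noteq> 1" using r(2) ev by auto
  then consider "r = 0" | "r = 2" using r(3) by linarith
  then show ?thesis
  proof cases
    case 1
    then have "N = {id} \<or> N = carrier (sym_group 2)" using N normal_sym_2 by simp
    then show ?thesis using False 1 by (auto simp: indices_def)
  next
    case 2
    then have "r + 2 = 4" by simp
    then have N4: "N \<lhd> sym_group 4" "acts_trivially 4 N" using N act by simp_all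
    then have "N = {id} \<or> N = klein4" using normal_le_klein4 acts_trivially_4_iff[OF ev even_ge_4[OF ev]] by blast
    then show ?thesis using False 2 by (auto simp: indices_def)
  qed
qed

lemma retractable_pairs:
  "{(I, M). retractable_IN_pair (brauer n) I M \<and> within_bar_sym n M} = pair_C n ` indices n"
proof -
  have "retractable_IN_pair (brauer n) I M \<and> within_bar_sym n M \<longleftrightarrow> (\<exists>i \<in> indices n. (I, M) = pair_C n i)" for I M
  proof
    assume "retractable_IN_pair (brauer n) I M \<and> within_bar_sym n M"
    then obtain r N where rN: "r < n" "r mod 2 = n mod 2" "N \<lhd> sym_group (r + 2)" "r \<le> 2" "acts_trivially (r + 2) N"
      and IM: "I = rank_ideal n r" "M = bar n (r + 2) ` N"
      unfolding retractable_IN_pair_iff by blast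
    show "\<exists>i \<in> indices n. (I, M) = pair_C n i"
      using index_cases[OF rN(1,2,4,3,5)] unfolding IM pair_C_eq by blast
  next
    assume "\<exists>i \<in> indices n. (I, M) = pair_C n i"
    then show "retractable_IN_pair (brauer n) I M \<and> within_bar_sym n M"
      using index_facts unfolding retractable_IN_pair_iff pair_C_eq by blast
  qed
  then show ?thesis by auto
qed

section \<open>Labels and the parameters of the family\<close>

lemma valid_index: "valid cu cl (index_rank i) (index_normal i)" if "i \<in> indices n"
  using index_facts[OF that] by (auto simp: valid_def)

lemma valid_rank: "valid False False q {id}" if "q \<in> ranks (n mod 2) n"
  using that trivial_normal by (simp add: valid_def ranks_iff)

lemma R_rank_family: "R_rank n q = family False False q {id}" if "q \<in> ranks (n mod 2) n"
  using rees_family[OF that] by (simp add: R_rank_def)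

lemma R_normal_family: "R_normal n (r + 2) N = family False False r N"
  by (simp add: R_normal_def R_IN_family)

lemma normals_iff: "(q, N) \<in> normals (n mod 2) n \<longleftrightarrow>
    (\<exists>r. q = r + 2 \<and> r < n \<and> r mod 2 = n mod 2 \<and> N \<lhd> sym_group (r + 2) \<and> N \<noteq> {id})"
proof
  assume "(q, N) \<in> normals (n mod 2) n"
  then have q: "n mod 2 + 2 \<le> q" "q \<le> n" "q mod 2 = n mod 2" "N \<lhd> sym_group q" "N \<noteq> {id}"
    by (auto simp: normals_def ranks_def)
  have q2: "q - 2 + 2 = q" using q(1) by simp
  have "(q - 2) mod 2 = n mod 2" using mod_add_self2[of "q - 2" 2] q(3) unfolding q2 by simp
  then show "\<exists>r. q = r + 2 \<and> r < n \<and> r mod 2 = n mod 2 \<and> N \<lhd> sym_group (r + 2) \<and> N \<noteq> {id}"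
    using q q2 by (intro exI[of _ "q - 2"]) auto
next
  assume "\<exists>r. q = r + 2 \<and> r < n \<and> r mod 2 = n mod 2 \<and> N \<lhd> sym_group (r + 2) \<and> N \<noteq> {id}"
  then obtain r where r: "q = r + 2" "r < n" "r mod 2 = n mod 2" "N \<lhd> sym_group (r + 2)" "N \<noteq> {id}" by blast
  have "n mod 2 \<le> r" using mod_less_eq_dividend[of r 2] r(3) by simp
  then show "(q, N) \<in> normals (n mod 2) n" using parity_gap[OF r(2,3)] r by (simp add: normals_def ranks_def)
qed

lemma valid_normals: "valid False False r N" if "(r + 2, N) \<in> normals (n mod 2) n"
  using that by (auto simp: normals_iff valid_def)

lemma xi_family: "xi n a i = family (upper_flag a) (lower_flag a) (index_rank i) (index_normal i)" if "i \<in> indices n"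
proof -
  note f = index_facts[OF that]
  have r: "index_rank i \<in> ranks (n mod 2) n" using f by (simp add: ranks_iff)
  show ?thesis
  proof (cases a)
    case Rees
    have "xi n Rees i = family False False (index_rank i) (index_normal i)"
      using R_rank_family[OF r] R_normal_family[of "index_rank i" "index_normal i"]
      by (cases i) (simp_all add: numeral_Bit0)
    then show ?thesis using Rees by simp
  qed (simp_all add: pair_C_eq lambda_family[OF f(4) r] rho_family[OF f(4) r] mu_family[OF f(4) r])
qed

lemma xi_Cong: "xi n a i \<in> Cong (brauer n)" if "i \<in> indices n"
  unfolding xi_family[OF that] by (rule family_Cong[OF valid_index[OF that]])

lemma valid_cases:
  assumes v: "valid cu cl r N"
  shows "\<not> cu \<and> \<not> cl \<and> r \<in> ranks (n mod 2) n \<and> N = {id} \<or> \<not> cu \<and> \<not> cl \<and> (r + 2, N) \<in> normals (n mod 2) n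
    \<or> (\<exists>a \<in> {Lambda, Rho, Mu}. \<exists>i \<in> indices n. cu = upper_flag a \<and> cl = lower_flag a \<and> r = index_rank i \<and> N = index_normal i)"
proof (cases "cu \<or> cl")
  case True
  then have a: "\<exists>a \<in> {Lambda, Rho, Mu}. cu = upper_flag a \<and> cl = lower_flag a" by auto
  have "r < n" "r mod 2 = n mod 2" "r \<le> 2" "N \<lhd> sym_group (r + 2)" "acts_trivially (r + 2) N"
    using v True unfolding valid_def by auto
  from index_cases[OF this] a show ?thesis by blast
next
  case False
  have r: "r \<in> ranks (n mod 2) n" using v by (simp add: valid_def ranks_iff)
  show ?thesis
  proof (cases "N = {id}")
    case True
    then show ?thesis using False r by simp
  next
    case ne: False
    then have "r < n" "r mod 2 = n mod 2" "N \<lhd> sym_group (r + 2)" using v by (auto simp: valid_def split: if_splits)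
    then have "(r + 2, N) \<in> normals (n mod 2) n" using ne unfolding normals_iff by blast
    then show ?thesis using False by blast
  qed
qed

text \<open>Translates labels into parameters of \<open>family\<close>, so that distinctness of the
  congruences splits into injectivity here and \<open>family_eq_iff\<close>. The shift by 2 is the
  distance from the ideal to the rank where the subgroup lives.\<close>

definition label_params :: "label \<Rightarrow> bool \<times> bool \<times> nat \<times> (nat \<Rightarrow> nat) set" where
  "label_params l = (case l of RankL q \<Rightarrow> (False, False, q, {id}) | NormalL q N \<Rightarrow> (False, False, q - 2, N)
     | XiL a i \<Rightarrow> (upper_flag a, lower_flag a, index_rank i, index_normal i))"

lemma labels_cases:
  assumes "l \<in> labels (n mod 2) n"
  obtains q where "l = RankL q" "q \<in> ranks (n mod 2) n"
    | r N where "l = NormalL (r + 2) N" "(r + 2, N) \<in> normals (n mod 2) n" "N \<noteq> {id}"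
    | a i where "l = XiL a i" "a \<in> {Lambda, Rho, Mu}" "i \<in> indices n"
proof -
  from assms consider "l \<in> RankL ` ranks (n mod 2) n" | "l \<in> {NormalL q N | q N. (q, N) \<in> normals (n mod 2) n}"
    | "l \<in> {XiL a i | a i. a \<in> {Lambda, Rho, Mu} \<and> i \<in> indices n}"
    unfolding labels_def by blast
  then show thesis
  proof cases
    case 1
    then show thesis using that(1) by blast
  next
    case 2
    then obtain q N where l: "l = NormalL q N" "(q, N) \<in> normals (n mod 2) n" by blast
    then obtain r where "q = r + 2" "N \<noteq> {id}" unfolding normals_iff by blast
    then show thesis using that(2) l by blast
  next
    case 3
    then show thesis using that(3) by blast
  qed
qed

lemma label_family:
  assumes "l \<in> labels (n mod 2) n" and p: "label_params l = (cu, cl, r, N)"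
  shows "valid cu cl r N" "cong_of n l = family cu cl r N"
proof -
  have "valid cu cl r N \<and> cong_of n l = family cu cl r N"
    using assms(1)
  proof (cases rule: labels_cases)
    case (1 q)
    then show ?thesis using p valid_rank R_rank_family by (auto simp: label_params_def)
  next
    case (2 r' N')
    then show ?thesis using p valid_normals R_normal_family[of r' N'] by (auto simp: label_params_def)
  next
    case (3 a i)
    then show ?thesis using p valid_index xi_family by (auto simp: label_params_def)
  qed
  then show "valid cu cl r N" "cong_of n l = family cu cl r N" by auto
qed

lemma index_params_inj: "i = j" if "i \<in> indices n" "j \<in> indices n" "index_rank i = index_rank j" "index_normal i = index_normal j"
proof (rule chain_pos_inj[OF that(1,2)])
  show "chain_pos i = chain_pos j"
    using index_chain[OF that(1,2)] index_chain[OF that(2,1)] that(3,4) by (intro le_antisym) auto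
qed

lemma label_params_inj: "inj_on label_params (labels (n mod 2) n)"
proof (rule inj_onI)
  fix l l' assume l: "l \<in> labels (n mod 2) n" and l': "l' \<in> labels (n mod 2) n" and eq: "label_params l = label_params l'"
  show "l = l'"
    using l
  proof (cases rule: labels_cases)
    case (1 q)
    from l' show ?thesis by (cases rule: labels_cases) (use 1 eq in \<open>auto simp: label_params_def\<close>)
  next
    case (2 r N)
    from l' show ?thesis by (cases rule: labels_cases) (use 2 eq in \<open>auto simp: label_params_def\<close>)
  next
    case (3 a i)
    from l' show ?thesis
    proof (cases rule: labels_cases)
      case (3 b j)
      have "a = b" using eq 3 \<open>l = XiL a i\<close> flags_inj by (simp add: label_params_def)
      moreover have "i = j" using eq 3 \<open>l = XiL a i\<close> \<open>i \<in> indices n\<close> index_params_inj by (simp add: label_params_def)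
      ultimately show ?thesis using 3 \<open>l = XiL a i\<close> by simp
    qed (use 3 eq in \<open>auto simp: label_params_def\<close>)
  qed
qed

lemma cong_of_inj: "inj_on (cong_of n) (labels (n mod 2) n)"
proof (rule inj_onI)
  fix l l' assume l: "l \<in> labels (n mod 2) n" and l': "l' \<in> labels (n mod 2) n" and eq: "cong_of n l = cong_of n l'"
  obtain cu cl r N where p: "label_params l = (cu, cl, r, N)" by (cases "label_params l") (rule that)
  obtain cu' cl' r' N' where p': "label_params l' = (cu', cl', r', N')" by (cases "label_params l'") (rule that)
  have "label_params l = label_params l'"
    using family_eq_iff[OF n3 label_family(1)[OF l p] label_family(1)[OF l' p']] eq label_family(2)[OF l p] label_family(2)[OF l' p'] p p'
    by simp
  then show "l = l'" using inj_onD[OF label_params_inj] l l' by blast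
qed

lemma Cong_eq: "Cong (brauer n) = R_rank n ` ranks (n mod 2) n
    \<union> {R_normal n q N | q N. (q, N) \<in> normals (n mod 2) n}
    \<union> {xi n a i | a i. a \<in> {Lambda, Rho, Mu} \<and> i \<in> indices n}" (is "_ = ?R")
proof
  show "Cong (brauer n) \<subseteq> ?R"
  proof
    fix \<xi> assume "\<xi> \<in> Cong (brauer n)"
    then obtain cu cl r N where v: "valid cu cl r N" and \<xi>: "\<xi> = family cu cl r N" using Cong_family[OF n3] by blast
    from valid_cases[OF v] show "\<xi> \<in> ?R"
    proof (elim disjE conjE bexE)
      assume "\<not> cu" "\<not> cl" "r \<in> ranks (n mod 2) n" "N = {id}"
      then have "\<xi> = R_rank n r" using R_rank_family \<xi> by simp
      then show ?thesis using \<open>r \<in> ranks (n mod 2) n\<close> by blast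
    next
      assume "\<not> cu" "\<not> cl" "(r + 2, N) \<in> normals (n mod 2) n"
      then have "\<xi> = R_normal n (r + 2) N" using R_normal_family \<xi> by simp
      then show ?thesis using \<open>(r + 2, N) \<in> normals (n mod 2) n\<close> by blast
    next
      fix a i assume a: "a \<in> {Lambda, Rho, Mu}" "i \<in> indices n"
        and "cu = upper_flag a" "cl = lower_flag a" "r = index_rank i" "N = index_normal i"
      then have "\<xi> = xi n a i" using xi_family \<xi> by simp
      then show ?thesis using a by blast
    qed
  qed
  show "?R \<subseteq> Cong (brauer n)"
  proof (intro Un_least)
    show "R_rank n ` ranks (n mod 2) n \<subseteq> Cong (brauer n)"
      using family_Cong[OF valid_rank] R_rank_family by auto
    show "{R_normal n q N | q N. (q, N) \<in> normals (n mod 2) n} \<subseteq> Cong (brauer n)"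
    proof
      fix \<xi> assume "\<xi> \<in> {R_normal n q N | q N. (q, N) \<in> normals (n mod 2) n}"
      then obtain q N where qN: "\<xi> = R_normal n q N" "(q, N) \<in> normals (n mod 2) n" by blast
      then obtain r where "q = r + 2" unfolding normals_iff by blast
      then show "\<xi> \<in> Cong (brauer n)" using qN family_Cong[OF valid_normals] R_normal_family by simp
    qed
    show "{xi n a i | a i. a \<in> {Lambda, Rho, Mu} \<and> i \<in> indices n} \<subseteq> Cong (brauer n)"
      using xi_Cong by blast
  qed
qed

lemma cong_of_labels: "Cong (brauer n) = cong_of n ` labels (n mod 2) n"
proof -
  have "cong_of n ` labels (n mod 2) n = R_rank n ` ranks (n mod 2) n
    \<union> {R_normal n q N | q N. (q, N) \<in> normals (n mod 2) n}
    \<union> {xi n a i | a i. a \<in> {Lambda, Rho, Mu} \<and> i \<in> indices n}"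
  proof -
    have "cong_of n ` RankL ` Q = R_rank n ` Q" for Q by (simp add: image_image)
    moreover have "cong_of n ` {NormalL q N | q N. (q, N) \<in> Q} = {R_normal n q N | q N. (q, N) \<in> Q}" for Q
      by (auto intro!: image_eqI[where x = "NormalL _ _"]) blast
    moreover have "cong_of n ` {XiL a i | a i. a \<in> X \<and> i \<in> Y} = {xi n a i | a i. a \<in> X \<and> i \<in> Y}" for X Y
      by (auto intro!: image_eqI[where x = "XiL _ _"]) blast
    ultimately show ?thesis by (simp only: labels_def image_Un)
  qed
  then show ?thesis using Cong_eq by (simp only:)
qed

lemma proper_pairs: "{(I, M). proper_IN_pair (brauer n) I M \<and> within_bar_sym n M}
    = {(rank_ideal n (q - 2), bar n q ` N) | q N. (q, N) \<in> normals (n mod 2) n}"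
proof -
  have card: "2 \<le> card (bar n q ` N) \<longleftrightarrow> N \<noteq> {id}" if q: "q \<le> n" "q mod 2 = n mod 2" and N: "N \<lhd> sym_group q" for q N
  proof -
    have "N \<subseteq> {\<sigma>. \<sigma> permutes {1..q}}" using normal_permutes[OF N] by blast
    then have fin: "finite N" by (rule finite_subset) (simp add: finite_permutations)
    have "inj_on (bar n q) N" by (intro inj_onI bar_inj[OF q]) (use normal_permutes[OF N] in auto)
    then have c: "card (bar n q ` N) = card N" by (rule card_image)
    have "card N \<noteq> 0" using fin normal_id[OF N] by auto
    then have "2 \<le> card N \<longleftrightarrow> card N \<noteq> 1" by linarith
    also have "card N = 1 \<longleftrightarrow> N = {id}" using normal_id[OF N] by (auto simp: card_1_singleton_iff)
    finally show ?thesis using c by simp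
  qed
  have "proper_IN_pair (brauer n) I M \<and> within_bar_sym n M \<longleftrightarrow>
      (\<exists>q N. (I, M) = (rank_ideal n (q - 2), bar n q ` N) \<and> (q, N) \<in> normals (n mod 2) n)" for I M
  proof
    assume h: "proper_IN_pair (brauer n) I M \<and> within_bar_sym n M"
    then have "IN_pair (brauer n) I M \<and> within_bar_sym n M" by (simp add: proper_IN_pair_def)
    then obtain r N where rN: "r < n" "r mod 2 = n mod 2" "N \<lhd> sym_group (r + 2)" "I = rank_ideal n r" "M = bar n (r + 2) ` N"
      unfolding IN_pair_iff by blast
    have q: "r + 2 \<le> n" "(r + 2) mod 2 = n mod 2" using parity_gap[OF rN(1,2)] rN by auto
    have "N \<noteq> {id}" using card[OF q rN(3)] h rN(5) by (simp add: proper_IN_pair_def)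
    then have "(r + 2, N) \<in> normals (n mod 2) n" using rN unfolding normals_iff by blast
    then show "\<exists>q N. (I, M) = (rank_ideal n (q - 2), bar n q ` N) \<and> (q, N) \<in> normals (n mod 2) n"
      using rN by (intro exI[of _ "r + 2"] exI[of _ N]) simp
  next
    assume "\<exists>q N. (I, M) = (rank_ideal n (q - 2), bar n q ` N) \<and> (q, N) \<in> normals (n mod 2) n"
    then obtain q N where qN: "I = rank_ideal n (q - 2)" "M = bar n q ` N" "(q, N) \<in> normals (n mod 2) n" by blast
    then obtain r where r: "q = r + 2" and rN: "r < n" "r mod 2 = n mod 2" "N \<lhd> sym_group (r + 2)" "N \<noteq> {id}"
      unfolding normals_iff by blast
    have IM: "I = rank_ideal n r" "M = bar n (r + 2) ` N" using qN r by simp_all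
    have q: "r + 2 \<le> n" "(r + 2) mod 2 = n mod 2" using parity_gap[OF rN(1,2)] rN by auto
    have "IN_pair (brauer n) I M \<and> within_bar_sym n M" unfolding IN_pair_iff using rN IM by blast
    then show "proper_IN_pair (brauer n) I M \<and> within_bar_sym n M"
      using card[OF q rN(3)] rN(4) IM by (simp add: proper_IN_pair_def)
  qed
  then show ?thesis by auto
qed

section \<open>The order\<close>

lemma family_less_iff:
  assumes "valid cu cl r N" "valid cu cl r' N'"
  shows "family cu cl r N \<subset> family cu cl r' N' \<longleftrightarrow> r < r' \<or> r = r' \<and> N \<subset> N'"
  unfolding psubset_eq family_le_iff[OF n3 assms] family_eq_iff[OF n3 assms] by auto

text \<open>The diagonal is a congruence, hence a member of the family, and the parameters on the
  left are below those of every member; no pattern has to be computed.\<close>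

lemma Delta_family: "family True True (n mod 2) {id} = Delta (brauer n)"
proof -
  have v: "valid True True (n mod 2) {id}"
  proof -
    have "n mod 2 < 2" by simp
    then have "n mod 2 < n" "n mod 2 \<le> 2" using n3 by linarith+
    then show ?thesis using trivial_normal acts_trivially_id by (simp add: valid_def)
  qed
  have "Delta (brauer n) \<in> Cong (brauer n)"
    unfolding Cong_iff Delta_def using mult_closed by (auto intro!: equivI refl_onI symI transI)
  then obtain cu cl r N where v': "valid cu cl r N" and D: "Delta (brauer n) = family cu cl r N"
    using Cong_family[OF n3] by blast
  have "id \<in> N"
    using v' normal_id unfolding valid_def by (auto split: if_splits)
  then have "family True True (n mod 2) {id} \<subseteq> Delta (brauer n)"
    unfolding D family_le_iff[OF n3 v v'] using valid_parity(3)[OF v'] by auto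
  moreover have "Delta (brauer n) \<subseteq> family True True (n mod 2) {id}"
    by (auto simp: Delta_def family_def)
  ultimately show ?thesis by (rule subset_antisym)
qed

text \<open>With \<open>r\<close> and \<open>N\<close> equal, anything strictly between would have
  to differ in a flag from both ends, but the ends differ in only one.\<close>

lemma covered_family:
  assumes v: "valid cu cl r N" and v': "valid cu' cl' r N"
    and fl: "cu' \<Longrightarrow> cu" "cl' \<Longrightarrow> cl" "(cu = cu') \<noteq> (cl = cl')"
  shows "covered_by (Cong (brauer n)) (family cu cl r N) (family cu' cl' r N)"
proof -
  have False if "c \<in> Cong (brauer n)" "family cu cl r N \<subset> c" "c \<subset> family cu' cl' r N" for c
  proof -
    obtain cu'' cl'' r'' N'' where v'': "valid cu'' cl'' r'' N''" and c: "c = family cu'' cl'' r'' N''"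
      using Cong_family[OF n3 \<open>c \<in> Cong (brauer n)\<close>] by blast
    show False
      using that(2,3) fl
      unfolding c psubset_eq family_le_iff[OF n3 v v''] family_le_iff[OF n3 v'' v'] family_eq_iff[OF n3 v v''] family_eq_iff[OF n3 v'' v']
      by auto
  qed
  then show ?thesis
    unfolding covered_by_def psubset_eq family_le_iff[OF n3 v v'] family_eq_iff[OF n3 v v']
    using family_Cong[OF v] family_Cong[OF v'] fl by (auto simp: psubset_eq)
qed

lemma R_rank_top: "R_rank n n = Nabla (brauer n)"
  using rank_le by (auto simp: R_rank_def rees_def Delta_def Nabla_def rank_ideal_iff)

end

context
  assumes n3: "n \<ge> 3"
  notes add_2_eq_Suc [simp del] add_2_eq_Suc' [simp del] xi.simps [simp del]
begin

section \<open>The chain of the large congruences\<close>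

lemma set_upper_chain: "x \<in> set (upper_chain m n) \<longleftrightarrow> (\<exists>q. m \<le> q \<and> q \<le> n \<and> q mod 2 = n mod 2 \<and>
    (x = R_normal n q (carrier (alt_group q)) \<or> x = R_normal n q (carrier (sym_group q)) \<or> x = R_rank n q))"
proof -
  have "set (filter (\<lambda>q. q mod 2 = n mod 2) [m..<n + 1]) = {q. m \<le> q \<and> q \<le> n \<and> q mod 2 = n mod 2}" by auto
  then show ?thesis unfolding upper_chain_def set_concat set_map by simp
qed

lemma upper_chain_family:
  assumes q: "r < n" "r mod 2 = n mod 2" "1 \<le> r"
  shows "R_normal n (r + 2) (carrier (alt_group (r + 2))) = family False False r (carrier (alt_group (r + 2)))"
    "R_normal n (r + 2) (carrier (sym_group (r + 2))) = family False False r (carrier (sym_group (r + 2)))"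
    "R_rank n (r + 2) = family False False (r + 2) {id}"
    "valid False False r (carrier (alt_group (r + 2)))" "valid False False r (carrier (sym_group (r + 2)))"
    "valid False False (r + 2) {id}"
proof -
  have r2: "r + 2 \<in> ranks (n mod 2) n" using parity_gap[OF q(1,2)] q(2) by (simp add: ranks_iff)
  show "R_rank n (r + 2) = family False False (r + 2) {id}" "valid False False (r + 2) {id}"
    using R_rank_family[OF n3 r2] valid_rank[OF n3 r2] .
  show "valid False False r (carrier (alt_group (r + 2)))" "valid False False r (carrier (sym_group (r + 2)))"
    using q alt_normal sym_normal by (simp_all add: valid_def)
qed (simp_all add: R_normal_family[OF n3])

lemma alt_less: "{id} \<subset> carrier (alt_group (r + 2))" if "1 \<le> r"
  using alt_ne_trivial[of "r + 2"] normal_id[OF alt_normal[of "r + 2"]] that by auto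

lemma upper_chain_block: "sorted_wrt (\<subset>) [R_normal n (r + 2) (carrier (alt_group (r + 2))),
    R_normal n (r + 2) (carrier (sym_group (r + 2))), R_rank n (r + 2)]"
  if q: "r < n" "r mod 2 = n mod 2" "1 \<le> r"
proof -
  note f = upper_chain_family[OF q]
  show ?thesis
    using alt_psubset_sym[of "r + 2"] family_less_iff[OF n3 f(4) f(5)] family_less_iff[OF n3 f(4) f(6)] family_less_iff[OF n3 f(5) f(6)]
    by (simp add: f(1-3))
qed

lemma upper_chain_sorted: "sorted_wrt (\<subset>) (upper_chain m n)" if m: "3 \<le> m"
  unfolding upper_chain_def
proof (rule sorted_wrt_concat)
  let ?qs = "filter (\<lambda>q. q mod 2 = n mod 2) [m..<n + 1]"
  let ?F = "\<lambda>q. [R_normal n q (carrier (alt_group q)), R_normal n q (carrier (sym_group q)), R_rank n q]"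
  have shift: "\<exists>r. q = r + 2 \<and> r < n \<and> r mod 2 = n mod 2 \<and> 1 \<le> r" if "q \<in> set ?qs" for q
  proof -
    have q: "m \<le> q" "q \<le> n" "q mod 2 = n mod 2" using that by auto
    have "q - 2 + 2 = q" using q(1) m by simp
    then show ?thesis using q m mod_add_self2[of "q - 2" 2] by (intro exI[of _ "q - 2"]) auto
  qed
  show "sorted_wrt (<) ?qs" by (intro sorted_wrt_filter sorted_wrt_upt)
  show "sorted_wrt (\<subset>) (?F q)" if q: "q \<in> set ?qs" for q
  proof -
    obtain r where r: "q = r + 2" "r < n" "r mod 2 = n mod 2" "1 \<le> r" using shift[OF q] by blast
    show ?thesis unfolding r(1) using upper_chain_block[OF r(2-4)] .
  qed
  show "x \<subset> y" if q: "q \<in> set ?qs" and q': "q' \<in> set ?qs" and less: "q < q'" and xy: "x \<in> set (?F q)" "y \<in> set (?F q')" for q q' x y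
  proof -
    obtain r where r: "q = r + 2" "r < n" "r mod 2 = n mod 2" "1 \<le> r" using shift[OF q] by blast
    obtain r' where r': "q' = r' + 2" "r' < n" "r' mod 2 = n mod 2" "1 \<le> r'" using shift[OF q'] by blast
    have rr': "r + 2 \<le> r'" using parity_gap[of r r'] less r r' by simp
    note f = upper_chain_family[OF r(2-4)] and f' = upper_chain_family[OF r'(2-4)]
    \<comment> \<open>This is \<open>R_rank n q\<close>, the last entry of the block of
      \<open>q\<close>; it lies strictly below the whole block of \<open>q'\<close> and so separates
      the two.\<close>
    define z where "z = family False False (r + 2) {id}"
    have "x \<subseteq> z"
      using xy(1) family_le_iff[OF n3 f(4,6)] family_le_iff[OF n3 f(5,6)] by (auto simp: r(1) f(1-3) z_def)
    moreover have "z \<subset> family False False r' (carrier (alt_group (r' + 2)))"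
      unfolding z_def family_less_iff[OF n3 f(6) f'(4)] using rr' alt_less[OF r'(4)] by (simp add: le_less)
    moreover have "family False False r' (carrier (alt_group (r' + 2))) \<subseteq> y"
      using xy(2) family_le_iff[OF n3 f'(4,4)] family_le_iff[OF n3 f'(4,5)] family_le_iff[OF n3 f'(4,6)]
        alt_psubset_sym[of "r' + 2"] by (auto simp: r'(1) f'(1-3))
    ultimately show ?thesis by blast
  qed
qed

lemma sorted_Cons_upper_chain:
  assumes m: "1 \<le> m" "m mod 2 = n mod 2" "m \<le> n" and v: "valid False False m N" and N: "N \<subset> carrier (alt_group (m + 2))"
  shows "sorted_wrt (\<subset>) (family False False m N # upper_chain (m + 2) n)"
proof -
  have "family False False m N \<subset> x" if x: "x \<in> set (upper_chain (m + 2) n)" for x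
  proof -
    have less: "family False False m N \<subset> R_normal n (r + 2) (carrier (alt_group (r + 2)))" if r: "r < n" "r mod 2 = n mod 2" "m \<le> r" for r
    proof -
      have r1: "1 \<le> r" using r(3) m(1) by simp
      note f = upper_chain_family[OF r(1,2) r1]
      show ?thesis unfolding f(1) family_less_iff[OF n3 v f(4)] using r(3) N by (auto simp: le_less)
    qed
    from x obtain q where q: "m + 2 \<le> q" "q \<le> n" "q mod 2 = n mod 2"
      and xq: "x = R_normal n q (carrier (alt_group q)) \<or> x = R_normal n q (carrier (sym_group q)) \<or> x = R_rank n q"
      unfolding set_upper_chain by blast
    define r where "r = q - 2"
    have r: "q = r + 2" "r < n" "m \<le> r" using q by (auto simp: r_def)
    have par: "r mod 2 = n mod 2" using q(3) mod_add_self2[of r 2] by (simp add: r(1))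
    have r1: "1 \<le> r" using r(3) m(1) by simp
    have "R_normal n (r + 2) (carrier (alt_group (r + 2))) \<subseteq> x"
      using upper_chain_block[OF r(2) par r1] xq by (auto simp: r(1) simp del: psubset_eq)
    then show ?thesis using less[OF r(2) par r(3)] by (rule psubset_subset_trans[rotated])
  qed
  then show ?thesis using upper_chain_sorted[of "m + 2"] m(1) by simp
qed

lemma klein4_valid: "valid False False 2 klein4" if "even n"
  using even_ge_4[OF n3 that] klein4_normal that by (simp add: valid_def)

lemma rest_chain_sorted: "sorted_wrt (\<subset>) (rest_chain n)"
proof (cases "odd n")
  case True
  then have "1 \<in> ranks (n mod 2) n" unfolding ranks_iff using n3 by (simp add: odd_iff_mod_2_eq_one)
  note f = R_rank_family[OF n3 this] valid_rank[OF n3 this]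
  have "sorted_wrt (\<subset>) (family False False 1 {id} # upper_chain (1 + 2) n)"
    using True n3 f(2) alt_less[of 1] by (intro sorted_Cons_upper_chain) (auto simp: odd_iff_mod_2_eq_one)
  moreover have "1 + 2 = (3 :: nat)" by simp
  ultimately show ?thesis using True f(1) by (simp add: rest_chain_def)
next
  case False
  then have ev: "even n" by simp
  have four: "2 + 2 = (4 :: nat)" by simp
  have "sorted_wrt (\<subset>) (family False False 2 klein4 # upper_chain (2 + 2) n)"
    using ev n3 klein4_valid[OF ev] klein4_psubset_alt by (intro sorted_Cons_upper_chain) (auto simp: four)
  then show ?thesis using False R_normal_family[OF n3, of 2 klein4] unfolding four by (simp add: rest_chain_def)
qed

lemma large_normal: "N = carrier (alt_group q) \<or> N = carrier (sym_group q) \<or> q = 4 \<and> N = klein4"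
  if N: "N \<lhd> sym_group q" "N \<noteq> {id}" and q: "3 \<le> q"
proof (cases "q = 4 \<and> N \<subseteq> klein4")
  case True
  then show ?thesis using normal_le_klein4 N by blast
next
  case False
  then have "carrier (alt_group q) \<subseteq> N" using alt_group_le_normal[OF N(1) q N(2)] by blast
  then show ?thesis using normal_ge_alt[OF N(1)] by blast
qed

lemma upper_chain_Cong: "set (upper_chain m n) \<subseteq> Cong (brauer n)" if m: "3 \<le> m"
proof
  fix x assume "x \<in> set (upper_chain m n)"
  then obtain q where q: "m \<le> q" "q \<le> n" "q mod 2 = n mod 2"
    and xq: "x = R_normal n q (carrier (alt_group q)) \<or> x = R_normal n q (carrier (sym_group q)) \<or> x = R_rank n q"
    unfolding set_upper_chain by blast
  define r where "r = q - 2"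
  have r: "q = r + 2" "r < n" "1 \<le> r" using q m by (auto simp: r_def)
  have par: "r mod 2 = n mod 2" using q(3) mod_add_self2[of r 2] by (simp add: r(1))
  note f = upper_chain_family[OF r(2) par r(3)]
  show "x \<in> Cong (brauer n)" using xq family_Cong[OF f(4)] family_Cong[OF f(5)] family_Cong[OF f(6)] by (auto simp: r(1) f(1-3))
qed

text \<open>Below rank \<open>m\<close>, and for \<open>klein4\<close> in rank 4, every
  \<open>R_rank\<close> and \<open>R_normal\<close> is some \<open>xi n Rees i\<close>; from
  \<open>m\<close> on the other nontrivial normal subgroups are alternating or symmetric by
  \<open>large_normal\<close>.\<close>

lemma Cong_chain:
  assumes m: "m = (if odd n then 3 else 4)"
  shows "Cong (brauer n) = {xi n a i | a i. i \<in> indices n} \<union> set (upper_chain m n)"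
proof
  show "Cong (brauer n) \<subseteq> {xi n a i | a i. i \<in> indices n} \<union> set (upper_chain m n)"
    unfolding Cong_eq[OF n3]
  proof (intro Un_least)
    show "R_rank n ` ranks (n mod 2) n \<subseteq> {xi n a i | a i. i \<in> indices n} \<union> set (upper_chain m n)"
    proof
      fix x assume "x \<in> R_rank n ` ranks (n mod 2) n"
      then obtain q where q: "x = R_rank n q" "q \<le> n" "q mod 2 = n mod 2" by (auto simp: ranks_iff)
      show "x \<in> {xi n a i | a i. i \<in> indices n} \<union> set (upper_chain m n)"
      proof (cases "m \<le> q")
        case True
        then have "x \<in> set (upper_chain m n)" using q unfolding set_upper_chain by blast
        then show ?thesis by blast
      next
        case False
        have "\<exists>i \<in> indices n. x = xi n Rees i"
        proof (cases "odd n")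
          case True
          then have "q = 0 \<or> q = 1 \<or> q = 2" using False m by auto
          then have "q = 1" using q(3) True by (auto simp: odd_iff_mod_2_eq_one)
          then show ?thesis using q(1) True by (simp add: indices_def xi.simps)
        next
          case ev: False
          then have "q = 0 \<or> q = 1 \<or> q = 2 \<or> q = 3" using False m by auto
          then have "q = 0 \<or> q = 2" using q(3) ev by auto
          then show ?thesis using q(1) ev by (auto simp: indices_def xi.simps)
        qed
        then show ?thesis by blast
      qed
    qed
    show "{R_normal n q N | q N. (q, N) \<in> normals (n mod 2) n} \<subseteq> {xi n a i | a i. i \<in> indices n} \<union> set (upper_chain m n)"
    proof
      fix x assume "x \<in> {R_normal n q N | q N. (q, N) \<in> normals (n mod 2) n}"
      then obtain q N where x: "x = R_normal n q N" and "(q, N) \<in> normals (n mod 2) n" by blast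
      then have q: "n mod 2 + 2 \<le> q" "q \<le> n" "q mod 2 = n mod 2" and N: "N \<lhd> sym_group q" "N \<noteq> {id}"
        by (auto simp: normals_def ranks_def)
      consider "N = carrier (alt_group q) \<or> N = carrier (sym_group q)" "m \<le> q" | "q = 4" "N = klein4" | "q = 2" "even n"
      proof (cases "q = 2")
        case True
        then have "n mod 2 = 0" using q(1) by simp
        then show ?thesis using that(3) True by auto
      next
        case False
        have q3: "3 \<le> q" using q(1) False by linarith
        have mq: "m \<le> q"
        proof (cases "odd n")
          case ev: False
          then have "q \<noteq> 3" using q(3) by auto
          then show ?thesis using q3 m ev by simp
        qed (use q3 m in simp)
        then show ?thesis using large_normal[OF N q3] that(1,2) by blast
      qed
      then show "x \<in> {xi n a i | a i. i \<in> indices n} \<union> set (upper_chain m n)"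
      proof cases
        case 1
        then have "x \<in> set (upper_chain m n)" using q(2,3) unfolding x set_upper_chain by blast
        then show ?thesis by blast
      next
        case 2
        have "even n" using q(3) 2(1) by auto
        then have "ix_K \<in> indices n" "x = xi n Rees ix_K" using 2 x by (simp_all add: indices_def xi.simps)
        then show ?thesis by blast
      next
        case 3
        have "N = carrier (sym_group 2)" using normal_sym_2 N 3 by blast
        then have "ix_S2 \<in> indices n" "x = xi n Rees ix_S2" using 3 x by (simp_all add: indices_def xi.simps)
        then show ?thesis by blast
      qed
    qed
  qed blast
  have "3 \<le> m" using m by simp
  then show "{xi n a i | a i. i \<in> indices n} \<union> set (upper_chain m n) \<subseteq> Cong (brauer n)"
    using upper_chain_Cong xi_Cong[OF n3] by blast
qed

section \<open>Congruences invariant under \<open>star\<close>\<close>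

lemma star_Cong_iff: "family cu cl r N \<in> star_Cong n \<longleftrightarrow> cu = cl" if v: "valid cu cl r N"
proof -
  \<comment> \<open>\<open>star_rel\<close> swaps the flags, so invariance means that the two flags
    agree.\<close>
  have "family cu cl r N \<in> star_Cong n \<longleftrightarrow> family cu cl r N \<subseteq> star_rel (family cu cl r N)"
    using family_Cong[OF v] by (auto simp: star_Cong_def subset_iff star_rel_iff)
  also have "\<dots> \<longleftrightarrow> cu = cl"
    unfolding star_rel_family[OF v] family_le_iff[OF n3 v valid_swap[OF v]] by auto
  finally show ?thesis .
qed

lemma xi_star: "xi n a i \<in> star_Cong n \<longleftrightarrow> a \<notin> {Lambda, Rho}" if i: "i \<in> indices n"
proof -
  have "xi n a i \<in> star_Cong n \<longleftrightarrow> upper_flag a = lower_flag a"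
    unfolding xi_family[OF n3 i] by (rule star_Cong_iff[OF valid_index[OF n3 i]])
  then show ?thesis by (cases a) simp_all
qed

lemma star_Cong_eq: "star_Cong n = R_rank n ` ranks (n mod 2) n
    \<union> {R_normal n q N | q N. (q, N) \<in> normals (n mod 2) n} \<union> {xi n Mu i | i. i \<in> indices n}" (is "_ = ?Q")
proof -
  have rank: "R_rank n q \<in> star_Cong n" if "q \<in> ranks (n mod 2) n" for q
    unfolding R_rank_family[OF n3 that] using star_Cong_iff[OF valid_rank[OF n3 that]] by simp
  have nor: "R_normal n q N \<in> star_Cong n" if qN: "(q, N) \<in> normals (n mod 2) n" for q N
  proof -
    obtain r where r: "q = r + 2" using qN unfolding normals_iff[OF n3] by blast
    then show ?thesis unfolding r R_normal_family[OF n3] using star_Cong_iff[OF valid_normals[OF n3 qN[unfolded r]]] by simp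
  qed
  have mu: "xi n Mu i \<in> star_Cong n" if "i \<in> indices n" for i using xi_star[OF that] by simp
  have "?Q \<subseteq> star_Cong n" using rank nor mu by blast
  moreover have "star_Cong n \<subseteq> ?Q"
  proof
    fix x assume x: "x \<in> star_Cong n"
    then have "x \<in> Cong (brauer n)" by (simp add: star_Cong_def)
    then show "x \<in> ?Q" using x xi_star unfolding Cong_eq[OF n3] by blast
  qed
  ultimately show ?thesis by blast
qed

lemma star_Cong_diff: "star_Cong n = Cong (brauer n) - {xi n a i | a i. a \<in> {Lambda, Rho} \<and> i \<in> indices n}" (is "_ = _ - ?X")
proof -
  have "star_Cong n \<subseteq> Cong (brauer n)" by (auto simp: star_Cong_def)
  moreover have "star_Cong n \<inter> ?X = {}" using xi_star by blast
  moreover have "Cong (brauer n) - ?X \<subseteq> star_Cong n"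
    unfolding Cong_eq[OF n3] star_Cong_eq by blast
  ultimately show ?thesis by blast
qed

lemma xi_le_iff: "xi n a i \<subseteq> xi n b j \<longleftrightarrow> diamond_le a b \<and> chain_pos i \<le> chain_pos j"
  if "i \<in> indices n" "j \<in> indices n"
  unfolding xi_family[OF n3 that(1)] xi_family[OF n3 that(2)] diamond_le_flags
    family_le_iff[OF n3 valid_index[OF n3 that(1)] valid_index[OF n3 that(2)]] index_chain[OF that] by blast

lemma xi_covered: "covered_by (Cong (brauer n)) (xi n a i) (xi n b i)"
  if i: "i \<in> indices n" and "a = Mu \<and> b \<in> {Lambda, Rho} \<or> a \<in> {Lambda, Rho} \<and> b = Rees"
  unfolding xi_family[OF n3 i] using that by (intro covered_family[OF n3 valid_index[OF n3 i] valid_index[OF n3 i]]) auto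

end

end

theorem theorem8p4:
  fixes n z :: nat
  assumes n: "n \<ge> 3"
    and z: "z \<in> {0, 1}" "z mod 2 = n mod 2"
  shows
    "({I. semigroup_ideal (brauer n) I} = rank_ideal n ` ranks z n \<and>
      (\<forall>q \<in> ranks z n. R_rank n q \<in> Cong (brauer n)))
     \<and>
     ({(I, M). proper_IN_pair (brauer n) I M \<and> within_bar_sym n M}
        = {(rank_ideal n (q - 2), bar n q ` N) | q N. (q, N) \<in> normals z n} \<and>
      (\<forall>(q, N) \<in> normals z n. R_normal n q N \<in> Cong (brauer n)))
     \<and>
     (odd n \<longrightarrow>
       {(I, M). retractable_IN_pair (brauer n) I M \<and> within_bar_sym n M} = {pair_C n ix_1} \<and>
       {xi n Lambda ix_1, xi n Rho ix_1, xi n Mu ix_1} \<subseteq> Cong (brauer n))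
     \<and>
     (even n \<longrightarrow>
       {(I, M). retractable_IN_pair (brauer n) I M \<and> within_bar_sym n M}
         = {pair_C n ix_0, pair_C n ix_S2, pair_C n ix_2, pair_C n ix_K} \<and>
       (\<forall>i \<in> {ix_0, ix_S2, ix_2, ix_K}.
          {xi n Lambda i, xi n Rho i, xi n Mu i} \<subseteq> Cong (brauer n)))
     \<and>
     (inj_on (cong_of n) (labels z n) \<and>
      Cong (brauer n) = cong_of n ` labels z n)
     \<and>
     (odd n \<longrightarrow>
       xi n Mu ix_1 = Delta (brauer n) \<and>
       covered_by (Cong (brauer n)) (xi n Mu ix_1) (xi n Lambda ix_1) \<and>
       covered_by (Cong (brauer n)) (xi n Mu ix_1) (xi n Rho ix_1) \<and>
       \<not> xi n Lambda ix_1 \<subseteq> xi n Rho ix_1 \<and> \<not> xi n Rho ix_1 \<subseteq> xi n Lambda ix_1 \<and>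
       covered_by (Cong (brauer n)) (xi n Lambda ix_1) (R_rank n 1) \<and>
       covered_by (Cong (brauer n)) (xi n Rho ix_1) (R_rank n 1) \<and>
       sorted_wrt (\<subset>) (rest_chain n) \<and>
       R_rank n n = Nabla (brauer n) \<and>
       Cong (brauer n)
         = {xi n Mu ix_1, xi n Lambda ix_1, xi n Rho ix_1} \<union> set (rest_chain n))
     \<and>
     (even n \<longrightarrow>
       (\<forall>a b. \<forall>i \<in> {ix_0, ix_S2, ix_2, ix_K}. \<forall>j \<in> {ix_0, ix_S2, ix_2, ix_K}.
          xi n a i \<subseteq> xi n b j \<longleftrightarrow> diamond_le a b \<and> chain_pos i \<le> chain_pos j) \<and>
       xi n Mu ix_0 = Delta (brauer n) \<and>
       sorted_wrt (\<subset>) (rest_chain n) \<and>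
       R_rank n n = Nabla (brauer n) \<and>
       Cong (brauer n)
         = {xi n a i | a i. i \<in> {ix_0, ix_S2, ix_2, ix_K}} \<union> set (rest_chain n))
     \<and>
     (star_Cong n = Cong (brauer n) - {xi n a i | a i. a \<in> {Lambda, Rho} \<and> i \<in> indices n} \<and>
      star_Cong n = R_rank n ` ranks z n
        \<union> {R_normal n q N | q N. (q, N) \<in> normals z n}
        \<union> {xi n Mu i | i. i \<in> indices n})"
proof -
  interpret brauer_monoid n .
  have z': "z = n mod 2" using z by auto
  have idx: "indices n = (if odd n then {ix_1} else {ix_0, ix_S2, ix_2, ix_K})" by (simp add: indices_def)
  note xi.simps [simp del]
  have bottom: "xi n Mu i = Delta (brauer n)" if "i \<in> indices n" "index_rank i = n mod 2" "index_normal i = {id}" for i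
    unfolding xi_family[OF n that(1)] that(2,3) using Delta_family[OF n] by simp
  have chain: "sorted_wrt (\<subset>) (rest_chain n)" "R_rank n n = Nabla (brauer n)"
    using rest_chain_sorted[OF n] R_rank_top[OF n] by this+
  note pairs = retractable_pairs[OF n]
  have ideals: "{I. semigroup_ideal (brauer n) I} = rank_ideal n ` ranks z n"
    unfolding z' using ideal_iff by auto
  let "?P1 \<and> ?P2 \<and> ?P3 \<and> ?P4 \<and> ?P5 \<and> ?P6 \<and> ?P7 \<and> ?P8" = ?thesis
  have 1: ?P1
    using ideals unfolding z' Cong_eq[OF n] by blast
  have 2: ?P2
  proof (intro conjI ballI)
    show "case x of (q, N) \<Rightarrow> R_normal n q N \<in> Cong (brauer n)" if "x \<in> normals z n" for x
      using that unfolding z' Cong_eq[OF n] by (cases x) blast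
  qed (unfold z', rule proper_pairs[OF n])
  have 3: ?P3
  proof (intro impI conjI)
    assume "odd n"
    then have i: "indices n = {ix_1}" using idx by simp
    show "{(I, M). retractable_IN_pair (brauer n) I M \<and> within_bar_sym n M} = {pair_C n ix_1}"
      unfolding pairs i by simp
    show "{xi n Lambda ix_1, xi n Rho ix_1, xi n Mu ix_1} \<subseteq> Cong (brauer n)"
      using xi_Cong[OF n, of ix_1] i by simp
  qed
  have 4: ?P4
  proof (intro impI conjI ballI)
    assume "even n"
    then have i: "indices n = {ix_0, ix_S2, ix_2, ix_K}" using idx by simp
    show "{(I, M). retractable_IN_pair (brauer n) I M \<and> within_bar_sym n M}
        = {pair_C n ix_0, pair_C n ix_S2, pair_C n ix_2, pair_C n ix_K}"
      unfolding pairs i by simp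
    show "{xi n Lambda j, xi n Rho j, xi n Mu j} \<subseteq> Cong (brauer n)" if "j \<in> {ix_0, ix_S2, ix_2, ix_K}" for j
      using xi_Cong[OF n that[folded i]] by simp
  qed
  have 5: ?P5
    unfolding z' using cong_of_inj[OF n] cong_of_labels[OF n] by (rule conjI)
  have 6: ?P6
  proof
    assume odd: "odd n"
    have i: "ix_1 \<in> indices n" using odd idx by simp
    have R: "R_rank n 1 = xi n Rees ix_1" by (simp add: xi.simps)
    have "a \<in> {Mu, Lambda, Rho, Rees}" for a by (cases a) simp_all
    then have symbs: "UNIV = {Mu, Lambda, Rho, Rees}" by blast
    have "{xi n a i | a i. i \<in> indices n} = (\<lambda>a. xi n a ix_1) ` UNIV" using odd idx by auto
    then have "{xi n a i | a i. i \<in> indices n} = {xi n Mu ix_1, xi n Lambda ix_1, xi n Rho ix_1, xi n Rees ix_1}"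
      unfolding symbs by simp
    then have "Cong (brauer n) = {xi n Mu ix_1, xi n Lambda ix_1, xi n Rho ix_1} \<union> set (rest_chain n)"
      using Cong_chain[OF n refl] odd R by (simp add: rest_chain_def insert_commute)
    moreover have "xi n Mu ix_1 = Delta (brauer n)"
      using odd by (intro bottom i) (simp_all add: odd_iff_mod_2_eq_one)
    ultimately show "xi n Mu ix_1 = Delta (brauer n) \<and>
       covered_by (Cong (brauer n)) (xi n Mu ix_1) (xi n Lambda ix_1) \<and>
       covered_by (Cong (brauer n)) (xi n Mu ix_1) (xi n Rho ix_1) \<and>
       \<not> xi n Lambda ix_1 \<subseteq> xi n Rho ix_1 \<and> \<not> xi n Rho ix_1 \<subseteq> xi n Lambda ix_1 \<and>
       covered_by (Cong (brauer n)) (xi n Lambda ix_1) (R_rank n 1) \<and>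
       covered_by (Cong (brauer n)) (xi n Rho ix_1) (R_rank n 1) \<and>
       sorted_wrt (\<subset>) (rest_chain n) \<and>
       R_rank n n = Nabla (brauer n) \<and>
       Cong (brauer n) = {xi n Mu ix_1, xi n Lambda ix_1, xi n Rho ix_1} \<union> set (rest_chain n)"
      using chain unfolding R by (intro conjI xi_covered[OF n i]) (simp_all add: xi_le_iff[OF n i i] diamond_le_def)
  qed
  have 7: ?P7
  proof (intro impI conjI allI ballI chain)
    assume even: "even n"
    then have i: "indices n = {ix_0, ix_S2, ix_2, ix_K}" using idx by simp
    show "xi n a j \<subseteq> xi n b k \<longleftrightarrow> diamond_le a b \<and> chain_pos j \<le> chain_pos k"
      if "j \<in> {ix_0, ix_S2, ix_2, ix_K}" "k \<in> {ix_0, ix_S2, ix_2, ix_K}" for a b j k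
      using xi_le_iff[OF n] that unfolding i .
    show "xi n Mu ix_0 = Delta (brauer n)" using even i by (intro bottom) simp_all
    \<comment> \<open>\<open>R_normal n 4 klein4\<close> is the top of the product of diamond and
      chain and also heads \<open>rest_chain n\<close>, so it occurs in both parts of the
      union.\<close>
    have "R_normal n 4 klein4 = xi n Rees ix_K" by (simp add: xi.simps)
    then have "R_normal n 4 klein4 \<in> {xi n a i | a i. i \<in> indices n}" using i by blast
    then show "Cong (brauer n) = {xi n a i | a i. i \<in> {ix_0, ix_S2, ix_2, ix_K}} \<union> set (rest_chain n)"
      using Cong_chain[OF n refl] even unfolding i by (simp add: rest_chain_def insert_absorb)
  qed
  have 8: ?P8
    unfolding z' using star_Cong_diff[OF n] star_Cong_eq[OF n] by (rule conjI)
  show ?thesis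
    by (rule conjI[OF 1 conjI[OF 2 conjI[OF 3 conjI[OF 4 conjI[OF 5 conjI[OF 6 conjI[OF 7 8]]]]]]])
qed

end
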